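(* A $D$-invariant subspace $W\subset\mathcal U_a$ admits weak spectral synthesis if and only if its annihilator submodule $\mathcal J=\mathcal F(W^0)\subset\mathcal P_a$ is weakly localisable.
   Context: Weight. $\omega:[0;\infty)\to[0;\infty)$ is a non-decreasing continuous function such that: $\varphi_\omega(t):=\omega(e^t)$ is convex on $[0;\infty)$; $\omega(x)=o(x)$ and $\ln x=o(\omega(x))$ as $x\to\infty$; for every $\sigma>1$ there is $C>0$ with $\omega(x+y)\le\sigma(\omega(x)+\omega(y))+C$ for all $x,y\ge0$; $\int_1^\infty\omega(x)x^{-2}\,dx<\infty$. Fix $0<a\le+\infty$, a sequence $0<c_k\nearrow a$ such that $\{[-c_k;c_k]\}$ is an increasing sequence of closed intervals exhausting $(-a;a)$, and a sequence $0<r_k\nearrow1$. Ultradifferentiable functions. Put $\varphi_\omega^*(s)=\sup_t(st-\varphi_\omega(t))$ and, for $f\in C^\infty(-a;a)$, $q\in(0;1)$, $k\in\mathbb N$, $\|f\|_{\omega,q,k}=\sup_{j\in\mathbb N_0}\sup_{|x|\le c_k}|f^{(j)}(x)|e^{-q\varphi_\omega^*(j/q)}$. $\mathcal U_a$ is the space of all $f\in C^\infty(-a;a)$ with $\|f\|_{\omega,q,k}<\infty$ for all $q\in(0;1)$, $k\in\mathbb N$, with the locally convex topology given by these semi-norms; $\mathcal U_a'$ is its strong dual. $D=d/dx$. A $D$-invariant subspace is a closed subspace $W\subset\mathcal U_a$ with $D(W)\subset W$. $W^0=\{S\in\mathcal U_a': S(f)=0\ \forall f\in W\}$. $\mathrm{Exp}(W)$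 is the set of all exponential monomials $t^je^{-\mathrm i\lambda t}$ ($j\in\mathbb Z_+$, $\lambda\in\mathbb C$) contained in $W$. Weak spectral synthesis. For an interval $I\subset(-a;a)$ relatively closed in $(-a;a)$ put $W_I=\{f\in\mathcal U_a: f=0\text{ on }I\}$. The residual interval $I_W$ of a $D$-invariant subspace $W$ is defined by the requirements: $I_W$ is relatively closed in $(-a;a)$, $W_{I_W}\subset W$, and $W_I\setminus W\ne\emptyset$ for every relatively closed interval $I\subsetneq I_W$. $W$ admits weak spectral synthesis if $W=\overline{\mathrm{span}(\mathrm{Exp}(W))+W_{I_W}}$ (closure in $\mathcal U_a$). Module. $P_k$ is the Banach space of entire functions $\varphi$ with $\|\varphi\|_k=\sup_{z\in\mathbb C}|\varphi(z)|e^{-r_k\omega(|z|)-c_k|\mathrm{Im}\,z|}<\infty$, and $\mathcal P_a$ is the locally convex inductive limit of the $P_k$. The Fourier-Laplace transform $\mathcal F(S)(z)=S(e^{-\mathrm itz})$ is a linear topological isomorphism of $\mathcal U_a'$ onto $\mathcal P_a$. $\mathcal P_a$ is a topological module over $\mathbb C[z]$; "submodule" means closed submodule. The zero set $\mathcal Z_{\mathcal J}$ of a submodule $\mathcal J$ is the collection of pairs $(\mu;n)$ such that every $\psi\in\mathcal J$ vanishes at $\mu$ with multiplicity at least $n$ and some $\varphi\in\mathcal J$ vanishes at $\mu$ with multiplicity $n$. For $\varphi\in\mathcal P_a$ let $h_\varphi(\theta)=\limsup_{r\to\infty}r^{-1}\ln|\varphi(re^{\mathrm i\theta})|$, $c_\varphi=-h_\varphi(-\pi/2)$,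 $d_\varphi=h_\varphi(\pi/2)$; the indicator diagram of $\varphi$ is $\mathrm i[c_\varphi;d_\varphi]$. The indicator segment of $\mathcal J$ is $[c_{\mathcal J};d_{\mathcal J}]\subset\overline{\mathbb R}$, where $c_{\mathcal J}=-\sup_{\varphi\in\mathcal J}h_\varphi(-\pi/2)$, $d_{\mathcal J}=\sup_{\varphi\in\mathcal J}h_\varphi(\pi/2)$. A submodule $\mathcal J$ is weakly localisable if it is maximal among all submodules $\widetilde{\mathcal J}\subset\mathcal P_a$ with $\mathcal Z_{\widetilde{\mathcal J}}=\mathcal Z_{\mathcal J}$ and $[c_{\widetilde{\mathcal J}};d_{\widetilde{\mathcal J}}]=[c_{\mathcal J};d_{\mathcal J}]$; such a submodule contains all functions $\psi\in\mathcal P_a$ with $[c_\psi;d_\psi]\subset[c_{\mathcal J};d_{\mathcal J}]$ vanishing on $\mathcal Z_{\mathcal J}$.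
   Formalization: For a one-point interval I={x}, "f=0 on I" is taken to mean that all derivatives of f vanish at x (otherwise W={f flat at x} has no residual interval although its annihilator submodule is weakly localisable); the empty interval is admitted as a residual interval. *)

theory Defs
  imports
    "HOL-Complex_Analysis.Complex_Analysis"
    "HOL-Library.Function_Algebras"
    "HOL-Library.Landau_Symbols"
begin

section \<open>Complex function spaces and topologies given by seminorms\<close>

definition cscale :: "complex \<Rightarrow> ('x \<Rightarrow> complex) \<Rightarrow> 'x \<Rightarrow> complex" where
  "cscale b f = (\<lambda>x. b * f x)"

global_interpretation cfun: vector_space "cscale :: complex \<Rightarrow> ('x \<Rightarrow> complex) \<Rightarrow> 'x \<Rightarrow> complex"
  by unfold_locales (auto simp: cscale_def algebra_simps fun_eq_iff)

definition seminorm_on :: "('x \<Rightarrow> complex) set \<Rightarrow> (('x \<Rightarrow> complex) \<Rightarrow> real) \<Rightarrow> bool" where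
  "seminorm_on X p \<longleftrightarrow>
     (\<forall>f\<in>X. \<forall>g\<in>X. p (f + g) \<le> p f + p g) \<and>
     (\<forall>b. \<forall>f\<in>X. p (cscale b f) = cmod b * p f)"

definition seminorm_topology ::
  "('x \<Rightarrow> complex) set \<Rightarrow> (('x \<Rightarrow> complex) \<Rightarrow> real) set \<Rightarrow> ('x \<Rightarrow> complex) topology" where
  "seminorm_topology X \<P> = topology_generated_by
     (insert X {{g \<in> X. p (g - f) < e} | p f e. p \<in> \<P> \<and> f \<in> X \<and> 0 < e})"

section \<open>The weight and the fixed data\<close>

locale weight =
  fixes \<omega> :: "real \<Rightarrow> real"
  assumes nonneg: "\<And>x. 0 \<le> x \<Longrightarrow> 0 \<le> \<omega> x"
    and mono: "mono_on {0..} \<omega>"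
    and cont: "continuous_on {0..} \<omega>"
    and convex: "convex_on {0..} (\<lambda>t. \<omega> (exp t))"
    and small: "\<omega> \<in> o(\<lambda>x. x)"
    and ln_small: "ln \<in> o(\<omega>)"
    and almost_subadditive:
      "\<And>\<sigma>. 1 < \<sigma> \<Longrightarrow> \<exists>C>0. \<forall>x\<ge>0. \<forall>y\<ge>0. \<omega> (x + y) \<le> \<sigma> * (\<omega> x + \<omega> y) + C"
    and nonquasianalytic: "set_integrable lborel {1..} (\<lambda>x. \<omega> x / x\<^sup>2)"

definition sym_interval :: "ereal \<Rightarrow> real set" where
  "sym_interval a = {x. - a < ereal x \<and> ereal x < a}"

text \<open>The monotonicity of \<open>c\<close> and \<open>r\<close> need not be strict, but all
  \<open>r k\<close> stay below \<open>1\<close> (and all \<open>c k\<close> below \<open>a\<close>, by exhaustion).\<close>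

locale ultra_data = weight \<omega> for \<omega> :: "real \<Rightarrow> real" +
  fixes a :: ereal and c :: "nat \<Rightarrow> real" and r :: "nat \<Rightarrow> real"
  assumes a_pos: "0 < a"
    and c_pos: "\<And>k. 0 < c k"
    and c_inc: "incseq c"
    and c_lim: "(\<lambda>k. ereal (c k)) \<longlonglongrightarrow> a"
    and c_exhausts: "(\<Union>k. {- c k..c k}) = sym_interval a"
    and r_bounds: "\<And>k. 0 < r k \<and> r k < 1"
    and r_inc: "incseq r"
    and r_lim: "r \<longlonglongrightarrow> 1"

section \<open>Ultradifferentiable functions\<close>

text \<open>A function on \<open>(-a;a)\<close> is represented by its extension by zero to the whole real line.\<close>

definition zero_ext :: "ereal \<Rightarrow> (real \<Rightarrow> complex) \<Rightarrow> real \<Rightarrow> complex" where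
  "zero_ext a f = (\<lambda>x. if x \<in> sym_interval a then f x else 0)"

definition diff_op :: "ereal \<Rightarrow> (real \<Rightarrow> complex) \<Rightarrow> real \<Rightarrow> complex" where
  "diff_op a f = zero_ext a (\<lambda>x. vector_derivative f (at x))"

definition smooth :: "ereal \<Rightarrow> (real \<Rightarrow> complex) set" where
  "smooth a = {f. (\<forall>x. x \<notin> sym_interval a \<longrightarrow> f x = 0) \<and>
                  (\<forall>j. \<forall>x\<in>sym_interval a. (diff_op a ^^ j) f differentiable (at x))}"

text \<open>The Young conjugate of \<open>t \<mapsto> \<omega> (exp t)\<close>, a function on \<open>[0;\<infinity>)\<close>; the supremum
  is finite since \<open>ln x = o(\<omega> x)\<close>.\<close>

definition young_conj :: "(real \<Rightarrow> real) \<Rightarrow> real \<Rightarrow> real" where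
  "young_conj \<omega> s = (SUP t\<in>{0..}. s * t - \<omega> (exp t))"

definition u_norm ::
  "(real \<Rightarrow> real) \<Rightarrow> ereal \<Rightarrow> (nat \<Rightarrow> real) \<Rightarrow> real \<Rightarrow> nat \<Rightarrow> (real \<Rightarrow> complex) \<Rightarrow> ereal" where
  "u_norm \<omega> a c q k f =
     (SUP j. SUP x\<in>{- c k..c k}.
        ereal (cmod ((diff_op a ^^ j) f x) * exp (- q * young_conj \<omega> (real j / q))))"

definition U_space :: "(real \<Rightarrow> real) \<Rightarrow> ereal \<Rightarrow> (nat \<Rightarrow> real) \<Rightarrow> (real \<Rightarrow> complex) set" where
  "U_space \<omega> a c = {f \<in> smooth a. \<forall>q\<in>{0<..<1}. \<forall>k. u_norm \<omega> a c q k f < \<infinity>}"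

definition U_top :: "(real \<Rightarrow> real) \<Rightarrow> ereal \<Rightarrow> (nat \<Rightarrow> real) \<Rightarrow> (real \<Rightarrow> complex) topology" where
  "U_top \<omega> a c = seminorm_topology (U_space \<omega> a c)
     {\<lambda>f. real_of_ereal (u_norm \<omega> a c q k f) | q k. q \<in> {0<..<1}}"

definition U_dual ::
  "(real \<Rightarrow> real) \<Rightarrow> ereal \<Rightarrow> (nat \<Rightarrow> real) \<Rightarrow> ((real \<Rightarrow> complex) \<Rightarrow> complex) set" where
  "U_dual \<omega> a c = {S \<in> extensional (U_space \<omega> a c).
     (\<forall>f\<in>U_space \<omega> a c. \<forall>g\<in>U_space \<omega> a c. S (f + g) = S f + S g) \<and>
     (\<forall>b. \<forall>f\<in>U_space \<omega> a c. S (cscale b f) = b * S f) \<and>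
     continuous_map (U_top \<omega> a c) euclidean S}"

definition D_invariant ::
  "(real \<Rightarrow> real) \<Rightarrow> ereal \<Rightarrow> (nat \<Rightarrow> real) \<Rightarrow> (real \<Rightarrow> complex) set \<Rightarrow> bool" where
  "D_invariant \<omega> a c W \<longleftrightarrow>
     cfun.subspace W \<and> closedin (U_top \<omega> a c) W \<and> diff_op a ` W \<subseteq> W"

definition annihilator ::
  "(real \<Rightarrow> real) \<Rightarrow> ereal \<Rightarrow> (nat \<Rightarrow> real) \<Rightarrow> (real \<Rightarrow> complex) set \<Rightarrow>
     ((real \<Rightarrow> complex) \<Rightarrow> complex) set" where
  "annihilator \<omega> a c W = {S \<in> U_dual \<omega> a c. \<forall>f\<in>W. S f = 0}"

section \<open>Weak spectral synthesis\<close>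

definition exp_monomial :: "ereal \<Rightarrow> nat \<Rightarrow> complex \<Rightarrow> real \<Rightarrow> complex" where
  "exp_monomial a j \<mu> = zero_ext a (\<lambda>t. of_real t ^ j * exp (- \<i> * \<mu> * of_real t))"

definition Exp_of :: "ereal \<Rightarrow> (real \<Rightarrow> complex) set \<Rightarrow> (real \<Rightarrow> complex) set" where
  "Exp_of a W = {exp_monomial a j \<mu> | j \<mu>. exp_monomial a j \<mu> \<in> W}"

text \<open>The empty set counts as an interval (it is the residual interval of the whole space),
  and so do singletons.\<close>

definition rel_closed_interval :: "ereal \<Rightarrow> real set \<Rightarrow> bool" where
  "rel_closed_interval a I \<longleftrightarrow> is_interval I \<and> closedin (top_of_set (sym_interval a)) I"

text \<open>For an interval with more than one point, a smooth \<open>f\<close> vanishes on \<open>I\<close> iff all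
  its derivatives do. For \<open>I = {x}\<close> vanishing on \<open>I\<close> is understood, as usual for
  differentiation-invariant subspaces, as vanishing of \<open>f\<close> to infinite order at \<open>x\<close>;
  with the condition \<open>f x = 0\<close> alone, the invariant subspace of all functions flat
  at \<open>x\<close> would have no residual interval.\<close>

definition W_of ::
  "(real \<Rightarrow> real) \<Rightarrow> ereal \<Rightarrow> (nat \<Rightarrow> real) \<Rightarrow> real set \<Rightarrow> (real \<Rightarrow> complex) set" where
  "W_of \<omega> a c I = {f \<in> U_space \<omega> a c. \<forall>j. \<forall>x\<in>I. (diff_op a ^^ j) f x = 0}"

definition is_residual_interval ::
  "(real \<Rightarrow> real) \<Rightarrow> ereal \<Rightarrow> (nat \<Rightarrow> real) \<Rightarrow> (real \<Rightarrow> complex) set \<Rightarrow> real set \<Rightarrow> bool" where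
  "is_residual_interval \<omega> a c W I \<longleftrightarrow>
     rel_closed_interval a I \<and> W_of \<omega> a c I \<subseteq> W \<and>
     (\<forall>I'. rel_closed_interval a I' \<and> I' \<subset> I \<longrightarrow> W_of \<omega> a c I' - W \<noteq> {})"

definition weak_synthesis ::
  "(real \<Rightarrow> real) \<Rightarrow> ereal \<Rightarrow> (nat \<Rightarrow> real) \<Rightarrow> (real \<Rightarrow> complex) set \<Rightarrow> bool" where
  "weak_synthesis \<omega> a c W \<longleftrightarrow>
     (\<exists>I. is_residual_interval \<omega> a c W I \<and>
          W = U_top \<omega> a c closure_of
                {f + g | f g. f \<in> cfun.span (Exp_of a W) \<and> g \<in> W_of \<omega> a c I})"

section \<open>The module of entire functions\<close>

definition p_norm ::
  "(real \<Rightarrow> real) \<Rightarrow> (nat \<Rightarrow> real) \<Rightarrow> (nat \<Rightarrow> real) \<Rightarrow> nat \<Rightarrow> (complex \<Rightarrow> complex) \<Rightarrow> ereal" where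
  "p_norm \<omega> c r k \<phi> =
     (SUP z. ereal (cmod (\<phi> z) * exp (- r k * \<omega> (cmod z) - c k * \<bar>Im z\<bar>)))"

definition Pk ::
  "(real \<Rightarrow> real) \<Rightarrow> (nat \<Rightarrow> real) \<Rightarrow> (nat \<Rightarrow> real) \<Rightarrow> nat \<Rightarrow> (complex \<Rightarrow> complex) set" where
  "Pk \<omega> c r k = {\<phi>. \<phi> holomorphic_on UNIV \<and> p_norm \<omega> c r k \<phi> < \<infinity>}"

definition Pk_top ::
  "(real \<Rightarrow> real) \<Rightarrow> (nat \<Rightarrow> real) \<Rightarrow> (nat \<Rightarrow> real) \<Rightarrow> nat \<Rightarrow> (complex \<Rightarrow> complex) topology" where
  "Pk_top \<omega> c r k =
     seminorm_topology (Pk \<omega> c r k) {\<lambda>\<phi>. real_of_ereal (p_norm \<omega> c r k \<phi>)}"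

definition P_space ::
  "(real \<Rightarrow> real) \<Rightarrow> (nat \<Rightarrow> real) \<Rightarrow> (nat \<Rightarrow> real) \<Rightarrow> (complex \<Rightarrow> complex) set" where
  "P_space \<omega> c r = (\<Union>k. Pk \<omega> c r k)"

text \<open>The inductive limit topology is the finest locally convex topology for which all
  inclusions of the steps are continuous, i.e. the one given by all seminorms with
  continuous restrictions to every step.\<close>

definition P_top ::
  "(real \<Rightarrow> real) \<Rightarrow> (nat \<Rightarrow> real) \<Rightarrow> (nat \<Rightarrow> real) \<Rightarrow> (complex \<Rightarrow> complex) topology" where
  "P_top \<omega> c r = seminorm_topology (P_space \<omega> c r)
     {p. seminorm_on (P_space \<omega> c r) p \<and> (\<forall>k. continuous_map (Pk_top \<omega> c r k) euclideanreal p)}"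

definition fourier_laplace ::
  "ereal \<Rightarrow> ((real \<Rightarrow> complex) \<Rightarrow> complex) \<Rightarrow> complex \<Rightarrow> complex" where
  "fourier_laplace a S = (\<lambda>z. S (zero_ext a (\<lambda>t. exp (- \<i> * of_real t * z))))"

definition submodule ::
  "(real \<Rightarrow> real) \<Rightarrow> (nat \<Rightarrow> real) \<Rightarrow> (nat \<Rightarrow> real) \<Rightarrow> (complex \<Rightarrow> complex) set \<Rightarrow> bool" where
  "submodule \<omega> c r J \<longleftrightarrow>
     cfun.subspace J \<and> closedin (P_top \<omega> c r) J \<and>
     (\<forall>p. \<forall>\<phi>\<in>J. (\<lambda>z. poly p z * \<phi> z) \<in> J)"

definition vanishes_at_least :: "(complex \<Rightarrow> complex) \<Rightarrow> complex \<Rightarrow> nat \<Rightarrow> bool" where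
  "vanishes_at_least \<phi> \<mu> n \<longleftrightarrow> (\<forall>i<n. (deriv ^^ i) \<phi> \<mu> = 0)"

definition zero_set :: "(complex \<Rightarrow> complex) set \<Rightarrow> (complex \<times> nat) set" where
  "zero_set J = {(\<mu>, n). 1 \<le> n \<and> (\<forall>\<psi>\<in>J. vanishes_at_least \<psi> \<mu> n) \<and>
     (\<exists>\<phi>\<in>J. vanishes_at_least \<phi> \<mu> n \<and> (deriv ^^ n) \<phi> \<mu> \<noteq> 0)}"

text \<open>The logarithm of \<open>0\<close> is \<open>-\<infinity>\<close> here, unlike \<open>ln 0 = 0\<close> for reals.\<close>

definition indicator_fun :: "(complex \<Rightarrow> complex) \<Rightarrow> real \<Rightarrow> ereal" where
  "indicator_fun \<phi> \<theta> = Limsup at_top (\<lambda>\<rho>::real.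
     if \<phi> (rcis \<rho> \<theta>) = 0 then - \<infinity> else ereal (ln (cmod (\<phi> (rcis \<rho> \<theta>))) / \<rho>))"

definition indicator_segment :: "(complex \<Rightarrow> complex) set \<Rightarrow> ereal set" where
  "indicator_segment J =
     {- (SUP \<phi>\<in>J. indicator_fun \<phi> (- (pi / 2))) .. (SUP \<phi>\<in>J. indicator_fun \<phi> (pi / 2))}"

definition weakly_localisable ::
  "(real \<Rightarrow> real) \<Rightarrow> (nat \<Rightarrow> real) \<Rightarrow> (nat \<Rightarrow> real) \<Rightarrow> (complex \<Rightarrow> complex) set \<Rightarrow> bool" where
  "weakly_localisable \<omega> c r J \<longleftrightarrow>
     submodule \<omega> c r J \<and>
     (\<forall>J'. submodule \<omega> c r J' \<and> zero_set J' = zero_set J \<and>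
           indicator_segment J' = indicator_segment J \<and> J \<subseteq> J' \<longrightarrow> J' = J)"

end

theory Submission
  imports
    Defs
    "HOL-Probability.Sinc_Integral"
    "HOL-Probability.Characteristic_Functions"
    "HOL-Real_Asymp.Real_Asymp"
begin

text \<open>Let \<open>J\<close> be the submodule of transforms of functionals annihilating \<open>W\<close>. By the Fourier
  representation of functionals, a functional whose transform has indicator segment \<open>[c; d]\<close> kills
  every function that is flat on \<open>[c; d]\<close> (a Paley-Wiener argument resting on Phragmen-Lindelof);
  conversely, if it kills all functions flat on an interval, then its indicator segment lies in that
  interval. Hence the residual interval of \<open>W\<close> is the indicator segment of \<open>J\<close>, while the zero set of
  \<open>J\<close> records the exponential monomials in \<open>W\<close>. The annihilator of the sum of these monomials and the
  functions flat on the residual interval therefore transforms to the largest submodule with the zero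
  set and the indicator segment of \<open>J\<close>, and by Hahn-Banach separation this submodule equals \<open>J\<close> if and
  only if that sum is dense in \<open>W\<close>.\<close>

section \<open>Phragmen-Lindelof and integrals over the real line\<close>

text \<open>The obstacle is that an element of the dual is known only through one seminorm bound.
  What makes it tractable is the formula expressing \<open>S f\<close> as
  \<open>1 / (2 * pi)\<close> times the integral of \<open>FT (\<eta> * f) x * \<phi> x\<close> over
  the real line, with \<open>\<phi>\<close> the transform of \<open>S\<close> and a cutoff
  \<open>\<eta>\<close> equal to 1 where the seminorm of \<open>S\<close> lives. It requires cutoffs
  within the ultradifferentiable class, hence the nonquasianalyticity of the weight, and it also
  defines a functional from any \<open>\<phi>\<close> in the module. Estimates lose a little in
  \<open>q\<close> at each product or derivative; there is room for this, because
  \<open>\<phi>\<close> grows with some \<open>r k < 1\<close> while \<open>f\<close> is controlled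
  for all \<open>q < 1\<close>. Upper and lower half-planes are treated together by a sign
  \<open>s\<close>. Topological questions are reduced to bounds: the dual to seminorm estimates,
  closedness of a submodule of transforms to the seminorms \<open>cmod (preimage \<phi> f)\<close>.
  The zero module needs separate care, since an empty segment does not determine its end points,
  whereas a nonzero transform always has a nonempty segment.\<close>

lemma Phragmen_Lindelof_quadrant:
  assumes hol: "H holomorphic_on UNIV"
    and type: "\<And>z. cmod (H z) \<le> A * exp (B * cmod z)"
    and re: "\<And>x. 0 \<le> x \<Longrightarrow> cmod (H (of_real x)) \<le> M"
    and im: "\<And>y. 0 \<le> y \<Longrightarrow> cmod (H (\<i> * of_real y)) \<le> M"
    and "0 \<le> Re z" "0 \<le> Im z" "0 < M"
  shows "cmod (H z) \<le> M"
proof -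
  \<comment> \<open>The factor \<open>1 - \<i>\<close> turns the quadrant into the sector of
    half-angle \<open>pi / 4\<close>, and the shift by \<open>1 + \<i>\<close> keeps its vertex off
    \<open>0\<close>, so that \<open>Ln\<close> is holomorphic on the closed quadrant. The exponent
    \<open>3 / 2\<close> lies between the order 1 of \<open>H\<close> and the value 2 at which the
    real part of the power could reach zero; hence the constant
    \<open>cos (3 * pi / 8)\<close>.\<close>
  define w where "w z = (z + (1 + \<i>)) * (1 - \<i>)" for z :: complex
  define u where "u z = exp (3 / 2 * Ln (w z))" for z
  define \<kappa> where "\<kappa> = cos (3 * pi / 8)"
  have \<kappa>: "\<kappa> > 0"
    unfolding \<kappa>_def by (rule cos_gt_zero) auto
  have w_re: "Re (w z) > 0" "\<bar>Im (w z)\<bar> \<le> Re (w z)" "cmod z \<le> cmod (w z)" "w z \<noteq> 0"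
    if "0 \<le> Re z" "0 \<le> Im z" for z
  proof -
    show w: "Re (w z) > 0" "\<bar>Im (w z)\<bar> \<le> Re (w z)"
      using that by (auto simp: w_def algebra_simps)
    then show "w z \<noteq> 0" by auto
    have "cmod z \<le> cmod (z + (1 + \<i>))"
      using that by (auto simp: cmod_def intro!: power_mono add_mono)
    also have "\<dots> \<le> cmod (z + (1 + \<i>)) * cmod (1 - \<i>)"
      by (auto simp: cmod_def intro!: mult_right_le_one_le)
        (metis mult.right_neutral mult_left_mono one_le_numeral real_sqrt_ge_1_iff real_sqrt_ge_zero
          sum_power2_ge_zero)
    finally show "cmod z \<le> cmod (w z)" by (simp add: w_def norm_mult)
  qed
  have u_re: "Re (u z) \<ge> \<kappa> * cmod z powr (3/2)" if "0 \<le> Re z" "0 \<le> Im z" for z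
  proof -
    note w = w_re[OF that]
    have "Im (Ln (w z)) = arctan (Im (w z) / Re (w z))"
      using w by (simp add: Arg_eq_Im_Ln[symmetric] arg_conv_arctan)
    moreover have "Im (w z) / Re (w z) \<le> 1" "- 1 \<le> Im (w z) / Re (w z)"
      using w by (auto simp: field_simps abs_le_iff)
    then have "arctan (Im (w z) / Re (w z)) \<le> pi / 4" "- (pi / 4) \<le> arctan (Im (w z) / Re (w z))"
      using arctan_monotone' arctan_one arctan_minus by metis+
    ultimately have "\<bar>Im (Ln (w z))\<bar> \<le> pi / 4" by linarith
    then have "\<kappa> \<le> cos \<bar>3 / 2 * Im (Ln (w z))\<bar>"
      unfolding \<kappa>_def by (intro cos_monotone_0_pi_le) auto
    then have c: "\<kappa> \<le> cos (3 / 2 * Im (Ln (w z)))" by (simp only: cos_abs_real)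
    have "cmod z powr (3/2) \<le> cmod (w z) powr (3/2)"
      using w by (intro powr_mono2) auto
    also have "\<dots> = exp (Re (3 / 2 * Ln (w z)))"
      using w by (simp add: powr_def)
    finally have "cmod z powr (3/2) * \<kappa> \<le> exp (Re (3 / 2 * Ln (w z))) * cos (3 / 2 * Im (Ln (w z)))"
      using c \<kappa> by (intro mult_mono) auto
    then show ?thesis by (simp add: u_def Re_exp mult.commute)
  qed
  have u_hol: "u holomorphic_on {z. 0 \<le> Re z \<and> 0 \<le> Im z}"
    unfolding u_def using w_re(1)
    by (intro holomorphic_intros) (auto simp: w_def complex_nonpos_Reals_iff intro!: holomorphic_intros)
  have main: "cmod (H z * exp (- of_real \<epsilon> * u z)) \<le> M" if \<epsilon>: "\<epsilon> > 0" for \<epsilon>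
  proof -
    define e where "e = \<epsilon> * \<kappa>"
    have "e > 0" using \<epsilon> \<kappa> by (simp add: e_def)
    then have "((\<lambda>R. exp (B * R - e * R powr (3/2))) \<longlongrightarrow> 0) at_top"
      by real_asymp
    then have "((\<lambda>R. A * exp (B * R - e * R powr (3/2))) \<longlongrightarrow> A * 0) at_top"
      by (intro tendsto_intros)
    then have "((\<lambda>R. A * exp (B * R) * exp (- (\<epsilon> * \<kappa>) * R powr (3/2))) \<longlongrightarrow> 0) at_top"
      by (simp add: e_def mult.assoc flip: exp_add)
    then have "eventually (\<lambda>R. A * exp (B * R) * exp (- (\<epsilon> * \<kappa>) * R powr (3/2)) < M) at_top"
      using \<open>0 < M\<close> by (simp add: order_tendstoD)
    moreover have "eventually (\<lambda>R. R > cmod z) at_top" by (rule eventually_gt_at_top)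
    ultimately obtain R where R: "A * exp (B * R) * exp (- (\<epsilon> * \<kappa>) * R powr (3/2)) < M" "R > cmod z"
      using eventually_happens'[OF trivial_limit_at_top_linorder eventually_conj] by blast
    \<comment> \<open>On the quarter disc the maximum is attained on the frontier: the straight
      sides are controlled by the hypotheses, the arc by the choice of \<open>R\<close>.\<close>
    define S where "S = {z. 0 \<le> Re z \<and> 0 \<le> Im z} \<inter> cball 0 R"
    have clS: "closed S" unfolding S_def
      by (intro closed_Int closed_Collect_conj closed_Collect_le continuous_intros closed_cball)
    have op: "open ({z. 0 < Re z \<and> 0 < Im z} \<inter> ball 0 R)"
      by (intro open_Int open_Collect_conj open_Collect_less continuous_intros open_ball)
    have S: "{z. 0 < Re z \<and> 0 < Im z} \<inter> ball 0 R \<subseteq> interior S"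
      by (intro interior_maximal op) (auto simp: S_def)
    have hol': "(\<lambda>z. H z * exp (- of_real \<epsilon> * u z)) holomorphic_on S"
      by (intro holomorphic_intros holomorphic_on_subset[OF hol] holomorphic_on_subset[OF u_hol])
        (auto simp: S_def)
    show ?thesis
    proof (rule maximum_modulus_frontier[where S = S and f = "\<lambda>z. H z * exp (- of_real \<epsilon> * u z)"])
      show "(\<lambda>z. H z * exp (- of_real \<epsilon> * u z)) holomorphic_on interior S"
        using hol' interior_subset by (rule holomorphic_on_subset)
      show "continuous_on (closure S) (\<lambda>z. H z * exp (- of_real \<epsilon> * u z))"
        using hol' clS by (simp add: holomorphic_on_imp_continuous_on)
      show "bounded S" by (auto simp: S_def bounded_Int)
      show "z \<in> S" using assms R by (auto simp: S_def)
      fix \<zeta> assume "\<zeta> \<in> frontier S"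
      then have z: "\<zeta> \<in> S" "\<zeta> \<notin> {z. 0 < Re z \<and> 0 < Im z} \<inter> ball 0 R"
        using clS S by (auto simp: frontier_def)
      have ur: "\<kappa> * cmod \<zeta> powr (3/2) \<le> Re (u \<zeta>)" using z u_re by (auto simp: S_def)
      have n: "cmod (H \<zeta> * exp (- of_real \<epsilon> * u \<zeta>)) = cmod (H \<zeta>) * exp (- \<epsilon> * Re (u \<zeta>))"
        by (simp add: norm_mult)
      have "0 \<le> \<kappa> * cmod \<zeta> powr (3/2)" using \<kappa> by simp
      then have e1: "exp (- \<epsilon> * Re (u \<zeta>)) \<le> 1" using ur \<epsilon> by simp
      consider "Re \<zeta> = 0" "Im \<zeta> \<ge> 0" | "Im \<zeta> = 0" "Re \<zeta> \<ge> 0" | "cmod \<zeta> = R"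
        using z by (force simp: S_def)
      then have "cmod (H \<zeta>) * exp (- \<epsilon> * Re (u \<zeta>)) \<le> M"
      proof cases
        case 1
        then have "\<zeta> = \<i> * of_real (Im \<zeta>)" by (simp add: complex_eq_iff)
        then have "cmod (H \<zeta>) \<le> M" using im[of "Im \<zeta>"] 1 by metis
        then show ?thesis using e1 \<open>0 < M\<close> by (meson exp_ge_zero mult_left_le norm_ge_zero order_trans)
      next
        case 2
        then have "\<zeta> = of_real (Re \<zeta>)" by (simp add: complex_eq_iff)
        then have "cmod (H \<zeta>) \<le> M" using re[of "Re \<zeta>"] 2 by metis
        then show ?thesis using e1 \<open>0 < M\<close> by (meson exp_ge_zero mult_left_le norm_ge_zero order_trans)
      next
        case 3
        have "cmod (H \<zeta>) * exp (- \<epsilon> * Re (u \<zeta>)) \<le>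
            (A * exp (B * R)) * exp (- (\<epsilon> * \<kappa>) * R powr (3/2))"
          using type[of \<zeta>] 3 ur \<epsilon> by (intro mult_mono) (auto simp: mult.assoc order_trans[OF norm_ge_zero])
        then show ?thesis using R by linarith
      qed
      then show "cmod (H \<zeta> * exp (- of_real \<epsilon> * u \<zeta>)) \<le> M" using n by simp
    qed
  qed
  \<comment> \<open>The bound \<open>M\<close> does not depend on the damping, which can therefore
    be removed in the limit.\<close>
  have "((\<lambda>\<epsilon>. cmod (H z * exp (- of_real \<epsilon> * u z))) \<longlongrightarrow> cmod (H z * exp (- of_real 0 * u z))) (at_right 0)"
    by (intro tendsto_intros)
  moreover have "eventually (\<lambda>\<epsilon>. cmod (H z * exp (- of_real \<epsilon> * u z)) \<le> M) (at_right 0)"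
    using main by (auto simp: eventually_at_right_less intro: eventually_at_rightI[of 0 1])
  ultimately have "cmod (H z * exp (- of_real 0 * u z)) \<le> M"
    by (intro tendsto_upperbound) auto
  then show ?thesis by simp
qed

text \<open>The left quadrant is \<open>\<i>\<close> times the right one, so the bound there follows
  by rotation: the positive imaginary and the negative real half-axis become its two sides.\<close>

lemma Phragmen_Lindelof_half_plane:
  assumes hol: "H holomorphic_on UNIV"
    and type: "\<And>z. cmod (H z) \<le> A * exp (B * cmod z)"
    and re: "\<And>x. cmod (H (of_real x)) \<le> M"
    and im: "\<And>y. 0 \<le> y \<Longrightarrow> cmod (H (\<i> * of_real y)) \<le> M"
    and "0 \<le> Im z" "0 < M"
  shows "cmod (H z) \<le> M"
proof (cases "0 \<le> Re z")
  case True
  show ?thesis by (rule Phragmen_Lindelof_quadrant[OF hol type re im True assms(5,6)])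
next
  case False
  have "cmod ((H \<circ> (\<lambda>w. \<i> * w)) (- \<i> * z)) \<le> M"
  proof (rule Phragmen_Lindelof_quadrant[where A = A and B = B and H = "H \<circ> (\<lambda>w. \<i> * w)"])
    show "(H \<circ> (\<lambda>w. \<i> * w)) holomorphic_on UNIV"
      by (intro holomorphic_on_compose_gen[OF _ hol]) (auto intro!: holomorphic_intros)
    show "cmod ((H \<circ> (\<lambda>w. \<i> * w)) z) \<le> A * exp (B * cmod z)" for z
      using type[of "\<i> * z"] by (simp add: norm_mult)
    show "cmod ((H \<circ> (\<lambda>w. \<i> * w)) (\<i> * of_real y)) \<le> M" for y
      using re[of "- y"] by (simp flip: mult.assoc)
  qed (use assms False in auto)
  then show ?thesis by (simp flip: mult.assoc)
qed

section \<open>Integrals over the real line by closing the contour\<close>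

lemma integrable_inverse_1_plus_square_lborel:
  "integrable lborel (\<lambda>x::real. 1 / (1 + x\<^sup>2))"
  and integral_inverse_1_plus_square_lborel: "(LBINT x. 1 / (1 + x\<^sup>2)) = pi"
proof -
  have e: "einterval (-\<infinity>) \<infinity> = UNIV" by (auto simp: einterval_def)
  show "integrable lborel (\<lambda>x::real. 1 / (1 + x\<^sup>2))"
    using integrable_inverse_1_plus_square by (simp add: e set_integrable_def inverse_eq_divide)
  show "(LBINT x. 1 / (1 + x\<^sup>2)) = pi"
    using LBINT_inverse_1_plus_square
    by (simp add: interval_lebesgue_integral_def e set_lebesgue_integral_def inverse_eq_divide)
qed

lemma integrable_bound_1_plus_square:
  fixes f :: "real \<Rightarrow> complex"
  assumes "f \<in> borel_measurable lborel" "\<And>x. x \<noteq> 0 \<Longrightarrow> cmod (f x) \<le> C / (1 + x\<^sup>2)"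
  shows "integrable lborel f"
proof (rule Bochner_Integration.integrable_bound)
  show "integrable lborel (\<lambda>x::real. C * (1 / (1 + x\<^sup>2)))"
    using integrable_inverse_1_plus_square_lborel by (rule integrable_mult_right)
  have "AE x in lborel. (x::real) \<noteq> 0" by (rule AE_lborel_singleton)
  then show "AE x in lborel. norm (f x) \<le> norm (C * (1 / (1 + x\<^sup>2)))"
  proof eventually_elim
    case (elim x)
    then have "norm (f x) \<le> C / (1 + x\<^sup>2)" using assms(2) by blast
    also have "\<dots> = C * (1 / (1 + x\<^sup>2))" by simp
    finally show ?case unfolding real_norm_def by (meson abs_ge_self order_trans)
  qed
qed fact

text \<open>Contour integrals over segments come out as gauge integrals over
  \<open>{- R..R}\<close>; this is the passage from them to the Lebesgue integral over the
  line.\<close>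

lemma tendsto_integral_symmetric:
  fixes f :: "real \<Rightarrow> complex"
  assumes "integrable lborel f"
  shows "(\<lambda>n. integral {- real n..real n} f) \<longlonglongrightarrow> (LBINT x. f x)"
proof -
  have "(\<lambda>n. LBINT x. indicator {- real n..real n} x *\<^sub>R f x) \<longlonglongrightarrow> (LBINT x. f x)"
  proof (rule integral_dominated_convergence[where w = "\<lambda>x. norm (f x)"])
    show "AE x in lborel. (\<lambda>n. indicator {- real n..real n} x *\<^sub>R f x) \<longlonglongrightarrow> f x"
    proof (rule AE_I2, rule tendsto_eventually)
      fix x :: real
      have "eventually (\<lambda>n. \<bar>x\<bar> \<le> real n) sequentially" by real_asymp
      then show "\<forall>\<^sub>F n in sequentially. indicator {- real n..real n} x *\<^sub>R f x = f x"
        by eventually_elim (auto simp: indicator_def)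
    qed
    show "AE x in lborel. norm (indicator {- real n..real n} x *\<^sub>R f x) \<le> norm (f x)" for n
      by (auto simp: indicator_def)
  qed (use assms in auto)
  moreover have "integral {- real n..real n} f = (LBINT x. indicator {- real n..real n} x *\<^sub>R f x)" for n
    using set_borel_integral_eq_integral(2)[of "{- real n..real n}" f] assms
    by (simp add: set_integrable_def set_lebesgue_integral_def integrable_mult_indicator)
  ultimately show ?thesis by simp
qed

text \<open>Since \<open>H\<close> is only bounded in the half-plane, the arc of a half-disc contour
  need not vanish in the limit. A factor that decays quadratically on the arc, and tends to 1 when
  its parameter tends to zero, repairs this. The strip below the axis leaves the contour inside an
  open convex set of holomorphy.\<close>

lemma integral_real_line_half_plane:
  assumes hol: "H holomorphic_on {z. - \<delta> < Im z}" and "0 < \<delta>"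
    and bd: "\<And>z. 0 \<le> Im z \<Longrightarrow> cmod (H z) \<le> M"
    and dec: "\<And>x. cmod (H (of_real x)) \<le> C / (1 + x\<^sup>2)"
  shows "integrable lborel (\<lambda>x. H (of_real x))" "(LBINT x. H (of_real x)) = 0"
proof -
  have M: "0 \<le> M" using bd[of 0] by (simp add: order_trans[OF norm_ge_zero])
  have contH: "continuous_on UNIV (\<lambda>x::real. H (of_real x))"
    using holomorphic_on_imp_continuous_on[OF hol] \<open>0 < \<delta>\<close>
    by (auto intro!: continuous_on_compose2[of _ H UNIV of_real] continuous_intros)
  then have measH: "(\<lambda>x::real. H (of_real x)) \<in> borel_measurable lborel"
    using borel_measurable_continuous_onI by simp
  show intH: "integrable lborel (\<lambda>x. H (of_real x))"
    using measH dec by (rule integrable_bound_1_plus_square)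
  \<comment> \<open>The factor has modulus at most 1 on the real line, so the integrand stays
    dominated by \<open>H\<close>, and its only pole \<open>- \<i> / \<epsilon>\<close> lies below
    the axis.\<close>
  define K where "K \<epsilon> z = H z * (\<i> / (\<i> + of_real \<epsilon> * z))\<^sup>2" for \<epsilon> :: real and z
  have Kf: "cmod (\<i> / (\<i> + of_real \<epsilon> * of_real x)) \<le> 1" for \<epsilon> x :: real
    using abs_Im_le_cmod[of "\<i> + of_real \<epsilon> * of_real x"] by (simp add: norm_divide divide_simps)
  have ne: "\<i> + of_real \<epsilon> * of_real x \<noteq> 0" for \<epsilon> x :: real
    by (auto simp: complex_eq_iff)
  have Kle: "cmod (K \<epsilon> (of_real x)) \<le> cmod (H (of_real x))" for \<epsilon> x
    unfolding K_def norm_mult norm_power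
    using power_mono[OF Kf[of \<epsilon> x] norm_ge_zero, of 2] by (simp add: mult_left_le)
  have Kcont: "continuous_on UNIV (\<lambda>x::real. K \<epsilon> (of_real x))" for \<epsilon>
    unfolding K_def using ne by (intro continuous_intros contH) auto
  then have Kmeas: "(\<lambda>x::real. K \<epsilon> (of_real x)) \<in> borel_measurable lborel" for \<epsilon>
    using borel_measurable_continuous_onI[of "\<lambda>x. K \<epsilon> (of_real x)"] by simp
  have Kint: "integrable lborel (\<lambda>x. K \<epsilon> (of_real x))" for \<epsilon>
    by (rule Bochner_Integration.integrable_bound[OF intH Kmeas]) (use Kle in auto)
  have K0: "(LBINT x. K \<epsilon> (of_real x)) = 0" if \<epsilon>: "\<epsilon> > 0" for \<epsilon>
  proof -
    \<comment> \<open>The strip is thinned so as to stay above the pole at height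
      \<open>- 1 / \<epsilon>\<close>.\<close>
    define d where "d = min \<delta> (1 / \<epsilon>)"
    have d: "d > 0" "d \<le> \<delta>" "d \<le> 1 / \<epsilon>" using \<epsilon> \<open>0 < \<delta>\<close> by (auto simp: d_def)
    define S where "S = {z. - d < Im z}"
    have nz: "\<i> + of_real \<epsilon> * z \<noteq> 0" if "z \<in> S" for z
    proof
      assume "\<i> + of_real \<epsilon> * z = 0"
      then have "Im z = - (1 / \<epsilon>)" using \<epsilon> by (auto simp: complex_eq_iff field_simps)
      then show False using that d by (auto simp: S_def)
    qed
    have Khol: "K \<epsilon> holomorphic_on S"
      unfolding K_def
      by (intro holomorphic_intros holomorphic_on_subset[OF hol]) (use nz d in \<open>auto simp: S_def\<close>)
    have convS: "convex S" unfolding S_def by (rule convex_halfspace_Im_gt)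
    have bound: "cmod (integral {- R..R} (\<lambda>x. K \<epsilon> (of_real x))) \<le> M * (1 / (\<epsilon> * R - 1))\<^sup>2 * R * pi"
      if R: "R > 0" "\<epsilon> * R > 1" for R
    proof -
      let ?l = "linepath (complex_of_real (- R)) (of_real R)" and ?a = "part_circlepath 0 R 0 pi"
      have a1: "pathstart ?a = of_real R" "pathfinish ?a = - of_real R"
        by (simp_all add: pathfinish_def pathstart_def part_circlepath_def linepath_def)
      have pa: "Im z \<ge> 0 \<and> cmod z = R" if "z \<in> path_image ?a" for z
      proof -
        from that obtain t where "0 \<le> t" "t \<le> pi" "z = of_real R * cis t"
          using R by (auto simp: path_image_part_circlepath cis_conv_exp)
        then show ?thesis using R by (auto simp: norm_mult sin_ge_zero)
      qed
      have pl: "Im z = 0" if "z \<in> path_image ?l" for z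
        using that by (auto simp: closed_segment_def)
      have sub: "path_image ?l \<subseteq> S" "path_image ?a \<subseteq> S"
        using pa pl d by (force simp: S_def)+
      have "(K \<epsilon> has_contour_integral 0) (?l +++ ?a)"
        using sub a1 by (intro Cauchy_theorem_convex_simple[OF Khol convS])
          (auto simp: path_image_join)
      moreover have i: "K \<epsilon> contour_integrable_on ?l" "K \<epsilon> contour_integrable_on ?a"
        using sub Khol
        by (auto intro!: contour_integrable_continuous_linepath contour_integrable_continuous_part_circlepath
            intro: holomorphic_on_imp_continuous_on holomorphic_on_subset)
      then have "(K \<epsilon> has_contour_integral contour_integral ?l (K \<epsilon>) + contour_integral ?a (K \<epsilon>)) (?l +++ ?a)"
        by (intro has_contour_integral_join has_contour_integral_integral) auto
      ultimately have "contour_integral ?l (K \<epsilon>) + contour_integral ?a (K \<epsilon>) = 0"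
        using contour_integral_unique by metis
      then have "contour_integral ?l (K \<epsilon>) = - contour_integral ?a (K \<epsilon>)"
        by (simp add: eq_neg_iff_add_eq_0)
      then have "cmod (contour_integral ?l (K \<epsilon>)) = cmod (contour_integral ?a (K \<epsilon>))" by simp
      also have "\<dots> \<le> M * (1 / (\<epsilon> * R - 1))\<^sup>2 * R * \<bar>pi - 0\<bar>"
      proof (intro contour_integral_bound_part_circlepath i)
        fix z assume "z \<in> path_image ?a"
        note z = pa[OF this]
        have "\<epsilon> * R - 1 \<le> cmod (\<i> + of_real \<epsilon> * z)"
          using norm_triangle_ineq2[of "of_real \<epsilon> * z" "- \<i>"] z \<epsilon> by (simp add: norm_mult algebra_simps)
        then have "cmod (\<i> / (\<i> + of_real \<epsilon> * z)) \<le> 1 / (\<epsilon> * R - 1)"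
          using R by (simp add: norm_divide frac_le)
        then have "(cmod (\<i> / (\<i> + of_real \<epsilon> * z)))\<^sup>2 \<le> (1 / (\<epsilon> * R - 1))\<^sup>2"
          by (intro power_mono) auto
        then show "cmod (K \<epsilon> z) \<le> M * (1 / (\<epsilon> * R - 1))\<^sup>2"
          unfolding K_def norm_mult norm_power using bd z M by (intro mult_mono) auto
      qed (use M R in auto)
      finally show ?thesis
        using contour_integral_linepath_Reals_eq[of "of_real (- R)" "of_real R" "K \<epsilon>"] R by simp
    qed
    have "((\<lambda>R. M * (1 / (\<epsilon> * R - 1))\<^sup>2 * R * pi) \<longlongrightarrow> 0) at_top"
      using \<epsilon> by real_asymp
    then have "(\<lambda>n. M * (1 / (\<epsilon> * real n - 1))\<^sup>2 * real n * pi) \<longlonglongrightarrow> 0"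
      by (rule filterlim_compose) (rule filterlim_real_sequentially)
    moreover have "eventually (\<lambda>n. real n > 0) sequentially" "eventually (\<lambda>n. \<epsilon> * real n > 1) sequentially"
      using \<epsilon> by real_asymp+
    then have "eventually (\<lambda>n. cmod (integral {- real n..real n} (\<lambda>x. K \<epsilon> (of_real x)))
        \<le> M * (1 / (\<epsilon> * real n - 1))\<^sup>2 * real n * pi) sequentially"
      by eventually_elim (use bound in blast)
    from this calculation(1) have "(\<lambda>n. integral {- real n..real n} (\<lambda>x. K \<epsilon> (of_real x))) \<longlonglongrightarrow> 0"
      by (rule Lim_null_comparison)
    then show ?thesis
      using tendsto_integral_symmetric[OF Kint[of \<epsilon>]] LIMSEQ_unique by blast
  qed
  have "(\<lambda>n. LBINT x. K (1 / real (Suc n)) (of_real x)) \<longlonglongrightarrow> (LBINT x. H (of_real x))"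
  proof (rule integral_dominated_convergence[where w = "\<lambda>x. cmod (H (of_real x))"])
    show "AE x in lborel. (\<lambda>n. K (1 / real (Suc n)) (of_real x)) \<longlonglongrightarrow> H (of_real x)"
    proof (rule AE_I2)
      fix x :: real
      have "(\<lambda>n. K (1 / real (Suc n)) (of_real x)) \<longlonglongrightarrow> H (of_real x) * (\<i> / (\<i> + of_real 0 * of_real x))\<^sup>2"
        unfolding K_def
        by (intro tendsto_intros LIMSEQ_Suc lim_1_over_n) auto
      then show "(\<lambda>n. K (1 / real (Suc n)) (of_real x)) \<longlonglongrightarrow> H (of_real x)" by simp
    qed
  qed (use Kle Kmeas measH intH in auto)
  moreover have "(\<lambda>n. LBINT x. K (1 / real (Suc n)) (of_real x)) = (\<lambda>n. 0)"
    using K0 by simp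
  ultimately show "(LBINT x. H (of_real x)) = 0"
    using LIMSEQ_unique[OF _ tendsto_const] by simp
qed


text \<open>Subtracting the constant \<open>P 0\<close> would cancel the pole at \<open>0\<close>
  but spoil the decay. The function \<open>P 0 * (\<i> / (z + \<i>))\<close> has the same value at
  \<open>0\<close>, decays like \<open>1 / x\<close>, and is holomorphic above height
  \<open>- 1\<close>.\<close>

lemma integral_real_line_pole_half_plane:
  assumes hol: "P holomorphic_on UNIV"
    and bd: "\<And>z. 0 \<le> Im z \<Longrightarrow> cmod (P z) \<le> M"
    and dec: "\<And>x. cmod (P (of_real x)) \<le> C / (1 + \<bar>x\<bar>)"
  shows "integrable lborel (\<lambda>x::real. (P x - P 0 * (\<i> / (x + \<i>))) / x)" (is "integrable _ ?f")
    and "(LBINT x. (P (of_real x) - P 0 * (\<i> / (x + \<i>))) / x) = 0"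
proof -
  define T where "T = (\<lambda>z. P z - P 0 * (\<i> / (z + \<i>)))"
  \<comment> \<open>The removable singularity at \<open>0\<close> is filled in with the derivative,
    in the shape required by \<open>pole_lemma\<close>.\<close>
  define H where "H = (\<lambda>z. if z = 0 then deriv T 0 else (T z - T 0) / (z - 0))"
  have T0: "T 0 = 0" by (simp add: T_def field_simps)
  have op: "open {z::complex. - 1 < Im z}" by (intro open_Collect_less continuous_intros)
  have "z + \<i> \<noteq> 0" if "- 1 < Im z" for z
  proof
    assume "z + \<i> = 0"
    then have "Im z = - 1" by (auto simp: complex_eq_iff)
    then show False using that by simp
  qed
  then have "T holomorphic_on {z. - 1 < Im z}" unfolding T_def
    by (intro holomorphic_intros holomorphic_on_subset[OF hol]) auto
  then have H: "H holomorphic_on {z. - 1 < Im z}"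
    unfolding H_def by (rule pole_lemma) (use op in \<open>simp add: interior_open\<close>)
  have ge1: "1 \<le> cmod (z + \<i>)" if "0 \<le> Im z" for z
    using abs_Im_le_cmod[of "z + \<i>"] that by simp
  have P0: "cmod (P 0) \<le> M" using bd[of 0] by simp
  have T2: "cmod (T z) \<le> M + cmod (P 0) / cmod (z + \<i>)" if "0 \<le> Im z" for z
    unfolding T_def using bd[OF that] norm_triangle_ineq4[of "P z" "P 0 * (\<i> / (z + \<i>))"]
    by (simp add: norm_mult norm_divide)
  have "compact (cball 0 1 \<inter> {z::complex. 0 \<le> Im z})"
    by (intro compact_Int_closed closed_Collect_le continuous_intros compact_cball)
  moreover have "continuous_on (cball 0 1 \<inter> {z::complex. 0 \<le> Im z}) H"
    using holomorphic_on_imp_continuous_on[OF H] by (rule continuous_on_subset) auto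
  ultimately have "bounded (H ` (cball 0 1 \<inter> {z::complex. 0 \<le> Im z}))"
    using compact_continuous_image compact_imp_bounded by blast
  then obtain B where B: "B > 0" "\<And>z. 0 \<le> Im z \<Longrightarrow> cmod z \<le> 1 \<Longrightarrow> cmod (H z) \<le> B"
    unfolding bounded_pos by auto
  \<comment> \<open>Near \<open>0\<close> compactness bounds the quotient. For
    \<open>1 < cmod z\<close> dividing by \<open>z\<close> only helps, and \<open>T\<close> is at
    most \<open>2 * M\<close> because \<open>1 \<le> cmod (z + \<i>)\<close> in the
    half-plane.\<close>
  define M' where "M' = max B (M + M)"
  have M': "cmod (H z) \<le> M'" if "0 \<le> Im z" for z
  proof (cases "cmod z \<le> 1")
    case True
    then show ?thesis using B that by (simp add: M'_def le_max_iff_disj)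
  next
    case False
    then have "cmod (H z) = cmod (T z) / cmod z" by (auto simp: H_def T0 norm_divide)
    also have "\<dots> \<le> cmod (T z)" using False by (simp add: divide_le_eq mult_le_cancel_left1)
    also have "\<dots> \<le> M + cmod (P 0) / cmod (z + \<i>)" by (rule T2[OF that])
    also have "cmod (P 0) / cmod (z + \<i>) \<le> cmod (P 0) / 1"
      using ge1[OF that] by (intro divide_left_mono) auto
    finally show ?thesis using P0 by (simp add: M'_def)
  qed
  have C: "cmod (P 0) \<le> C" using dec[of 0] by simp
  then have C0: "0 \<le> C" using norm_ge_zero order_trans by blast
  have "M' > 0" using B by (simp add: M'_def)
  \<comment> \<open>For \<open>\<bar>x\<bar> \<le> 1\<close> the factor 2 bounds
    \<open>1 + x\<^sup>2\<close>. Beyond, both terms of \<open>T\<close> contribute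
    \<open>C / \<bar>x\<bar>\<close>, and another 2 comes from
    \<open>1 + x\<^sup>2 \<le> 2 * x\<^sup>2\<close>.\<close>
  define C' where "C' = max (2 * M') (4 * C)"
  have dec': "cmod (H (of_real x)) \<le> C' / (1 + x\<^sup>2)" for x
  proof (cases "\<bar>x\<bar> \<le> 1")
    case True
    then have "1 + x\<^sup>2 \<le> 2" by (simp add: abs_square_le_1)
    have "cmod (H (of_real x)) \<le> M'" by (rule M') simp
    also have "\<dots> \<le> C' / 2" by (simp add: C'_def)
    also have "\<dots> \<le> C' / (1 + x\<^sup>2)"
      using \<open>1 + x\<^sup>2 \<le> 2\<close> \<open>M' > 0\<close>
      by (intro divide_left_mono) (auto simp: C'_def le_max_iff_disj add_pos_nonneg)
    finally show ?thesis .
  next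
    case False
    have "\<bar>x\<bar> \<le> cmod (of_real x + \<i>)" using abs_Re_le_cmod[of "of_real x + \<i>"] by simp
    then have "cmod (P 0) / cmod (of_real x + \<i>) \<le> C / \<bar>x\<bar>"
      using C False C0 by (intro frac_le) auto
    moreover have "C / (1 + \<bar>x\<bar>) \<le> C / \<bar>x\<bar>" using C0 False by (intro divide_left_mono) auto
    ultimately have "cmod (T (of_real x)) \<le> 2 * C / \<bar>x\<bar>"
      unfolding T_def using dec[of x] norm_triangle_ineq4[of "P x" "P 0 * (\<i> / (x + \<i>))"]
      by (simp add: norm_mult norm_divide)
    moreover have "cmod (H (of_real x)) = cmod (T (of_real x)) / \<bar>x\<bar>"
      using False by (auto simp: H_def T0 norm_divide)
    ultimately have "cmod (H (of_real x)) \<le> (2 * C / \<bar>x\<bar>) / \<bar>x\<bar>"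
      using divide_right_mono[OF _ abs_ge_zero] by metis
    also have "\<dots> = 4 * C / (2 * x\<^sup>2)" by (simp add: power2_eq_square)
    also have "\<dots> \<le> 4 * C / (1 + x\<^sup>2)"
    proof (intro divide_left_mono)
      have "\<bar>x\<bar> * \<bar>x\<bar> \<ge> 1" using False mult_mono[of 1 "\<bar>x\<bar>" 1 "\<bar>x\<bar>"] by simp
      then have "x\<^sup>2 \<ge> 1" by (simp add: power2_eq_square)
      then show "1 + x\<^sup>2 \<le> 2 * x\<^sup>2" "0 < 2 * x\<^sup>2 * (1 + x\<^sup>2)"
        by (auto intro!: mult_pos_pos simp: add_pos_nonneg)
    qed (use C0 in auto)
    also have "\<dots> \<le> C' / (1 + x\<^sup>2)" by (intro divide_right_mono) (auto simp: C'_def)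
    finally show ?thesis .
  qed
  have res: "integrable lborel (\<lambda>x. H (of_real x))" "(LBINT x. H (of_real x)) = 0"
    by (rule integral_real_line_half_plane[OF H _ M' dec']; simp)+
  have AE: "AE x in lborel. H (of_real x) = ?f x"
    using AE_lborel_singleton[of "0::real"] by eventually_elim (simp add: H_def T0, simp add: T_def)
  have "continuous_on UNIV (\<lambda>x::real. P (of_real x))"
    by (rule continuous_on_compose2[OF holomorphic_on_imp_continuous_on[OF hol]])
      (auto intro: continuous_intros)
  then have [measurable]: "(\<lambda>x::real. P (of_real x)) \<in> borel_measurable borel"
    by (rule borel_measurable_continuous_onI)
  have meas: "?f \<in> borel_measurable lborel" by simp
  show "integrable lborel ?f"
    using integrable_cong_AE[THEN iffD1, OF borel_measurable_integrable[OF res(1)] meas AE res(1)] .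
  show "(LBINT x. ?f x) = 0"
    using integral_cong_AE[OF borel_measurable_integrable[OF res(1)] meas AE] res(2) by simp
qed

text \<open>Each quotient by \<open>x\<close> is corrected by a Cauchy kernel with its pole in the opposite half-plane,
  so that both pieces integrate to zero and only the difference of the kernels remains.\<close>

lemma integral_difference_over_x:
  assumes P: "P holomorphic_on UNIV" "\<And>z. 0 \<le> Im z \<Longrightarrow> cmod (P z) \<le> M"
      "\<And>x. cmod (P (of_real x)) \<le> C / (1 + \<bar>x\<bar>)"
    and Q: "Q holomorphic_on UNIV" "\<And>z. Im z \<le> 0 \<Longrightarrow> cmod (Q z) \<le> M"
      "\<And>x. cmod (Q (of_real x)) \<le> C / (1 + \<bar>x\<bar>)"
    and eq: "P 0 = Q 0"
  shows "(LBINT x. (P (of_real x) - Q (of_real x)) / (\<i> * of_real x)) = 2 * of_real pi * P 0"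
proof -
  define p where "p x = (P (of_real x) - P 0 * (\<i> / (of_real x + \<i>))) / of_real x" for x :: real
  \<comment> \<open>\<open>Q\<close> is reflected, so that the result for the upper half-plane
    applies to it as well.\<close>
  define q where "q x = (Q (- of_real x) - Q 0 * (\<i> / (of_real x + \<i>))) / of_real x" for x :: real
  have p: "integrable lborel p" "(LBINT x. p x) = 0"
    unfolding p_def using integral_real_line_pole_half_plane[OF P] by auto
  have Q1: "(\<lambda>z. Q (- z)) holomorphic_on UNIV"
    using holomorphic_on_compose_gen[of uminus UNIV Q UNIV] Q(1)
    by (simp add: o_def holomorphic_on_minus holomorphic_on_ident)
  have Q2: "cmod (Q (- z)) \<le> M" if "0 \<le> Im z" for z using Q(2)[of "- z"] that by simp
  have Q3: "cmod (Q (- of_real x)) \<le> C / (1 + \<bar>x\<bar>)" for x using Q(3)[of "- x"] by simp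
  have q: "integrable lborel q" "(LBINT x. q x) = 0"
    unfolding q_def using integral_real_line_pole_half_plane[OF Q1 Q2 Q3] by auto
  have q': "integrable lborel (\<lambda>x. q (- x))" "(LBINT x. q (- x)) = 0"
    using q lborel_integral_real_affine[of "- 1" q 0] lborel_integrable_real_affine_iff[of "- 1" q 0]
    by simp_all
  \<comment> \<open>What is left of the two kernels:
    \<open>(\<i> / (- x + \<i>) - \<i> / (x + \<i>)) / x\<close> is a multiple of
    \<open>1 / (1 + x\<^sup>2)\<close>, whose integral \<open>pi\<close> is the origin of the value
    \<open>2 * pi * P 0\<close>.\<close>
  define k where "k x = 2 * P 0 * of_real (1 / (1 + x\<^sup>2))" for x :: real
  have "integrable lborel (\<lambda>x::real. complex_of_real (1 / (1 + x\<^sup>2)))"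
      "(LBINT x. complex_of_real (1 / (1 + x\<^sup>2))) = of_real pi"
    using integrable_inverse_1_plus_square_lborel integral_inverse_1_plus_square_lborel
    by (simp_all only: integrable_of_real integral_complex_of_real)
  then have k: "integrable lborel k" "(LBINT x. k x) = 2 * of_real pi * P 0"
    unfolding k_def by (auto simp del: of_real_divide of_real_add)
  have split: "(P (of_real x) - Q (of_real x)) / (\<i> * of_real x) = (p x + q (- x)) / \<i> + k x"
    if "x \<noteq> 0" for x
  proof -
    define X where "X = complex_of_real x"
    have X: "X \<noteq> 0" using that by (simp add: X_def)
    have "1 + x\<^sup>2 \<noteq> 0" by (metis add_pos_nonneg less_irrefl zero_le_power2 zero_less_one)
    then have "complex_of_real (1 + x\<^sup>2) \<noteq> 0" using of_real_eq_0_iff by blast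
    define S where "S = 1 + X\<^sup>2"
    have n3: "S \<noteq> 0" using \<open>complex_of_real (1 + x\<^sup>2) \<noteq> 0\<close> by (simp add: S_def X_def)
    have n: "X + \<i> \<noteq> 0" "- X + \<i> \<noteq> 0" by (auto simp: complex_eq_iff X_def)
    have prod: "(- X + \<i>) * (X + \<i>) = - S"
      by (simp add: S_def algebra_simps power2_eq_square)
    have "\<i> / (- X + \<i>) - \<i> / (X + \<i>) = \<i> * (2 * X) / (- S)"
      unfolding prod[symmetric] using n by (subst diff_frac_eq) (auto simp: algebra_simps)
    then have D: "P 0 * (\<i> / (- X + \<i>) - \<i> / (X + \<i>)) / X = - (2 * \<i> * P 0 / S)"
      using X n3 by (simp only:) (simp add: field_simps)
    have "p x + q (- x) = (P X - P 0 * (\<i> / (X + \<i>))) / X - (Q X - P 0 * (\<i> / (- X + \<i>))) / X"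
      by (simp add: p_def q_def X_def eq)
    also have "\<dots> = (P X - Q X) / X + P 0 * (\<i> / (- X + \<i>) - \<i> / (X + \<i>)) / X"
      by (simp only: right_diff_distrib diff_divide_distrib) simp
    also have "\<dots> = (P X - Q X) / X - 2 * \<i> * P 0 / S" unfolding D by simp
    finally have "(p x + q (- x)) / \<i> = ((P X - Q X) / X) / \<i> - (2 * \<i> * P 0 / S) / \<i>"
      by (simp only: diff_divide_distrib)
    also have "(2 * \<i> * P 0 / S) / \<i> = 2 * P 0 / S" using n3 by (simp add: field_simps)
    also have "2 * P 0 / S = k x" by (simp add: k_def S_def X_def)
    also have "((P X - Q X) / X) / \<i> = (P X - Q X) / (\<i> * X)"
      by (simp only: divide_divide_eq_left mult.commute)
    finally show ?thesis by (simp add: X_def)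
  qed
  have AE: "AE x in lborel. (P (of_real x) - Q (of_real x)) / (\<i> * of_real x) = (p x + q (- x)) / \<i> + k x"
    using AE_lborel_singleton[of "0::real"] by (rule eventually_mono) (rule split)
  have c: "continuous_on UNIV (\<lambda>x::real. f (of_real x))" if "f holomorphic_on UNIV" for f
    by (rule continuous_on_compose2[OF holomorphic_on_imp_continuous_on[OF that]])
      (auto intro: continuous_intros)
  have [measurable]: "(\<lambda>x::real. P (of_real x)) \<in> borel_measurable borel"
       "(\<lambda>x::real. Q (of_real x)) \<in> borel_measurable borel"
    using c[OF P(1)] c[OF Q(1)] by (auto intro: borel_measurable_continuous_onI)
  have "(LBINT x. (P (of_real x) - Q (of_real x)) / (\<i> * of_real x)) = (LBINT x. (p x + q (- x)) / \<i> + k x)"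
    by (rule integral_cong_AE[OF _ _ AE])
      (use borel_measurable_integrable[OF p(1)] borel_measurable_integrable[OF q'(1)]
        borel_measurable_integrable[OF k(1)] in simp_all)
  also have "\<dots> = 2 * of_real pi * P 0"
    using p q' k by simp
  finally show ?thesis .
qed

section \<open>Weight functions\<close>

context weight
begin

text \<open>The admissible size of the \<open>j\<close>-th derivative. Substituting
  \<open>x = exp t\<close> shows that it is the supremum of
  \<open>x ^ j * exp (- q * \<omega> x)\<close> over \<open>x \<ge> 1\<close>;
  \<open>power_le_E\<close> and \<open>E_least\<close> express this, and most estimates of
  \<open>E\<close> go through them.\<close>

definition E :: "real \<Rightarrow> nat \<Rightarrow> real" where
  "E q j = exp (q * young_conj \<omega> (real j / q))"

lemma E_pos [simp]: "0 < E q j" "0 \<le> E q j" "E q j \<noteq> 0"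
  by (simp_all add: E_def)

lemma omega_mono: "0 \<le> x \<Longrightarrow> x \<le> y \<Longrightarrow> \<omega> x \<le> \<omega> y"
  using mono by (auto simp: mono_on_def)

lemma ln_le_omega:
  assumes "0 < \<epsilon>"
  obtains C where "0 < C" "\<And>x. 1 \<le> x \<Longrightarrow> ln x \<le> \<epsilon> * \<omega> x + C"
proof -
  have "eventually (\<lambda>x. norm (ln x) \<le> \<epsilon> * norm (\<omega> x)) at_top"
    using landau_o.smallD[OF ln_small assms] .
  then obtain x0 where x0: "\<And>x. x \<ge> x0 \<Longrightarrow> \<bar>ln x\<bar> \<le> \<epsilon> * \<bar>\<omega> x\<bar>"
    by (auto simp: eventually_at_top_linorder)
  have p: "0 \<le> ln (max 1 x0)" by simp
  have "ln x \<le> \<epsilon> * \<omega> x + (ln (max 1 x0) + 1)" if "1 \<le> x" for x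
  proof (cases "x0 \<le> x")
    case True
    then have "ln x \<le> \<epsilon> * \<omega> x" using x0[of x] nonneg[of x] that by simp
    then show ?thesis using p by linarith
  next
    case False
    then have "ln x \<le> ln (max 1 x0)" using that by simp
    moreover have "0 \<le> \<epsilon> * \<omega> x" using nonneg[of x] that assms by simp
    ultimately show ?thesis by linarith
  qed
  moreover have "0 < ln (max 1 x0) + 1" using p by linarith
  ultimately show thesis using that by blast
qed

lemma omega_le_linear:
  assumes "0 < \<epsilon>"
  obtains C where "0 < C" "\<And>x. 0 \<le> x \<Longrightarrow> \<omega> x \<le> \<epsilon> * x + C"
proof -
  have "eventually (\<lambda>x. norm (\<omega> x) \<le> \<epsilon> * norm x) at_top"
    using landau_o.smallD[OF small assms] .
  then obtain x0 where x0: "\<And>x. x \<ge> x0 \<Longrightarrow> \<bar>\<omega> x\<bar> \<le> \<epsilon> * \<bar>x\<bar>"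
    by (auto simp: eventually_at_top_linorder)
  have "\<omega> x \<le> \<epsilon> * x + (\<omega> (max 0 x0) + 1)" if "0 \<le> x" for x
  proof (cases "x0 \<le> x")
    case True
    then show ?thesis using x0[of x] nonneg[of x] nonneg[of "max 0 x0"] that by simp
  next
    case False
    then have "\<omega> x \<le> \<omega> (max 0 x0)" using that by (intro omega_mono) auto
    moreover have "0 \<le> \<epsilon> * x" using that assms by simp
    ultimately show ?thesis by linarith
  qed
  then show thesis using that[of "\<omega> (max 0 x0) + 1"] nonneg[of "max 0 x0"] by simp
qed

lemma power_exp_omega_bounded:
  assumes "0 < \<epsilon>"
  obtains C where "0 < C" "\<And>x. 0 \<le> x \<Longrightarrow> (1 + x) ^ n * exp (- \<epsilon> * \<omega> x) \<le> C"
proof -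
  obtain C where C: "0 < C" "\<And>x. 1 \<le> x \<Longrightarrow> ln x \<le> \<epsilon> / (real n + 1) * \<omega> x + C"
    using ln_le_omega[of "\<epsilon> / (real n + 1)"] assms by auto
  have "(1 + x) ^ n * exp (- \<epsilon> * \<omega> x) \<le> 2 ^ n * exp (real n * C)" if x: "0 \<le> x" for x
  proof (cases "1 \<le> x")
    case True
    have "real n * ln x \<le> real n * (\<epsilon> / (real n + 1) * \<omega> x + C)"
      by (intro mult_left_mono C True) auto
    also have "\<dots> = (real n / (real n + 1)) * (\<epsilon> * \<omega> x) + real n * C"
      by (simp add: field_simps)
    also have "\<dots> \<le> 1 * (\<epsilon> * \<omega> x) + real n * C"
      using assms nonneg[OF x] by (intro add_right_mono mult_right_mono) auto
    finally have "exp (real n * ln x - \<epsilon> * \<omega> x) \<le> exp (real n * C)" by simp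
    moreover have "exp (real n * ln x) = x ^ n" using True by (simp add: exp_of_nat_mult)
    ultimately have "x ^ n * exp (- \<epsilon> * \<omega> x) \<le> exp (real n * C)"
      by (simp add: exp_diff exp_minus divide_inverse)
    moreover have "(1 + x) ^ n \<le> (2 * x) ^ n" using True by (intro power_mono) auto
    then have "(1 + x) ^ n * exp (- \<epsilon> * \<omega> x) \<le> (2 * x) ^ n * exp (- \<epsilon> * \<omega> x)"
      by (intro mult_right_mono) auto
    then have "(1 + x) ^ n * exp (- \<epsilon> * \<omega> x) \<le> 2 ^ n * (x ^ n * exp (- \<epsilon> * \<omega> x))"
      by (simp add: power_mult_distrib mult.assoc)
    moreover have "2 ^ n * (x ^ n * exp (- \<epsilon> * \<omega> x)) \<le> 2 ^ n * exp (real n * C)"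
      using calculation(1) by (intro mult_left_mono) auto
    ultimately show ?thesis by linarith
  next
    case False
    have "(1 + x) ^ n * exp (- \<epsilon> * \<omega> x) \<le> 2 ^ n * 1"
      using False x assms nonneg[OF x] by (intro mult_mono power_mono) auto
    also have "\<dots> \<le> 2 ^ n * exp (real n * C)" using C by (intro mult_left_mono) auto
    finally show ?thesis .
  qed
  then show thesis using that[of "2 ^ n * exp (real n * C)"] by simp
qed

lemma young_conj_bdd: "bdd_above ((\<lambda>t. s * t - \<omega> (exp t)) ` {0..})"
proof -
  obtain C where C: "\<And>x. 1 \<le> x \<Longrightarrow> ln x \<le> 1 / (\<bar>s\<bar> + 1) * \<omega> x + C" "0 < C"
    using ln_le_omega[of "1 / (\<bar>s\<bar> + 1)"] by (auto simp: add_nonneg_pos)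
  have "s * t - \<omega> (exp t) \<le> (\<bar>s\<bar> + 1) * C" if "0 \<le> t" for t
  proof -
    have "s * t \<le> (\<bar>s\<bar> + 1) * t" using that by (intro mult_right_mono) auto
    also have "\<dots> \<le> (\<bar>s\<bar> + 1) * (1 / (\<bar>s\<bar> + 1) * \<omega> (exp t) + C)"
      using C(1)[of "exp t"] that by (intro mult_left_mono) auto
    also have "\<dots> = \<omega> (exp t) + (\<bar>s\<bar> + 1) * C" by (simp add: field_simps)
    finally show ?thesis by simp
  qed
  then show ?thesis by (intro bdd_aboveI2[where M = "(\<bar>s\<bar> + 1) * C"]) auto
qed

lemma power_le_E:
  assumes "0 < q" "1 \<le> x"
  shows "x ^ j * exp (- q * \<omega> x) \<le> E q j"
proof -
  have "real j / q * ln x - \<omega> (exp (ln x)) \<le> young_conj \<omega> (real j / q)"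
    unfolding young_conj_def using assms by (intro cSUP_upper young_conj_bdd) auto
  then have "real j * ln x - q * \<omega> x \<le> q * young_conj \<omega> (real j / q)"
    using assms by (simp add: field_simps)
  then have "exp (real j * ln x - q * \<omega> x) \<le> E q j" unfolding E_def by simp
  moreover have "exp (real j * ln x) = x ^ j" using assms by (simp add: exp_of_nat_mult)
  ultimately show ?thesis by (simp add: exp_diff exp_minus divide_inverse)
qed

lemma E_least:
  assumes "0 < q" "\<And>x. 1 \<le> x \<Longrightarrow> x ^ j * exp (- q * \<omega> x) \<le> M"
  shows "E q j \<le> M"
proof -
  have "1 ^ j * exp (- q * \<omega> 1) \<le> M" using assms(2)[of 1] by simp
  moreover have "0 < 1 ^ j * exp (- q * \<omega> 1)" by simp
  ultimately have M: "0 < M" by (rule less_le_trans[rotated])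
  have "young_conj \<omega> (real j / q) \<le> ln M / q"
    unfolding young_conj_def
  proof (rule cSUP_least)
    fix t :: real assume "t \<in> {0..}"
    then have "exp t ^ j * exp (- q * \<omega> (exp t)) \<le> M" using assms(2)[of "exp t"] by simp
    then have "exp (real j * t - q * \<omega> (exp t)) \<le> M"
      by (simp add: exp_diff exp_minus divide_inverse exp_of_nat_mult)
    then have "real j * t - q * \<omega> (exp t) \<le> ln M" using M by (simp add: ln_ge_iff)
    then have "(real j * t - q * \<omega> (exp t)) / q \<le> ln M / q" using assms(1) by (intro divide_right_mono) auto
    then show "real j / q * t - \<omega> (exp t) \<le> ln M / q" using assms(1) by (simp add: diff_divide_distrib)
  qed auto
  then have "q * young_conj \<omega> (real j / q) \<le> ln M" using assms(1) by (simp add: field_simps)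
  then show ?thesis unfolding E_def using M by (metis exp_le_cancel_iff exp_ln)
qed

text \<open>The supremum behind \<open>E\<close> ranges over \<open>x \<ge> 1\<close> only. Below 1
  the left-hand side is at most 1, which the value at \<open>x = 1\<close> compensates up to the
  factor \<open>exp (q * \<omega> 1)\<close>.\<close>

lemma power_le_E':
  assumes "0 < q" "0 \<le> x"
  shows "x ^ j * exp (- q * \<omega> x) \<le> exp (q * \<omega> 1) * E q j"
proof (cases "1 \<le> x")
  case True
  have "1 * E q j \<le> exp (q * \<omega> 1) * E q j"
    using assms nonneg[of 1] by (intro mult_right_mono) auto
  then show ?thesis using power_le_E[OF assms(1) True, of j] by linarith
next
  case False
  have "x ^ j * exp (- q * \<omega> x) \<le> 1 * 1"
    using False assms nonneg[of x] by (intro mult_mono power_le_one) auto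
  also have "1 * 1 = exp (q * \<omega> 1) * (1 ^ j * exp (- q * \<omega> 1))" by (simp flip: exp_add)
  also have "\<dots> \<le> exp (q * \<omega> 1) * E q j" using power_le_E[OF assms(1), of 1 j] by simp
  finally show ?thesis .
qed

lemma E_antimono:
  assumes "0 < q" "q \<le> q'"
  shows "E q' j \<le> E q j"
proof (rule E_least)
  fix x :: real assume x: "1 \<le> x"
  have "x ^ j * exp (- q' * \<omega> x) \<le> x ^ j * exp (- q * \<omega> x)"
    using x assms nonneg[of x] by (intro mult_left_mono) (auto intro: mult_right_mono)
  also have "\<dots> \<le> E q j" using assms x by (intro power_le_E)
  finally show "x ^ j * exp (- q' * \<omega> x) \<le> E q j" .
qed (use assms in auto)

text \<open>The additional factor \<open>x\<close> is absorbed by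
  \<open>(q' - q) * \<omega> x\<close>. This is what makes differentiation continuous, with a loss
  from \<open>q'\<close> to \<open>q\<close>.\<close>

lemma E_Suc:
  assumes "0 < q" "q < q'"
  obtains C where "0 < C" "\<And>j. E q' (Suc j) \<le> C * E q j"
proof -
  obtain C where C: "0 < C" "\<And>x. 0 \<le> x \<Longrightarrow> (1 + x) ^ 1 * exp (- (q' - q) * \<omega> x) \<le> C"
    using power_exp_omega_bounded[of "q' - q" 1] assms by auto
  have "E q' (Suc j) \<le> C * E q j" for j
  proof (rule E_least)
    fix x :: real assume x: "1 \<le> x"
    have "x ^ Suc j * exp (- q' * \<omega> x) = (x * exp (- (q' - q) * \<omega> x)) * (x ^ j * exp (- q * \<omega> x))"
      by (simp add: algebra_simps flip: exp_add)
    also have "\<dots> \<le> C * E q j"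
    proof (rule mult_mono)
      have "x * exp (- (q' - q) * \<omega> x) \<le> (1 + x) ^ 1 * exp (- (q' - q) * \<omega> x)"
        by (intro mult_right_mono) auto
      then show "x * exp (- (q' - q) * \<omega> x) \<le> C" using C(2)[of x] x by linarith
    qed (use x C power_le_E[OF assms(1) x] in auto)
    finally show "x ^ Suc j * exp (- q' * \<omega> x) \<le> C * E q j" .
  qed (use assms in auto)
  then show thesis using C that by blast
qed

text \<open>Almost subadditivity compares \<open>x\<close> with \<open>2 * x\<close> only at the
  price of the factor 4; convexity of \<open>\<omega> (exp t)\<close> interpolates between the two
  points and brings the factor as close to 1 as desired for a small dilation.\<close>

lemma omega_dilation:
  assumes "1 < \<sigma>"
  obtains h C where "0 < h" "\<And>x. 1 \<le> x \<Longrightarrow> \<omega> (x * exp h) \<le> \<sigma> * \<omega> x + C"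
proof -
  obtain C0 where C0: "\<And>x y. 0 \<le> x \<Longrightarrow> 0 \<le> y \<Longrightarrow> \<omega> (x + y) \<le> 2 * (\<omega> x + \<omega> y) + C0" "0 < C0"
    using almost_subadditive[of 2] by auto
  \<comment> \<open>Convexity gives weight \<open>1 - l\<close> to \<open>\<omega> x\<close> and
    \<open>l\<close> to \<open>\<omega> (2 * x)\<close>, the latter at most
    \<open>4 * \<omega> x + C0\<close>; the resulting factor \<open>1 + 3 * l\<close> must not
    exceed \<open>\<sigma>\<close>.\<close>
  define l where "l = min 1 ((\<sigma> - 1) / 3)"
  have l: "0 < l" "l \<le> 1" "3 * l \<le> \<sigma> - 1" using assms by (auto simp: l_def min_def)
  define h where "h = l * ln 2"
  have "\<omega> (x * exp h) \<le> \<sigma> * \<omega> x + C0" if x: "1 \<le> x" for x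
  proof -
    have "\<omega> (exp ((1 - l) *\<^sub>R ln x + l *\<^sub>R (ln x + ln 2))) \<le> (1 - l) * \<omega> (exp (ln x)) + l * \<omega> (exp (ln x + ln 2))"
      using l x by (intro convex_onD[OF convex]) auto
    moreover have "(1 - l) *\<^sub>R ln x + l *\<^sub>R (ln x + ln 2) = ln x + h" by (simp add: h_def algebra_simps)
    ultimately have "\<omega> (x * exp h) \<le> (1 - l) * \<omega> x + l * \<omega> (x + x)"
      using x by (simp only:) (simp add: exp_add mult_2_right)
    also have "l * \<omega> (x + x) \<le> l * (4 * \<omega> x + C0)"
      using C0(1)[of x x] x l by (intro mult_left_mono) auto
    also have "(1 - l) * \<omega> x + l * (4 * \<omega> x + C0) = (1 + 3 * l) * \<omega> x + l * C0"
      by (simp add: algebra_simps)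
    also have "\<dots> \<le> \<sigma> * \<omega> x + 1 * C0"
      using l C0 nonneg[of x] x by (intro add_mono mult_right_mono) auto
    finally show ?thesis by simp
  qed
  then show thesis using that[of h C0] l by (auto simp: h_def)
qed

text \<open>Evaluating the supremum at \<open>x * exp h\<close> instead of \<open>x\<close> gains
  \<open>exp (real j * h)\<close>, and \<open>omega_dilation\<close> pays for it by the passage from
  \<open>q'\<close> to \<open>q\<close>. A geometric factor beats the linear one.\<close>

lemma E_linear_factor:
  assumes "0 < q" "q < q'"
  obtains C where "0 < C" "\<And>j. (real j + 1) * E q' j \<le> C * E q j"
proof -
  obtain h C where h: "0 < h" "\<And>x. 1 \<le> x \<Longrightarrow> \<omega> (x * exp h) \<le> q' / q * \<omega> x + C"
    using omega_dilation[of "q' / q"] assms by auto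
  have "(real j + 1) * E q' j \<le> (1 + 1 / h) * exp (q * C) * E q j" for j
  proof -
    have "E q' j \<le> exp (q * C) * E q j * exp (- (real j * h))"
    proof (rule E_least)
      fix x :: real assume x: "1 \<le> x"
      have "1 * 1 \<le> x * exp h" using x h by (intro mult_mono) auto
      then have "(x * exp h) ^ j * exp (- q * \<omega> (x * exp h)) \<le> E q j"
        by (intro power_le_E assms) auto
      moreover have "q * \<omega> (x * exp h) \<le> q' * \<omega> x + q * C"
        using h(2)[OF x] assms by (simp add: field_simps)
      then have "(x * exp h) ^ j * exp (- q' * \<omega> x - q * C) \<le> (x * exp h) ^ j * exp (- q * \<omega> (x * exp h))"
        using x by (intro mult_left_mono) auto
      ultimately have "(x * exp h) ^ j * exp (- q' * \<omega> x - q * C) \<le> E q j" by linarith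
      then have "(x * exp h) ^ j * exp (- q' * \<omega> x - q * C) * (exp (q * C) * exp (- (real j * h)))
          \<le> E q j * (exp (q * C) * exp (- (real j * h)))"
        by (intro mult_right_mono) auto
      moreover have "(x * exp h) ^ j * exp (- q' * \<omega> x - q * C) * (exp (q * C) * exp (- (real j * h)))
          = x ^ j * exp (- q' * \<omega> x)"
        by (simp add: power_mult_distrib exp_of_nat_mult[symmetric] flip: exp_add)
      moreover have "E q j * (exp (q * C) * exp (- (real j * h))) = exp (q * C) * E q j * exp (- (real j * h))"
        by simp
      ultimately show "x ^ j * exp (- q' * \<omega> x) \<le> exp (q * C) * E q j * exp (- (real j * h))"
        by linarith
    qed (use assms in auto)
    moreover have "real j + 1 \<le> (1 + 1 / h) * (1 + real j * h)"
      using h by (simp add: field_simps)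
    moreover have "(1 + 1 / h) * (1 + real j * h) \<le> (1 + 1 / h) * exp (real j * h)"
      using h exp_ge_add_one_self[of "real j * h"] by (intro mult_left_mono) auto
    ultimately have "(real j + 1) * E q' j \<le>
        ((1 + 1 / h) * exp (real j * h)) * (exp (q * C) * E q j * exp (- (real j * h)))"
      using h by (intro mult_mono) auto
    also have "\<dots> = (1 + 1 / h) * exp (q * C) * E q j * (exp (real j * h) * exp (- (real j * h)))"
      by (simp only: mult_ac)
    finally show ?thesis by (simp flip: exp_add)
  qed
  then show thesis using that[of "(1 + 1 / h) * exp (q * C)"] h by (simp add: add_pos_pos)
qed

text \<open>A single binomial term is at most \<open>(x + y) ^ j\<close>, and almost subadditivity
  with \<open>\<sigma> = q' / q\<close> bounds the weight at \<open>x + y\<close> by those at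
  \<open>x\<close> and \<open>y\<close>.\<close>

lemma E_binomial:
  assumes "0 < q" "q < q'"
  obtains C where "0 < C" "\<And>i j. i \<le> j \<Longrightarrow> real (j choose i) * E q' i * E q' (j - i) \<le> C * E q j"
proof -
  obtain C where C: "\<And>x y. 0 \<le> x \<Longrightarrow> 0 \<le> y \<Longrightarrow> \<omega> (x + y) \<le> q' / q * (\<omega> x + \<omega> y) + C" "0 < C"
    using almost_subadditive[of "q' / q"] assms by auto
  have "real (j choose i) * E q' i * E q' (j - i) \<le> exp (q * C) * E q j" if ij: "i \<le> j" for i j
  proof -
    have b: "0 < real (j choose i)" using ij by simp
    have main: "real (j choose i) * (x ^ i * exp (- q' * \<omega> x)) * (y ^ (j - i) * exp (- q' * \<omega> y)) \<le> exp (q * C) * E q j"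
      if x: "1 \<le> x" and y: "1 \<le> y" for x y
    proof -
      have "real (j choose i) * x ^ i * y ^ (j - i) \<le> (\<Sum>k\<le>j. real (j choose k) * x ^ k * y ^ (j - k))"
        using x y ij by (intro member_le_sum) auto
      then have p: "real (j choose i) * x ^ i * y ^ (j - i) \<le> (x + y) ^ j" by (simp add: binomial_ring)
      have "q * \<omega> (x + y) \<le> q' * \<omega> x + q' * \<omega> y + q * C"
        using C(1)[of x y] x y assms by (simp add: field_simps)
      then have e: "exp (- q' * \<omega> x - q' * \<omega> y) \<le> exp (q * C - q * \<omega> (x + y))" by simp
      have "real (j choose i) * (x ^ i * exp (- q' * \<omega> x)) * (y ^ (j - i) * exp (- q' * \<omega> y)) =
        (real (j choose i) * x ^ i * y ^ (j - i)) * exp (- q' * \<omega> x - q' * \<omega> y)"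
        by (simp add: exp_diff exp_minus divide_inverse mult_ac)
      also have "\<dots> \<le> (x + y) ^ j * exp (q * C - q * \<omega> (x + y))"
        using x y by (intro mult_mono p e) auto
      also have "\<dots> = exp (q * C) * ((x + y) ^ j * exp (- q * \<omega> (x + y)))"
        by (simp add: exp_diff exp_minus divide_inverse mult_ac)
      also have "\<dots> \<le> exp (q * C) * E q j"
        using power_le_E[of q "x + y" j] x y assms by simp
      finally show ?thesis .
    qed
    \<comment> \<open>The supremum over \<open>x\<close> is taken with \<open>y\<close> fixed, then
      the one over \<open>y\<close>, each time after moving the other factors to the right-hand
      side.\<close>
    have "E q' i \<le> exp (q * C) * E q j / (real (j choose i) * (y ^ (j - i) * exp (- q' * \<omega> y)))"
      if y: "1 \<le> y" for y
    proof (rule E_least)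
      fix x :: real assume "1 \<le> x"
      moreover have "0 < real (j choose i) * (y ^ (j - i) * exp (- q' * \<omega> y))" using b y by simp
      ultimately show "x ^ i * exp (- q' * \<omega> x) \<le> exp (q * C) * E q j / (real (j choose i) * (y ^ (j - i) * exp (- q' * \<omega> y)))"
        using main[of x y] y by (simp only: pos_le_divide_eq mult_ac)
    qed (use assms in auto)
    moreover have "0 < real (j choose i) * (y ^ (j - i) * exp (- q' * \<omega> y))" if "1 \<le> y" for y
      using b that by simp
    ultimately have m2: "E q' i * (real (j choose i) * (y ^ (j - i) * exp (- q' * \<omega> y))) \<le> exp (q * C) * E q j" if "1 \<le> y" for y
      using that pos_le_divide_eq by blast
    have "E q' (j - i) \<le> exp (q * C) * E q j / (real (j choose i) * E q' i)"
    proof (rule E_least)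
      fix y :: real assume "1 \<le> y"
      moreover have "0 < real (j choose i) * E q' i" using b by simp
      ultimately show "y ^ (j - i) * exp (- q' * \<omega> y) \<le> exp (q * C) * E q j / (real (j choose i) * E q' i)"
        using m2[of y] by (simp only: pos_le_divide_eq mult_ac)
    qed (use assms in auto)
    then show ?thesis using b by (simp add: pos_le_divide_eq mult_ac)
  qed
  then show thesis using that[of "exp (q * C)"] by simp
qed

text \<open>Each term is bounded with an intermediate exponent \<open>p\<close>; the number
  \<open>j + 1\<close> of terms is absorbed between \<open>p\<close> and \<open>q\<close>.\<close>

lemma E_Leibniz:
  assumes "0 < q" "q < q'"
  obtains C where "0 < C" "\<And>j. (\<Sum>i\<le>j. real (j choose i) * E q' i * E q' (j - i)) \<le> C * E q j"
proof -
  define p where "p = (q + q') / 2"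
  have p: "0 < p" "q < p" "p < q'" using assms by (auto simp: p_def)
  obtain C where C: "0 < C" "\<And>i j. i \<le> j \<Longrightarrow> real (j choose i) * E q' i * E q' (j - i) \<le> C * E p j"
    using E_binomial[OF p(1,3)] by blast
  obtain C' where C': "0 < C'" "\<And>j. (real j + 1) * E p j \<le> C' * E q j"
    using E_linear_factor[OF assms(1) p(2)] by blast
  have "(\<Sum>i\<le>j. real (j choose i) * E q' i * E q' (j - i)) \<le> C * C' * E q j" for j
  proof -
    have "(\<Sum>i\<le>j. real (j choose i) * E q' i * E q' (j - i)) \<le> (\<Sum>i\<le>j. C * E p j)"
      by (intro sum_mono C) auto
    also have "\<dots> = C * ((real j + 1) * E p j)" by (simp add: algebra_simps)
    also have "\<dots> \<le> C * (C' * E q j)" using C C' by (intro mult_left_mono) auto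
    finally show ?thesis by (simp add: mult.assoc)
  qed
  then show thesis using that[of "C * C'"] C(1) C'(1) by simp
qed

text \<open>Recovers the weight from the sequence \<open>E q j\<close>, a discrete form of the
  biduality of the convex function \<open>\<omega> (exp t)\<close>. Restricting the slopes to
  multiples of \<open>1 / q\<close> costs the extra factor \<open>x\<close>.\<close>

lemma E_infimum:
  assumes "0 < q" "1 \<le> x"
  obtains j where "E q j \<le> x ^ Suc j * exp (- q * \<omega> x)"
proof (cases "x = 1")
  case True
  \<comment> \<open>At \<open>x = 1\<close>, the end point \<open>t = 0\<close> of the domain of
    convexity, \<open>j = 0\<close> serves by monotonicity of \<open>\<omega>\<close>.\<close>
  have "E q 0 \<le> exp (- q * \<omega> 1)"
    using assms(1) by (intro E_least) (auto intro!: omega_mono)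
  then show thesis using that[of 0] True by simp
next
  case False
  define \<phi> where "\<phi> = (\<lambda>t. \<omega> (exp t))"
  define t where "t = ln x"
  have t: "t > 0" using assms False by (simp add: t_def)
  \<comment> \<open>The infimum of the difference quotients to the right of \<open>t\<close> is the
    right derivative, hence the slope of a supporting line.\<close>
  define s where "s = Inf ((\<lambda>u. (\<phi> t - \<phi> u) / (t - u)) ` ({t<..} \<inter> {0..}))"
  have sub: "\<phi> u \<ge> \<phi> t + s * (u - t)" if "0 \<le> u" for u
    unfolding s_def using t that convex by (intro convex_le_Inf_differential) (auto simp: \<phi>_def)
  have s: "0 \<le> s" unfolding s_def
  proof (rule cInf_greatest)
    show "(\<lambda>u. (\<phi> t - \<phi> u) / (t - u)) ` ({t<..} \<inter> {0..}) \<noteq> {}"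
      using t by (force dest: equals0D[of _ "t + 1"])
    fix y assume "y \<in> (\<lambda>u. (\<phi> t - \<phi> u) / (t - u)) ` ({t<..} \<inter> {0..})"
    then obtain u where u: "t < u" "y = (\<phi> t - \<phi> u) / (t - u)" by auto
    then show "0 \<le> y" using omega_mono[of "exp t" "exp u"] by (auto simp: \<phi>_def divide_nonpos_neg)
  qed
  \<comment> \<open>Rounding down makes the coefficient \<open>real j - q * s\<close> of
    \<open>u \<ge> 0\<close> nonpositive; the defect, less than 1, is paid by one more power of
    \<open>x\<close>.\<close>
  define j where "j = nat \<lfloor>q * s\<rfloor>"
  have j: "real j \<le> q * s" "q * s < real j + 1" using assms s by (auto simp: j_def)
  have "E q j \<le> x ^ Suc j * exp (- q * \<omega> x)"
  proof (rule E_least)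
    fix y :: real assume y: "1 \<le> y"
    define u where "u = ln y"
    have u: "0 \<le> u" using y by (simp add: u_def)
    have "q * (\<phi> t + s * (u - t)) \<le> q * \<phi> u" using sub[OF u] assms(1) by simp
    then have "real j * u - q * \<phi> u \<le> real j * u - q * \<phi> t - q * s * u + q * s * t"
      by (simp add: algebra_simps)
    also have "\<dots> = (real j - q * s) * u + q * s * t - q * \<phi> t" by (simp add: algebra_simps)
    also have "(real j - q * s) * u \<le> 0" using j u by (simp add: mult_nonpos_nonneg)
    also have "q * s * t \<le> (real j + 1) * t" using j t by (intro mult_right_mono) auto
    finally have "exp (real j * u - q * \<phi> u) \<le> exp (real (Suc j) * t - q * \<phi> t)" by (simp add: add.commute)
    moreover have "exp (real j * u) = y ^ j" "exp (real (Suc j) * t) = x ^ Suc j"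
      using y assms by (auto simp: u_def t_def exp_of_nat_mult simp del: of_nat_Suc power_Suc)
    ultimately show "y ^ j * exp (- q * \<omega> y) \<le> x ^ Suc j * exp (- q * \<omega> x)"
      using y assms by (simp add: exp_diff exp_minus divide_inverse \<phi>_def u_def t_def)
  qed (use assms in auto)
  then show thesis by (rule that)
qed

end

section \<open>An entire multiplier and cutoff functions\<close>

text \<open>The Fourier transform of the uniform density on \<open>[-1; 1]\<close>: of exponential
  type 1, equal to 1 at \<open>0\<close> and decaying like \<open>1 / x\<close>, hence a building
  block for multipliers of small type.\<close>

definition csinc :: "complex \<Rightarrow> complex" where
  "csinc z = (if z = 0 then 1 else sin z / z)"

lemma csinc_0 [simp]: "csinc 0 = 1"
  by (simp add: csinc_def)

lemma holomorphic_csinc: "csinc holomorphic_on UNIV"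
proof -
  have "csinc = (\<lambda>z. if z = 0 then deriv sin 0 else (sin z - sin 0) / (z - 0))"
    by (auto simp: csinc_def fun_eq_iff DERIV_imp_deriv[OF DERIV_sin])
  moreover have "(\<lambda>z. if z = 0 then deriv sin 0 else (sin z - sin 0) / (z - 0)) holomorphic_on (UNIV::complex set)"
    by (rule pole_lemma) (auto intro: holomorphic_intros)
  ultimately show ?thesis by simp
qed

text \<open>The mean value inequality along the segment from \<open>0\<close> to \<open>z\<close>,
  where the derivative \<open>cos\<close> of \<open>sin\<close> is at most
  \<open>exp \<bar>Im z\<bar>\<close>.\<close>

lemma norm_csinc_le: "cmod (csinc z) \<le> exp \<bar>Im z\<bar>"
proof (cases "z = 0")
  case False
  have conv: "convex (closed_segment 0 z)" by simp
  have "cmod (sin z - sin 0) \<le> exp \<bar>Im z\<bar> * cmod (z - 0)"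
  proof (rule field_differentiable_bound[OF conv, where f' = cos])
    fix w assume "w \<in> closed_segment 0 z"
    then obtain u where "0 \<le> u" "u \<le> 1" "w = u *\<^sub>R z" by (auto simp: closed_segment_def)
    then show "cmod (cos w) \<le> exp \<bar>Im z\<bar>" using cmod_cos_le_exp[of u z] by simp
  qed (auto intro!: derivative_eq_intros)
  then show ?thesis using False by (simp add: csinc_def norm_divide divide_le_eq)
qed simp

lemma norm_csinc_real_le: "x \<noteq> 0 \<Longrightarrow> cmod (csinc (of_real x)) \<le> 1 / \<bar>x\<bar>"
proof -
  assume x: "x \<noteq> 0"
  have "cmod (sin (complex_of_real x)) \<le> 1"
    by (metis abs_sin_le_one norm_of_real sin_of_real)
  then show ?thesis using x by (simp add: csinc_def norm_divide divide_right_mono)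
qed

text \<open>Two applications of the mean value inequality, to \<open>cos\<close> and to
  \<open>sin z - z\<close>. The factor \<open>cmod z\<close> makes the infinite product of dyadic
  dilations converge.\<close>

lemma norm_csinc_minus_1_le: "cmod (csinc z - 1) \<le> cmod z * exp (cmod z)"
proof (cases "z = 0")
  case False
  have conv: "convex (closed_segment 0 z)" by simp
  have seg: "cmod w \<le> cmod z" if "w \<in> closed_segment 0 z" for w
    using that by (metis norm_minus_commute diff_zero segment_bound1)
  have imle: "exp \<bar>Im w\<bar> \<le> exp (cmod z)" if "w \<in> closed_segment 0 z" for w
    using seg[OF that] abs_Im_le_cmod[of w] by simp
  have cosb: "cmod (cos w - 1) \<le> cmod z * exp (cmod z)" if w: "w \<in> closed_segment 0 z" for w
  proof -
    have sub: "closed_segment 0 w \<subseteq> closed_segment 0 z" using w by (simp add: subset_closed_segment)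
    have "cmod (cos w - cos 0) \<le> exp (cmod z) * cmod (w - 0)"
    proof (rule field_differentiable_bound[OF convex_closed_segment, where f' = "\<lambda>z. - sin z"])
      fix v assume "v \<in> closed_segment 0 w"
      then have "v \<in> closed_segment 0 z" using sub by blast
      then show "cmod (- sin v) \<le> exp (cmod z)"
        using cmod_sin_le_exp[of 1 v] imle[of v] by (simp del: exp_le_cancel_iff)
    qed (auto intro!: derivative_eq_intros)
    also have "\<dots> \<le> exp (cmod z) * cmod z" using seg[OF w] by (intro mult_left_mono) auto
    finally show ?thesis by (simp add: mult.commute)
  qed
  have "cmod ((sin z - z) - (sin 0 - 0)) \<le> (cmod z * exp (cmod z)) * cmod (z - 0)"
    by (rule field_differentiable_bound[OF conv, where f' = "\<lambda>z. cos z - 1"])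
      (auto intro!: derivative_eq_intros cosb)
  moreover have "csinc z - 1 = (sin z - z) / z" using False by (simp add: csinc_def diff_divide_distrib)
  ultimately show ?thesis using False by (simp add: norm_divide divide_le_eq)
qed simp

lemma norm_power_minus_1_le:
  fixes u :: complex
  assumes "cmod u \<le> B" "1 \<le> B"
  shows "cmod (u ^ m - 1) \<le> real m * cmod (u - 1) * B ^ m"
proof (induction m)
  case (Suc m)
  have "u ^ Suc m - 1 = u * (u ^ m - 1) + (u - 1)" by (simp add: algebra_simps)
  also have "cmod \<dots> \<le> B * (real m * cmod (u - 1) * B ^ m) + cmod (u - 1) * 1"
    using Suc assms by (intro order_trans[OF norm_triangle_ineq] add_mono)
      (auto simp: norm_mult intro!: mult_mono)
  also have "\<dots> \<le> B * (real m * cmod (u - 1) * B ^ m) + cmod (u - 1) * B ^ Suc m"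
    using one_le_power[OF assms(2), of "Suc m"] by (intro add_left_mono mult_left_mono) auto
  also have "\<dots> = real (Suc m) * cmod (u - 1) * B ^ Suc m" by (simp add: algebra_simps)
  finally show ?case .
qed simp

section \<open>An entire multiplier of small exponential type\<close>

context weight
begin

text \<open>Nonquasianalyticity in discrete form. On the dyadic block starting at
  \<open>2 ^ n\<close>, of length \<open>2 ^ n\<close>, the integrand is at least
  \<open>\<omega> (2 ^ n) / 4 ^ Suc n\<close>, so the block contributes at least a quarter of the
  corresponding term.\<close>

lemma summable_omega_dyadic: "summable (\<lambda>n. \<omega> (2 ^ n) / 2 ^ n)"
proof -
  define h where "h x = indicator {1..} x * (\<omega> x / x\<^sup>2)" for x :: real
  define I where "I n = {2 ^ n..<2 ^ Suc n :: real}" for n :: nat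
  have h: "integrable lborel h"
    using nonquasianalytic unfolding set_integrable_def h_def by simp
  have h0: "0 \<le> h x" for x using nonneg[of x] by (auto simp: h_def indicator_def)
  have pt: "(\<Sum>n<N. indicator (I n) x * (\<omega> (2 ^ n) / 4 ^ Suc n)) \<le> h x * indicator {1..<2 ^ N} x" for N x
  proof (induction N)
    case (Suc N)
    show ?case
    proof (cases "x \<in> I N")
      case True
      then have x: "2 ^ N \<le> x" "x < 2 ^ Suc N" by (auto simp: I_def)
      then have "1 \<le> x" using one_le_power[of "2::real" N] by linarith
      have "x * x \<le> 2 ^ Suc N * 2 ^ Suc N" using x \<open>1 \<le> x\<close> by (intro mult_mono) auto
      then have "x\<^sup>2 \<le> 4 ^ Suc N" by (simp add: power2_eq_square power_mult_distrib[symmetric])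
      then have "\<omega> (2 ^ N) / 4 ^ Suc N \<le> \<omega> x / x\<^sup>2"
        using x \<open>1 \<le> x\<close> nonneg by (intro frac_le omega_mono) auto
      then have "indicator (I N) x * (\<omega> (2 ^ N) / 4 ^ Suc N) \<le> h x"
        using True \<open>1 \<le> x\<close> by (simp add: h_def)
      moreover have "(\<Sum>n<N. indicator (I n) x * (\<omega> (2 ^ n) / 4 ^ Suc n)) \<le> 0"
        using Suc x by (simp add: indicator_def)
      moreover have "indicator {1..<2 ^ Suc N} x = (1::real)" using x \<open>1 \<le> x\<close> by (simp add: indicator_def)
      ultimately show ?thesis by simp
    next
      case False
      have "indicator {1..<2 ^ N} x \<le> (indicator {1..<2 ^ Suc N} x :: real)"
        by (auto simp: indicator_def)
      then have "h x * indicator {1..<2 ^ N} x \<le> h x * indicator {1..<2 ^ Suc N} x"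
        using h0 by (intro mult_left_mono) auto
      then show ?thesis using Suc False by (simp add: indicator_def)
    qed
  qed simp
  have "(\<Sum>n<N. \<omega> (2 ^ n) / 2 ^ n) \<le> 4 * (LBINT x. h x)" for N
  proof -
    have int: "integrable lborel (\<lambda>x. indicator (I n) x * (\<omega> (2 ^ n) / 4 ^ Suc n))"
      and val: "(LBINT x. indicator (I n) x * (\<omega> (2 ^ n) / 4 ^ Suc n)) = \<omega> (2 ^ n) / 2 ^ n / 4" for n
    proof -
      have e: "emeasure lborel (I n) = ennreal (2 ^ Suc n - 2 ^ n)" by (simp add: I_def)
      then have fin: "emeasure lborel (I n) < \<infinity>" by simp
      have meas: "measure lborel (I n) = 2 ^ n" using e by (simp add: measure_def)
      show "integrable lborel (\<lambda>x. indicator (I n) x * (\<omega> (2 ^ n) / 4 ^ Suc n))"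
        using fin by (intro integrable_mult_left integrable_real_indicator) (auto simp: I_def)
      have "(4::real) ^ n = 2 ^ n * 2 ^ n" by (simp flip: power_mult_distrib)
      then show "(LBINT x. indicator (I n) x * (\<omega> (2 ^ n) / 4 ^ Suc n)) = \<omega> (2 ^ n) / 2 ^ n / 4"
        using meas fin by (simp add: measure_def I_def)
    qed
    have "(\<Sum>n<N. \<omega> (2 ^ n) / 2 ^ n) / 4 = (\<Sum>n<N. (LBINT x. indicator (I n) x * (\<omega> (2 ^ n) / 4 ^ Suc n)))"
      by (simp only: val sum_divide_distrib)
    also have "\<dots> = (LBINT x. (\<Sum>n<N. indicator (I n) x * (\<omega> (2 ^ n) / 4 ^ Suc n)))"
      using int by (intro Bochner_Integration.integral_sum[symmetric])
    also have "\<dots> \<le> (LBINT x. h x)"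
    proof (intro integral_mono)
      show "integrable lborel (\<lambda>x. \<Sum>n<N. indicator (I n) x * (\<omega> (2 ^ n) / 4 ^ Suc n))"
        using int by (intro Bochner_Integration.integrable_sum)
      fix x
      have "h x * indicator {1..<2 ^ N} x \<le> h x" using h0[of x] by (auto simp: indicator_def)
      then show "(\<Sum>n<N. indicator (I n) x * (\<omega> (2 ^ n) / 4 ^ Suc n)) \<le> h x"
        using pt[where N = N and x = x] by linarith
    qed fact
    finally show ?thesis by simp
  qed
  then show ?thesis using nonneg by (intro summableI_nonneg_bounded) auto
qed

text \<open>The dyadic factors \<open>csinc (z / 2 ^ n)\<close> are repeated so often that the single factor with
  \<open>2 ^ (n + 2) \<le> \<bar>x\<bar> \<le> 2 ^ (n + 3)\<close> already yields the decay at \<open>x\<close>; nonquasianalyticity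
  makes the total exponential type finite.\<close>

lemma multiplier_exists:
  assumes A: "0 < A"
  obtains \<Phi> C where "\<Phi> holomorphic_on UNIV" "\<Phi> 0 = 1" "0 < C"
    "\<And>z. cmod (\<Phi> z) \<le> exp (A * \<bar>Im z\<bar>)"
    "\<And>x. cmod (\<Phi> (of_real x)) \<le> C * exp (- 2 * \<omega> \<bar>x\<bar>)"
proof -
  \<comment> \<open>The exponents are chosen for the decay: a factor of modulus at most
    \<open>exp (- 1)\<close>, raised to the power \<open>m n\<close>, is at most
    \<open>exp (- 2 * \<omega> (2 ^ (n + 3)))\<close>. The shift by 3 serves all \<open>x\<close> up
    to \<open>2 ^ (n + 3)\<close>.\<close>
  define m where "m n = nat \<lceil>2 * \<omega> (2 ^ (n + 3))\<rceil>" for n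
  define s where "s n = real (m n) / 2 ^ n" for n
  have m: "2 * \<omega> (2 ^ (n + 3)) \<le> real (m n)" "real (m n) \<le> 2 * \<omega> (2 ^ (n + 3)) + 1" for n
    using nonneg[of "2 ^ (n + 3)"] by (auto simp: m_def)
  have s0: "0 \<le> s n" for n by (simp add: s_def)
  have "summable (\<lambda>n. 16 * (\<omega> (2 ^ (n + 3)) / 2 ^ (n + 3)) + (1 / 2) ^ n)"
    by (intro summable_add summable_mult summable_geometric
        summable_ignore_initial_segment[OF summable_omega_dyadic]) auto
  moreover have "norm (s n) \<le> 16 * (\<omega> (2 ^ (n + 3)) / 2 ^ (n + 3)) + (1 / 2) ^ n" for n
    using divide_right_mono[OF m(2)[of n], of "2 ^ n"]
    by (simp add: s_def add_divide_distrib power_add power_one_over)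
  ultimately have summ: "summable s" by (rule summable_comparison_test'[where N = 0])
  \<comment> \<open>Dropping the first \<open>n0\<close> factors leaves types with a sum below
    \<open>A\<close>; only a bounded range of \<open>x\<close> thereby loses its small
    factor.\<close>
  obtain n0 where n0: "norm (\<Sum>i. s (i + n0)) < A"
    using suminf_exist_split[OF A summ] by blast
  define t where "t n = s (n + n0)" for n
  have t: "summable t" "0 \<le> t n" "suminf t < A" for n
    using n0 s0 summable_ignore_initial_segment[OF summ, of n0] by (auto simp: t_def[abs_def])
  have tsum: "(\<Sum>n<N. t n) \<le> A" for N
    using sum_le_suminf[OF t(1), of "{..<N}"] t by auto
  have tle: "t n \<le> A" for n
    using sum_le_suminf[OF t(1), of "{n}"] t by auto
  define f where "f n z = csinc (z / 2 ^ (n + n0)) ^ m (n + n0)" for n z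
  define F where "F N z = (\<Prod>n<N. f n z)" for N z
  have fhol: "f n holomorphic_on UNIV" for n
    unfolding f_def
    by (intro holomorphic_intros holomorphic_on_compose_gen[OF _ holomorphic_csinc, unfolded o_def]) auto
  then have Fhol: "F N holomorphic_on UNIV" for N
    unfolding F_def by (intro holomorphic_intros)
  have fle: "cmod (f n z) \<le> exp (t n * \<bar>Im z\<bar>)" for n z
  proof -
    have "cmod (f n z) \<le> exp \<bar>Im (z / 2 ^ (n + n0))\<bar> ^ m (n + n0)"
      unfolding f_def norm_power by (intro power_mono norm_csinc_le) auto
    also have "Im (z / 2 ^ (n + n0)) = Im z / 2 ^ (n + n0)"
      using Im_divide_of_real[of z "2 ^ (n + n0)"] by simp
    also have "exp \<bar>Im z / 2 ^ (n + n0)\<bar> ^ m (n + n0) = exp (t n * \<bar>Im z\<bar>)"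
      by (simp add: t_def s_def field_simps flip: exp_of_nat_mult)
    finally show ?thesis .
  qed
  have Fle: "cmod (F N z) \<le> exp (A * \<bar>Im z\<bar>)" for N z
  proof -
    have "cmod (F N z) \<le> (\<Prod>n<N. exp (t n * \<bar>Im z\<bar>))"
      unfolding F_def prod_norm[symmetric] by (intro prod_mono) (auto simp: fle)
    also have "\<dots> = exp ((\<Sum>n<N. t n) * \<bar>Im z\<bar>)" by (simp add: exp_sum sum_distrib_right)
    also have "\<dots> \<le> exp (A * \<bar>Im z\<bar>)" using tsum by (auto intro: mult_right_mono)
    finally show ?thesis .
  qed
  \<comment> \<open>A summable bound on discs, from which the product converges locally uniformly by
    the Weierstrass test.\<close>
  have f1: "cmod (f n z - 1) \<le> t n * (R * exp R * exp (A * R))" if "cmod z \<le> R" for n z R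
  proof -
    have R: "0 \<le> R" using that norm_ge_zero order_trans by blast
    define w where "w = z / 2 ^ (n + n0)"
    have "(1::real) \<le> 2 ^ (n + n0)" by simp
    then have w: "cmod w = cmod z / 2 ^ (n + n0)" "cmod w \<le> R"
      using that mult_left_mono[OF \<open>1 \<le> 2 ^ (n + n0)\<close> R]
      by (auto simp: w_def norm_divide norm_power divide_le_eq)
    have "cmod (csinc w) \<le> exp (cmod w)"
      using norm_csinc_le[of w] abs_Im_le_cmod[of w] by (meson exp_le_cancel_iff order_trans)
    then have "cmod (f n z - 1) \<le> real (m (n + n0)) * cmod (csinc w - 1) * exp (cmod w) ^ m (n + n0)"
      unfolding f_def w_def[symmetric] by (rule norm_power_minus_1_le) simp
    also have "\<dots> \<le> real (m (n + n0)) * (cmod w * exp R) * exp (A * R)"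
    proof (intro mult_mono order_trans[OF norm_csinc_minus_1_le])
      have "exp (cmod w) ^ m (n + n0) = exp (t n * cmod z)"
        by (simp add: t_def s_def w field_simps flip: exp_of_nat_mult)
      also have "\<dots> \<le> exp (A * R)" using tle[of n] that A by (auto intro: mult_mono)
      finally show "exp (cmod w) ^ m (n + n0) \<le> exp (A * R)" .
    qed (use w R in auto)
    also have "\<dots> = t n * (cmod z * exp R * exp (A * R))"
      by (simp add: w t_def s_def)
    also have "\<dots> \<le> t n * (R * exp R * exp (A * R))"
      using that t(2)[of n] by (intro mult_left_mono mult_right_mono) auto
    finally show ?thesis .
  qed
  have uc: "uniformly_convergent_on (cball 0 R) F" for R
    unfolding F_def
  proof (rule uniformly_convergent_on_prod')
    show "continuous_on (cball 0 R) (f n)" for n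
      using holomorphic_on_imp_continuous_on[OF fhol] by (rule continuous_on_subset) auto
    have "uniform_limit (cball 0 R) (\<lambda>N z. \<Sum>n<N. norm (f n z - 1)) (\<lambda>z. \<Sum>n. norm (f n z - 1)) sequentially"
      by (rule Weierstrass_m_test[where M = "\<lambda>n. t n * (R * exp R * exp (A * R))"])
        (auto intro!: f1 summable_mult2 t)
    then show "uniformly_convergent_on (cball 0 R) (\<lambda>N z. \<Sum>n<N. norm (f n z - 1))"
      by (auto simp: uniformly_convergent_on_def)
  qed auto
  define \<Phi> where "\<Phi> z = lim (\<lambda>N. F N z)" for z
  have ul: "uniform_limit (cball 0 R) F \<Phi> sequentially" for R
    using uc[of R] unfolding uniformly_convergent_uniform_limit_iff \<Phi>_def .
  have lim: "(\<lambda>N. F N z) \<longlonglongrightarrow> \<Phi> z" for z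
    using ul[of "cmod z"] by (rule tendsto_uniform_limitI) auto
  have hol: "\<Phi> holomorphic_on UNIV"
  proof (rule holomorphic_uniform_sequence[OF open_UNIV Fhol])
    fix z :: complex
    have "cball z 1 \<subseteq> cball 0 (cmod z + 1)"
      by (metis cball_subset_cball_iff dist_0_norm dist_commute order_refl)
    then show "\<exists>d>0. cball z d \<subseteq> UNIV \<and> uniform_limit (cball z d) F \<Phi> sequentially"
      using uniform_limit_on_subset[OF ul] by (intro exI[of _ 1]) auto
  qed
  have "F N 0 = 1" for N by (simp add: F_def f_def)
  then have "\<Phi> 0 = 1" using lim[of 0] by (simp add: LIMSEQ_const_iff)
  have le: "cmod (\<Phi> z) \<le> exp (A * \<bar>Im z\<bar>)" for z
    using tendsto_norm[OF lim[of z]] by (rule LIMSEQ_le_const2) (use Fle in auto)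
  \<comment> \<open>Covers the range \<open>\<bar>x\<bar> \<le> 2 ^ (n0 + 2)\<close>, out of reach
    of the remaining factors; there the bound 1 on the real line is enough.\<close>
  define C where "C = exp (2 * \<omega> (2 ^ (n0 + 2)))"
  have C: "0 < C" "1 \<le> C" using nonneg[of "2 ^ (n0 + 2)"] by (auto simp: C_def)
  have dec: "cmod (\<Phi> (of_real x)) \<le> C * exp (- 2 * \<omega> \<bar>x\<bar>)" for x
  proof (cases "\<bar>x\<bar> \<le> 2 ^ (n0 + 2)")
    case True
    then have "\<omega> \<bar>x\<bar> \<le> \<omega> (2 ^ (n0 + 2))" by (intro omega_mono) auto
    then have "1 \<le> C * exp (- 2 * \<omega> \<bar>x\<bar>)" by (simp add: C_def flip: exp_add)
    then show ?thesis using le[of "of_real x"] by simp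
  next
    case False
    define k where "k = nat \<lfloor>log 2 \<bar>x\<bar>\<rfloor>"
    have x0: "(2::real) ^ (n0 + 2) < \<bar>x\<bar>" using False by simp
    then have x1: "1 < \<bar>x\<bar>" using one_le_power[of "2::real" "n0 + 2"] by linarith
    have "2 powr real (n0 + 2) \<le> \<bar>x\<bar>"
      using x0 by (subst powr_realpow) linarith+
    then have "real (n0 + 2) \<le> log 2 \<bar>x\<bar>"
      using x1 by (subst le_log_iff) linarith+
    then have k: "n0 + 2 \<le> k" by (simp add: k_def le_nat_floor)
    have "0 \<le> log 2 \<bar>x\<bar>" using x1 by simp
    then have "real k \<le> log 2 \<bar>x\<bar>" "log 2 \<bar>x\<bar> \<le> real (Suc k)"
      unfolding k_def by linarith+
    then have "2 powr real k \<le> \<bar>x\<bar>" "\<bar>x\<bar> \<le> 2 powr real (Suc k)"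
      using x1 by (simp_all only: le_log_iff[of 2 "\<bar>x\<bar>"] log_le_iff[of 2 "\<bar>x\<bar>"])
    then have kx: "2 ^ k \<le> \<bar>x\<bar>" "\<bar>x\<bar> \<le> 2 ^ Suc k"
      using powr_realpow[of 2 k] powr_realpow[of 2 "Suc k"] by linarith+
    \<comment> \<open>With this index \<open>\<bar>x / 2 ^ (n + n0)\<bar>\<close> is at least 4, so
      that the corresponding value of \<open>csinc\<close> is at most \<open>1 / 4\<close>, below
      \<open>exp (- 1)\<close>.\<close>
    define n where "n = k - 2 - n0"
    have nk: "n + n0 + 2 = k" using k by (simp add: n_def)
    have "cmod (f n (of_real x)) \<le> exp (- 2 * \<omega> \<bar>x\<bar>)"
    proof -
      have "cmod (csinc (of_real (x / 2 ^ (n + n0)))) \<le> 1 / \<bar>x / 2 ^ (n + n0)\<bar>"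
        using x1 by (intro norm_csinc_real_le) auto
      also have "\<dots> = 2 ^ (n + n0) / \<bar>x\<bar>" by (simp add: abs_divide)
      also have "\<dots> \<le> 2 ^ (n + n0) / 2 ^ k" using kx x1 by (intro divide_left_mono) auto
      also have "(2::real) ^ k = 4 * 2 ^ (n + n0)" unfolding nk[symmetric] by (simp add: power_add)
      also have "2 ^ (n + n0) / (4 * 2 ^ (n + n0)) = 1 / (4::real)" by simp
      also have "\<dots> \<le> 1 / exp 1" using exp_le by (intro divide_left_mono) auto
      also have "\<dots> = exp (- 1)" by (simp add: exp_minus divide_inverse)
      finally have "cmod (f n (of_real x)) \<le> exp (- 1) ^ m (n + n0)"
        unfolding f_def norm_power by (intro power_mono) auto
      also have "\<dots> = exp (- real (m (n + n0)))" by (simp flip: exp_of_nat_mult)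
      also have "\<dots> \<le> exp (- 2 * \<omega> \<bar>x\<bar>)"
      proof -
        have "Suc k = n + n0 + 3" using nk by simp
        then have "\<omega> \<bar>x\<bar> \<le> \<omega> (2 ^ (n + n0 + 3))" using kx(2) by (metis abs_ge_zero omega_mono)
        then show ?thesis using m(1)[of "n + n0"] by simp
      qed
      finally show ?thesis .
    qed
    moreover have fr: "cmod (f i (of_real x)) \<le> 1" for i using fle[of i "of_real x"] by simp
    ultimately have "cmod (F N (of_real x)) \<le> exp (- 2 * \<omega> \<bar>x\<bar>)" if "n < N" for N
    proof -
      have "cmod (F N (of_real x)) = cmod (f n (of_real x)) * (\<Prod>i\<in>{..<N} - {n}. cmod (f i (of_real x)))"
        unfolding F_def prod_norm[symmetric] using that by (subst prod.remove[of _ n]) auto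
      also have "\<dots> \<le> exp (- 2 * \<omega> \<bar>x\<bar>) * 1"
        using \<open>cmod (f n (of_real x)) \<le> exp (- 2 * \<omega> \<bar>x\<bar>)\<close> fr
        by (intro mult_mono prod_le_1) (auto intro: prod_nonneg)
      finally show ?thesis by simp
    qed
    then have "cmod (\<Phi> (of_real x)) \<le> exp (- 2 * \<omega> \<bar>x\<bar>)"
      by (intro LIMSEQ_le_const2[OF tendsto_norm[OF lim]] exI[of _ "Suc n"]) auto
    also have "\<dots> \<le> C * exp (- 2 * \<omega> \<bar>x\<bar>)" using C by simp
    finally show ?thesis .
  qed
  show thesis by (rule that[OF hol \<open>\<Phi> 0 = 1\<close> C(1) le dec])
qed

text \<open>Of the two copies of \<open>\<omega>\<close> in the exponent one pays for the power
  \<open>j\<close>, the other for integrability. This is why the multiplier is made to decay with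
  the factor 2.\<close>

lemma power_times_decay_bound:
  obtains C where "0 < C"
    "\<And>x j. \<bar>x\<bar> ^ j * exp (- 2 * \<omega> \<bar>x\<bar>) \<le> C * E 1 j / (1 + x\<^sup>2)"
proof -
  obtain C where C: "0 < C" "\<And>x. 0 \<le> x \<Longrightarrow> (1 + x) ^ 2 * exp (- 1 * \<omega> x) \<le> C"
    using power_exp_omega_bounded[of 1 2] by auto
  have "\<bar>x\<bar> ^ j * exp (- 2 * \<omega> \<bar>x\<bar>) \<le> (exp (\<omega> 1) * C) * E 1 j / (1 + x\<^sup>2)" for x j
  proof -
    have "1 + x\<^sup>2 \<le> (1 + \<bar>x\<bar>)\<^sup>2" by (simp add: power2_sum)
    then have "(1 + x\<^sup>2) * exp (- \<omega> \<bar>x\<bar>) \<le> (1 + \<bar>x\<bar>)\<^sup>2 * exp (- \<omega> \<bar>x\<bar>)"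
      by (intro mult_right_mono) auto
    also have "\<dots> \<le> C" using C(2)[of "\<bar>x\<bar>"] by simp
    finally have "exp (- \<omega> \<bar>x\<bar>) \<le> C / (1 + x\<^sup>2)"
      by (simp add: pos_le_divide_eq add_pos_nonneg mult.commute)
    then have "(\<bar>x\<bar> ^ j * exp (- 1 * \<omega> \<bar>x\<bar>)) * exp (- \<omega> \<bar>x\<bar>) \<le> (exp (1 * \<omega> 1) * E 1 j) * (C / (1 + x\<^sup>2))"
      by (intro mult_mono power_le_E') auto
    moreover have "exp (- 2 * \<omega> \<bar>x\<bar>) = exp (- 1 * \<omega> \<bar>x\<bar>) * exp (- \<omega> \<bar>x\<bar>)"
      by (simp flip: exp_add)
    ultimately show ?thesis by (simp add: mult_ac)
  qed
  then show thesis using that[of "exp (\<omega> 1) * C"] C by simp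
qed

end

section \<open>Fourier integrals and cutoff functions\<close>

lemma norm_exp_minus_i [simp]: "cmod (exp (- \<i> * of_real x * of_real t)) = 1"
  by simp

text \<open>The second-order remainder of \<open>exp (\<i> * y)\<close> is at most
  \<open>y\<^sup>2 / 2\<close>, so the difference quotient has an error linear in the step, with
  half the second absolute moment of \<open>h\<close> as constant.\<close>

lemma has_vector_derivative_fourier_integral:
  fixes h :: "real \<Rightarrow> complex"
  assumes int: "integrable lborel h" "integrable lborel (\<lambda>x. of_real x * h x)"
      "integrable lborel (\<lambda>x. of_real x ^ 2 * h x)"
  shows "((\<lambda>t. LBINT x. h x * exp (- \<i> * of_real x * of_real t)) has_vector_derivative
     (LBINT x. (- \<i> * of_real x * h x) * exp (- \<i> * of_real x * of_real t))) (at t)"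
    (is "(?f has_vector_derivative ?f' t) _")
proof -
  define K where "K = (LBINT x. cmod (of_real x ^ 2 * h x)) / 2"
  have ie: "integrable lborel (\<lambda>x. g x * exp (- \<i> * of_real x * of_real t))"
    if "integrable lborel g" for g :: "real \<Rightarrow> complex" and t :: real
    by (rule Bochner_Integration.integrable_bound[OF that])
      (use borel_measurable_integrable[OF that] in \<open>auto simp: norm_mult\<close>)
  have int': "integrable lborel (\<lambda>x. - \<i> * of_real x * h x)"
    using integrable_mult_right[of "- \<i>" lborel "\<lambda>x. of_real x * h x"] int(2) by (simp add: mult.assoc)
  have bound: "cmod (?f s - ?f t - (s - t) *\<^sub>R ?f' t) \<le> K * (s - t)\<^sup>2" for s
  proof -
    define G where "G x = h x * exp (- \<i> * of_real x * of_real s) - h x * exp (- \<i> * of_real x * of_real t)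
        - (s - t) *\<^sub>R ((- \<i> * of_real x * h x) * exp (- \<i> * of_real x * of_real t))" for x
    have c: "integrable lborel (\<lambda>x. (s - t) *\<^sub>R ((- \<i> * of_real x * h x) * exp (- \<i> * of_real x * of_real t)))"
      by (intro integrable_scaleR_right ie int')
    note ab = ie[OF int(1), of s] ie[OF int(1), of t]
    note abd = Bochner_Integration.integrable_diff[OF ab]
    have "?f s - ?f t - (s - t) *\<^sub>R ?f' t = (LBINT x. G x)"
      unfolding G_def
      by (simp only: Bochner_Integration.integral_diff[OF abd c] Bochner_Integration.integral_diff[OF ab]
          integral_scaleR_right)
    also have "cmod \<dots> \<le> (LBINT x. cmod (of_real x ^ 2 * h x) / 2 * (s - t)\<^sup>2)"
    proof (rule Bochner_Integration.integral_norm_bound_integral)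
      show "integrable lborel G"
        unfolding G_def by (intro Bochner_Integration.integrable_diff ab c)
      show "integrable lborel (\<lambda>x. cmod (of_real x ^ 2 * h x) / 2 * (s - t)\<^sup>2)"
        using int(3) by simp
      fix x
      define y where "y = - (x * (s - t))"
      have "exp (- \<i> * of_real x * of_real s) = exp (\<i> * of_real y) * exp (- \<i> * of_real x * of_real t)"
        by (simp add: y_def algebra_simps flip: exp_add)
      then have "G x = h x * exp (- \<i> * of_real x * of_real t) * (exp (\<i> * of_real y) - (1 + \<i> * of_real y))"
        unfolding G_def by (simp add: y_def algebra_simps scaleR_conv_of_real)
      then have "cmod (G x) = cmod (h x) * cmod (exp (\<i> * of_real y) - (1 + \<i> * of_real y))"
        by (simp add: norm_mult)
      also have "\<dots> \<le> cmod (h x) * (y\<^sup>2 / 2)"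
      proof (intro mult_left_mono)
        have "(\<Sum>k\<le>1. (\<i> * of_real y) ^ k / fact k) = 1 + \<i> * of_real y" by simp
        then show "cmod (exp (\<i> * of_real y) - (1 + \<i> * of_real y)) \<le> y\<^sup>2 / 2"
          using iexp_approx1[of y 1] by (simp only:) (simp add: power2_eq_square)
      qed simp
      also have "\<dots> = cmod (of_real x ^ 2 * h x) / 2 * (s - t)\<^sup>2"
        by (simp add: y_def norm_mult norm_power power_mult_distrib)
      finally show "cmod (G x) \<le> cmod (of_real x ^ 2 * h x) / 2 * (s - t)\<^sup>2" .
    qed
    also have "\<dots> = K * (s - t)\<^sup>2" by (simp add: K_def)
    finally show ?thesis .
  qed
  have "(?f has_derivative (\<lambda>u. u *\<^sub>R ?f' t)) (at t within UNIV)"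
  proof (rule has_derivativeI_sandwich[where e = 1 and H = "\<lambda>s. K * \<bar>s - t\<bar>"])
    show "bounded_linear (\<lambda>u. u *\<^sub>R ?f' t)" by (rule bounded_linear_scaleR_left)
    show "((\<lambda>s. K * \<bar>s - t\<bar>) \<longlongrightarrow> 0) (at t)"
      by (rule tendsto_eq_intros | simp)+
    fix s :: real assume "s \<noteq> t"
    then show "cmod (?f s - ?f t - (s - t) *\<^sub>R ?f' t) / norm (s - t) \<le> K * \<bar>s - t\<bar>"
      using bound[of s] by (simp add: divide_le_eq power2_eq_square mult.assoc)
  qed auto
  then show ?thesis by (simp add: has_vector_derivative_def)
qed

lemma iterated_derivative_locally_constant:
  fixes \<eta> :: "nat \<Rightarrow> real \<Rightarrow> complex"
  assumes "open S" "\<And>j t. t \<in> S \<Longrightarrow> (\<eta> j has_vector_derivative \<eta> (Suc j) t) (at t)"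
    and "\<And>t. t \<in> S \<Longrightarrow> \<eta> 0 t = b" and "t \<in> S"
  shows "\<eta> (Suc j) t = 0"
  using \<open>t \<in> S\<close>
proof (induction j arbitrary: t)
  case 0
  have "(\<eta> 0 has_vector_derivative 0) (at t)"
    using assms(3)[symmetric] has_vector_derivative_transform_within_open[OF has_vector_derivative_const assms(1) 0]
    by blast
  then show ?case using assms(2)[OF 0, of 0] vector_derivative_unique_at by blast
next
  case (Suc j)
  have "(\<eta> (Suc j) has_vector_derivative 0) (at t)"
    using Suc.IH[symmetric] has_vector_derivative_transform_within_open[OF has_vector_derivative_const assms(1) Suc.prems]
    by blast
  then show ?case using assms(2)[OF Suc.prems, of "Suc j"] vector_derivative_unique_at by blast
qed

context weight
begin

text \<open>Each derivative multiplies the density by \<open>- \<i> * x\<close>, and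
  \<open>power_times_decay_bound\<close> converts the decay of the density into the bound
  \<open>E 1 j\<close>. The constant is uniform over all densities.\<close>

lemma fourier_integral_smooth:
  obtains C where "0 < C"
    "\<And>h K. h \<in> borel_measurable borel \<Longrightarrow> (\<And>x. cmod (h x) \<le> K * exp (- 2 * \<omega> \<bar>x\<bar>)) \<Longrightarrow>
      (\<forall>j t. ((\<lambda>t. LBINT x. (- \<i> * of_real x) ^ j * h x * exp (- \<i> * of_real x * of_real t)) has_vector_derivative
        (LBINT x. (- \<i> * of_real x) ^ Suc j * h x * exp (- \<i> * of_real x * of_real t))) (at t)) \<and>
      (\<forall>j t. cmod (LBINT x. (- \<i> * of_real x) ^ j * h x * exp (- \<i> * of_real x * of_real t)) \<le> K * C * E 1 j)"
proof -
  obtain C where C: "0 < C" "\<And>x j. \<bar>x\<bar> ^ j * exp (- 2 * \<omega> \<bar>x\<bar>) \<le> C * E 1 j / (1 + x\<^sup>2)"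
    using power_times_decay_bound by blast
  have main: "(\<forall>j t. ((\<lambda>t. LBINT x. (- \<i> * of_real x) ^ j * h x * exp (- \<i> * of_real x * of_real t)) has_vector_derivative
        (LBINT x. (- \<i> * of_real x) ^ Suc j * h x * exp (- \<i> * of_real x * of_real t))) (at t)) \<and>
      (\<forall>j t. cmod (LBINT x. (- \<i> * of_real x) ^ j * h x * exp (- \<i> * of_real x * of_real t)) \<le> K * (C * pi) * E 1 j)"
    if h: "h \<in> borel_measurable borel" and le: "\<And>x. cmod (h x) \<le> K * exp (- 2 * \<omega> \<bar>x\<bar>)" for h K
  proof (intro conjI allI)
    have "0 \<le> K * exp (- 2 * \<omega> \<bar>0\<bar>)" using le[of 0] norm_ge_zero order_trans by blast
    then have K: "0 \<le> K" by (simp add: zero_le_mult_iff)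
    have [measurable]: "h \<in> borel_measurable borel" by (rule h)
    have b: "\<bar>x\<bar> ^ j * cmod (h x) \<le> K * C * E 1 j / (1 + x\<^sup>2)" for x j
    proof -
      have "\<bar>x\<bar> ^ j * cmod (h x) \<le> \<bar>x\<bar> ^ j * (K * exp (- 2 * \<omega> \<bar>x\<bar>))"
        by (intro mult_left_mono le) auto
      also have "\<dots> = K * (\<bar>x\<bar> ^ j * exp (- 2 * \<omega> \<bar>x\<bar>))" by simp
      also have "\<dots> \<le> K * (C * E 1 j / (1 + x\<^sup>2))" using K by (intro mult_left_mono C)
      finally show ?thesis by (simp add: mult.assoc)
    qed
    have int: "integrable lborel (\<lambda>x. c * of_real x ^ j * h x)" if "cmod c = 1" for j and c :: complex
    proof (rule integrable_bound_1_plus_square[where C = "K * C * E 1 j"])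
      show "(\<lambda>x. c * of_real x ^ j * h x) \<in> borel_measurable lborel" by measurable
    qed (use b that in \<open>simp add: norm_mult norm_power\<close>)
    fix j :: nat and t :: real
    have d: "((\<lambda>t. LBINT x. (- \<i> * of_real x) ^ j * h x * exp (- \<i> * of_real x * of_real t)) has_vector_derivative
        (LBINT x. (- \<i> * of_real x * ((- \<i> * of_real x) ^ j * h x)) * exp (- \<i> * of_real x * of_real t))) (at t)"
    proof (rule has_vector_derivative_fourier_integral)
      note I = int[of "(- \<i>) ^ j"]
      show "integrable lborel (\<lambda>x. (- \<i> * of_real x) ^ j * h x)"
        using I[of j] unfolding power_mult_distrib by (simp add: norm_power)
      show "integrable lborel (\<lambda>x. of_real x * ((- \<i> * of_real x) ^ j * h x))"
        using I[of "Suc j"] unfolding power_mult_distrib by (simp add: norm_power mult_ac)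
      show "integrable lborel (\<lambda>x. of_real x ^ 2 * ((- \<i> * of_real x) ^ j * h x))"
        using I[of "Suc (Suc j)"] unfolding power_mult_distrib by (simp add: norm_power mult_ac power2_eq_square)
    qed
    show "((\<lambda>t. LBINT x. (- \<i> * of_real x) ^ j * h x * exp (- \<i> * of_real x * of_real t)) has_vector_derivative
        (LBINT x. (- \<i> * of_real x) ^ Suc j * h x * exp (- \<i> * of_real x * of_real t))) (at t)"
      using d by (simp only: power_Suc mult.assoc)
    have "cmod (LBINT x. (- \<i> * of_real x) ^ j * h x * exp (- \<i> * of_real x * of_real t))
        \<le> (LBINT x. K * C * E 1 j * (1 / (1 + x\<^sup>2)))"
    proof (rule Bochner_Integration.integral_norm_bound_integral)
      show "integrable lborel (\<lambda>x. (- \<i> * of_real x) ^ j * h x * exp (- \<i> * of_real x * of_real t))"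
      proof (rule integrable_bound_1_plus_square[where C = "K * C * E 1 j"])
        show "(\<lambda>x. (- \<i> * of_real x) ^ j * h x * exp (- \<i> * of_real x * of_real t)) \<in> borel_measurable lborel"
          by measurable
      qed (use b in \<open>simp add: norm_mult norm_power\<close>)
      show "integrable lborel (\<lambda>x. K * C * E 1 j * (1 / (1 + x\<^sup>2)))"
        by (intro integrable_mult_right integrable_inverse_1_plus_square_lborel)
      show "cmod ((- \<i> * of_real x) ^ j * h x * exp (- \<i> * of_real x * of_real t)) \<le> K * C * E 1 j * (1 / (1 + x\<^sup>2))" for x
        using b[of x j] by (simp add: norm_mult norm_power)
    qed
    also have "\<dots> = K * C * E 1 j * pi"
      by (simp only: integral_mult_right_zero integral_inverse_1_plus_square_lborel)
    finally show "cmod (LBINT x. (- \<i> * of_real x) ^ j * h x * exp (- \<i> * of_real x * of_real t)) \<le> K * (C * pi) * E 1 j"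
      by (simp add: mult_ac)
  qed
  show thesis by (rule that[of "C * pi", OF _ main]) (use C in auto)
qed

text \<open>\<open>\<eta>\<close> is the convolution of the indicator function of
  \<open>[\<alpha> - \<delta> / 2; \<beta> + \<delta> / 2]\<close> with a kernel whose transform is
  a multiplier of type \<open>\<delta> / 4\<close>, but built on the Fourier side. Its constancy on
  intervals is a Paley-Wiener statement, read off from
  \<open>integral_difference_over_x\<close>.\<close>

lemma cutoff_exists:
  assumes "\<alpha> \<le> \<beta>" "0 < \<delta>"
  obtains \<eta> :: "nat \<Rightarrow> real \<Rightarrow> complex" and C where "0 < C"
    "\<And>j t. (\<eta> j has_vector_derivative \<eta> (Suc j) t) (at t)"
    "\<And>j t. cmod (\<eta> j t) \<le> C * E 1 j"
    "\<And>t. \<alpha> \<le> t \<Longrightarrow> t \<le> \<beta> \<Longrightarrow> \<eta> 0 t = 1"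
    "\<And>j t. \<alpha> \<le> t \<Longrightarrow> t \<le> \<beta> \<Longrightarrow> \<eta> (Suc j) t = 0"
    "\<And>j t. t \<le> \<alpha> - \<delta> \<or> \<beta> + \<delta> \<le> t \<Longrightarrow> \<eta> j t = 0"
proof -
  define a b A where "a = \<alpha> - \<delta> / 2" and "b = \<beta> + \<delta> / 2" and "A = \<delta> / 4"
  have ab: "a < b" "0 < A" using assms by (auto simp: a_def b_def A_def)
  obtain \<Phi> C where \<Phi>: "\<Phi> holomorphic_on UNIV" "\<Phi> 0 = 1" "0 < C"
    "\<And>z. cmod (\<Phi> z) \<le> exp (A * \<bar>Im z\<bar>)" "\<And>x. cmod (\<Phi> (of_real x)) \<le> C * exp (- 2 * \<omega> \<bar>x\<bar>)"
    using multiplier_exists[OF ab(2)] by blast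
  obtain D where D: "0 < D"
    "\<And>h K. h \<in> borel_measurable borel \<Longrightarrow> (\<And>x. cmod (h x) \<le> K * exp (- 2 * \<omega> \<bar>x\<bar>)) \<Longrightarrow>
      (\<forall>j t. ((\<lambda>t. LBINT x. (- \<i> * of_real x) ^ j * h x * exp (- \<i> * of_real x * of_real t)) has_vector_derivative
        (LBINT x. (- \<i> * of_real x) ^ Suc j * h x * exp (- \<i> * of_real x * of_real t))) (at t)) \<and>
      (\<forall>j t. cmod (LBINT x. (- \<i> * of_real x) ^ j * h x * exp (- \<i> * of_real x * of_real t)) \<le> K * D * E 1 j)"
    using fourier_integral_smooth by blast
  \<comment> \<open>The quotient is the Fourier transform of the indicator function of
    \<open>[a; b]\<close>. At \<open>x = 0\<close> the division yields \<open>0\<close>, which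
    affects a null set only.\<close>
  define h where "h x = (exp (\<i> * of_real b * of_real x) - exp (\<i> * of_real a * of_real x)) / (\<i> * of_real x)
      * \<Phi> (of_real x) / (2 * of_real pi)" for x :: real
  define \<eta> where "\<eta> j t = (LBINT x. (- \<i> * of_real x) ^ j * h x * exp (- \<i> * of_real x * of_real t))" for j t
  have "continuous_on UNIV (\<lambda>x::real. \<Phi> (of_real x))"
    by (rule continuous_on_compose2[OF holomorphic_on_imp_continuous_on[OF \<Phi>(1)]])
      (auto intro: continuous_intros)
  then have [measurable]: "(\<lambda>x::real. \<Phi> (of_real x)) \<in> borel_measurable borel"
    by (rule borel_measurable_continuous_onI)
  have [measurable]: "h \<in> borel_measurable borel" unfolding h_def by simp
  have hle: "cmod (h x) \<le> ((b - a) * C) * exp (- 2 * \<omega> \<bar>x\<bar>)" for x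
  proof (cases "x = 0")
    case False
    have "exp (\<i> * of_real b * of_real x) - exp (\<i> * of_real a * of_real x) =
       exp (\<i> * of_real a * of_real x) * (exp (\<i> * of_real ((b - a) * x)) - 1)"
      by (simp add: algebra_simps flip: exp_add)
    also have "cmod \<dots> = cmod (exp (\<i> * of_real ((b - a) * x)) - 1)" by (simp add: norm_mult)
    also have "\<dots> \<le> (b - a) * \<bar>x\<bar>" using iexp_approx1[of "(b - a) * x" 0] ab by (simp add: abs_mult del: of_real_mult of_real_diff)
    finally have "cmod ((exp (\<i> * of_real b * of_real x) - exp (\<i> * of_real a * of_real x)) / (\<i> * of_real x)) \<le> b - a"
      using False by (simp add: norm_divide norm_mult divide_le_eq)
    then have "cmod (h x) \<le> (b - a) * (C * exp (- 2 * \<omega> \<bar>x\<bar>)) / (2 * pi)"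
      unfolding h_def norm_divide[of _ "2 * of_real pi"] norm_mult[of _ "\<Phi> _"] using ab \<Phi>(5)
      by (simp add: norm_mult) (intro divide_right_mono mult_mono, auto)
    also have "\<dots> \<le> (b - a) * (C * exp (- 2 * \<omega> \<bar>x\<bar>)) / 1"
      using ab \<Phi>(3) pi_ge_two by (intro divide_left_mono) auto
    finally show ?thesis by simp
  qed (use ab \<Phi> in \<open>simp add: h_def\<close>)
  have der: "(\<eta> j has_vector_derivative \<eta> (Suc j) t) (at t)" for j t
    using D(2)[OF \<open>h \<in> _\<close> hle] unfolding \<eta>_def[abs_def] by blast
  have bnd: "cmod (\<eta> j t) \<le> ((b - a) * C * D) * E 1 j" for j t
    using D(2)[OF \<open>h \<in> _\<close> hle] unfolding \<eta>_def by blast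
  \<comment> \<open>As \<open>\<Phi>\<close> has type \<open>A\<close>, \<open>P t\<close> is
    bounded above the axis if \<open>t \<le> b - A\<close> and below it if
    \<open>b + A \<le> t\<close>; likewise \<open>Q t\<close> with \<open>a\<close>. Well inside
    \<open>[a; b]\<close> the two take opposite half-planes and the value is 1; well outside they
    share a half-plane and the value is \<open>0\<close>.\<close>
  define P where "P t z = exp (\<i> * of_real (b - t) * z) * \<Phi> z" for t :: real and z
  define Q where "Q t z = exp (\<i> * of_real (a - t) * z) * \<Phi> z" for t :: real and z
  have hol: "P t holomorphic_on UNIV" "Q t holomorphic_on UNIV" for t
    unfolding P_def Q_def by (intro holomorphic_intros \<Phi>)+
  have val: "\<eta> 0 t = (LBINT x. (P t (of_real x) - Q t (of_real x)) / (\<i> * of_real x)) / (2 * of_real pi)" for t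
  proof -
    have "h x * exp (- \<i> * of_real x * of_real t) = (P t (of_real x) - Q t (of_real x)) / (\<i> * of_real x) / (2 * of_real pi)" for x
    proof -
      have "P t (of_real x) = exp (\<i> * of_real b * of_real x) * exp (- \<i> * of_real x * of_real t) * \<Phi> x"
        "Q t (of_real x) = exp (\<i> * of_real a * of_real x) * exp (- \<i> * of_real x * of_real t) * \<Phi> x"
        by (simp_all add: P_def Q_def algebra_simps flip: exp_add)
      then show ?thesis by (simp add: h_def algebra_simps diff_divide_distrib)
    qed
    then have "\<eta> 0 t = (LBINT x. (P t (of_real x) - Q t (of_real x)) / (\<i> * of_real x) / (2 * of_real pi))"
      by (simp only: \<eta>_def power_0 mult_1)
    then show ?thesis by (simp only: integral_divide_zero)
  qed
  have le: "cmod (exp (\<i> * of_real c * z) * \<Phi> z) \<le> 1" if "A \<le> \<bar>c\<bar>" "0 \<le> c * Im z" for c z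
  proof -
    have "A * \<bar>Im z\<bar> \<le> \<bar>c\<bar> * \<bar>Im z\<bar>" using that by (intro mult_right_mono) auto
    also have "\<dots> = c * Im z" using that by (simp flip: abs_mult)
    finally have "exp (- (c * Im z)) * exp (A * \<bar>Im z\<bar>) \<le> 1" by (simp flip: exp_add)
    moreover have "cmod (exp (\<i> * of_real c * z) * \<Phi> z) \<le> exp (- (c * Im z)) * exp (A * \<bar>Im z\<bar>)"
      unfolding norm_mult norm_exp_eq_Re using \<Phi>(4) by (intro mult_mono) auto
    ultimately show ?thesis by linarith
  qed
  obtain C1 where C1: "0 < C1" "\<And>x. 0 \<le> x \<Longrightarrow> (1 + x) ^ 1 * exp (- 2 * \<omega> x) \<le> C1"
    using power_exp_omega_bounded[of 2 1] by auto
  have dec: "cmod (exp (\<i> * of_real c * of_real x) * \<Phi> (of_real x)) \<le> C * C1 / (1 + \<bar>x\<bar>)" for c x :: real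
  proof -
    have "cmod (exp (\<i> * of_real c * of_real x) * \<Phi> (of_real x)) \<le> C * exp (- 2 * \<omega> \<bar>x\<bar>)"
      using \<Phi>(5)[of x] by (simp add: norm_mult)
    also have "exp (- 2 * \<omega> \<bar>x\<bar>) \<le> C1 / (1 + \<bar>x\<bar>)"
      using C1(2)[of "\<bar>x\<bar>"] by (simp add: pos_le_divide_eq mult.commute)
    finally show ?thesis using \<Phi>(3) by (simp add: mult_left_mono)
  qed
  have Ple: "cmod (P t z) \<le> 1" if "A \<le> \<bar>b - t\<bar>" "0 \<le> (b - t) * Im z" for t z
    unfolding P_def by (rule le[OF that])
  have Qle: "cmod (Q t z) \<le> 1" if "A \<le> \<bar>a - t\<bar>" "0 \<le> (a - t) * Im z" for t z
    unfolding Q_def by (rule le[OF that])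
  have decPQ: "cmod (P t (of_real x)) \<le> C * C1 / (1 + \<bar>x\<bar>)" "cmod (Q t (of_real x)) \<le> C * C1 / (1 + \<bar>x\<bar>)" for t x
    unfolding P_def Q_def by (rule dec)+
  have PQ0: "P t 0 = \<Phi> 0" "Q t 0 = \<Phi> 0" for t by (simp_all add: P_def Q_def)
  have one: "\<eta> 0 t = 1" if "\<alpha> - \<delta> / 4 \<le> t" "t \<le> \<beta> + \<delta> / 4" for t
  proof -
    have "(LBINT x. (P t (of_real x) - Q t (of_real x)) / (\<i> * of_real x)) = 2 * of_real pi * P t 0"
    proof (rule integral_difference_over_x[where M = 1 and C = "C * C1"])
      show "cmod (P t z) \<le> 1" if "0 \<le> Im z" for z
        using that \<open>t \<le> \<beta> + \<delta> / 4\<close> assms by (intro Ple) (auto simp: A_def b_def)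
      show "cmod (Q t z) \<le> 1" if "Im z \<le> 0" for z
        using that \<open>\<alpha> - \<delta> / 4 \<le> t\<close> assms
        by (intro Qle) (auto simp: A_def a_def mult_nonpos_nonpos)
    qed (use decPQ hol PQ0 in auto)
    then show ?thesis using val by (simp add: PQ0 \<Phi>)
  qed
  have zero: "\<eta> 0 t = 0" if t: "t < \<alpha> - 3 * \<delta> / 4 \<or> \<beta> + 3 * \<delta> / 4 < t" for t
  proof -
    have dec2: "cmod (P t (of_real x) - Q t (of_real x)) \<le> 2 * C * C1 / (1 + \<bar>x\<bar>)" for x
    proof -
      have "cmod (P t (of_real x) - Q t (of_real x)) \<le> C * C1 / (1 + \<bar>x\<bar>) + C * C1 / (1 + \<bar>x\<bar>)"
        by (rule order_trans[OF norm_triangle_ineq4 add_mono[OF decPQ]])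
      then show ?thesis by (simp add: mult_ac)
    qed
    have dec0: "cmod 0 \<le> 2 * C * C1 / (1 + \<bar>x\<bar>)" for x :: real
      using \<Phi>(3) C1(1) by (simp add: divide_nonneg_pos)
    consider "t < \<alpha> - 3 * \<delta> / 4" | "\<beta> + 3 * \<delta> / 4 < t" using t by blast
    then have "(LBINT x. (P t (of_real x) - Q t (of_real x)) / (\<i> * of_real x)) = 0"
    proof cases
      case 1
      \<comment> \<open>The whole difference is bounded above the axis, so its partner below is the
        zero function.\<close>
      have "(LBINT x. ((P t (of_real x) - Q t (of_real x)) - 0) / (\<i> * of_real x)) = 2 * of_real pi * (P t 0 - Q t 0)"
      proof (rule integral_difference_over_x[where P = "\<lambda>z. P t z - Q t z" and Q = "\<lambda>_. 0" and M = 2 and C = "2 * C * C1"])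
        fix z assume z: "0 \<le> Im z"
        have "cmod (P t z) \<le> 1" "cmod (Q t z) \<le> 1"
          using z 1 assms by (auto intro!: Ple Qle simp: A_def b_def a_def)
        then show "cmod (P t z - Q t z) \<le> 2" using norm_triangle_ineq4[of "P t z" "Q t z"] by linarith
      qed (use dec2 dec0 hol PQ0[of t] in \<open>auto intro: holomorphic_intros\<close>)
      then show ?thesis by (simp add: PQ0)
    next
      case 2
      have "(LBINT x. (0 - (Q t (of_real x) - P t (of_real x))) / (\<i> * of_real x)) = 2 * of_real pi * 0"
      proof (rule integral_difference_over_x[where P = "\<lambda>_. 0" and Q = "\<lambda>z. Q t z - P t z" and M = 2 and C = "2 * C * C1"])
        fix z assume z: "Im z \<le> 0"
        have "cmod (P t z) \<le> 1" "cmod (Q t z) \<le> 1"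
          using z 2 assms by (auto intro!: Ple Qle mult_nonpos_nonpos simp: A_def b_def a_def)
        then show "cmod (Q t z - P t z) \<le> 2" using norm_triangle_ineq4[of "Q t z" "P t z"] by linarith
      qed (use dec2 dec0 hol PQ0[of t] in \<open>auto intro: holomorphic_intros simp: norm_minus_commute\<close>)
      then show ?thesis by simp
    qed
    then show ?thesis using val by simp
  qed
  show thesis
  proof (rule that[of "(b - a) * C * D" \<eta>])
    show "0 < (b - a) * C * D" using ab \<Phi> D by simp
    show "\<eta> 0 t = 1" if "\<alpha> \<le> t" "t \<le> \<beta>" for t
      using that assms by (intro one; linarith)
    show "\<eta> (Suc j) t = 0" if "\<alpha> \<le> t" "t \<le> \<beta>" for j t
    \<comment> \<open>The margin \<open>\<delta> / 4\<close> makes \<open>\<eta>\<close> constant on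
      an open neighbourhood, so that the derivatives vanish up to the end points.\<close>
    proof (rule iterated_derivative_locally_constant[where S = "{\<alpha> - \<delta> / 4<..<\<beta> + \<delta> / 4}" and b = 1 and \<eta> = \<eta>, OF _ der one])
      show "t \<in> {\<alpha> - \<delta> / 4<..<\<beta> + \<delta> / 4}" using that assms by auto
    qed auto
    fix j t assume t: "t \<le> \<alpha> - \<delta> \<or> \<beta> + \<delta> \<le> t"
    then have t': "t < \<alpha> - 3 * \<delta> / 4 \<or> \<beta> + 3 * \<delta> / 4 < t" using assms by auto
    show "\<eta> j t = 0"
    proof (cases j)
      case 0
      then show ?thesis using zero t' by simp
    next
      case (Suc i)
      show ?thesis unfolding Suc
      proof (rule iterated_derivative_locally_constant[where S = "{..<\<alpha> - 3 * \<delta> / 4} \<union> {\<beta> + 3 * \<delta> / 4<..}" and b = 0 and \<eta> = \<eta>, OF _ der zero])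
        show "t \<in> {..<\<alpha> - 3 * \<delta> / 4} \<union> {\<beta> + 3 * \<delta> / 4<..}" using t' by auto
      qed auto
    qed
  qed (rule der bnd)+
qed

end

section \<open>Spaces of ultradifferentiable functions\<close>

lemma Leibniz_sum:
  fixes A :: "nat \<Rightarrow> nat \<Rightarrow> complex"
  shows "(\<Sum>i\<le>j. of_nat (j choose i) * (A (Suc i) (j - i) + A i (Suc (j - i)))) =
    (\<Sum>i\<le>Suc j. of_nat (Suc j choose i) * A i (Suc j - i))"
proof -
  have "(\<Sum>i\<le>Suc j. of_nat (Suc j choose i) * A i (Suc j - i)) =
      A 0 (Suc j) + (\<Sum>i\<le>j. of_nat (Suc j choose Suc i) * A (Suc i) (j - i))"
    by (subst sum.atMost_Suc_shift) simp
  also have "(\<Sum>i\<le>j. of_nat (Suc j choose Suc i) * A (Suc i) (j - i)) =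
      (\<Sum>i\<le>j. of_nat (j choose i) * A (Suc i) (j - i)) + (\<Sum>i\<le>j. of_nat (j choose Suc i) * A (Suc i) (j - i))"
    by (simp add: sum.distrib distrib_right)
  also have "A 0 (Suc j) + ((\<Sum>i\<le>j. of_nat (j choose i) * A (Suc i) (j - i)) + (\<Sum>i\<le>j. of_nat (j choose Suc i) * A (Suc i) (j - i)))
     = (\<Sum>i\<le>j. of_nat (j choose i) * A (Suc i) (j - i)) + (A 0 (Suc j) + (\<Sum>i\<le>j. of_nat (j choose Suc i) * A (Suc i) (j - i)))"
    by simp
  also have "A 0 (Suc j) + (\<Sum>i\<le>j. of_nat (j choose Suc i) * A (Suc i) (j - i)) =
      (\<Sum>i\<le>Suc j. of_nat (j choose i) * A i (Suc j - i))"
    by (subst sum.atMost_Suc_shift) simp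
  also have "\<dots> = (\<Sum>i\<le>j. of_nat (j choose i) * A i (Suc (j - i)))"
    by (simp add: Suc_diff_le)
  finally show ?thesis by (simp add: sum.distrib distrib_left)
qed

lemma has_vector_derivative_Leibniz:
  fixes F G :: "nat \<Rightarrow> real \<Rightarrow> complex"
  assumes "\<And>j. (F j has_vector_derivative F (Suc j) x) (at x)"
    and "\<And>j. (G j has_vector_derivative G (Suc j) x) (at x)"
  shows "((\<lambda>x. \<Sum>i\<le>j. of_nat (j choose i) * F i x * G (j - i) x) has_vector_derivative
    (\<Sum>i\<le>Suc j. of_nat (Suc j choose i) * F i x * G (Suc j - i) x)) (at x)"
proof -
  have "((\<lambda>x. \<Sum>i\<le>j. of_nat (j choose i) * (F i x * G (j - i) x)) has_vector_derivative
    (\<Sum>i\<le>j. of_nat (j choose i) * (F i x * G (Suc (j - i)) x + F (Suc i) x * G (j - i) x))) (at x)"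
    by (intro has_vector_derivative_sum has_vector_derivative_mult_right has_vector_derivative_mult assms)
  then show ?thesis
    using Leibniz_sum[of j "\<lambda>i k. F i x * G k x"] by (simp add: mult.assoc add.commute)
qed

context ultra_data
begin

abbreviation "U \<equiv> U_space \<omega> a c"
abbreviation "I \<equiv> sym_interval a"

definition D :: "nat \<Rightarrow> (real \<Rightarrow> complex) \<Rightarrow> real \<Rightarrow> complex" where
  "D j f = (diff_op a ^^ j) f"

lemma D_0 [simp]: "D 0 f = f"
  by (simp add: D_def)

lemma D_Suc: "D (Suc j) f = diff_op a (D j f)"
  by (simp add: D_def)

lemma D_diff_op: "D j (diff_op a f) = D (Suc j) f"
  by (simp add: D_def funpow_swap1)

definition nrm :: "real \<Rightarrow> nat \<Rightarrow> (real \<Rightarrow> complex) \<Rightarrow> real" where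
  "nrm q k f = real_of_ereal (u_norm \<omega> a c q k f)"

lemma open_I: "open I"
proof -
  have "I = real_of_ereal -` {} \<union> {x. - a < ereal x} \<inter> {x. ereal x < a}"
    by (auto simp: sym_interval_def)
  moreover have "open {x. - a < ereal x}" "open {x. ereal x < a}"
    by (cases a; simp add: open_Collect_less continuous_on_const continuous_on_id)+
  ultimately show ?thesis by auto
qed

lemma I_Union: "x \<in> I \<longleftrightarrow> (\<exists>k. \<bar>x\<bar> \<le> c k)"
  using c_exhausts by (auto simp: abs_le_iff set_eq_iff) (metis minus_le_iff)+

lemma c_mono: "k \<le> l \<Longrightarrow> c k \<le> c l"
  using c_inc by (simp add: incseqD)

lemma c_in_I: "\<bar>x\<bar> \<le> c k \<Longrightarrow> x \<in> I"
  using I_Union by blast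

lemma I_convex: "x \<in> I \<Longrightarrow> y \<in> I \<Longrightarrow> x \<le> z \<Longrightarrow> z \<le> y \<Longrightarrow> z \<in> I"
  unfolding sym_interval_def by (cases a) auto

text \<open>The sequence may be stationary for a while, but no \<open>c k\<close> is the largest,
  since closed intervals exhaust the open interval \<open>(-a;a)\<close>. This leaves room for a
  cutoff outside \<open>[-c k; c k]\<close>.\<close>

lemma c_unbounded: "\<exists>l. k \<le> l \<and> c k < c l"
proof -
  have "c k \<in> I" using c_pos[of k] by (intro c_in_I[of _ k]) simp
  then obtain e where e: "e > 0" "ball (c k) e \<subseteq> I" using open_I openE by blast
  have "c k + e / 2 \<in> ball (c k) e" using e by (simp add: dist_real_def)
  then obtain l where "\<bar>c k + e / 2\<bar> \<le> c l" using e I_Union by blast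
  then have "c k < c l" using e by linarith
  then show ?thesis using c_mono[of l k] by (meson linorder_not_le nat_le_linear)
qed

lemma zero_ext_in [simp]: "x \<in> I \<Longrightarrow> zero_ext a f x = f x"
  and zero_ext_out [simp]: "x \<notin> I \<Longrightarrow> zero_ext a f x = 0"
  by (auto simp: zero_ext_def)

lemma has_vector_derivative_D:
  assumes "f \<in> smooth a" "x \<in> I"
  shows "(D j f has_vector_derivative D (Suc j) f x) (at x)"
  unfolding D_Suc using assms by (auto simp: smooth_def diff_op_def vector_derivative_works D_def)

lemma D_outside: "f \<in> smooth a \<Longrightarrow> x \<notin> I \<Longrightarrow> D j f x = 0"
  by (cases j) (auto simp: smooth_def diff_op_def D_Suc)

text \<open>Smoothness is established by exhibiting the whole tower of derivatives at once; then the
  iterates of \<open>diff_op\<close>, with their zero extensions, never have to be computed.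
  \<open>U_zero_ext\<close> adds the growth conditions.\<close>

lemma smooth_zero_ext:
  assumes "\<And>j x. x \<in> I \<Longrightarrow> (F j has_vector_derivative F (Suc j) x) (at x)"
  shows "zero_ext a (F 0) \<in> smooth a" "D j (zero_ext a (F 0)) = zero_ext a (F j)"
proof -
  have der: "(zero_ext a (F j) has_vector_derivative F (Suc j) x) (at x)" if "x \<in> I" for x j
    by (rule has_vector_derivative_transform_within_open[OF assms[OF that] open_I that]) simp
  have D: "D j (zero_ext a (F 0)) = zero_ext a (F j)" for j
  proof (induction j)
    case (Suc j)
    show ?case unfolding D_Suc Suc
      using vector_derivative_at[OF der] by (auto simp: diff_op_def fun_eq_iff zero_ext_def)
  qed simp
  then show "D j (zero_ext a (F 0)) = zero_ext a (F j)" .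
  show "zero_ext a (F 0) \<in> smooth a"
    using der by (auto simp: smooth_def D_def[symmetric] D intro: differentiableI_vector)
qed

lemma exp_neg_conj: "exp (- q * young_conj \<omega> (real j / q)) = 1 / E q j"
  by (simp add: E_def exp_minus divide_inverse)

lemma u_norm_le_iff:
  "u_norm \<omega> a c q k f \<le> ereal M \<longleftrightarrow> (\<forall>j x. \<bar>x\<bar> \<le> c k \<longrightarrow> cmod (D j f x) \<le> M * E q j)"
  unfolding u_norm_def exp_neg_conj D_def by (auto simp: SUP_le_iff divide_le_eq abs_le_iff minus_le_iff)

lemma u_norm_nonneg: "0 \<le> u_norm \<omega> a c q k f"
proof -
  have "0 \<le> ereal (cmod (D 0 f 0) * exp (- q * young_conj \<omega> (real 0 / q)))" by simp
  also have "\<dots> \<le> u_norm \<omega> a c q k f"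
    unfolding u_norm_def D_def using c_pos[of k]
    by (intro SUP_upper2[of 0] SUP_upper2[of "0::real"]) auto
  finally show ?thesis .
qed

lemma u_norm_less_infinity_iff:
  "u_norm \<omega> a c q k f < \<infinity> \<longleftrightarrow> (\<exists>M. \<forall>j x. \<bar>x\<bar> \<le> c k \<longrightarrow> cmod (D j f x) \<le> M * E q j)"
proof -
  have "u_norm \<omega> a c q k f < \<infinity> \<longleftrightarrow> (\<exists>M. u_norm \<omega> a c q k f \<le> ereal M)"
    using u_norm_nonneg[of q k f] by (cases "u_norm \<omega> a c q k f") auto
  then show ?thesis by (simp only: u_norm_le_iff)
qed

lemma U_iff:
  "f \<in> U \<longleftrightarrow> f \<in> smooth a \<and> (\<forall>q k. 0 < q \<and> q < 1 \<longrightarrow> (\<exists>M. \<forall>j x. \<bar>x\<bar> \<le> c k \<longrightarrow> cmod (D j f x) \<le> M * E q j))"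
  unfolding U_space_def u_norm_less_infinity_iff by auto

lemma U_smooth: "f \<in> U \<Longrightarrow> f \<in> smooth a"
  by (simp add: U_iff)

lemma U_outside: "f \<in> U \<Longrightarrow> x \<notin> I \<Longrightarrow> D j f x = 0"
  by (simp add: U_smooth D_outside)

lemma U_derivative: "f \<in> U \<Longrightarrow> x \<in> I \<Longrightarrow> (D j f has_vector_derivative D (Suc j) f x) (at x)"
  by (simp add: U_smooth has_vector_derivative_D)

lemma U_zero_ext:
  assumes "\<And>j x. x \<in> I \<Longrightarrow> (F j has_vector_derivative F (Suc j) x) (at x)"
    and "\<And>q k. 0 < q \<Longrightarrow> q < 1 \<Longrightarrow> \<exists>M. \<forall>j x. \<bar>x\<bar> \<le> c k \<longrightarrow> cmod (F j x) \<le> M * E q j"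
  shows "zero_ext a (F 0) \<in> U" "D j (zero_ext a (F 0)) = zero_ext a (F j)"
proof -
  have s: "zero_ext a (F 0) \<in> smooth a" "D j (zero_ext a (F 0)) = zero_ext a (F j)" for j
    by (rule smooth_zero_ext, erule assms(1))+
  show "D j (zero_ext a (F 0)) = zero_ext a (F j)" by (rule s)
  show "zero_ext a (F 0) \<in> U"
  proof (subst U_iff, intro conjI allI impI s(1))
    fix q :: real and k assume "0 < q \<and> q < 1"
    then obtain M where "\<forall>j x. \<bar>x\<bar> \<le> c k \<longrightarrow> cmod (F j x) \<le> M * E q j" using assms(2) by blast
    then show "\<exists>M. \<forall>j x. \<bar>x\<bar> \<le> c k \<longrightarrow> cmod (D j (zero_ext a (F 0)) x) \<le> M * E q j"
      unfolding s(2) using c_in_I by (intro exI[of _ M]) auto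
  qed
qed

lemma nrm_nonneg [simp]: "0 \<le> nrm q k f"
  by (simp add: nrm_def u_norm_nonneg real_of_ereal_pos)

lemma ereal_nrm:
  assumes "f \<in> U" "0 < q" "q < 1"
  shows "ereal (nrm q k f) = u_norm \<omega> a c q k f"
proof -
  have "u_norm \<omega> a c q k f < \<infinity>" using assms by (auto simp: U_space_def)
  then show ?thesis using u_norm_nonneg[of q k f] by (auto simp: nrm_def ereal_real)
qed

lemma nrm_bound:
  assumes "f \<in> U" "0 < q" "q < 1" "\<bar>x\<bar> \<le> c k"
  shows "cmod (D j f x) \<le> nrm q k f * E q j"
  using u_norm_le_iff[of q k f "nrm q k f"] ereal_nrm[OF assms(1-3), of k] assms(4) by simp

lemma nrm_least:
  assumes "f \<in> U" "0 < q" "q < 1" "\<And>j x. \<bar>x\<bar> \<le> c k \<Longrightarrow> cmod (D j f x) \<le> M * E q j"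
  shows "nrm q k f \<le> M"
  using u_norm_le_iff[of q k f M] ereal_nrm[OF assms(1-3), of k, symmetric] assms(4) by simp

lemma nrm_mono:
  assumes "f \<in> U" "0 < q" "q \<le> q'" "q' < 1" "k \<le> k'"
  shows "nrm q k f \<le> nrm q' k' f"
proof (rule nrm_least)
  fix j x assume "\<bar>x\<bar> \<le> c k"
  then have "\<bar>x\<bar> \<le> c k'" using c_mono[OF assms(5)] by linarith
  then have "cmod (D j f x) \<le> nrm q' k' f * E q' j" using assms by (intro nrm_bound) auto
  also have "\<dots> \<le> nrm q' k' f * E q j" using assms by (intro mult_left_mono E_antimono) auto
  finally show "cmod (D j f x) \<le> nrm q' k' f * E q j" .
qed (use assms in auto)

lemma U_lincomb:
  assumes "f \<in> U" "g \<in> U"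
  shows "f + cscale b g \<in> U" "D j (f + cscale b g) = (\<lambda>x. D j f x + b * D j g x)"
proof -
  define F where "F j x = D j f x + b * D j g x" for j x
  have e: "zero_ext a (F j) = F j" for j
    using assms U_outside by (auto simp: F_def fun_eq_iff zero_ext_def)
  have F0: "zero_ext a (F 0) = f + cscale b g"
    unfolding e by (auto simp: F_def cscale_def fun_eq_iff)
  have 1: "(F j has_vector_derivative F (Suc j) x) (at x)" if "x \<in> I" for j x
    unfolding F_def
    by (intro has_vector_derivative_add has_vector_derivative_mult_right U_derivative assms that)
  have 2: "\<exists>M. \<forall>j x. \<bar>x\<bar> \<le> c k \<longrightarrow> cmod (F j x) \<le> M * E q j" if q: "0 < q" "q < 1" for q k
  proof (intro exI allI impI)
    fix j x assume "\<bar>x\<bar> \<le> c k"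
    then have "cmod (D j f x) + cmod b * cmod (D j g x) \<le> nrm q k f * E q j + cmod b * (nrm q k g * E q j)"
      using assms q by (intro add_mono mult_left_mono nrm_bound) auto
    then show "cmod (F j x) \<le> (nrm q k f + cmod b * nrm q k g) * E q j"
      unfolding F_def using norm_triangle_ineq[of "D j f x" "b * D j g x"]
      by (simp add: norm_mult algebra_simps)
  qed
  show "f + cscale b g \<in> U" "D j (f + cscale b g) = (\<lambda>x. D j f x + b * D j g x)"
    using U_zero_ext[of F, OF 1 2] unfolding F0 by (auto simp: e F_def)
qed

lemma U_zero: "0 \<in> U" "D j 0 = (\<lambda>_. 0)"
proof -
  have "zero_ext a (\<lambda>x. 0) \<in> U" "D j (zero_ext a (\<lambda>x. 0)) = zero_ext a (\<lambda>x. 0)"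
    by (rule U_zero_ext[where F = "\<lambda>_ _. 0"]; auto intro: exI[of _ 0])+
  moreover have "zero_ext a (\<lambda>x. 0) = 0" by (auto simp: zero_ext_def fun_eq_iff)
  ultimately show "0 \<in> U" "D j 0 = (\<lambda>_. 0)" by (auto simp: fun_eq_iff)
qed

lemma U_add:
  assumes "f \<in> U" "g \<in> U"
  shows "f + g \<in> U" "D j (f + g) x = D j f x + D j g x"
proof -
  have "f + g = f + cscale 1 g" by (auto simp: cscale_def fun_eq_iff)
  then show "f + g \<in> U" "D j (f + g) x = D j f x + D j g x"
    using U_lincomb[OF assms, where b = 1] by auto
qed

lemma U_diff:
  assumes "f \<in> U" "g \<in> U"
  shows "f - g \<in> U" "D j (f - g) x = D j f x - D j g x"
proof -
  have "f - g = f + cscale (- 1) g" by (auto simp: cscale_def fun_eq_iff)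
  then show "f - g \<in> U" "D j (f - g) x = D j f x - D j g x"
    using U_lincomb[OF assms, where b = "- 1"] by auto
qed

lemma U_cscale:
  assumes "f \<in> U"
  shows "cscale b f \<in> U" "D j (cscale b f) x = b * D j f x"
  using U_lincomb[OF U_zero(1) assms, where b = b] U_zero by auto

lemma U_subspace: "cfun.subspace U"
  using U_zero U_add U_cscale by (auto simp: cfun.subspace_def)

lemma nrm_triangle:
  assumes "f \<in> U" "g \<in> U" "0 < q" "q < 1"
  shows "nrm q k (f + g) \<le> nrm q k f + nrm q k g"
proof (rule nrm_least)
  fix j x assume x: "\<bar>x\<bar> \<le> c k"
  have "cmod (D j (f + g) x) \<le> cmod (D j f x) + cmod (D j g x)"
    using U_add(2)[OF assms(1,2)] norm_triangle_ineq by metis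
  also have "\<dots> \<le> nrm q k f * E q j + nrm q k g * E q j"
    using assms x by (intro add_mono nrm_bound)
  finally show "cmod (D j (f + g) x) \<le> (nrm q k f + nrm q k g) * E q j" by (simp add: distrib_right)
qed (use assms U_add in auto)

lemma nrm_cscale_le:
  assumes "f \<in> U" "0 < q" "q < 1"
  shows "nrm q k (cscale b f) \<le> cmod b * nrm q k f"
proof (rule nrm_least)
  fix j x assume x: "\<bar>x\<bar> \<le> c k"
  show "cmod (D j (cscale b f) x) \<le> (cmod b * nrm q k f) * E q j"
    unfolding U_cscale(2)[OF assms(1)] norm_mult mult.assoc
    using assms x by (intro mult_left_mono nrm_bound) auto
qed (use assms U_cscale in auto)

lemma nrm_cscale:
  assumes "f \<in> U" "0 < q" "q < 1"
  shows "nrm q k (cscale b f) = cmod b * nrm q k f"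
proof (cases "b = 0")
  case True
  then show ?thesis using nrm_cscale_le[OF assms, of k b] nrm_nonneg[of q k "cscale b f"] by (intro antisym) auto
next
  case False
  have "f = cscale (1 / b) (cscale b f)" using False by (auto simp: cscale_def fun_eq_iff)
  then have "nrm q k f \<le> cmod (1 / b) * nrm q k (cscale b f)"
    using nrm_cscale_le[OF U_cscale(1)[OF assms(1)] assms(2,3), of k "1 / b" b] by simp
  then have "cmod b * nrm q k f \<le> nrm q k (cscale b f)"
    using False by (simp add: norm_divide field_simps)
  then show ?thesis using nrm_cscale_le[OF assms, of k b] by simp
qed

lemma U_diff_op: "f \<in> U \<Longrightarrow> diff_op a f \<in> U"
  and nrm_diff_op:
    "0 < q \<Longrightarrow> q < q' \<Longrightarrow> q' < 1 \<Longrightarrow> \<exists>C>0. \<forall>k. \<forall>f\<in>U. nrm q k (diff_op a f) \<le> C * nrm q' k f"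
proof -
  have b: "\<exists>C>0. \<forall>k. \<forall>f\<in>U. \<forall>j x. \<bar>x\<bar> \<le> c k \<longrightarrow> cmod (D (Suc j) f x) \<le> C * nrm q' k f * E q j"
    if "0 < q" "q < q'" "q' < 1" for q q'
  proof -
    obtain C where C: "0 < C" "\<And>j. E q' (Suc j) \<le> C * E q j"
      using E_Suc[OF \<open>0 < q\<close> \<open>q < q'\<close>] by blast
    have "cmod (D (Suc j) f x) \<le> C * nrm q' k f * E q j" if "f \<in> U" "\<bar>x\<bar> \<le> c k" for k f j x
    proof -
      have "cmod (D (Suc j) f x) \<le> nrm q' k f * E q' (Suc j)"
        by (rule nrm_bound) (use that \<open>0 < q\<close> \<open>q < q'\<close> \<open>q' < 1\<close> in auto)
      also have "\<dots> \<le> nrm q' k f * (C * E q j)" by (intro mult_left_mono C) auto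
      finally show ?thesis by (simp add: mult_ac)
    qed
    then show ?thesis using C by blast
  qed
  show U: "diff_op a f \<in> U" if f: "f \<in> U" for f
  proof -
    have e: "zero_ext a (D (Suc j) f) = D (Suc j) f" for j
      using U_outside[OF f, of _ "Suc j"] by (auto simp: fun_eq_iff zero_ext_def)
    have "zero_ext a (D (Suc 0) f) \<in> U"
    proof (rule U_zero_ext(1)[where F = "\<lambda>j. D (Suc j) f"])
      fix q :: real and k assume q: "0 < q" "q < 1"
      have q2: "q < (q + 1) / 2" "(q + 1) / 2 < 1" using q by auto
      show "\<exists>M. \<forall>j x. \<bar>x\<bar> \<le> c k \<longrightarrow> cmod (D (Suc j) f x) \<le> M * E q j"
        using b[OF q(1) q2] f by blast
    qed (use f U_derivative in blast)
    then show ?thesis unfolding e by (simp add: D_Suc)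
  qed
  show "\<exists>C>0. \<forall>k. \<forall>f\<in>U. nrm q k (diff_op a f) \<le> C * nrm q' k f" if q: "0 < q" "q < q'" "q' < 1"
  proof -
    obtain C where C: "C > 0" "\<And>k f j x. f \<in> U \<Longrightarrow> \<bar>x\<bar> \<le> c k \<Longrightarrow> cmod (D (Suc j) f x) \<le> C * nrm q' k f * E q j"
      using b[OF q] by blast
    have "nrm q k (diff_op a f) \<le> C * nrm q' k f" if "f \<in> U" for k f
      by (rule nrm_least) (use U that q C(2) in \<open>auto simp: D_diff_op\<close>)
    then show ?thesis using C by blast
  qed
qed

section \<open>Products and multipliers\<close>

lemma E_product_bound:
  assumes "0 < q" "q < q'"
  obtains C where "0 < C" "\<And>F G M N j. 0 \<le> M \<Longrightarrow> 0 \<le> N \<Longrightarrow> (\<And>i. cmod (F i) \<le> M * E q' i) \<Longrightarrow>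
    (\<And>i. cmod (G i) \<le> N * E q' i) \<Longrightarrow> cmod (\<Sum>i\<le>j. of_nat (j choose i) * F i * G (j - i)) \<le> C * M * N * E q j"
proof -
  obtain C where C: "0 < C" "\<And>j. (\<Sum>i\<le>j. real (j choose i) * E q' i * E q' (j - i)) \<le> C * E q j"
    using E_Leibniz[OF assms] by blast
  have "cmod (\<Sum>i\<le>j. of_nat (j choose i) * F i * G (j - i)) \<le> C * M * N * E q j"
    if "0 \<le> M" "0 \<le> N" "\<And>i. cmod (F i) \<le> M * E q' i" "\<And>i. cmod (G i) \<le> N * E q' i" for F G M N j
  proof -
    have "cmod (\<Sum>i\<le>j. of_nat (j choose i) * F i * G (j - i)) \<le> (\<Sum>i\<le>j. real (j choose i) * (M * E q' i) * (N * E q' (j - i)))"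
    proof (intro order_trans[OF norm_sum] sum_mono)
      fix i
      have "real (j choose i) * cmod (F i) * cmod (G (j - i)) \<le> real (j choose i) * (M * E q' i) * (N * E q' (j - i))"
        by (intro mult_mono that mult_nonneg_nonneg) (use that in auto)
      then show "cmod (of_nat (j choose i) * F i * G (j - i)) \<le> real (j choose i) * (M * E q' i) * (N * E q' (j - i))"
        by (simp add: norm_mult)
    qed
    also have "\<dots> = M * N * (\<Sum>i\<le>j. real (j choose i) * E q' i * E q' (j - i))"
      unfolding sum_distrib_left by (intro sum.cong) (auto simp: mult_ac)
    also have "\<dots> \<le> M * N * (C * E q j)" using that by (intro mult_left_mono C) auto
    finally show ?thesis by (simp add: mult_ac)
  qed
  then show thesis using that C by blast
qed

text \<open>The multiplier is a tower of derivatives and need not vanish off \<open>(-a;a)\<close>,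
  since the factor \<open>f\<close> does. Finiteness of the seminorm of index \<open>q\<close> uses
  the index \<open>(q + 1) / 2\<close> on both factors, because the Leibniz sum loses a
  little.\<close>

lemma U_mult_gen:
  assumes f: "f \<in> U" and \<eta>: "\<And>j x. x \<in> I \<Longrightarrow> (\<eta> j has_vector_derivative \<eta> (Suc j) x) (at x)"
    "\<And>q k. 0 < q \<Longrightarrow> q < 1 \<Longrightarrow> \<exists>M. \<forall>j x. \<bar>x\<bar> \<le> c k \<longrightarrow> cmod (\<eta> j x) \<le> M * E q j"
  shows "(\<lambda>x. \<eta> 0 x * f x) \<in> U"
    "D j (\<lambda>x. \<eta> 0 x * f x) = (\<lambda>x. \<Sum>i\<le>j. of_nat (j choose i) * \<eta> i x * D (j - i) f x)"
proof -
  define F where "F j x = (\<Sum>i\<le>j. of_nat (j choose i) * \<eta> i x * D (j - i) f x)" for j x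
  have e: "zero_ext a (F j) = F j" for j
    using U_outside[OF f] by (auto simp: F_def fun_eq_iff zero_ext_def)
  have F0: "F 0 = (\<lambda>x. \<eta> 0 x * f x)" by (auto simp: F_def fun_eq_iff)
  have 1: "(F j has_vector_derivative F (Suc j) x) (at x)" if "x \<in> I" for j x
    unfolding F_def by (intro has_vector_derivative_Leibniz \<eta> U_derivative f that)
  have 2: "\<exists>M. \<forall>j x. \<bar>x\<bar> \<le> c k \<longrightarrow> cmod (F j x) \<le> M * E q j" if q: "0 < q" "q < 1" for q k
  proof -
    define p where "p = (q + 1) / 2"
    have p: "q < p" "0 < p" "p < 1" using q by (auto simp: p_def)
    obtain M where M: "\<And>j x. \<bar>x\<bar> \<le> c k \<Longrightarrow> cmod (\<eta> j x) \<le> M * E p j"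
      using \<eta>(2)[OF p(2,3)] by blast
    have "0 \<le> M * E p 0" using M[of 0 0] c_pos[of k] norm_ge_zero order_trans by (metis abs_zero less_imp_le)
    then have M0: "0 \<le> M" using E_pos(1)[of p 0] by (auto simp: zero_le_mult_iff dest: leD)
    obtain C where C: "0 < C" "\<And>F G M N j. 0 \<le> M \<Longrightarrow> 0 \<le> N \<Longrightarrow> (\<And>i. cmod (F i) \<le> M * E p i) \<Longrightarrow>
      (\<And>i. cmod (G i) \<le> N * E p i) \<Longrightarrow> cmod (\<Sum>i\<le>j. of_nat (j choose i) * F i * G (j - i)) \<le> C * M * N * E q j"
      using E_product_bound[OF q(1) p(1)] by blast
    have "cmod (F j x) \<le> C * M * nrm p k f * E q j" if "\<bar>x\<bar> \<le> c k" for j x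
      unfolding F_def
      by (rule C(2)[where F = "\<lambda>i. \<eta> i x" and G = "\<lambda>i. D i f x"]) (use M M0 f p that nrm_bound in auto)
    then show ?thesis by blast
  qed
  show "(\<lambda>x. \<eta> 0 x * f x) \<in> U"
    "D j (\<lambda>x. \<eta> 0 x * f x) = (\<lambda>x. \<Sum>i\<le>j. of_nat (j choose i) * \<eta> i x * D (j - i) f x)"
  proof -
    have "zero_ext a (F 0) \<in> U" "D j (zero_ext a (F 0)) = zero_ext a (F j)"
      by (rule U_zero_ext, erule 1, erule (1) 2)+
    moreover have "zero_ext a (F 0) = (\<lambda>x. \<eta> 0 x * f x)" by (rule trans[OF e F0])
    ultimately show "(\<lambda>x. \<eta> 0 x * f x) \<in> U"
      "D j (\<lambda>x. \<eta> 0 x * f x) = (\<lambda>x. \<Sum>i\<le>j. of_nat (j choose i) * \<eta> i x * D (j - i) f x)"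
      by (simp_all only: e) (simp add: F_def[abs_def])
  qed
qed

text \<open>The constant is independent of both factors and of \<open>k\<close>; the differentiation
  of \<open>S (exp_monomial a n z)\<close> in \<open>z\<close> relies on this, as its multipliers
  vary with the increment.\<close>

lemma nrm_mult_gen:
  assumes q: "0 < q" "q < q'" "q' < 1"
  obtains C where "0 < C" "\<And>f \<eta> M k. f \<in> U \<Longrightarrow> (\<And>j x. x \<in> I \<Longrightarrow> (\<eta> j has_vector_derivative \<eta> (Suc j) x) (at x)) \<Longrightarrow>
    (\<And>q k. 0 < q \<Longrightarrow> q < 1 \<Longrightarrow> \<exists>M. \<forall>j x. \<bar>x\<bar> \<le> c k \<longrightarrow> cmod (\<eta> j x) \<le> M * E q j) \<Longrightarrow> 0 \<le> M \<Longrightarrow>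
    (\<And>j x. \<bar>x\<bar> \<le> c k \<Longrightarrow> cmod (\<eta> j x) \<le> M * E q' j) \<Longrightarrow> nrm q k (\<lambda>x. \<eta> 0 x * f x) \<le> C * M * nrm q' k f"
proof -
  obtain C where C: "0 < C" "\<And>F G M N j. 0 \<le> M \<Longrightarrow> 0 \<le> N \<Longrightarrow> (\<And>i. cmod (F i) \<le> M * E q' i) \<Longrightarrow>
      (\<And>i. cmod (G i) \<le> N * E q' i) \<Longrightarrow> cmod (\<Sum>i\<le>j. of_nat (j choose i) * F i * G (j - i)) \<le> C * M * N * E q j"
    using E_product_bound[OF q(1,2)] by blast
  have "nrm q k (\<lambda>x. \<eta> 0 x * f x) \<le> C * M * nrm q' k f"
    if f: "f \<in> U" and \<eta>: "\<And>j x. x \<in> I \<Longrightarrow> (\<eta> j has_vector_derivative \<eta> (Suc j) x) (at x)"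
    "\<And>q k. 0 < q \<Longrightarrow> q < 1 \<Longrightarrow> \<exists>M. \<forall>j x. \<bar>x\<bar> \<le> c k \<longrightarrow> cmod (\<eta> j x) \<le> M * E q j"
    and M: "0 \<le> M" "\<And>j x. \<bar>x\<bar> \<le> c k \<Longrightarrow> cmod (\<eta> j x) \<le> M * E q' j" for f \<eta> M k
  proof (rule nrm_least)
    note p = U_mult_gen[of f \<eta>, OF f]
    show "(\<lambda>x. \<eta> 0 x * f x) \<in> U" by (rule p(1)) (use \<eta> in auto)
    have e: "D j (\<lambda>x. \<eta> 0 x * f x) = (\<lambda>x. \<Sum>i\<le>j. of_nat (j choose i) * \<eta> i x * D (j - i) f x)" for j
      by (rule p(2)) (use \<eta> in auto)
    fix j x assume x: "\<bar>x\<bar> \<le> c k"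
    show "cmod (D j (\<lambda>x. \<eta> 0 x * f x) x) \<le> C * M * nrm q' k f * E q j"
      unfolding e
      by (rule C(2)[where F = "\<lambda>i. \<eta> i x" and G = "\<lambda>i. D i f x"]) (use M x f q nrm_bound in auto)
  qed (use q in auto)
  then show thesis using that C(1) by blast
qed

text \<open>Keeps \<open>E\<close> away from zero uniformly in \<open>j\<close>, so that every
  multiplier with locally uniformly bounded derivatives is eligible.\<close>

lemma one_le_E: "0 < q \<Longrightarrow> q \<le> 1 \<Longrightarrow> 1 \<le> exp (\<omega> 1) * E q j"
proof -
  assume q: "0 < q" "q \<le> 1"
  have "q * \<omega> 1 \<le> 1 * \<omega> 1" using q nonneg[of 1] by (intro mult_right_mono) auto
  then have "1 \<le> exp (\<omega> 1) * (1 ^ j * exp (- q * \<omega> 1))" by (simp flip: exp_add)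
  also have "\<dots> \<le> exp (\<omega> 1) * E q j" by (intro mult_left_mono power_le_E q) auto
  finally show ?thesis .
qed

section \<open>Exponentials, monomials and cutoffs in the space\<close>

definition efun :: "complex \<Rightarrow> real \<Rightarrow> complex" where
  "efun z = zero_ext a (\<lambda>t. exp (- \<i> * of_real t * z))"

lemma fourier_laplace_efun: "fourier_laplace a S z = S (efun z)"
  by (simp add: fourier_laplace_def efun_def)

lemma norm_exp_i_le:
  assumes "\<bar>x\<bar> \<le> R"
  shows "cmod (exp (- \<i> * of_real x * z)) \<le> exp (R * \<bar>Im z\<bar>)"
proof -
  have "x * Im z \<le> \<bar>x\<bar> * \<bar>Im z\<bar>" by (metis abs_ge_self abs_mult)
  also have "\<dots> \<le> R * \<bar>Im z\<bar>" using assms by (intro mult_right_mono) auto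
  finally show ?thesis by simp
qed

lemma efun_deriv:
  "((\<lambda>t. (- \<i> * z) ^ j * exp (- \<i> * of_real t * z)) has_vector_derivative
     (- \<i> * z) ^ Suc j * exp (- \<i> * of_real x * z)) (at x)"
proof -
  have "((\<lambda>w. (- \<i> * z) ^ j * exp (- \<i> * w * z)) has_field_derivative
      (- \<i> * z) ^ Suc j * exp (- \<i> * of_real x * z)) (at (of_real x))"
    by (auto intro!: derivative_eq_intros)
  then show ?thesis by (rule has_vector_derivative_real_field)
qed

lemma efun_bound:
  assumes q: "0 < q" "q \<le> 1" and x: "\<bar>x\<bar> \<le> R"
  shows "cmod ((- \<i> * z) ^ j * exp (- \<i> * of_real x * z)) \<le>
    exp (\<omega> 1) * exp (R * \<bar>Im z\<bar>) * exp (q * \<omega> (cmod z)) * E q j"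
proof -
  have "q * \<omega> 1 \<le> 1 * \<omega> 1" using q nonneg[of 1] by (intro mult_right_mono) auto
  have "cmod z ^ j * exp (- q * \<omega> (cmod z)) \<le> exp (q * \<omega> 1) * E q j"
    by (rule power_le_E') (use q in auto)
  also have "\<dots> \<le> exp (\<omega> 1) * E q j" using \<open>q * \<omega> 1 \<le> 1 * \<omega> 1\<close> by (intro mult_right_mono) auto
  finally have "cmod z ^ j * exp (- q * \<omega> (cmod z)) * exp (q * \<omega> (cmod z)) \<le> exp (\<omega> 1) * E q j * exp (q * \<omega> (cmod z))"
    by (intro mult_right_mono) auto
  then have "cmod z ^ j \<le> exp (\<omega> 1) * E q j * exp (q * \<omega> (cmod z))"
    by (simp add: mult.assoc flip: exp_add)
  then have "cmod z ^ j * cmod (exp (- \<i> * of_real x * z)) \<le> (exp (\<omega> 1) * E q j * exp (q * \<omega> (cmod z))) * exp (R * \<bar>Im z\<bar>)"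
    by (intro mult_mono norm_exp_i_le x) auto
  then show ?thesis by (simp only: norm_mult norm_power norm_minus_cancel norm_ii mult_1 mult_ac)
qed

lemma efun_U: "efun z \<in> U"
  and D_efun: "D j (efun z) = zero_ext a (\<lambda>t. (- \<i> * z) ^ j * exp (- \<i> * of_real t * z))"
proof -
  define F where "F j t = (- \<i> * z) ^ j * exp (- \<i> * of_real t * z)" for j t
  have e: "efun z = zero_ext a (F 0)" by (simp add: efun_def F_def[abs_def])
  have 1: "(F j has_vector_derivative F (Suc j) x) (at x)" for j x
    unfolding F_def[abs_def] by (rule efun_deriv)
  have 2: "\<exists>M. \<forall>j x. \<bar>x\<bar> \<le> c k \<longrightarrow> cmod (F j x) \<le> M * E q j" if "0 < q" "q < 1" for q k
    unfolding F_def using efun_bound[of q _ "c k" z] that by (intro exI allI impI) auto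
  have "zero_ext a (F 0) \<in> U" "D j (zero_ext a (F 0)) = zero_ext a (F j)" for j
    by (rule U_zero_ext, rule 1, erule (1) 2)+
  then show "efun z \<in> U" "D j (efun z) = zero_ext a (\<lambda>t. (- \<i> * z) ^ j * exp (- \<i> * of_real t * z))"
    unfolding e by (simp_all add: F_def[abs_def])
qed

text \<open>By this growth, \<open>c k\<close> in the imaginary part and \<open>q * \<omega>\<close>
  in the modulus, the transforms of functionals fall into the steps \<open>Pk\<close>.\<close>

lemma nrm_efun:
  assumes "0 < q" "q < 1"
  shows "nrm q k (efun z) \<le> exp (\<omega> 1) * exp (c k * \<bar>Im z\<bar>) * exp (q * \<omega> (cmod z))"
proof (rule nrm_least[OF efun_U assms])
  fix j x assume x: "\<bar>x\<bar> \<le> c k"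
  show "cmod (D j (efun z) x) \<le> exp (\<omega> 1) * exp (c k * \<bar>Im z\<bar>) * exp (q * \<omega> (cmod z)) * E q j"
    unfolding D_efun using efun_bound[of q x "c k" z j] x assms c_in_I by simp
qed

lemma multiplier_bounded:
  assumes "\<And>k. \<exists>M. \<forall>j x. \<bar>x\<bar> \<le> c k \<longrightarrow> cmod (\<eta> j x) \<le> M" "0 < q" "q < 1"
  shows "\<exists>M. \<forall>j x. \<bar>x\<bar> \<le> c k \<longrightarrow> cmod (\<eta> j x) \<le> M * E q j"
proof -
  obtain M where M: "\<And>j x. \<bar>x\<bar> \<le> c k \<Longrightarrow> cmod (\<eta> j x) \<le> M" using assms(1) by blast
  have M0: "0 \<le> M" using M[of 0 0] c_pos[of k] norm_ge_zero order_trans by (metis abs_zero less_imp_le)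
  have "cmod (\<eta> j x) \<le> M * exp (\<omega> 1) * E q j" if "\<bar>x\<bar> \<le> c k" for j x
  proof -
    have "cmod (\<eta> j x) \<le> M * 1" using M[OF that] by simp
    also have "\<dots> \<le> M * (exp (\<omega> 1) * E q j)" using M0 assms by (intro mult_left_mono one_le_E) auto
    finally show ?thesis by simp
  qed
  then show ?thesis by blast
qed

lemma U_times_t:
  assumes f: "f \<in> U"
  shows "(\<lambda>x. of_real x * f x) \<in> U"
proof -
  define \<eta> :: "nat \<Rightarrow> real \<Rightarrow> complex" where
    "\<eta> j x = (if j = 0 then of_real x else if j = 1 then 1 else 0)" for j x
  have "(\<lambda>x. \<eta> 0 x * f x) \<in> U"
  proof (rule U_mult_gen(1)[OF f])
    fix j x
    have "((\<lambda>x. of_real x :: complex) has_vector_derivative 1) (at x)"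
      using has_vector_derivative_of_real[OF DERIV_ident[of "at x"]] by simp
    then show "(\<eta> j has_vector_derivative \<eta> (Suc j) x) (at x)"
      by (cases j) (auto simp: \<eta>_def[abs_def])
  next
    fix q :: real and k assume "0 < q" "q < 1"
    then show "\<exists>M. \<forall>j x. \<bar>x\<bar> \<le> c k \<longrightarrow> cmod (\<eta> j x) \<le> M * E q j"
    proof (rule multiplier_bounded[rotated])
      show "\<exists>M. \<forall>j x. \<bar>x\<bar> \<le> c k \<longrightarrow> cmod (\<eta> j x) \<le> M" for k
        by (rule exI[of _ "max 1 (c k)"]) (auto simp: \<eta>_def)
    qed
  qed
  then show ?thesis by (simp add: \<eta>_def)
qed

lemma exp_monomial_0: "exp_monomial a 0 \<mu> = efun \<mu>"
  by (simp add: exp_monomial_def efun_def mult_ac)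

lemma exp_monomial_Suc: "exp_monomial a (Suc n) \<mu> = (\<lambda>x. of_real x * exp_monomial a n \<mu> x)"
  by (auto simp: exp_monomial_def zero_ext_def fun_eq_iff)

lemma exp_monomial_U: "exp_monomial a n \<mu> \<in> U"
  by (induction n) (simp_all add: exp_monomial_0 efun_U exp_monomial_Suc U_times_t)

text \<open>Bounds by \<open>E 1\<close> are stronger than those by any \<open>E q\<close> with
  \<open>q < 1\<close>, so one constant serves all seminorms.\<close>

lemma U_cutoff:
  assumes f: "f \<in> U" and \<eta>: "\<And>j x. (\<eta> j has_vector_derivative \<eta> (Suc j) x) (at x)"
    "\<And>j x. cmod (\<eta> j x) \<le> C * E 1 j"
  shows "(\<lambda>x. \<eta> 0 x * f x) \<in> U"
    "D j (\<lambda>x. \<eta> 0 x * f x) = (\<lambda>x. \<Sum>i\<le>j. of_nat (j choose i) * \<eta> i x * D (j - i) f x)"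
    and "0 < q \<Longrightarrow> q < 1 \<Longrightarrow> cmod (\<eta> j x) \<le> C * E q j"
proof -
  have "0 \<le> C * E 1 0" using \<eta>(2)[of 0 0] norm_ge_zero order_trans by blast
  then have C: "0 \<le> C" using E_pos(1)[of 1 0] by (auto simp: zero_le_mult_iff dest: leD)
  have le: "cmod (\<eta> j x) \<le> C * E q j" if "0 < q" "q < 1" for q j x
    using \<eta>(2)[of j x] mult_left_mono[OF E_antimono[of q 1 j] C] that by linarith
  then show "0 < q \<Longrightarrow> q < 1 \<Longrightarrow> cmod (\<eta> j x) \<le> C * E q j" .
  show "(\<lambda>x. \<eta> 0 x * f x) \<in> U"
    by (rule U_mult_gen(1)[OF f]) (use \<eta> le in blast)+
  show "D j (\<lambda>x. \<eta> 0 x * f x) = (\<lambda>x. \<Sum>i\<le>j. of_nat (j choose i) * \<eta> i x * D (j - i) f x)"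
    by (rule U_mult_gen(2)[OF f]) (use \<eta> le in blast)+
qed

lemma nrm_cutoff:
  assumes \<eta>: "\<And>j x. (\<eta> j has_vector_derivative \<eta> (Suc j) x) (at x)"
    "\<And>j x. cmod (\<eta> j x) \<le> C * E 1 j" and q: "0 < q" "q < q'" "q' < 1"
  shows "\<exists>B>0. \<forall>k. \<forall>f\<in>U. nrm q k (\<lambda>x. \<eta> 0 x * f x) \<le> B * nrm q' k f"
proof -
  have "0 \<le> C * E 1 0" using \<eta>(2)[of 0 0] norm_ge_zero order_trans by blast
  then have C: "0 \<le> C" using E_pos(1)[of 1 0] by (auto simp: zero_le_mult_iff dest: leD)
  obtain B where B: "0 < B" "\<And>f \<eta> M k. f \<in> U \<Longrightarrow> (\<And>j x. x \<in> I \<Longrightarrow> (\<eta> j has_vector_derivative \<eta> (Suc j) x) (at x)) \<Longrightarrow>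
    (\<And>q k. 0 < q \<Longrightarrow> q < 1 \<Longrightarrow> \<exists>M. \<forall>j x. \<bar>x\<bar> \<le> c k \<longrightarrow> cmod (\<eta> j x) \<le> M * E q j) \<Longrightarrow> 0 \<le> M \<Longrightarrow>
    (\<And>j x. \<bar>x\<bar> \<le> c k \<Longrightarrow> cmod (\<eta> j x) \<le> M * E q' j) \<Longrightarrow> nrm q k (\<lambda>x. \<eta> 0 x * f x) \<le> B * M * nrm q' k f"
    using nrm_mult_gen[OF q] by blast
  have le: "cmod (\<eta> j x) \<le> C * E q j" if "0 < q" "q < 1" for q j x
    using U_cutoff(3)[OF efun_U[of 0] \<eta> that] .
  have "nrm q k (\<lambda>x. \<eta> 0 x * f x) \<le> (B * (C + 1)) * nrm q' k f" if "f \<in> U" for k f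
  proof -
    have "nrm q k (\<lambda>x. \<eta> 0 x * f x) \<le> B * C * nrm q' k f"
      by (rule B(2)[OF that]) (use \<eta> le C q in \<open>blast | simp\<close>)+
    also have "\<dots> \<le> (B * (C + 1)) * nrm q' k f" using B(1) by (intro mult_right_mono) auto
    finally show ?thesis .
  qed
  then show ?thesis using B C by (intro exI[of _ "B * (C + 1)"]) (auto simp: add_nonneg_pos)
qed

text \<open>Infinite flatness at \<open>m\<close> allows the two sides of \<open>f\<close> to be
  separated inside the class: the truncated tower of derivatives is again a tower, with the same
  bounds.\<close>

lemma U_split:
  assumes f: "f \<in> U" and m: "\<And>j. D j f m = 0"
  shows "(\<lambda>t. if m \<le> t then f t else 0) \<in> U"
    "D j (\<lambda>t. if m \<le> t then f t else 0) = (\<lambda>t. if m \<le> t then D j f t else 0)"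
proof -
  define F where "F j t = (if m \<le> t then D j f t else 0)" for j t
  have e: "zero_ext a (F j) = F j" for j
    using U_outside[OF f] by (auto simp: F_def fun_eq_iff zero_ext_def)
  have 1: "(F j has_vector_derivative F (Suc j) x) (at x)" if x: "x \<in> I" for j x
  proof -
    note d = U_derivative[OF f x, of j]
    consider "x < m" | "m < x" | "x = m" by linarith
    then show ?thesis
    proof cases
      case 1
      have "((\<lambda>_. 0) has_vector_derivative 0) (at x)" by simp
      then have "(F j has_vector_derivative 0) (at x)"
        by (rule has_vector_derivative_transform_within_open[where S = "{..<m}"]) (use 1 in \<open>auto simp: F_def\<close>)
      then show ?thesis using 1 by (simp add: F_def)
    next
      case 2
      have "(F j has_vector_derivative D (Suc j) f x) (at x)"
        by (rule has_vector_derivative_transform_within_open[OF d, where S = "{m<..}"]) (use 2 in \<open>auto simp: F_def\<close>)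
      then show ?thesis using 2 by (simp add: F_def)
    next
      case 3
      \<comment> \<open>At the cut the truncated function is dominated by \<open>D j f\<close>,
        whose difference quotient tends to \<open>D (Suc j) f m = 0\<close>.\<close>
      have "((\<lambda>y. norm (D j f y - D j f m - (y - m) *\<^sub>R 0) / norm (y - m)) \<longlongrightarrow> 0) (at m)"
        using d m[of "Suc j"] 3 by (simp add: has_vector_derivative_def has_derivative_iff_norm)
      then have lim: "((\<lambda>y. norm (D j f y) / norm (y - m)) \<longlongrightarrow> 0) (at m)" using m[of j] by simp
      have "((\<lambda>y. norm (F j y) / norm (y - m)) \<longlongrightarrow> 0) (at m)"
        by (rule Lim_null_comparison[OF always_eventually lim]) (auto simp: F_def divide_right_mono)
      then have "(F j has_vector_derivative 0) (at m)"
        using m[of j] by (simp add: has_vector_derivative_def has_derivative_iff_norm F_def[of _ m])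
      then show ?thesis using m[of "Suc j"] 3 by (simp add: F_def)
    qed
  qed
  have 2: "\<exists>M. \<forall>j x. \<bar>x\<bar> \<le> c k \<longrightarrow> cmod (F j x) \<le> M * E q j" if q: "0 < q" "q < 1" for q k
    using nrm_bound[OF f q, of _ k] by (intro exI[of _ "nrm q k f"]) (auto simp: F_def)
  have "zero_ext a (F 0) \<in> U" "D j (zero_ext a (F 0)) = zero_ext a (F j)"
    by (rule U_zero_ext, erule 1, erule (1) 2)+
  moreover have "zero_ext a (F 0) = (\<lambda>t. if m \<le> t then f t else 0)" unfolding e by (auto simp: F_def)
  ultimately show "(\<lambda>t. if m \<le> t then f t else 0) \<in> U"
    "D j (\<lambda>t. if m \<le> t then f t else 0) = (\<lambda>t. if m \<le> t then D j f t else 0)"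
    by (simp_all only: e) (simp add: F_def[abs_def])
qed

end

section \<open>Fourier-Laplace transforms of compactly supported functions\<close>

text \<open>The sign of the exponent is opposite to that of \<open>efun\<close>, so that inversion
  writes \<open>g\<close> as a superposition of the exponentials \<open>efun x\<close> with real
  \<open>x\<close>.\<close>

definition FT :: "real \<Rightarrow> real \<Rightarrow> (real \<Rightarrow> complex) \<Rightarrow> complex \<Rightarrow> complex" where
  "FT \<alpha> \<beta> g \<zeta> = integral {\<alpha>..\<beta>} (\<lambda>t. g t * exp (\<i> * \<zeta> * of_real t))"

lemma FT_integrable:
  assumes "continuous_on {\<alpha>..\<beta>} g"
  shows "(\<lambda>t. g t * exp (\<i> * \<zeta> * of_real t)) integrable_on {\<alpha>..\<beta>}"
  by (intro integrable_continuous_interval continuous_intros assms)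

lemma holomorphic_FT:
  assumes "continuous_on {\<alpha>..\<beta>} g"
  shows "FT \<alpha> \<beta> g holomorphic_on UNIV"
proof -
  have "(\<lambda>\<zeta>. integral (cbox \<alpha> \<beta>) (\<lambda>t. g t * exp (\<i> * \<zeta> * of_real t))) holomorphic_on UNIV"
  proof (rule leibniz_rule_holomorphic)
    show "((\<lambda>\<zeta>. g t * exp (\<i> * \<zeta> * of_real t)) has_field_derivative
        g t * (exp (\<i> * \<zeta> * of_real t) * (\<i> * of_real t))) (at \<zeta> within UNIV)" for \<zeta> t
      by (auto intro!: derivative_eq_intros)
    show "(\<lambda>t. g t * exp (\<i> * \<zeta> * of_real t)) integrable_on cbox \<alpha> \<beta>" for \<zeta>
      using FT_integrable[OF assms] by simp
    have "continuous_on (UNIV \<times> {\<alpha>..\<beta>}) (\<lambda>p::complex \<times> real. g (snd p))"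
      by (rule continuous_on_compose2[OF assms]) (auto intro: continuous_intros)
    then show "continuous_on (UNIV \<times> cbox \<alpha> \<beta>) (\<lambda>(\<zeta>, t). g t * (exp (\<i> * \<zeta> * of_real t) * (\<i> * of_real t)))"
      unfolding split_beta by (auto intro!: continuous_intros)
  qed auto
  then show ?thesis by (simp add: FT_def[abs_def])
qed

lemma norm_FT_le:
  assumes "continuous_on {\<alpha>..\<beta>} g" "\<alpha> \<le> \<beta>" "\<And>t. \<alpha> \<le> t \<Longrightarrow> t \<le> \<beta> \<Longrightarrow> cmod (g t) \<le> M"
    and "\<And>t. \<alpha> \<le> t \<Longrightarrow> t \<le> \<beta> \<Longrightarrow> exp (- (Im \<zeta> * t)) \<le> K"
  shows "cmod (FT \<alpha> \<beta> g \<zeta>) \<le> M * K * (\<beta> - \<alpha>)"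
proof -
  have "0 \<le> M" using assms(3)[of \<alpha>] assms(2) norm_ge_zero order_trans by blast
  then show ?thesis unfolding FT_def
    by (intro integral_bound continuous_intros assms) (auto simp: norm_mult intro!: mult_mono assms)
qed

lemma continuous_on_if_vector_derivative:
  assumes "\<And>t. \<alpha> \<le> t \<Longrightarrow> t \<le> \<beta> \<Longrightarrow> (g has_vector_derivative g' t) (at t)"
  shows "continuous_on {\<alpha>..\<beta>} g"
proof (rule continuous_at_imp_continuous_on, rule ballI)
  fix t assume "t \<in> {\<alpha>..\<beta>}"
  then have "(g has_vector_derivative g' t) (at t)" using assms by simp
  then show "isCont g t" by (rule has_vector_derivative_continuous)
qed

lemma FT_parts:
  assumes "\<alpha> \<le> \<beta>" "\<And>t. \<alpha> \<le> t \<Longrightarrow> t \<le> \<beta> \<Longrightarrow> (g has_vector_derivative g' t) (at t)"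
    and "continuous_on {\<alpha>..\<beta>} g'"
  shows "\<i> * \<zeta> * FT \<alpha> \<beta> g \<zeta> =
    g \<beta> * exp (\<i> * \<zeta> * of_real \<beta>) - g \<alpha> * exp (\<i> * \<zeta> * of_real \<alpha>) - FT \<alpha> \<beta> g' \<zeta>"
proof -
  have cg: "continuous_on {\<alpha>..\<beta>} g"
    by (rule continuous_on_if_vector_derivative, rule assms(2))
  have "((\<lambda>t. g t * (exp (\<i> * \<zeta> * of_real t) * (\<i> * \<zeta>)) + g' t * exp (\<i> * \<zeta> * of_real t)) has_integral
    g \<beta> * exp (\<i> * \<zeta> * of_real \<beta>) - g \<alpha> * exp (\<i> * \<zeta> * of_real \<alpha>)) {\<alpha>..\<beta>}"
  proof (rule fundamental_theorem_of_calculus[OF assms(1)])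
    fix t assume "t \<in> {\<alpha>..\<beta>}"
    then have d: "(g has_vector_derivative g' t) (at t within {\<alpha>..\<beta>})"
      by (auto intro!: has_vector_derivative_at_within[OF assms(2)])
    have "((\<lambda>z. exp (\<i> * \<zeta> * z)) has_field_derivative (exp (\<i> * \<zeta> * of_real t) * (\<i> * \<zeta>))) (at (of_real t))"
      by (auto intro!: derivative_eq_intros)
    then have "((\<lambda>t. exp (\<i> * \<zeta> * of_real t)) has_vector_derivative (exp (\<i> * \<zeta> * of_real t) * (\<i> * \<zeta>))) (at t within {\<alpha>..\<beta>})"
      by (rule has_vector_derivative_at_within[OF has_vector_derivative_real_field])
    from has_vector_derivative_mult[OF d this]
    show "((\<lambda>t. g t * exp (\<i> * \<zeta> * of_real t)) has_vector_derivative
       g t * (exp (\<i> * \<zeta> * of_real t) * (\<i> * \<zeta>)) + g' t * exp (\<i> * \<zeta> * of_real t)) (at t within {\<alpha>..\<beta>})" .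
  qed
  moreover have "((\<lambda>t. g t * (exp (\<i> * \<zeta> * of_real t) * (\<i> * \<zeta>)) + g' t * exp (\<i> * \<zeta> * of_real t)) has_integral
      FT \<alpha> \<beta> g \<zeta> * (\<i> * \<zeta>) + FT \<alpha> \<beta> g' \<zeta>) {\<alpha>..\<beta>}"
    unfolding FT_def
    using has_integral_add[OF has_integral_mult_left[OF integrable_integral[OF FT_integrable[OF cg]], of \<zeta> "\<i> * \<zeta>"]
        integrable_integral[OF FT_integrable[OF assms(3), of \<zeta>]]]
    by (simp add: mult.assoc)
  ultimately have "FT \<alpha> \<beta> g \<zeta> * (\<i> * \<zeta>) + FT \<alpha> \<beta> g' \<zeta> =
    g \<beta> * exp (\<i> * \<zeta> * of_real \<beta>) - g \<alpha> * exp (\<i> * \<zeta> * of_real \<alpha>)"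
    by (rule has_integral_unique[rotated])
  then show ?thesis by (simp add: algebra_simps)
qed

lemma FT_split:
  assumes "continuous_on {\<alpha>..\<beta>} g" "\<alpha> \<le> x" "x \<le> \<beta>"
  shows "FT \<alpha> \<beta> g \<zeta> = FT \<alpha> x g \<zeta> + FT x \<beta> g \<zeta>"
  unfolding FT_def using assms
  by (intro Henstock_Kurzweil_Integration.integral_combine[symmetric] FT_integrable) auto

lemma FT_0: "\<alpha> \<le> \<beta> \<Longrightarrow> (\<And>t. \<alpha> \<le> t \<Longrightarrow> t \<le> \<beta> \<Longrightarrow> (g has_vector_derivative g' t) (at t)) \<Longrightarrow>
  FT \<alpha> \<beta> g' 0 = g \<beta> - g \<alpha>"
  using fundamental_theorem_of_calculus[of \<alpha> \<beta> g g']
  by (auto simp: FT_def intro!: integral_unique intro: has_vector_derivative_at_within)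

lemma FT_cong: "(\<And>t. \<alpha> \<le> t \<Longrightarrow> t \<le> \<beta> \<Longrightarrow> g t = h t) \<Longrightarrow> FT \<alpha> \<beta> g = FT \<alpha> \<beta> h"
  unfolding FT_def fun_eq_iff by (auto intro!: Henstock_Kurzweil_Integration.integral_cong)

text \<open>With \<open>\<phi> = 1\<close> this is Fourier inversion at \<open>x\<close>; the general form evaluates the pairing of
  \<open>\<phi>\<close> with a cutoff function. Splitting at \<open>x\<close> and integrating by parts separates the part that
  decays in the upper half-plane from the part that decays in the lower one.\<close>

lemma FT_inversion_gen:
  assumes x: "\<alpha> \<le> x" "x \<le> \<beta>" and der: "\<And>t. \<alpha> \<le> t \<Longrightarrow> t \<le> \<beta> \<Longrightarrow> (g has_vector_derivative g' t) (at t)"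
    and c': "continuous_on {\<alpha>..\<beta>} g'" and end0: "g \<alpha> = 0" "g \<beta> = 0"
    and \<phi>: "\<phi> holomorphic_on UNIV"
    and P: "\<And>z. 0 \<le> Im z \<Longrightarrow> cmod (FT x \<beta> g' z * exp (- (\<i> * z * of_real x)) * \<phi> z) \<le> M"
      "\<And>t. cmod (FT x \<beta> g' (of_real t) * exp (- (\<i> * of_real t * of_real x)) * \<phi> (of_real t)) \<le> C / (1 + \<bar>t\<bar>)"
    and Q: "\<And>z. Im z \<le> 0 \<Longrightarrow> cmod (FT \<alpha> x g' z * exp (- (\<i> * z * of_real x)) * \<phi> z) \<le> M"
      "\<And>t. cmod (FT \<alpha> x g' (of_real t) * exp (- (\<i> * of_real t * of_real x)) * \<phi> (of_real t)) \<le> C / (1 + \<bar>t\<bar>)"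
  shows "(LBINT t. FT \<alpha> \<beta> g (of_real t) * exp (- (\<i> * of_real t * of_real x)) * \<phi> (of_real t)) = 2 * of_real pi * g x * \<phi> 0"
proof -
  define p where "p z = - (FT x \<beta> g' z * exp (- (\<i> * z * of_real x)) * \<phi> z)" for z
  define q where "q z = FT \<alpha> x g' z * exp (- (\<i> * z * of_real x)) * \<phi> z" for z
  have c1: "continuous_on {\<alpha>..x} g'" "continuous_on {x..\<beta>} g'"
    using x by (auto intro: continuous_on_subset[OF c'])
  have cg: "continuous_on {\<alpha>..\<beta>} g"
    by (rule continuous_on_if_vector_derivative, rule der)
  have eq: "p 0 = q 0" "p 0 = g x * \<phi> 0"
    using FT_0[OF x(1), of g g'] FT_0[OF x(2), of g g'] der x end0 by (auto simp: p_def q_def)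
  have "(LBINT t. (p (of_real t) - q (of_real t)) / (\<i> * of_real t)) = 2 * of_real pi * p 0"
    by (rule integral_difference_over_x[where M = M and C = C])
      (use P Q eq c1 in \<open>auto simp: p_def[abs_def] q_def[abs_def] intro!: holomorphic_intros holomorphic_FT \<phi>\<close>)
  moreover have "FT \<alpha> \<beta> g (of_real t) * exp (- (\<i> * of_real t * of_real x)) * \<phi> (of_real t) =
      (p (of_real t) - q (of_real t)) / (\<i> * of_real t)" if "t \<noteq> 0" for t :: real
  proof -
    have "\<i> * of_real t * FT x \<beta> g (of_real t) = - g x * exp (\<i> * of_real t * of_real x) - FT x \<beta> g' (of_real t)"
      using FT_parts[OF x(2) _ c1(2), of g "of_real t"] der x end0 by simp
    moreover have "\<i> * of_real t * FT \<alpha> x g (of_real t) = g x * exp (\<i> * of_real t * of_real x) - FT \<alpha> x g' (of_real t)"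
      using FT_parts[OF x(1) _ c1(1), of g "of_real t"] der x end0 by simp
    ultimately have "\<i> * of_real t * FT \<alpha> \<beta> g (of_real t) = - FT x \<beta> g' (of_real t) - FT \<alpha> x g' (of_real t)"
      unfolding FT_split[OF cg x] distrib_left by simp
    then have "(\<i> * of_real t * FT \<alpha> \<beta> g (of_real t)) * (exp (- (\<i> * of_real t * of_real x)) * \<phi> (of_real t)) = p (of_real t) - q (of_real t)"
      by (simp add: p_def q_def left_diff_distrib mult.assoc)
    then have "\<i> * of_real t * (FT \<alpha> \<beta> g (of_real t) * exp (- (\<i> * of_real t * of_real x)) * \<phi> (of_real t)) = p (of_real t) - q (of_real t)"
      by (simp only: mult.assoc)
    then show ?thesis using that by (simp add: field_simps)
  qed
  then have "AE t in lborel. FT \<alpha> \<beta> g (of_real t) * exp (- (\<i> * of_real t * of_real x)) * \<phi> (of_real t) =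
      (p (of_real t) - q (of_real t)) / (\<i> * of_real t)"
    using AE_lborel_singleton[of "0::real"] by (auto elim: eventually_mono)
  moreover have c: "continuous_on UNIV (\<lambda>x::real. f (of_real x))" if "f holomorphic_on UNIV" for f
    by (rule continuous_on_compose2[OF holomorphic_on_imp_continuous_on[OF that]])
      (auto intro: continuous_intros)
  have [measurable]: "(\<lambda>t. FT \<alpha> \<beta> g (of_real t)) \<in> borel_measurable borel" "(\<lambda>t. \<phi> (of_real t)) \<in> borel_measurable borel"
    "(\<lambda>t. p (of_real t)) \<in> borel_measurable borel" "(\<lambda>t. q (of_real t)) \<in> borel_measurable borel"
    unfolding p_def[abs_def] q_def[abs_def]
    by (intro borel_measurable_continuous_onI c holomorphic_intros holomorphic_FT cg \<phi> c1; fail)+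
  ultimately show ?thesis
    using integral_cong_AE[of "\<lambda>t. FT \<alpha> \<beta> g (of_real t) * exp (- (\<i> * of_real t * of_real x)) * \<phi> (of_real t)" lborel
        "\<lambda>t. (p (of_real t) - q (of_real t)) / (\<i> * of_real t)"] eq by simp
qed

lemma norm_exp_half_plane:
  "cmod (exp (- (\<i> * z * of_real x))) = exp (Im z * x)"
  by simp

lemma decay_from_bounds:
  fixes y :: complex
  assumes "cmod y \<le> A" "\<bar>t\<bar> * cmod y \<le> B"
  shows "cmod y \<le> (A + B) / (1 + \<bar>t\<bar>)"
  using assms by (simp add: pos_le_divide_eq algebra_simps)

text \<open>On \<open>[x; \<beta>]\<close> the exponential with phase \<open>t - x \<ge> 0\<close>
  is bounded above the axis, on \<open>[\<alpha>; x]\<close> the one with phase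
  \<open>t - x \<le> 0\<close> below it. The decay on the real line comes from one more integration
  by parts, which is where the second derivative enters.\<close>

lemma FT_inversion:
  fixes G :: "nat \<Rightarrow> real \<Rightarrow> complex"
  assumes x: "\<alpha> \<le> x" "x \<le> \<beta>" and der: "\<And>j t. \<alpha> \<le> t \<Longrightarrow> t \<le> \<beta> \<Longrightarrow> (G j has_vector_derivative G (Suc j) t) (at t)"
    and end0: "\<And>j. G j \<alpha> = 0" "\<And>j. G j \<beta> = 0"
  shows "(LBINT t. FT \<alpha> \<beta> (G 0) (of_real t) * exp (- (\<i> * of_real t * of_real x))) = 2 * of_real pi * G 0 x"
proof -
  have cG: "continuous_on {\<alpha>..\<beta>} (G j)" for j
    by (rule continuous_on_if_vector_derivative, rule der)
  then have cG': "continuous_on {\<alpha>..x} (G j)" "continuous_on {x..\<beta>} (G j)" for j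
    using x by (auto intro: continuous_on_subset[OF cG[of j]])
  have "\<exists>M. \<forall>t\<in>{\<alpha>..\<beta>}. cmod (G j t) \<le> M" for j
    using compact_imp_bounded[OF compact_continuous_image[OF cG[of j] compact_Icc]] by (auto simp: bounded_iff)
  then obtain M1 M2 where M: "\<And>t. \<alpha> \<le> t \<Longrightarrow> t \<le> \<beta> \<Longrightarrow> cmod (G (Suc 0) t) \<le> M1"
      "\<And>t. \<alpha> \<le> t \<Longrightarrow> t \<le> \<beta> \<Longrightarrow> cmod (G (Suc (Suc 0)) t) \<le> M2" by (meson atLeastAtMost_iff)
  have M0: "0 \<le> M1" "0 \<le> M2" using M[of x] x norm_ge_zero order_trans by blast+
  have pos: "cmod (FT x \<beta> (G (Suc 0)) z * exp (- (\<i> * z * of_real x)) * 1) \<le> M1 * (\<beta> - \<alpha>)" if z: "0 \<le> Im z" for z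
  proof -
    have "cmod (FT x \<beta> (G (Suc 0)) z) \<le> M1 * exp (- (Im z * x)) * (\<beta> - x)"
      by (rule norm_FT_le) (use cG' x M z in \<open>auto intro: mult_left_mono\<close>)
    then have "cmod (FT x \<beta> (G (Suc 0)) z) * exp (Im z * x) \<le> M1 * exp (- (Im z * x)) * (\<beta> - x) * exp (Im z * x)"
      by (intro mult_right_mono) auto
    also have "\<dots> = M1 * (\<beta> - x)" by (simp add: mult_ac flip: exp_add)
    also have "\<dots> \<le> M1 * (\<beta> - \<alpha>)" using M0 x by (intro mult_left_mono) auto
    finally show ?thesis by (simp only: norm_mult norm_exp_half_plane norm_one mult_1_right)
  qed
  have neg: "cmod (FT \<alpha> x (G (Suc 0)) z * exp (- (\<i> * z * of_real x)) * 1) \<le> M1 * (\<beta> - \<alpha>)" if z: "Im z \<le> 0" for z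
  proof -
    have "cmod (FT \<alpha> x (G (Suc 0)) z) \<le> M1 * exp (- (Im z * x)) * (x - \<alpha>)"
      by (rule norm_FT_le) (use cG' x M z in \<open>auto intro: mult_left_mono_neg\<close>)
    then have "cmod (FT \<alpha> x (G (Suc 0)) z) * exp (Im z * x) \<le> M1 * exp (- (Im z * x)) * (x - \<alpha>) * exp (Im z * x)"
      by (intro mult_right_mono) auto
    also have "\<dots> = M1 * (x - \<alpha>)" by (simp add: mult_ac flip: exp_add)
    also have "\<dots> \<le> M1 * (\<beta> - \<alpha>)" using M0 x by (intro mult_left_mono) auto
    finally show ?thesis by (simp only: norm_mult norm_exp_half_plane norm_one mult_1_right)
  qed
  define C where "C = M1 * (\<beta> - \<alpha>) + (M1 + M2 * (\<beta> - \<alpha>))"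
  have tb: "\<bar>t\<bar> * cmod (FT u v (G (Suc 0)) (of_real t)) \<le> M1 + M2 * (\<beta> - \<alpha>)"
    if uv: "(u = x \<and> v = \<beta>) \<or> (u = \<alpha> \<and> v = x)" for u v t
  proof -
    have uv': "\<alpha> \<le> u" "u \<le> v" "v \<le> \<beta>" using uv x by auto
    then have cuv: "continuous_on {u..v} (G j)" for j by (intro continuous_on_subset[OF cG[of j]]) auto
    have "\<i> * of_real t * FT u v (G (Suc 0)) (of_real t) = G (Suc 0) v * exp (\<i> * of_real t * of_real v)
        - G (Suc 0) u * exp (\<i> * of_real t * of_real u) - FT u v (G (Suc (Suc 0))) (of_real t)"
      by (rule FT_parts) (use uv' der cuv in auto)
    also have "cmod \<dots> \<le> (cmod (G (Suc 0) v) + cmod (G (Suc 0) u)) + M2 * 1 * (v - u)"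
    proof (intro order_trans[OF norm_triangle_ineq4] add_mono)
      show "cmod (FT u v (G (Suc (Suc 0))) (of_real t)) \<le> M2 * 1 * (v - u)"
        by (rule norm_FT_le) (use uv' M cuv in auto)
    qed (auto simp: norm_mult)
    also have "\<dots> \<le> M1 + M2 * (\<beta> - \<alpha>)"
      using uv M[of x] x end0 M0 uv' mult_left_mono[of "v - u" "\<beta> - \<alpha>" M2] by auto
    finally show ?thesis by (simp add: norm_mult)
  qed
  have "(LBINT t. FT \<alpha> \<beta> (G 0) (of_real t) * exp (- (\<i> * of_real t * of_real x)) * 1) = 2 * of_real pi * G 0 x * 1"
  proof (rule FT_inversion_gen[where g' = "G (Suc 0)" and M = "M1 * (\<beta> - \<alpha>)" and C = C])
    show "cmod (FT x \<beta> (G (Suc 0)) (of_real t) * exp (- (\<i> * of_real t * of_real x)) * 1) \<le> C / (1 + \<bar>t\<bar>)" for t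
      unfolding C_def using pos[of "of_real t"] tb[of x \<beta> t] by (intro decay_from_bounds) (auto simp: norm_mult)
    show "cmod (FT \<alpha> x (G (Suc 0)) (of_real t) * exp (- (\<i> * of_real t * of_real x)) * 1) \<le> C / (1 + \<bar>t\<bar>)" for t
      unfolding C_def using neg[of "of_real t"] tb[of \<alpha> x t] by (intro decay_from_bounds) (auto simp: norm_mult)
  qed (use x der cG end0 pos neg in auto)
  then show ?thesis by simp
qed

lemma FT_iterate:
  fixes G :: "nat \<Rightarrow> real \<Rightarrow> complex"
  assumes "\<alpha> \<le> \<beta>" and der: "\<And>j t. \<alpha> \<le> t \<Longrightarrow> t \<le> \<beta> \<Longrightarrow> (G j has_vector_derivative G (Suc j) t) (at t)"
    and end0: "\<And>j. G j \<alpha> = 0" "\<And>j. G j \<beta> = 0"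
  shows "FT \<alpha> \<beta> (G j) \<zeta> = (- \<i> * \<zeta>) ^ j * FT \<alpha> \<beta> (G 0) \<zeta>"
proof (induction j)
  case (Suc j)
  have "continuous_on {\<alpha>..\<beta>} (G (Suc j))"
    by (rule continuous_on_if_vector_derivative, rule der)
  then have "\<i> * \<zeta> * FT \<alpha> \<beta> (G j) \<zeta> = - FT \<alpha> \<beta> (G (Suc j)) \<zeta>"
    using FT_parts[of \<alpha> \<beta> "G j" "G (Suc j)" \<zeta>] assms end0 by simp
  then have "FT \<alpha> \<beta> (G (Suc j)) \<zeta> = - \<i> * \<zeta> * FT \<alpha> \<beta> (G j) \<zeta>" by (simp add: minus_equation_iff)
  then show ?case using Suc by simp
qed simp

text \<open>Integrating by parts \<open>j\<close> times bounds \<open>\<bar>x\<bar> ^ j\<close>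
  times the transform by a multiple of \<open>E q j\<close>, and \<open>E_infimum\<close> selects
  the best \<open>j\<close>. The factor \<open>1 + \<bar>x\<bar>\<close> is the price for integer
  \<open>j\<close>.\<close>

lemma (in weight) FT_decay:
  fixes G :: "nat \<Rightarrow> real \<Rightarrow> complex"
  assumes "\<alpha> \<le> \<beta>" and der: "\<And>j t. \<alpha> \<le> t \<Longrightarrow> t \<le> \<beta> \<Longrightarrow> (G j has_vector_derivative G (Suc j) t) (at t)"
    and end0: "\<And>j. G j \<alpha> = 0" "\<And>j. G j \<beta> = 0"
    and q: "0 < q" "q \<le> 1" and bd: "\<And>j t. \<alpha> \<le> t \<Longrightarrow> t \<le> \<beta> \<Longrightarrow> cmod (G j t) \<le> N * E q j"
  shows "cmod (FT \<alpha> \<beta> (G 0) (of_real x)) \<le> N * (exp (\<omega> 1) * (\<beta> - \<alpha>)) * (1 + \<bar>x\<bar>) * exp (- q * \<omega> \<bar>x\<bar>)"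
proof -
  have "0 \<le> N * E q 0" using bd[of \<alpha> 0] assms(1) norm_ge_zero order_trans by blast
  then have N: "0 \<le> N" using E_pos(1)[of q 0] by (auto simp: zero_le_mult_iff dest: leD)
  have c: "continuous_on {\<alpha>..\<beta>} (G j)" for j
    by (rule continuous_on_if_vector_derivative, rule der)
  have j: "\<bar>x\<bar> ^ j * cmod (FT \<alpha> \<beta> (G 0) (of_real x)) \<le> N * (\<beta> - \<alpha>) * E q j" for j
  proof -
    have "cmod (FT \<alpha> \<beta> (G j) (of_real x)) \<le> N * E q j * 1 * (\<beta> - \<alpha>)"
      by (rule norm_FT_le) (use c assms in auto)
    then show ?thesis
      using FT_iterate[of \<alpha> \<beta> G j "of_real x"] assms(1) der end0 by (simp add: norm_mult norm_power mult_ac)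
  qed
  have e1: "1 \<le> exp (\<omega> 1)" using nonneg[of 1] by simp
  have n0: "0 \<le> N * (\<beta> - \<alpha>)" using N assms(1) by simp
  show ?thesis
  proof (cases "1 \<le> \<bar>x\<bar>")
    case True
    obtain j where E: "E q j \<le> \<bar>x\<bar> ^ Suc j * exp (- q * \<omega> \<bar>x\<bar>)" using E_infimum[OF q(1) True] by blast
    have "\<bar>x\<bar> ^ j * cmod (FT \<alpha> \<beta> (G 0) (of_real x)) \<le> N * (\<beta> - \<alpha>) * (\<bar>x\<bar> ^ Suc j * exp (- q * \<omega> \<bar>x\<bar>))"
      using j[of j] mult_left_mono[OF E n0] by linarith
    also have "\<dots> = \<bar>x\<bar> ^ j * (N * (\<beta> - \<alpha>) * \<bar>x\<bar> * exp (- q * \<omega> \<bar>x\<bar>))" by simp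
    finally have "cmod (FT \<alpha> \<beta> (G 0) (of_real x)) \<le> (N * (\<beta> - \<alpha>)) * \<bar>x\<bar> * exp (- q * \<omega> \<bar>x\<bar>)"
      using True by (simp add: mult_le_cancel_left_pos)
    also have "\<dots> \<le> (N * (\<beta> - \<alpha>) * exp (\<omega> 1)) * (1 + \<bar>x\<bar>) * exp (- q * \<omega> \<bar>x\<bar>)"
    proof (intro mult_right_mono[of "N * (\<beta> - \<alpha>) * \<bar>x\<bar>"] mult_mono[of "N * (\<beta> - \<alpha>)"])
      show "N * (\<beta> - \<alpha>) \<le> N * (\<beta> - \<alpha>) * exp (\<omega> 1)" using mult_left_mono[OF e1 n0] by simp
    qed (use n0 in auto)
    finally show ?thesis by (simp add: mult_ac)
  next
    case False
    have "E q 0 \<le> 1" using q nonneg by (intro E_least) auto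
    then have "cmod (FT \<alpha> \<beta> (G 0) (of_real x)) \<le> N * (\<beta> - \<alpha>)"
      using j[of 0] mult_left_mono[OF \<open>E q 0 \<le> 1\<close> n0] by simp
    also have "\<dots> \<le> N * (\<beta> - \<alpha>) * ((1 + \<bar>x\<bar>) * (exp (\<omega> 1) * exp (- q * \<omega> \<bar>x\<bar>)))"
    proof -
      have "q * \<omega> \<bar>x\<bar> \<le> 1 * \<omega> 1" using False q nonneg by (intro mult_mono omega_mono) auto
      then have "1 \<le> exp (\<omega> 1) * exp (- q * \<omega> \<bar>x\<bar>)" by (simp flip: exp_add)
      then have "1 * 1 \<le> (1 + \<bar>x\<bar>) * (exp (\<omega> 1) * exp (- q * \<omega> \<bar>x\<bar>))" by (intro mult_mono) auto
      then show ?thesis using mult_left_mono[OF _ n0] by fastforce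
    qed
    finally show ?thesis by (simp add: mult_ac)
  qed
qed

section \<open>Representation of functionals\<close>

context ultra_data
begin

text \<open>Continuity is encoded by one seminorm bound, and nothing is required off
  \<open>U\<close>, so that combinations and transposes need no restriction.
  \<open>U_dual_iff\<close> adds extensionality to obtain the dual.\<close>

definition functional :: "((real \<Rightarrow> complex) \<Rightarrow> complex) \<Rightarrow> bool" where
  "functional S \<longleftrightarrow> (\<forall>f\<in>U. \<forall>g\<in>U. S (f + g) = S f + S g) \<and> (\<forall>b. \<forall>f\<in>U. S (cscale b f) = b * S f) \<and>
     (\<exists>q k K. 0 < q \<and> q < 1 \<and> 0 < K \<and> (\<forall>f\<in>U. cmod (S f) \<le> K * nrm q k f))"

lemma functional_linear:
  assumes "functional S" "f \<in> U" "g \<in> U"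
  shows "S (f + g) = S f + S g" "S (cscale b f) = b * S f" "S (f - g) = S f - S g"
proof -
  show a: "S (f + g) = S f + S g" and s: "S (cscale b f) = b * S f"
    using assms by (auto simp: functional_def)
  have "f - g = f + cscale (- 1) g" by (auto simp: cscale_def fun_eq_iff)
  moreover have "S (f + cscale (- 1) g) = S f + S (cscale (- 1) g)"
    using assms(1,2) U_cscale(1)[OF assms(3)] unfolding functional_def by blast
  moreover have "S (cscale (- 1) g) = - 1 * S g"
    using assms(1,3) unfolding functional_def by blast
  ultimately show "S (f - g) = S f - S g" by simp
qed

lemma functional_bound:
  assumes "functional S"
  obtains q k K where "0 < q" "q < 1" "0 < K" "\<And>f. f \<in> U \<Longrightarrow> cmod (S f) \<le> K * nrm q k f"
  using assms unfolding functional_def by blast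

lemma functional_zero: "functional S \<Longrightarrow> S 0 = 0"
  using functional_linear(3)[OF _ U_zero(1) U_zero(1)] by simp

section \<open>Superpositions of exponentials under a functional\<close>

definition admissible :: "(real \<Rightarrow> complex) \<Rightarrow> bool" where
  "admissible m \<longleftrightarrow> m \<in> borel_measurable borel \<and>
     (\<forall>q. 0 < q \<longrightarrow> q < 1 \<longrightarrow> (\<exists>A. \<forall>x. cmod (m x) \<le> A * (1 + \<bar>x\<bar>) * exp (- q * \<omega> \<bar>x\<bar>)))"

text \<open>The superposition of the exponentials \<open>efun x\<close> with density
  \<open>m\<close>. The decay demanded by \<open>admissible\<close>, for every \<open>q < 1\<close>
  and with the factor \<open>1 + \<bar>x\<bar>\<close>, is the one that \<open>FT_decay\<close>
  provides for cut-off functions.\<close>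

definition synth :: "(real \<Rightarrow> complex) \<Rightarrow> real \<Rightarrow> complex" where
  "synth m = zero_ext a (\<lambda>t. LBINT x. m x * exp (- \<i> * of_real x * of_real t))"

lemma omega_measurable: "(\<lambda>x. \<omega> \<bar>x\<bar>) \<in> borel_measurable borel"
  by (intro borel_measurable_continuous_onI continuous_on_compose2[OF cont]) (auto intro: continuous_intros)

lemma admissible_decay:
  assumes "admissible m" "q < 1"
  obtains A where "0 \<le> A" "\<And>x. \<bar>x\<bar> ^ j * cmod (m x) * exp (q * \<omega> \<bar>x\<bar>) \<le> A / (1 + x\<^sup>2)"
proof -
  \<comment> \<open>The lemma is also used with \<open>q = 0\<close>; \<open>max q 0\<close> keeps
    \<open>p\<close> positive.\<close>
  define p where "p = (max q 0 + 1) / 2"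
  have p: "0 < p" "p < 1" "q < p" using assms by (auto simp: p_def)
  obtain A where A: "\<And>x. cmod (m x) \<le> A * (1 + \<bar>x\<bar>) * exp (- p * \<omega> \<bar>x\<bar>)"
    using assms p unfolding admissible_def by blast
  have "0 \<le> A * (1 + \<bar>0\<bar>) * exp (- p * \<omega> \<bar>0\<bar>)" using A[of 0] norm_ge_zero order_trans by blast
  then have A0: "0 \<le> A" by (simp add: zero_le_mult_iff)
  obtain C where C: "0 < C" "\<And>x. 0 \<le> x \<Longrightarrow> (1 + x) ^ (j + 3) * exp (- (p - q) * \<omega> x) \<le> C"
    using power_exp_omega_bounded[of "p - q" "j + 3"] p by auto
  have "\<bar>x\<bar> ^ j * cmod (m x) * exp (q * \<omega> \<bar>x\<bar>) \<le> (A * C) / (1 + x\<^sup>2)" for x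
  proof -
    have "\<bar>x\<bar> ^ j * cmod (m x) * exp (q * \<omega> \<bar>x\<bar>) \<le>
        (1 + \<bar>x\<bar>) ^ j * (A * (1 + \<bar>x\<bar>) * exp (- p * \<omega> \<bar>x\<bar>)) * exp (q * \<omega> \<bar>x\<bar>)"
      using A0 by (intro mult_right_mono mult_mono power_mono A) auto
    also have "\<dots> = A * ((1 + \<bar>x\<bar>) ^ (j + 1) * exp (- (p - q) * \<omega> \<bar>x\<bar>))"
      by (simp add: algebra_simps flip: exp_add)
    finally have 1: "\<bar>x\<bar> ^ j * cmod (m x) * exp (q * \<omega> \<bar>x\<bar>) \<le> A * ((1 + \<bar>x\<bar>) ^ (j + 1) * exp (- (p - q) * \<omega> \<bar>x\<bar>))" .
    have "1 + x\<^sup>2 \<le> (1 + \<bar>x\<bar>)\<^sup>2" by (simp add: power2_sum)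
    then have "((1 + \<bar>x\<bar>) ^ (j + 1) * exp (- (p - q) * \<omega> \<bar>x\<bar>)) * (1 + x\<^sup>2) \<le>
      ((1 + \<bar>x\<bar>) ^ (j + 1) * exp (- (p - q) * \<omega> \<bar>x\<bar>)) * (1 + \<bar>x\<bar>)\<^sup>2"
      by (intro mult_left_mono) auto
    also have "\<dots> = (1 + \<bar>x\<bar>) ^ (j + 3) * exp (- (p - q) * \<omega> \<bar>x\<bar>)"
      by (simp add: power_add power2_eq_square power3_eq_cube)
    also have "\<dots> \<le> C" by (rule C) simp
    finally have "(1 + \<bar>x\<bar>) ^ (j + 1) * exp (- (p - q) * \<omega> \<bar>x\<bar>) \<le> C / (1 + x\<^sup>2)"
      by (simp add: pos_le_divide_eq add_pos_nonneg)
    then have "A * ((1 + \<bar>x\<bar>) ^ (j + 1) * exp (- (p - q) * \<omega> \<bar>x\<bar>)) \<le> A * (C / (1 + x\<^sup>2))"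
      using A0 by (intro mult_left_mono)
    then show ?thesis using 1 by simp
  qed
  then show thesis using that[of "A * C"] A0 C by simp
qed

lemma admissible_integrable:
  assumes "admissible m" "q < 1"
  shows "integrable lborel (\<lambda>x. cmod (m x) * exp (q * \<omega> \<bar>x\<bar>))"
    "u \<in> borel_measurable borel \<Longrightarrow> (\<And>x. cmod (u x) \<le> K * \<bar>x\<bar> ^ j * exp (q * \<omega> \<bar>x\<bar>)) \<Longrightarrow> integrable lborel (\<lambda>x. m x * u x)"
proof -
  have m[measurable]: "m \<in> borel_measurable borel" using assms by (simp add: admissible_def)
  obtain A where A: "0 \<le> A" "\<And>x. \<bar>x\<bar> ^ 0 * cmod (m x) * exp (q * \<omega> \<bar>x\<bar>) \<le> A / (1 + x\<^sup>2)"
    using admissible_decay[OF assms, of 0] by blast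
  have "integrable lborel (\<lambda>x. complex_of_real (cmod (m x) * exp (q * \<omega> \<bar>x\<bar>)))"
  proof (rule integrable_bound_1_plus_square[where C = A])
    show "(\<lambda>x. complex_of_real (cmod (m x) * exp (q * \<omega> \<bar>x\<bar>))) \<in> borel_measurable lborel"
      using omega_measurable by measurable
    show "cmod (complex_of_real (cmod (m x) * exp (q * \<omega> \<bar>x\<bar>))) \<le> A / (1 + x\<^sup>2)" for x
      using A(2)[of x] by (simp add: norm_mult)
  qed
  then show "integrable lborel (\<lambda>x. cmod (m x) * exp (q * \<omega> \<bar>x\<bar>))"
    by (simp only: complex_of_real_integrable_eq)
  assume u[measurable]: "u \<in> borel_measurable borel" and ub: "\<And>x. cmod (u x) \<le> K * \<bar>x\<bar> ^ j * exp (q * \<omega> \<bar>x\<bar>)"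
  obtain B where B: "0 \<le> B" "\<And>x. \<bar>x\<bar> ^ j * cmod (m x) * exp (q * \<omega> \<bar>x\<bar>) \<le> B / (1 + x\<^sup>2)"
    using admissible_decay[OF assms, of j] by blast
  have "0 \<le> K * \<bar>1\<bar> ^ j * exp (q * \<omega> \<bar>1\<bar>)" using ub[of 1] norm_ge_zero order_trans by blast
  then have K: "0 \<le> K" by (simp add: zero_le_mult_iff)
  show "integrable lborel (\<lambda>x. m x * u x)"
  proof (rule integrable_bound_1_plus_square[where C = "K * B"])
    fix x :: real
    have "cmod (m x * u x) \<le> cmod (m x) * (K * \<bar>x\<bar> ^ j * exp (q * \<omega> \<bar>x\<bar>))"
      unfolding norm_mult by (intro mult_left_mono ub) auto
    also have "\<dots> = K * (\<bar>x\<bar> ^ j * cmod (m x) * exp (q * \<omega> \<bar>x\<bar>))" by (simp add: mult_ac)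
    also have "\<dots> \<le> K * (B / (1 + x\<^sup>2))" using K by (intro mult_left_mono B)
    finally show "cmod (m x * u x) \<le> K * B / (1 + x\<^sup>2)" by simp
  qed simp
qed

definition ker :: "nat \<Rightarrow> real \<Rightarrow> real \<Rightarrow> complex" where
  "ker j t x = (- \<i> * of_real x) ^ j * exp (- \<i> * of_real x * of_real t)"

lemma norm_ker: "cmod (ker j t x) = \<bar>x\<bar> ^ j"
  by (simp add: ker_def norm_mult norm_power)

lemma measurable_ker: "ker j t \<in> borel_measurable borel"
  unfolding ker_def[abs_def] by measurable

lemma norm_ker_le:
  assumes "0 < q" "q \<le> 1"
  shows "cmod (ker j t x) \<le> exp (\<omega> 1) * exp (q * \<omega> \<bar>x\<bar>) * E q j"
  using efun_bound[OF assms, of 0 0 "of_real x" j] by (simp add: norm_ker norm_mult norm_power)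

lemma ker_integrable:
  assumes "admissible m"
  shows "integrable lborel (\<lambda>x. m x * ker j t x)"
  by (rule admissible_integrable(2)[OF assms, of 0 _ 1 j]) (auto simp: norm_ker measurable_ker)

lemma D_efun_real: "t \<in> I \<Longrightarrow> D j (efun (of_real x)) t = ker j t x"
  by (simp add: D_efun ker_def mult_ac)

lemma synth_deriv:
  assumes "admissible m"
  shows "((\<lambda>t. LBINT x. m x * ker j t x) has_vector_derivative (LBINT x. m x * ker (Suc j) t x)) (at t)"
proof -
  have i: "integrable lborel (\<lambda>x. m x * (of_real x ^ n * (- \<i> * of_real x) ^ j))" for n
    by (rule admissible_integrable(2)[OF assms, of 0 _ 1 "n + j"])
      (auto simp: norm_mult norm_power power_add)
  have "((\<lambda>t. LBINT x. (m x * (- \<i> * of_real x) ^ j) * exp (- \<i> * of_real x * of_real t)) has_vector_derivative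
     (LBINT x. (- \<i> * of_real x * (m x * (- \<i> * of_real x) ^ j)) * exp (- \<i> * of_real x * of_real t))) (at t)"
    by (rule has_vector_derivative_fourier_integral) (use i[of 0] i[of 1] i[of 2] in \<open>simp_all add: mult_ac\<close>)
  then show ?thesis unfolding ker_def by (simp only: power_Suc mult_ac)
qed

lemma synth_bound:
  assumes m: "admissible m" and q: "0 < q" "q < 1"
  shows "cmod (LBINT x. m x * ker j t x) \<le> exp (\<omega> 1) * (LBINT x. cmod (m x) * exp (q * \<omega> \<bar>x\<bar>)) * E q j"
proof -
  have "cmod (LBINT x. m x * ker j t x) \<le> (LBINT x. (exp (\<omega> 1) * E q j) * (cmod (m x) * exp (q * \<omega> \<bar>x\<bar>)))"
  proof (rule Bochner_Integration.integral_norm_bound_integral)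
    show "integrable lborel (\<lambda>x. (exp (\<omega> 1) * E q j) * (cmod (m x) * exp (q * \<omega> \<bar>x\<bar>)))"
      using admissible_integrable(1)[OF m q(2)] by (rule integrable_mult_right)
    fix x
    have "cmod (m x * ker j t x) \<le> cmod (m x) * (exp (\<omega> 1) * exp (q * \<omega> \<bar>x\<bar>) * E q j)"
      unfolding norm_mult by (intro mult_left_mono norm_ker_le) (use q in auto)
    then show "cmod (m x * ker j t x) \<le> (exp (\<omega> 1) * E q j) * (cmod (m x) * exp (q * \<omega> \<bar>x\<bar>))"
      by (simp only: mult_ac)
  qed (rule ker_integrable[OF m])
  then show ?thesis unfolding integral_mult_right_zero by (simp only: mult_ac)
qed

lemma synth_U:
  assumes m: "admissible m"
  shows "synth m \<in> U" "D j (synth m) = zero_ext a (\<lambda>t. LBINT x. m x * ker j t x)"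
proof -
  define F where "F j t = (LBINT x. m x * ker j t x)" for j t
  have 1: "(F j has_vector_derivative F (Suc j) x) (at x)" for j x
    unfolding F_def[abs_def] by (rule synth_deriv[OF m])
  have 2: "\<exists>M. \<forall>j x. \<bar>x\<bar> \<le> c k \<longrightarrow> cmod (F j x) \<le> M * E q j" if "0 < q" "q < 1" for q k
    unfolding F_def using synth_bound[OF m that] by blast
  have "zero_ext a (F 0) \<in> U" "D j (zero_ext a (F 0)) = zero_ext a (F j)" for j
    by (rule U_zero_ext, rule 1, erule (1) 2)+
  moreover have "zero_ext a (F 0) = synth m" by (simp add: synth_def F_def[abs_def] ker_def)
  ultimately show "synth m \<in> U" "D j (synth m) = zero_ext a (\<lambda>t. LBINT x. m x * ker j t x)"
    by (simp_all add: F_def[abs_def])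
qed

lemma nrm_synth:
  assumes m: "admissible m" and q: "0 < q" "q < 1"
  shows "nrm q k (synth m) \<le> exp (\<omega> 1) * (LBINT x. cmod (m x) * exp (q * \<omega> \<bar>x\<bar>))"
  by (rule nrm_least[OF synth_U(1)[OF m] q]) (use synth_U(2)[OF m] c_in_I synth_bound[OF m q] in simp)

lemma synth_add:
  assumes "admissible m" "admissible n"
  shows "synth (\<lambda>x. m x + n x) = synth m + synth n"
proof
  fix t
  have "(LBINT x. (m x + n x) * ker 0 t x) = (LBINT x. m x * ker 0 t x) + (LBINT x. n x * ker 0 t x)"
    unfolding distrib_right by (intro Bochner_Integration.integral_add ker_integrable assms)
  then show "synth (\<lambda>x. m x + n x) t = (synth m + synth n) t"
    by (simp add: synth_def zero_ext_def ker_def)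
qed

lemma admissible_bound:
  assumes "admissible m" "n \<in> borel_measurable borel" "\<And>x. cmod (n x) \<le> cmod (m x)"
  shows "admissible n"
  unfolding admissible_def
proof (intro conjI allI impI)
  fix q :: real assume "0 < q" "q < 1"
  then obtain A where "\<And>x. cmod (m x) \<le> A * (1 + \<bar>x\<bar>) * exp (- q * \<omega> \<bar>x\<bar>)"
    using assms(1) unfolding admissible_def by blast
  then show "\<exists>A. \<forall>x. cmod (n x) \<le> A * (1 + \<bar>x\<bar>) * exp (- q * \<omega> \<bar>x\<bar>)"
    using assms(3) order_trans by blast
qed (rule assms(2))

text \<open>Uniform in \<open>j\<close> relative to \<open>E q j\<close>: the factor
  \<open>j\<close> from differentiating the power is absorbed by enlarging \<open>N\<close> to
  \<open>N + 1\<close>.\<close>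

lemma ker_Lipschitz:
  assumes "0 < q" "q \<le> 1" "\<bar>t\<bar> \<le> R" "\<bar>x\<bar> \<le> N" "\<bar>y\<bar> \<le> N"
  shows "cmod (ker j t x - ker j t y) \<le> (1 + R) * (exp (\<omega> 1) * exp (q * \<omega> (N + 1))) * E q j * \<bar>x - y\<bar>"
proof -
  have N: "0 \<le> N" "0 \<le> R" using assms by auto
  define f where "f w = (- \<i> * w) ^ j * exp (- \<i> * w * of_real t)" for w
  define f' where "f' w = (of_nat j * (- \<i> * w) ^ (j - 1) * (- \<i>) + (- \<i> * w) ^ j * (- \<i> * of_real t)) * exp (- \<i> * w * of_real t)" for w
  have e: "(N + 1) ^ j \<le> exp (\<omega> 1) * exp (q * \<omega> (N + 1)) * E q j"
    using efun_bound[OF assms(1,2), of 0 0 "of_real (N + 1)" j] N by (simp add: norm_mult norm_power)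
  have jN: "real j * N ^ (j - 1) \<le> (N + 1) ^ j"
  proof (cases j)
    case (Suc i)
    have "real (Suc i) * N ^ i \<le> (N + 1) ^ Suc i"
    proof (induction i)
      case (Suc i)
      have "real (Suc (Suc i)) * N ^ Suc i = N * (real (Suc i) * N ^ i) + N ^ Suc i"
        by (simp add: algebra_simps)
      also have "\<dots> \<le> N * (N + 1) ^ Suc i + (N + 1) ^ Suc i"
        using N Suc by (intro add_mono mult_left_mono power_mono) auto
      finally show ?case by (simp add: algebra_simps)
    qed (use N in simp)
    then show ?thesis using Suc by simp
  qed (use N in simp)
  have "cmod (f (of_real x) - f (of_real y)) \<le> ((1 + R) * (N + 1) ^ j) * cmod (of_real x - of_real y)"
  proof (rule field_differentiable_bound[OF convex_closed_segment[of "of_real x" "of_real y"], where f' = f'])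
    fix w :: complex assume w: "w \<in> closed_segment (of_real x) (of_real y)"
    show "(f has_field_derivative f' w) (at w within closed_segment (of_real x) (of_real y))"
      unfolding f_def[abs_def] f'_def by (auto intro!: derivative_eq_intros simp: algebra_simps)
    obtain v where v: "w = of_real v" "v \<in> closed_segment x y"
      using w closed_segment_of_real[of x y] by auto
    then have vN: "\<bar>v\<bar> \<le> N" using assms by (auto simp: closed_segment_eq_real_ivl split: if_splits)
    have "cmod (f' w) = cmod (of_nat j * (- \<i> * w) ^ (j - 1) * (- \<i>) + (- \<i> * w) ^ j * (- \<i> * of_real t))"
      by (simp add: f'_def norm_mult v)
    also have "\<dots> \<le> real j * \<bar>v\<bar> ^ (j - 1) + \<bar>v\<bar> ^ j * \<bar>t\<bar>"
      by (rule order_trans[OF norm_triangle_ineq]) (simp add: norm_mult norm_power v)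
    also have "\<dots> \<le> real j * N ^ (j - 1) + (N + 1) ^ j * R"
      using vN N assms by (intro add_mono mult_mono power_mono) auto
    also have "\<dots> \<le> (1 + R) * (N + 1) ^ j" using jN by (simp add: algebra_simps)
    finally show "cmod (f' w) \<le> (1 + R) * (N + 1) ^ j" .
  qed auto
  also have "cmod (of_real x - of_real y) = \<bar>x - y\<bar>" by (metis norm_of_real of_real_diff)
  also have "((1 + R) * (N + 1) ^ j) * \<bar>x - y\<bar> \<le> ((1 + R) * (exp (\<omega> 1) * exp (q * \<omega> (N + 1)) * E q j)) * \<bar>x - y\<bar>"
    using N e by (intro mult_right_mono mult_left_mono) auto
  finally show ?thesis by (simp add: f_def ker_def mult.assoc)
qed

text \<open>The defect \<open>T m\<close> of the interchange of \<open>S\<close> with the integral is additive in the density \<open>m\<close> and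
  quadratically small on short intervals, so it vanishes.\<close>

lemma functional_synth:
  assumes S: "functional S" and h: "admissible h"
  shows "S (synth h) = (LBINT x. h x * S (efun (of_real x)))"
    "integrable lborel (\<lambda>x. h x * S (efun (of_real x)))"
proof -
  obtain q k K where q: "0 < q" "q < 1" and K: "0 < K" "\<And>f. f \<in> U \<Longrightarrow> cmod (S f) \<le> K * nrm q k f"
    by (rule functional_bound[OF S]) (rule that)
  define \<phi> where "\<phi> x = S (efun (of_real x))" for x :: real
  have lip: "cmod (\<phi> x - \<phi> y) \<le> K * ((1 + c k) * (exp (\<omega> 1) * exp (q * \<omega> (N + 1))) * \<bar>x - y\<bar>)"
    if "\<bar>x\<bar> \<le> N" "\<bar>y\<bar> \<le> N" for x y N
  proof -
    have "nrm q k (efun (of_real x) - efun (of_real y)) \<le> (1 + c k) * (exp (\<omega> 1) * exp (q * \<omega> (N + 1))) * \<bar>x - y\<bar>"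
    proof (rule nrm_least[OF U_diff(1)[OF efun_U efun_U] q])
      fix j t assume t: "\<bar>t\<bar> \<le> c k"
      have e: "D j (efun (of_real x) - efun (of_real y)) t = ker j t x - ker j t y"
        using c_in_I[OF t] by (simp only: U_diff(2)[OF efun_U efun_U] D_efun_real)
      have "cmod (ker j t x - ker j t y) \<le> (1 + c k) * (exp (\<omega> 1) * exp (q * \<omega> (N + 1))) * E q j * \<bar>x - y\<bar>"
        by (rule ker_Lipschitz) (use q t that in auto)
      then show "cmod (D j (efun (of_real x) - efun (of_real y)) t) \<le>
          (1 + c k) * (exp (\<omega> 1) * exp (q * \<omega> (N + 1))) * \<bar>x - y\<bar> * E q j"
        unfolding e by (simp only: mult_ac)
    qed
    then have "K * nrm q k (efun (of_real x) - efun (of_real y)) \<le> K * ((1 + c k) * (exp (\<omega> 1) * exp (q * \<omega> (N + 1))) * \<bar>x - y\<bar>)"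
      using K by (intro mult_left_mono) auto
    moreover have "\<phi> x - \<phi> y = S (efun (of_real x) - efun (of_real y))"
      unfolding \<phi>_def by (rule functional_linear(3)[OF S efun_U efun_U, symmetric])
    ultimately show ?thesis
      using K(2)[OF U_diff(1)[OF efun_U efun_U], of "of_real x" "of_real y"] by (simp only:)
  qed
  have "isCont \<phi> x" for x
    unfolding isCont_def
  proof (rule LIM_zero_cancel, rule Lim_null_comparison)
    define M where "M = K * ((1 + c k) * (exp (\<omega> 1) * exp (q * \<omega> (\<bar>x\<bar> + 1 + 1))))"
    have "eventually (\<lambda>y. dist y x < 1) (at x)" unfolding eventually_at by (rule exI[of _ 1]) auto
    then show "eventually (\<lambda>y. norm (\<phi> y - \<phi> x) \<le> M * \<bar>y - x\<bar>) (at x)"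
    proof eventually_elim
      case (elim y)
      then have "\<bar>y\<bar> \<le> \<bar>x\<bar> + 1" by (simp add: dist_real_def)
      then show ?case using lip[of y "\<bar>x\<bar> + 1" x] unfolding M_def by (simp only: mult_ac)
    qed
    show "((\<lambda>y. M * \<bar>y - x\<bar>) \<longlongrightarrow> 0) (at x)" by (rule tendsto_eq_intros | simp)+
  qed
  then have "continuous_on UNIV \<phi>" by (simp add: continuous_at_imp_continuous_on)
  then have \<phi>m[measurable]: "\<phi> \<in> borel_measurable borel" by (rule borel_measurable_continuous_onI)
  have \<phi>b: "cmod (\<phi> x) \<le> (K * exp (\<omega> 1)) * \<bar>x\<bar> ^ 0 * exp (q * \<omega> \<bar>x\<bar>)" for x
  proof -
    have "cmod (\<phi> x) \<le> K * nrm q k (efun (of_real x))" unfolding \<phi>_def by (rule K(2)[OF efun_U])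
    also have "\<dots> \<le> K * (exp (\<omega> 1) * exp (q * \<omega> \<bar>x\<bar>))"
      using nrm_efun[OF q, of k "of_real x"] K by (intro mult_left_mono) auto
    finally show ?thesis by simp
  qed
  have int\<phi>: "integrable lborel (\<lambda>x. m x * \<phi> x)" if "admissible m" for m
    by (rule admissible_integrable(2)[OF that q(2) \<phi>m \<phi>b])
  then show "integrable lborel (\<lambda>x. h x * S (efun (of_real x)))" using h by (simp add: \<phi>_def)
  define T where "T m = S (synth m) - (LBINT x. m x * \<phi> x)" for m
  have Tadd: "T (\<lambda>x. m x + n x) = T m + T n" if "admissible m" "admissible n" for m n
    unfolding T_def using that int\<phi> synth_U(1) functional_linear(1)[OF S]
    by (simp add: synth_add distrib_right)
  have Tle: "cmod (T m) \<le> 2 * K * exp (\<omega> 1) * (LBINT x. cmod (m x) * exp (q * \<omega> \<bar>x\<bar>))" if m: "admissible m" for m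
  proof -
    have "cmod (S (synth m)) \<le> K * nrm q k (synth m)" by (rule K(2)[OF synth_U(1)[OF m]])
    also have "\<dots> \<le> K * (exp (\<omega> 1) * (LBINT x. cmod (m x) * exp (q * \<omega> \<bar>x\<bar>)))"
      using K by (intro mult_left_mono nrm_synth m q) auto
    finally have 1: "cmod (S (synth m)) \<le> K * exp (\<omega> 1) * (LBINT x. cmod (m x) * exp (q * \<omega> \<bar>x\<bar>))" by simp
    have "cmod (LBINT x. m x * \<phi> x) \<le> (LBINT x. (K * exp (\<omega> 1)) * (cmod (m x) * exp (q * \<omega> \<bar>x\<bar>)))"
    proof (rule Bochner_Integration.integral_norm_bound_integral[OF int\<phi>[OF m]])
      show "integrable lborel (\<lambda>x. (K * exp (\<omega> 1)) * (cmod (m x) * exp (q * \<omega> \<bar>x\<bar>)))"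
        using admissible_integrable(1)[OF m q(2)] by (rule integrable_mult_right)
      show "cmod (m x * \<phi> x) \<le> (K * exp (\<omega> 1)) * (cmod (m x) * exp (q * \<omega> \<bar>x\<bar>))" for x
        using mult_left_mono[OF \<phi>b[of x] norm_ge_zero[of "m x"]] by (simp add: norm_mult mult_ac)
    qed
    then have "cmod (LBINT x. m x * \<phi> x) \<le> K * exp (\<omega> 1) * (LBINT x. cmod (m x) * exp (q * \<omega> \<bar>x\<bar>))" by simp
    then show ?thesis unfolding T_def using 1 norm_triangle_ineq4[of "S (synth m)" "LBINT x. m x * \<phi> x"] by linarith
  qed
  have hm[measurable]: "h \<in> borel_measurable borel" using h by (simp add: admissible_def)
  define cut where "cut A x = indicator A x * h x" for A :: "real set" and x
  have cutm[measurable]: "cut A \<in> borel_measurable borel" if "A \<in> sets borel" for A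
    unfolding cut_def[abs_def] using that by measurable
  have cuta: "admissible (cut A)" if "A \<in> sets borel" for A
    by (rule admissible_bound[OF h cutm[OF that]]) (auto simp: cut_def indicator_def)
  obtain H where H: "0 \<le> H" "\<And>x. cmod (h x) \<le> H"
  proof -
    obtain A where A: "0 \<le> A" "\<And>x. \<bar>x\<bar> ^ 0 * cmod (h x) * exp (0 * \<omega> \<bar>x\<bar>) \<le> A / (1 + x\<^sup>2)"
      using admissible_decay[OF h, of 0 0] by auto
    have "A / (1 + x\<^sup>2) \<le> A / 1" for x using A(1) by (intro divide_left_mono) (auto simp: add_pos_nonneg)
    then have "cmod (h x) \<le> A" for x using A(2)[of x] order_trans by fastforce
    then show thesis using that A by blast
  qed
  have short: "cmod (T (cut {R<..R'})) \<le> 2 * (K * ((1 + c k) * (exp (\<omega> 1) * exp (q * \<omega> (N + 1)))) * H) * (R' - R)\<^sup>2"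
    if R: "R \<le> R'" "\<bar>R\<bar> \<le> N" "\<bar>R'\<bar> \<le> N" for R R' N
  proof -
    define L where "L = (1 + c k) * (exp (\<omega> 1) * exp (q * \<omega> (N + 1)))"
    have L0: "0 \<le> L" using c_pos[of k] by (simp add: L_def)
    define m where "m = cut {R<..R'}"
    have m: "admissible m" unfolding m_def by (rule cuta) simp
    have intm: "integrable lborel m"
      using admissible_integrable(2)[OF m, of 0 "\<lambda>_. 1" 1 0] by simp
    have inorm: "integrable lborel (\<lambda>x. L' * (indicator {R<..R'} x :: real))" for L'
      by (intro integrable_mult_right integrable_real_indicator) (use R in auto)
    have vol: "(LBINT x. L' * (indicator {R<..R'} x :: real)) = L' * (R' - R)" for L'
      using R by simp
    have bd: "cmod (LBINT x. m x * (u x - u0)) \<le> A * H * (R' - R)\<^sup>2"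
      if "integrable lborel (\<lambda>x. m x * (u x - u0))" "0 \<le> A" "\<And>x. R < x \<Longrightarrow> x \<le> R' \<Longrightarrow> cmod (u x - u0) \<le> A * \<bar>x - R\<bar>" for u u0 A
    proof -
      have "cmod (LBINT x. m x * (u x - u0)) \<le> (LBINT x. (A * H * (R' - R)) * indicator {R<..R'} x)"
      proof (rule Bochner_Integration.integral_norm_bound_integral[OF that(1) inorm])
        fix x
        show "cmod (m x * (u x - u0)) \<le> (A * H * (R' - R)) * indicator {R<..R'} x"
        proof (cases "x \<in> {R<..R'}")
          case True
          have "cmod (m x * (u x - u0)) \<le> H * (A * \<bar>x - R\<bar>)"
            unfolding norm_mult m_def cut_def using True H that by (intro mult_mono) auto
          also have "\<dots> \<le> H * (A * (R' - R))" using True H that by (intro mult_left_mono) auto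
          finally show ?thesis using True by (simp add: mult_ac)
        qed (simp add: m_def cut_def)
      qed
      then show ?thesis unfolding vol by (simp add: power2_eq_square mult_ac)
    qed
    define \<eta> where "\<eta> = (LBINT x. m x)"
    have su: "synth m - cscale \<eta> (efun (of_real R)) \<in> U"
      by (intro U_diff(1) U_cscale(1) efun_U synth_U(1) m)
    have n: "nrm q k (synth m - cscale \<eta> (efun (of_real R))) \<le> L * H * (R' - R)\<^sup>2"
    proof (rule nrm_least[OF su q])
      fix j t assume t: "\<bar>t\<bar> \<le> c k"
      have i: "integrable lborel (\<lambda>x. m x * ker j t x)" by (rule ker_integrable[OF m])
      have "D j (synth m - cscale \<eta> (efun (of_real R))) t = (LBINT x. m x * ker j t x) - \<eta> * ker j t R"
        using c_in_I[OF t]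
        by (simp only: U_diff(2)[OF synth_U(1)[OF m] U_cscale(1)[OF efun_U]] U_cscale(2)[OF efun_U] D_efun_real
            synth_U(2)[OF m] zero_ext_in)
      also have "\<dots> = (LBINT x. m x * (ker j t x - ker j t R))"
        unfolding right_diff_distrib \<eta>_def
        using Bochner_Integration.integral_diff[OF i integrable_mult_left[OF intm, of "ker j t R"]]
        by (simp only: integral_mult_left_zero)
      also have "cmod \<dots> \<le> (L * E q j) * H * (R' - R)\<^sup>2"
      proof (rule bd)
        show "integrable lborel (\<lambda>x. m x * (ker j t x - ker j t R))"
          unfolding right_diff_distrib by (intro Bochner_Integration.integrable_diff i integrable_mult_left intm)
        fix x assume "R < x" "x \<le> R'"
        then show "cmod (ker j t x - ker j t R) \<le> (L * E q j) * \<bar>x - R\<bar>"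
          unfolding L_def by (intro ker_Lipschitz) (use q t R in auto)
      qed (use L0 in simp)
      finally show "cmod (D j (synth m - cscale \<eta> (efun (of_real R))) t) \<le> L * H * (R' - R)\<^sup>2 * E q j"
        by (simp add: mult_ac)
    qed
    have "T m = S (synth m - cscale \<eta> (efun (of_real R))) - (LBINT x. m x * (\<phi> x - \<phi> R))"
    proof -
      have "(LBINT x. m x * (\<phi> x - \<phi> R)) = (LBINT x. m x * \<phi> x) - \<eta> * \<phi> R"
        unfolding right_diff_distrib \<eta>_def
        using Bochner_Integration.integral_diff[OF int\<phi>[OF m] integrable_mult_left[OF intm, of "\<phi> R"]]
        by (simp only: integral_mult_left_zero)
      moreover have "S (synth m - cscale \<eta> (efun (of_real R))) = S (synth m) - \<eta> * \<phi> R"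
        using functional_linear(3)[OF S synth_U(1)[OF m] U_cscale(1)[OF efun_U]] functional_linear(2)[OF S efun_U efun_U]
        by (simp add: \<phi>_def)
      ultimately show ?thesis by (simp add: T_def)
    qed
    moreover have "cmod (S (synth m - cscale \<eta> (efun (of_real R)))) \<le> K * (L * H * (R' - R)\<^sup>2)"
      using K(2)[OF su] mult_left_mono[OF n, of K] K(1) by linarith
    moreover have "cmod (LBINT x. m x * (\<phi> x - \<phi> R)) \<le> (K * L) * H * (R' - R)\<^sup>2"
    proof (rule bd)
      show "integrable lborel (\<lambda>x. m x * (\<phi> x - \<phi> R))"
        unfolding right_diff_distrib by (intro Bochner_Integration.integrable_diff int\<phi> m integrable_mult_left intm)
      fix x assume "R < x" "x \<le> R'"
      then show "cmod (\<phi> x - \<phi> R) \<le> (K * L) * \<bar>x - R\<bar>"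
        using lip[of x N R] R by (simp add: L_def mult_ac)
    qed (use L0 K in simp)
    ultimately show ?thesis
      unfolding m_def[symmetric] L_def[symmetric]
      using norm_triangle_ineq4[of "S (synth m - cscale \<eta> (efun (of_real R)))" "LBINT x. m x * (\<phi> x - \<phi> R)"]
      by (simp add: mult_ac)
  qed
  \<comment> \<open>\<open>v\<close> is the distribution function of the defect; with quadratically
    small increments it has derivative zero and is constant.\<close>
  define v where "v R = T (cut {..R})" for R
  have vdiff: "v R' - v R = T (cut {R<..R'})" if "R \<le> R'" for R R'
  proof -
    have "cut {..R'} = (\<lambda>x. cut {..R} x + cut {R<..R'} x)"
      using that by (auto simp: cut_def indicator_def fun_eq_iff)
    then have "v R' = v R + T (cut {R<..R'})" unfolding v_def by (simp add: Tadd cuta)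
    then show ?thesis by simp
  qed
  have "(v has_derivative (\<lambda>_. 0)) (at R within UNIV)" for R
  proof -
    define M where "M = 2 * (K * ((1 + c k) * (exp (\<omega> 1) * exp (q * \<omega> ((\<bar>R\<bar> + 1) + 1)))) * H)"
    show ?thesis
    proof (rule has_derivativeI_sandwich[where e = 1 and H = "\<lambda>y. M * \<bar>y - R\<bar>"])
      show "((\<lambda>y. M * \<bar>y - R\<bar>) \<longlongrightarrow> 0) (at R)" by (rule tendsto_eq_intros | simp)+
      fix y assume y: "y \<noteq> R" "dist y R < 1"
      then have ab: "\<bar>y\<bar> \<le> \<bar>R\<bar> + 1" by (simp add: dist_real_def)
      have "cmod (v y - v R) \<le> M * (y - R)\<^sup>2"
      proof (cases "R \<le> y")
        case True
        then show ?thesis unfolding vdiff[OF True] M_def using ab by (intro short) auto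
      next
        case False
        then have "cmod (v R - v y) \<le> M * (R - y)\<^sup>2"
          using vdiff[of y R] ab unfolding M_def by (metis short abs_ge_self le_add_same_cancel1 nle_le zero_le_one)
        then show ?thesis by (simp add: norm_minus_commute power2_commute)
      qed
      then show "norm (v y - v R - 0) / norm (y - R) \<le> M * \<bar>y - R\<bar>"
        using y by (simp add: divide_le_eq power2_eq_square mult.assoc)
    qed auto
  qed
  then obtain v0 where v0: "\<And>R. v R = v0"
    using has_derivative_zero_constant[of UNIV v] by auto
  have W: "integrable lborel (\<lambda>x. cmod (h x) * exp (q * \<omega> \<bar>x\<bar>))" by (rule admissible_integrable(1)[OF h q(2)])
  \<comment> \<open>The defect is also dominated by a weighted mass of the density. This mass tends
    to zero at both ends of the line, which kills first the constant and then the remaining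
    tail.\<close>
  define Z where "Z A = (LBINT x. indicator A x * (cmod (h x) * exp (q * \<omega> \<bar>x\<bar>)))" for A :: "real set"
  have TZ: "cmod (T (cut A)) \<le> 2 * K * exp (\<omega> 1) * Z A" if "A \<in> sets borel" for A
  proof -
    have "cmod (cut A x) = indicator A x * cmod (h x)" for x by (simp add: cut_def indicator_def)
    then show ?thesis using Tle[OF cuta[OF that]] by (simp add: Z_def mult.assoc)
  qed
  have Zlim: "(\<lambda>n. Z (A n)) \<longlonglongrightarrow> 0" if "\<And>n. A n \<in> sets borel" "\<And>x. eventually (\<lambda>n. x \<notin> A n) sequentially" for A :: "nat \<Rightarrow> real set"
  proof -
    have "(\<lambda>n. Z (A n)) \<longlonglongrightarrow> (LBINT x::real. 0)" unfolding Z_def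
    proof (rule integral_dominated_convergence[OF _ _ W])
      show "AE x in lborel. (\<lambda>n. indicator (A n) x * (cmod (h x) * exp (q * \<omega> \<bar>x\<bar>))) \<longlonglongrightarrow> 0"
      proof (intro AE_I2 tendsto_eventually)
        fix x
        show "eventually (\<lambda>n. indicator (A n) x * (cmod (h x) * exp (q * \<omega> \<bar>x\<bar>)) = 0) sequentially"
          using that(2)[of x] by (rule eventually_mono) simp
      qed
      show "AE x in lborel. norm (indicator (A n) x * (cmod (h x) * exp (q * \<omega> \<bar>x\<bar>))) \<le> cmod (h x) * exp (q * \<omega> \<bar>x\<bar>)" for n
        by (auto simp: indicator_def)
      show "(\<lambda>x. indicator (A n) x * (cmod (h x) * exp (q * \<omega> \<bar>x\<bar>))) \<in> borel_measurable lborel" for n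
        using that(1)[of n] omega_measurable by measurable
    qed simp
    then show ?thesis by simp
  qed
  have "(\<lambda>n. Z {..- real n}) \<longlonglongrightarrow> 0"
  proof (rule Zlim)
    fix x :: real
    have "eventually (\<lambda>n. real n > \<bar>x\<bar>) sequentially" by real_asymp
    then show "eventually (\<lambda>n. x \<notin> {..- real n}) sequentially" by eventually_elim auto
  qed simp
  then have "(\<lambda>n. 2 * K * exp (\<omega> 1) * Z {..- real n}) \<longlonglongrightarrow> 2 * K * exp (\<omega> 1) * 0" by (intro tendsto_intros)
  moreover have "cmod v0 \<le> 2 * K * exp (\<omega> 1) * Z {..- real n}" for n
    using TZ[of "{..- real n}"] v0[of "- real n"] by (simp add: v_def)
  ultimately have "cmod v0 \<le> 2 * K * exp (\<omega> 1) * 0" by (intro LIMSEQ_le_const) auto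
  then have v00: "v0 = 0" by simp
  have "(\<lambda>n. Z {real n<..}) \<longlonglongrightarrow> 0"
  proof (rule Zlim)
    fix x :: real
    have "eventually (\<lambda>n. real n > \<bar>x\<bar>) sequentially" by real_asymp
    then show "eventually (\<lambda>n. x \<notin> {real n<..}) sequentially" by eventually_elim auto
  qed simp
  then have "(\<lambda>n. 2 * K * exp (\<omega> 1) * Z {real n<..}) \<longlonglongrightarrow> 2 * K * exp (\<omega> 1) * 0" by (intro tendsto_intros)
  moreover have "cmod (T h) \<le> 2 * K * exp (\<omega> 1) * Z {real n<..}" for n
  proof -
    have "h = (\<lambda>x. cut {..real n} x + cut {real n<..} x)"
      by (auto simp: cut_def indicator_def fun_eq_iff)
    then have "T h = v (real n) + T (cut {real n<..})" unfolding v_def using Tadd[of "cut {..real n}" "cut {real n<..}"] by (simp add: cuta)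
    then show ?thesis using TZ[of "{real n<..}"] v0 v00 by simp
  qed
  ultimately have "cmod (T h) \<le> 2 * K * exp (\<omega> 1) * 0" by (intro LIMSEQ_le_const) auto
  then have "T h = 0" by simp
  then show "S (synth h) = (LBINT x. h x * S (efun (of_real x)))" by (simp add: T_def \<phi>_def)
qed

end

lemma holomorphic_real_measurable:
  assumes "f holomorphic_on UNIV"
  shows "(\<lambda>x::real. f (of_real x)) \<in> borel_measurable borel"
  by (rule borel_measurable_continuous_onI,
      rule continuous_on_compose2[OF holomorphic_on_imp_continuous_on[OF assms]])
    (rule continuous_on_of_real_id, simp)

text \<open>On the real axis the decay with \<open>q\<close> beats the growth with
  \<open>\<rho> < q\<close>, on one imaginary half-axis a bound is assumed, and Phragmen-Lindelof
  fills the half-plane in between.\<close>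

lemma (in weight) half_plane_bound:
  fixes G :: "nat \<Rightarrow> real \<Rightarrow> complex"
  assumes "\<alpha> \<le> \<beta>" and der: "\<And>j t. \<alpha> \<le> t \<Longrightarrow> t \<le> \<beta> \<Longrightarrow> (G j has_vector_derivative G (Suc j) t) (at t)"
    and end0: "\<And>j. G j \<alpha> = 0" "\<And>j. G j \<beta> = 0"
    and q: "0 < q" "q \<le> 1" and bd: "\<And>j t. \<alpha> \<le> t \<Longrightarrow> t \<le> \<beta> \<Longrightarrow> cmod (G j t) \<le> N * E q j"
    and \<psi>: "\<psi> holomorphic_on UNIV" and type: "\<And>z. cmod (\<psi> z) \<le> A * exp (T * cmod z)"
    and re: "\<And>x. cmod (\<psi> (of_real x)) \<le> A * exp (\<rho> * \<omega> \<bar>x\<bar>)" and \<rho>: "\<rho> < q"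
    and s: "s = 1 \<or> s = (- 1 :: real)"
    and im: "\<And>y. 0 \<le> y \<Longrightarrow> cmod (FT \<alpha> \<beta> (G 0) (\<i> * of_real (s * y)) * \<psi> (\<i> * of_real (s * y))) \<le> M"
  obtains M' where "0 < M'"
    "\<And>z. 0 \<le> s * Im z \<Longrightarrow> cmod (FT \<alpha> \<beta> (G 0) z * \<psi> z) \<le> M'"
    "\<And>x. cmod (FT \<alpha> \<beta> (G 0) (of_real x) * \<psi> (of_real x)) \<le> M' / (1 + x\<^sup>2)"
proof -
  have cG: "continuous_on {\<alpha>..\<beta>} (G 0)" by (rule continuous_on_if_vector_derivative, rule der)
  have "0 \<le> N * E q 0" using bd[of \<alpha> 0] assms(1) norm_ge_zero order_trans by blast
  then have N: "0 \<le> N" using E_pos(1)[of q 0] by (auto simp: zero_le_mult_iff dest: leD)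
  have "0 \<le> A * exp (T * cmod 0)" using type[of 0] norm_ge_zero order_trans by blast
  then have A: "0 \<le> A" by (simp add: zero_le_mult_iff)
  define N' where "N' = N * (exp (\<omega> 1) * (\<beta> - \<alpha>))"
  have N': "0 \<le> N'" using N assms(1) by (simp add: N'_def)
  have dec: "cmod (FT \<alpha> \<beta> (G 0) (of_real x)) \<le> N' * (1 + \<bar>x\<bar>) * exp (- q * \<omega> \<bar>x\<bar>)" for x
    unfolding N'_def by (rule FT_decay) (use assms in auto)
  obtain C where C: "0 < C" "\<And>x. 0 \<le> x \<Longrightarrow> (1 + x) ^ 3 * exp (- (q - \<rho>) * \<omega> x) \<le> C"
    using power_exp_omega_bounded[of "q - \<rho>" 3] \<rho> by auto
  have real: "cmod (FT \<alpha> \<beta> (G 0) (of_real x) * \<psi> (of_real x)) \<le> N' * A * C / (1 + x\<^sup>2)" for x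
  proof -
    have "cmod (FT \<alpha> \<beta> (G 0) (of_real x) * \<psi> (of_real x)) \<le> (N' * (1 + \<bar>x\<bar>) * exp (- q * \<omega> \<bar>x\<bar>)) * (A * exp (\<rho> * \<omega> \<bar>x\<bar>))"
      unfolding norm_mult using N' by (intro mult_mono dec re) auto
    also have "\<dots> = N' * A * ((1 + \<bar>x\<bar>) * exp (- (q - \<rho>) * \<omega> \<bar>x\<bar>))"
      by (simp add: algebra_simps flip: exp_add)
    finally have 1: "cmod (FT \<alpha> \<beta> (G 0) (of_real x) * \<psi> (of_real x)) \<le> N' * A * ((1 + \<bar>x\<bar>) * exp (- (q - \<rho>) * \<omega> \<bar>x\<bar>))" .
    have "((1 + \<bar>x\<bar>) * exp (- (q - \<rho>) * \<omega> \<bar>x\<bar>)) * (1 + x\<^sup>2) \<le> ((1 + \<bar>x\<bar>) * exp (- (q - \<rho>) * \<omega> \<bar>x\<bar>)) * (1 + \<bar>x\<bar>)\<^sup>2"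
      by (intro mult_left_mono) (auto simp: power2_sum)
    also have "\<dots> = (1 + \<bar>x\<bar>) ^ 3 * exp (- (q - \<rho>) * \<omega> \<bar>x\<bar>)"
      by (simp add: power2_eq_square power3_eq_cube)
    also have "\<dots> \<le> C" by (rule C) simp
    finally have "(1 + \<bar>x\<bar>) * exp (- (q - \<rho>) * \<omega> \<bar>x\<bar>) \<le> C / (1 + x\<^sup>2)"
      by (simp add: pos_le_divide_eq add_pos_nonneg)
    then have "N' * A * ((1 + \<bar>x\<bar>) * exp (- (q - \<rho>) * \<omega> \<bar>x\<bar>)) \<le> N' * A * (C / (1 + x\<^sup>2))"
      using N' A by (intro mult_left_mono) auto
    then show ?thesis using 1 by simp
  qed
  define M' where "M' = max 1 (max M (N' * A * C))"
  have real': "cmod (FT \<alpha> \<beta> (G 0) (of_real x) * \<psi> (of_real x)) \<le> M' / (1 + x\<^sup>2)" for x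
    using real[of x] by (rule order_trans) (auto simp: M'_def intro!: divide_right_mono)
  define B where "B = max \<bar>\<alpha>\<bar> \<bar>\<beta>\<bar>"
  have B: "\<bar>t\<bar> \<le> B" if "\<alpha> \<le> t" "t \<le> \<beta>" for t using that by (auto simp: B_def)
  \<comment> \<open>For \<open>s = - 1\<close> the argument is reflected through the origin, which
    exchanges the two half-planes.\<close>
  define H where "H z = FT \<alpha> \<beta> (G 0) (of_real s * z) * \<psi> (of_real s * z)" for z
  have Hle: "cmod (H z) \<le> M'" if "0 \<le> Im z" for z
  proof (rule Phragmen_Lindelof_half_plane[where H = H and A = "N * E q 0 * (\<beta> - \<alpha>) * A" and B = "B + T"])
    show "H holomorphic_on UNIV"
      unfolding H_def[abs_def]
      by (intro holomorphic_intros holomorphic_on_compose_gen[OF _ holomorphic_FT[OF cG], unfolded o_def]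
          holomorphic_on_compose_gen[OF _ \<psi>, unfolded o_def]) auto
    show "cmod (H z) \<le> N * E q 0 * (\<beta> - \<alpha>) * A * exp ((B + T) * cmod z)" for z
    proof -
      have sz: "cmod (of_real s * z) = cmod z" using s by (auto simp: norm_mult)
      have "cmod (FT \<alpha> \<beta> (G 0) (of_real s * z)) \<le> N * E q 0 * exp (B * cmod z) * (\<beta> - \<alpha>)"
      proof (rule norm_FT_le[OF cG assms(1) bd])
        fix t assume "\<alpha> \<le> t" "t \<le> \<beta>"
        then have "\<bar>Im (of_real s * z) * t\<bar> \<le> cmod z * B"
          unfolding abs_mult using abs_Im_le_cmod[of "of_real s * z"] sz B by (intro mult_mono) auto
        then show "exp (- (Im (of_real s * z) * t)) \<le> exp (B * cmod z)" by (simp add: mult.commute)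
      qed
      then have "cmod (H z) \<le> (N * E q 0 * exp (B * cmod z) * (\<beta> - \<alpha>)) * (A * exp (T * cmod z))"
        unfolding H_def norm_mult[of "FT _ _ _ _"] using type[of "of_real s * z"] sz N assms(1)
        by (intro mult_mono) auto
      also have "\<dots> = N * E q 0 * (\<beta> - \<alpha>) * A * (exp (B * cmod z) * exp (T * cmod z))" by (simp only: mult_ac)
      also have "exp (B * cmod z) * exp (T * cmod z) = exp ((B + T) * cmod z)" by (simp add: distrib_right exp_add)
      finally show ?thesis .
    qed
    show "cmod (H (of_real x)) \<le> M'" for x
    proof -
      have "M' / (1 + (s * x)\<^sup>2) \<le> M' / 1" by (intro divide_left_mono) (auto simp: M'_def add_pos_nonneg)
      then show ?thesis using real'[of "s * x"] by (simp add: H_def)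
    qed
    show "cmod (H (\<i> * of_real y)) \<le> M'" if "0 \<le> y" for y
    proof -
      have "cmod (H (\<i> * of_real y)) \<le> M" using im[OF that] by (simp add: H_def mult_ac)
      then show ?thesis by (simp add: M'_def le_max_iff_disj)
    qed
  qed (use that in \<open>simp_all add: M'_def\<close>)
  show thesis
  proof (rule that[of M'])
    show "cmod (FT \<alpha> \<beta> (G 0) z * \<psi> z) \<le> M'" if "0 \<le> s * Im z" for z
    proof -
      have "of_real s * (of_real s * z) = z" using s by auto
      then have "H (of_real s * z) = FT \<alpha> \<beta> (G 0) z * \<psi> z" unfolding H_def by (simp only:)
      then show ?thesis using Hle[of "of_real s * z"] that by simp
    qed
  qed (use real' in \<open>simp_all add: M'_def\<close>)
qed

section \<open>Fourier representation of functionals\<close>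

context ultra_data
begin

text \<open>A functional bounded by a seminorm over \<open>[-c k; c k]\<close> sees only the
  derivatives there, so it does not distinguish functions that agree on that interval.\<close>

lemma norm_S_zero_if_agree:
  assumes S: "functional S" and b: "\<And>f. f \<in> U \<Longrightarrow> cmod (S f) \<le> K * nrm q k f" "0 < q" "q < 1" "0 < K"
    and f: "f \<in> U" "g \<in> U" and agree: "\<And>j t. \<bar>t\<bar> \<le> c k \<Longrightarrow> D j f t = D j g t"
  shows "S f = S g"
proof -
  have "nrm q k (f - g) \<le> 0"
    by (rule nrm_least[OF U_diff(1)[OF f] b(2,3)]) (simp add: U_diff(2)[OF f] agree)
  then have "K * nrm q k (f - g) \<le> 0" using b(4) by (simp add: mult_le_0_iff)
  then have "cmod (S (f - g)) \<le> 0" using b(1)[OF U_diff(1)[OF f]] by linarith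
  then show ?thesis using functional_linear(3)[OF S f] by simp
qed

text \<open>All derivatives vanish at the end points \<open>- B\<close> and \<open>B\<close>
  themselves, so that integrations by parts over \<open>[-B; B]\<close> leave no boundary terms;
  \<open>B \<in> I\<close> keeps the interval inside the domain of smoothness.\<close>

definition supported :: "real \<Rightarrow> (real \<Rightarrow> complex) \<Rightarrow> bool" where
  "supported B g \<longleftrightarrow> g \<in> U \<and> 0 < B \<and> B \<in> I \<and> (\<forall>j t. B \<le> \<bar>t\<bar> \<longrightarrow> D j g t = 0)"

lemma supported_I: "supported B g \<Longrightarrow> \<bar>t\<bar> \<le> B \<Longrightarrow> t \<in> I"
  using I_Union[of B] I_Union[of t] by (auto simp: supported_def intro: order_trans)

lemma supported_der:
  "supported B g \<Longrightarrow> - B \<le> t \<Longrightarrow> t \<le> B \<Longrightarrow> (D j g has_vector_derivative D (Suc j) g t) (at t)"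
  using supported_I[of B g t] U_derivative by (auto simp: supported_def)

lemma supported_decay:
  assumes g: "supported B g" and q: "0 < q" "q < 1" and k: "B \<le> c k"
  shows "cmod (FT (- B) B g (of_real x)) \<le> nrm q k g * (exp (\<omega> 1) * (2 * B)) * (1 + \<bar>x\<bar>) * exp (- q * \<omega> \<bar>x\<bar>)"
proof -
  have B: "0 < B" "g \<in> U" "\<And>j. D j g B = 0" "\<And>j. D j g (- B) = 0" using g by (auto simp: supported_def)
  have "cmod (FT (- B) B (D 0 g) (of_real x)) \<le> nrm q k g * (exp (\<omega> 1) * (B - - B)) * (1 + \<bar>x\<bar>) * exp (- q * \<omega> \<bar>x\<bar>)"
  proof (rule FT_decay)
    show "cmod (D j g t) \<le> nrm q k g * E q j" if "- B \<le> t" "t \<le> B" for j t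
      using that k B q by (intro nrm_bound) auto
  qed (use B q supported_der[OF g] in auto)
  then show ?thesis by simp
qed

lemma supported_FT_continuous: "supported B g \<Longrightarrow> continuous_on {- B..B} g"
  using continuous_on_if_vector_derivative[of "- B" B "D 0 g" "D (Suc 0) g"] supported_der[of B g _ 0] by simp

lemma supported_FT_measurable:
  assumes "supported B g"
  shows "(\<lambda>x. FT (- B) B g (of_real x)) \<in> borel_measurable borel"
proof (rule borel_measurable_continuous_onI)
  show "continuous_on UNIV (\<lambda>x. FT (- B) B g (of_real x))"
    by (rule continuous_on_compose2[OF holomorphic_on_imp_continuous_on[OF holomorphic_FT[OF supported_FT_continuous[OF assms]]]])
      (rule continuous_on_of_real_id, simp)
qed

lemma supported_admissible:
  assumes g: "supported B g"
  shows "admissible (\<lambda>x. FT (- B) B g (of_real x) / (2 * of_real pi))"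
  unfolding admissible_def
proof (intro conjI allI impI)
  show "(\<lambda>x. FT (- B) B g (of_real x) / (2 * of_real pi)) \<in> borel_measurable borel"
    using supported_FT_measurable[OF g] by measurable
  fix q :: real assume q: "0 < q" "q < 1"
  have "B \<in> I" "0 < B" using g by (auto simp: supported_def)
  then obtain k where k: "B \<le> c k" using I_Union by auto
  show "\<exists>A. \<forall>x. cmod (FT (- B) B g (of_real x) / (2 * of_real pi)) \<le> A * (1 + \<bar>x\<bar>) * exp (- q * \<omega> \<bar>x\<bar>)"
  proof (intro exI allI)
    fix x
    have "cmod (FT (- B) B g (of_real x) / (2 * of_real pi)) = cmod (FT (- B) B g (of_real x)) / (2 * pi)"
      by (simp add: norm_divide norm_mult)
    also have "\<dots> \<le> (nrm q k g * (exp (\<omega> 1) * (2 * B)) * (1 + \<bar>x\<bar>) * exp (- q * \<omega> \<bar>x\<bar>)) / (2 * pi)"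
      by (intro divide_right_mono supported_decay[OF g q k]) auto
    finally show "cmod (FT (- B) B g (of_real x) / (2 * of_real pi)) \<le>
      (nrm q k g * (exp (\<omega> 1) * (2 * B)) / (2 * pi)) * (1 + \<bar>x\<bar>) * exp (- q * \<omega> \<bar>x\<bar>)" by simp
  qed
qed

lemma synth_supported:
  assumes g: "supported B g" and t: "\<bar>t\<bar> \<le> B"
  shows "D j (synth (\<lambda>x. FT (- B) B g (of_real x) / (2 * of_real pi))) t = D j g t"
proof -
  have B: "0 < B" "g \<in> U" "\<And>j. D j g B = 0" "\<And>j. D j g (- B) = 0" using g by (auto simp: supported_def)
  have it: "FT (- B) B (D j g) z = (- \<i> * z) ^ j * FT (- B) B g z" for z
    using FT_iterate[of "- B" B "\<lambda>j. D j g" j z] B supported_der[OF g] by simp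
  have "(LBINT x. FT (- B) B (D (0 + j) g) (of_real x) * exp (- (\<i> * of_real x * of_real t))) = 2 * of_real pi * D (0 + j) g t"
    by (rule FT_inversion[where G = "\<lambda>i. D (i + j) g"]) (use B t supported_der[OF g] in auto)
  then have "(LBINT x. FT (- B) B g (of_real x) * ker j t x) = 2 * of_real pi * D j g t"
    by (simp add: it ker_def mult_ac)
  moreover have "(LBINT x. FT (- B) B g (of_real x) / (2 * of_real pi) * ker j t x) =
      (LBINT x. FT (- B) B g (of_real x) * ker j t x) / (2 * of_real pi)"
    by (simp flip: integral_divide_zero)
  ultimately show ?thesis
    using supported_I[OF g t] by (simp add: synth_U(2)[OF supported_admissible[OF g]])
qed

text \<open>Fourier inversion writes \<open>g\<close> as a superposition of exponentials on
  \<open>[-B; B]\<close>. Since \<open>S\<close> sees only the smaller interval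
  \<open>[-c k; c k]\<close>, nothing has to be known about the superposition outside, and
  \<open>functional_synth\<close> interchanges \<open>S\<close> with the integral.\<close>

lemma functional_hat:
  assumes S: "functional S" and b: "\<And>f. f \<in> U \<Longrightarrow> cmod (S f) \<le> K * nrm q k f" "0 < q" "q < 1" "0 < K"
    and g: "supported B g" and k: "c k \<le> B"
  shows "S g = (LBINT x. FT (- B) B g (of_real x) * S (efun (of_real x))) / (2 * of_real pi)"
    and "integrable lborel (\<lambda>x. FT (- B) B g (of_real x) * S (efun (of_real x)))"
proof -
  define h where "h x = FT (- B) B g (of_real x) / (2 * of_real pi)" for x
  have h: "admissible h" unfolding h_def[abs_def] by (rule supported_admissible[OF g])
  have "S g = S (synth h)"
    by (rule norm_S_zero_if_agree[OF S b _ synth_U(1)[OF h]])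
      (use g synth_supported[OF g] k in \<open>auto simp: supported_def h_def[abs_def]\<close>)
  also have "\<dots> = (LBINT x. h x * S (efun (of_real x)))" by (rule functional_synth(1)[OF S h])
  also have "\<dots> = (LBINT x. FT (- B) B g (of_real x) * S (efun (of_real x))) / (2 * of_real pi)"
    by (simp add: h_def flip: integral_divide_zero)
  finally show "S g = (LBINT x. FT (- B) B g (of_real x) * S (efun (of_real x))) / (2 * of_real pi)" .
  have "integrable lborel (\<lambda>x. (2 * of_real pi) * (h x * S (efun (of_real x))))"
    by (intro integrable_mult_right functional_synth(2)[OF S h])
  then show "integrable lborel (\<lambda>x. FT (- B) B g (of_real x) * S (efun (of_real x)))"
    by (simp add: h_def)
qed

text \<open>Two radii beyond \<open>c k\<close>: the function is 1 up to \<open>b\<close> and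
  \<open>0\<close> from \<open>B\<close> on. The gap between \<open>c k\<close> and \<open>b\<close>
  later absorbs the contribution of \<open>\<omega>\<close> on the imaginary axis.\<close>

definition cutoff :: "nat \<Rightarrow> real \<Rightarrow> real \<Rightarrow> (nat \<Rightarrow> real \<Rightarrow> complex) \<Rightarrow> bool" where
  "cutoff k b B \<eta> \<longleftrightarrow> c k < b \<and> b < B \<and> B \<in> I \<and>
     (\<forall>j t. (\<eta> j has_vector_derivative \<eta> (Suc j) t) (at t)) \<and>
     (\<exists>C. \<forall>j t. cmod (\<eta> j t) \<le> C * E 1 j) \<and>
     (\<forall>t. \<bar>t\<bar> \<le> b \<longrightarrow> \<eta> 0 t = 1) \<and> (\<forall>j t. \<bar>t\<bar> \<le> b \<longrightarrow> \<eta> (Suc j) t = 0) \<and> (\<forall>j t. B \<le> \<bar>t\<bar> \<longrightarrow> \<eta> j t = 0)"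

lemma cutoff_ex: "\<exists>b B \<eta>. cutoff k b B \<eta>"
proof -
  obtain l where l: "c k < c l" using c_unbounded by blast
  define b where "b = (c k + c l) / 2"
  have b: "c k < b" "b < c l" "0 < b" using l c_pos[of k] by (auto simp: b_def)
  obtain \<eta> :: "nat \<Rightarrow> real \<Rightarrow> complex" and C where \<eta>: "0 < C"
    "\<And>j t. (\<eta> j has_vector_derivative \<eta> (Suc j) t) (at t)"
    "\<And>j t. cmod (\<eta> j t) \<le> C * E 1 j"
    "\<And>t. - b \<le> t \<Longrightarrow> t \<le> b \<Longrightarrow> \<eta> 0 t = 1"
    "\<And>j t. - b \<le> t \<Longrightarrow> t \<le> b \<Longrightarrow> \<eta> (Suc j) t = 0"
    "\<And>j t. t \<le> - b - (c l - b) \<or> b + (c l - b) \<le> t \<Longrightarrow> \<eta> j t = 0"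
    by (rule cutoff_exists[of "- b" b "c l - b"]) (use b that in auto)
  have "c l \<in> I" using c_pos[of l] by (intro c_in_I[of _ l]) auto
  then have "cutoff k b (c l) \<eta>"
    unfolding cutoff_def using b \<eta>(2,3) \<eta>(4,5,6) by (intro conjI allI impI exI[of _ C]) (auto simp: abs_if split: if_splits)
  then show ?thesis by blast
qed

lemma cutoff_mult:
  assumes \<eta>: "cutoff k b B \<eta>" and f: "f \<in> U"
  shows "supported B (\<lambda>x. \<eta> 0 x * f x)" "\<bar>t\<bar> \<le> b \<Longrightarrow> D j (\<lambda>x. \<eta> 0 x * f x) t = D j f t"
proof -
  obtain C where C: "\<And>j t. cmod (\<eta> j t) \<le> C * E 1 j" using \<eta> unfolding cutoff_def by blast
  have der: "\<And>j t. (\<eta> j has_vector_derivative \<eta> (Suc j) t) (at t)" using \<eta> by (simp add: cutoff_def)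
  have u: "(\<lambda>x. \<eta> 0 x * f x) \<in> U" by (rule U_cutoff(1)[OF f]) (rule der C)+
  have D: "D j (\<lambda>x. \<eta> 0 x * f x) = (\<lambda>x. \<Sum>i\<le>j. of_nat (j choose i) * \<eta> i x * D (j - i) f x)" for j
    by (rule U_cutoff(2)[OF f]) (rule der C)+
  show "supported B (\<lambda>x. \<eta> 0 x * f x)"
    using \<eta> u c_pos[of k] unfolding supported_def D by (auto simp: cutoff_def)
  assume t: "\<bar>t\<bar> \<le> b"
  have "(\<Sum>i\<le>j. of_nat (j choose i) * \<eta> i t * D (j - i) f t) = (\<Sum>i\<le>j. if i = 0 then D j f t else 0)"
    using \<eta> t by (intro sum.cong) (auto simp: cutoff_def gr0_conv_Suc)
  then show "D j (\<lambda>x. \<eta> 0 x * f x) t = D j f t" unfolding D by simp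
qed

text \<open>Since the cutoff is 1 on \<open>[-c k; c k]\<close>, multiplying by it is invisible to
  \<open>S\<close>; hence \<open>S\<close> is determined by the values of its transform on the real
  line.\<close>

lemma functional_cutoff:
  assumes S: "functional S" and b: "\<And>f. f \<in> U \<Longrightarrow> cmod (S f) \<le> K * nrm q k f" "0 < q" "q < 1" "0 < K"
    and \<eta>: "cutoff k b B \<eta>" and f: "f \<in> U"
  shows "S f = (LBINT x. FT (- B) B (\<lambda>x. \<eta> 0 x * f x) (of_real x) * S (efun (of_real x))) / (2 * of_real pi)"
    and "integrable lborel (\<lambda>x. FT (- B) B (\<lambda>x. \<eta> 0 x * f x) (of_real x) * S (efun (of_real x)))"
    and "S f = S (\<lambda>x. \<eta> 0 x * f x)"
proof -
  have kb: "c k < b" "b < B" using \<eta> by (auto simp: cutoff_def)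
  note g = cutoff_mult(1)[OF \<eta> f]
  show "S f = S (\<lambda>x. \<eta> 0 x * f x)"
  proof (rule norm_S_zero_if_agree[OF S b f])
    show "(\<lambda>x. \<eta> 0 x * f x) \<in> U" using g by (simp add: supported_def)
    show "D j f t = D j (\<lambda>x. \<eta> 0 x * f x) t" if "\<bar>t\<bar> \<le> c k" for j t
      using cutoff_mult(2)[OF \<eta> f, of t j] that kb by simp
  qed
  also have "\<dots> = (LBINT x. FT (- B) B (\<lambda>x. \<eta> 0 x * f x) (of_real x) * S (efun (of_real x))) / (2 * of_real pi)"
    by (rule functional_hat(1)[OF S b g]) (use kb in auto)
  finally show "S f = (LBINT x. FT (- B) B (\<lambda>x. \<eta> 0 x * f x) (of_real x) * S (efun (of_real x))) / (2 * of_real pi)" .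
  show "integrable lborel (\<lambda>x. FT (- B) B (\<lambda>x. \<eta> 0 x * f x) (of_real x) * S (efun (of_real x)))"
    by (rule functional_hat(2)[OF S b g]) (use kb in auto)
qed

lemma functional_bound_mono:
  assumes "\<And>f. f \<in> U \<Longrightarrow> cmod (S f) \<le> K * nrm q k f" "0 < q" "q < 1" "0 < K" "k \<le> k'" "f \<in> U"
  shows "cmod (S f) \<le> K * nrm q k' f"
proof -
  have "K * nrm q k f \<le> K * nrm q k' f" using assms by (intro mult_left_mono nrm_mono) auto
  then show ?thesis using assms(1)[OF assms(6)] by linarith
qed

text \<open>Both functionals are represented with one cutoff, chosen for the larger of their two
  indices, and the representation involves only the transform.\<close>

lemma functional_injective:
  assumes S: "functional S" and T: "functional T" and eq: "\<And>z. S (efun z) = T (efun z)" and f: "f \<in> U"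
  shows "S f = T f"
proof -
  obtain q k K where q: "0 < q" "q < 1" and K: "0 < K" "\<And>f. f \<in> U \<Longrightarrow> cmod (S f) \<le> K * nrm q k f"
    by (rule functional_bound[OF S]) (rule that)
  obtain q' k' K' where q': "0 < q'" "q' < 1" and K': "0 < K'" "\<And>f. f \<in> U \<Longrightarrow> cmod (T f) \<le> K' * nrm q' k' f"
    by (rule functional_bound[OF T]) (rule that)
  define l where "l = max k k'"
  have b1: "cmod (S f) \<le> K * nrm q l f" if "f \<in> U" for f
    by (rule functional_bound_mono[OF K(2) q K(1) _ that]) (simp_all add: l_def)
  have b2: "cmod (T f) \<le> K' * nrm q' l f" if "f \<in> U" for f
    by (rule functional_bound_mono[OF K'(2) q' K'(1) _ that]) (simp_all add: l_def)
  obtain b B \<eta> where \<eta>: "cutoff l b B \<eta>" using cutoff_ex by blast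
  show ?thesis
    using functional_cutoff(1)[OF S b1 q K(1) \<eta> f] functional_cutoff(1)[OF T b2 q' K'(1) \<eta> f] by (simp add: eq)
qed

section \<open>Holomorphy of transforms\<close>

lemma exp_quadratic_bounds:
  fixes h :: complex
  assumes h: "cmod h \<le> 1" and t: "\<bar>t\<bar> \<le> R" "1 \<le> R"
  shows "cmod (exp (- \<i> * of_real t * h) - 1 + \<i> * of_real t * h) \<le> R\<^sup>2 * exp R * (cmod h)\<^sup>2"
    and "cmod (- \<i> * h * (exp (- \<i> * of_real t * h) - 1)) \<le> R\<^sup>2 * exp R * (cmod h)\<^sup>2"
    and "2 \<le> j \<Longrightarrow> cmod ((- \<i> * h) ^ j * exp (- \<i> * of_real t * h)) \<le> R\<^sup>2 * exp R * (cmod h)\<^sup>2"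
proof -
  define w where "w = - \<i> * of_real t * h"
  have wn: "cmod w = \<bar>t\<bar> * cmod h" by (simp add: w_def norm_mult)
  have wh: "cmod w \<le> R * cmod h" unfolding wn using t by (intro mult_right_mono) auto
  have wR: "cmod w \<le> R" using wh mult_left_mono[OF h, of R] t by linarith
  have eR: "exp \<bar>Re w\<bar> \<le> exp R" "exp (Re w) \<le> exp R" using abs_Re_le_cmod[of w] wR by auto
  have R2: "R \<le> R\<^sup>2" using t by (simp add: power2_eq_square)
  have "cmod (exp w - (\<Sum>i\<le>1. w ^ i / fact i)) \<le> exp \<bar>Re w\<bar> * cmod w ^ Suc 1 / fact 1" by (rule Taylor_exp)
  also have "\<dots> = exp \<bar>Re w\<bar> * (cmod w)\<^sup>2" by (simp add: power2_eq_square)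
  also have "\<dots> \<le> exp R * (R * cmod h)\<^sup>2" by (intro mult_mono eR power_mono wh) auto
  finally show "cmod (exp (- \<i> * of_real t * h) - 1 + \<i> * of_real t * h) \<le> R\<^sup>2 * exp R * (cmod h)\<^sup>2"
    by (simp add: w_def power_mult_distrib mult_ac algebra_simps)
  have "cmod (exp w - (\<Sum>i\<le>0. w ^ i / fact i)) \<le> exp \<bar>Re w\<bar> * cmod w ^ Suc 0 / fact 0" by (rule Taylor_exp)
  then have "cmod (exp w - 1) \<le> exp \<bar>Re w\<bar> * cmod w" by simp
  also have "\<dots> \<le> exp R * (R\<^sup>2 * cmod h)"
    using wh mult_right_mono[OF R2, of "cmod h"] by (intro mult_mono eR) auto
  finally have "cmod h * cmod (exp w - 1) \<le> cmod h * (exp R * (R\<^sup>2 * cmod h))" by (intro mult_left_mono) auto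
  then show "cmod (- \<i> * h * (exp (- \<i> * of_real t * h) - 1)) \<le> R\<^sup>2 * exp R * (cmod h)\<^sup>2"
    by (simp add: norm_mult w_def power2_eq_square mult_ac)
  assume j: "2 \<le> j"
  have "cmod h ^ j * exp (Re w) \<le> (cmod h)\<^sup>2 * exp R"
    using h j by (intro mult_mono eR power_decreasing) auto
  also have "\<dots> \<le> R\<^sup>2 * ((cmod h)\<^sup>2 * exp R)"
    using mult_right_mono[of 1 "R\<^sup>2" "(cmod h)\<^sup>2 * exp R"] R2 t by auto
  also have "cmod h ^ j * exp (Re w) = cmod ((- \<i> * h) ^ j * exp (- \<i> * of_real t * h))"
    unfolding w_def by (simp only: norm_mult norm_power norm_minus_cancel norm_ii mult_1 norm_exp_eq_Re)
  finally show "cmod ((- \<i> * h) ^ j * exp (- \<i> * of_real t * h)) \<le> R\<^sup>2 * exp R * (cmod h)\<^sup>2"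
    by (simp only: mult_ac)
qed

text \<open>The remainder of the first-order expansion in \<open>z\<close> is the monomial
  multiplied by \<open>exp (- \<i> * t * h) - 1 + \<i> * t * h\<close>. This multiplier and all its
  derivatives in \<open>t\<close> are of order \<open>(cmod h)\<^sup>2\<close>, so its image under
  \<open>S\<close> vanishes after division by \<open>h\<close>.\<close>

lemma functional_exp_monomial_derivative:
  assumes S: "functional S"
  shows "((\<lambda>z. S (exp_monomial a n z)) has_field_derivative - \<i> * S (exp_monomial a (Suc n) z)) (at z)"
proof -
  obtain q k K where q: "0 < q" "q < 1" and K: "0 < K" "\<And>f. f \<in> U \<Longrightarrow> cmod (S f) \<le> K * nrm q k f"
    by (rule functional_bound[OF S]) (rule that)
  define q' where "q' = (q + 1) / 2"
  have q': "q < q'" "q' < 1" using q by (auto simp: q'_def)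
  define f where "f = exp_monomial a n z"
  have f: "f \<in> U" unfolding f_def by (rule exp_monomial_U)
  define g where "g = exp_monomial a (Suc n) z"
  have g: "g \<in> U" unfolding g_def by (rule exp_monomial_U)
  define \<eta> where "\<eta> h j t = (if j = 0 then exp (- \<i> * of_real t * h) - 1 + \<i> * of_real t * h
     else if j = 1 then - \<i> * h * (exp (- \<i> * of_real t * h) - 1)
     else (- \<i> * h) ^ j * exp (- \<i> * of_real t * h))" for h :: complex and j :: nat and t :: real
  have der: "(\<eta> h j has_vector_derivative \<eta> h (Suc j) t) (at t)" for h j t
  proof -
    consider "j = 0" | "j = 1" | "2 \<le> j" by linarith
    then show ?thesis
    proof cases
      case 1
      have "((\<lambda>w. exp (- \<i> * w * h) - 1 + \<i> * w * h) has_field_derivative - \<i> * h * (exp (- \<i> * of_real t * h) - 1)) (at (of_real t))"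
        by (auto intro!: derivative_eq_intros simp: algebra_simps)
      then show ?thesis using 1 has_vector_derivative_real_field by (simp add: \<eta>_def[abs_def])
    next
      case 2
      have "((\<lambda>w. - \<i> * h * (exp (- \<i> * w * h) - 1)) has_field_derivative (- \<i> * h) ^ 2 * exp (- \<i> * of_real t * h)) (at (of_real t))"
        by (auto intro!: derivative_eq_intros simp: algebra_simps power2_eq_square)
      then show ?thesis using 2 has_vector_derivative_real_field by (simp add: \<eta>_def[abs_def] numeral_2_eq_2)
    next
      case 3
      then show ?thesis using efun_deriv[of h j t] by (simp add: \<eta>_def[abs_def])
    qed
  qed
  define R where "R l = max 1 (c l)" for l
  have bnd: "cmod (\<eta> h j t) \<le> (R l)\<^sup>2 * exp (R l) * (cmod h)\<^sup>2" if "cmod h \<le> 1" "\<bar>t\<bar> \<le> c l" for h j t l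
    using exp_quadratic_bounds[OF that(1), of t "R l"] that(2) by (auto simp: \<eta>_def R_def)
  obtain C where C: "0 < C" "\<And>f \<eta> M k. f \<in> U \<Longrightarrow> (\<And>j x. x \<in> I \<Longrightarrow> (\<eta> j has_vector_derivative \<eta> (Suc j) x) (at x)) \<Longrightarrow>
    (\<And>q k. 0 < q \<Longrightarrow> q < 1 \<Longrightarrow> \<exists>M. \<forall>j x. \<bar>x\<bar> \<le> c k \<longrightarrow> cmod (\<eta> j x) \<le> M * E q j) \<Longrightarrow> 0 \<le> M \<Longrightarrow>
    (\<And>j x. \<bar>x\<bar> \<le> c k \<Longrightarrow> cmod (\<eta> j x) \<le> M * E q' j) \<Longrightarrow> nrm q k (\<lambda>x. \<eta> 0 x * f x) \<le> C * M * nrm q' k f"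
    using nrm_mult_gen[OF q(1) q'] by blast
  define M where "M = (R k)\<^sup>2 * exp (R k) * exp (\<omega> 1)"
  have M0: "0 \<le> M" by (simp add: M_def)
  have prod: "(\<lambda>t. \<eta> h 0 t * f t) \<in> U" "nrm q k (\<lambda>t. \<eta> h 0 t * f t) \<le> C * (M * (cmod h)\<^sup>2) * nrm q' k f"
    if h: "cmod h \<le> 1" for h
  proof -
    have e: "\<exists>M. \<forall>j x. \<bar>x\<bar> \<le> c k \<longrightarrow> cmod (\<eta> h j x) \<le> M * E q j" if "0 < q" "q < 1" for q k
    proof (rule multiplier_bounded[OF _ that])
      show "\<exists>M. \<forall>j x. \<bar>x\<bar> \<le> c k \<longrightarrow> cmod (\<eta> h j x) \<le> M" for k
        using bnd[OF h] by blast
    qed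
    show "(\<lambda>t. \<eta> h 0 t * f t) \<in> U" by (rule U_mult_gen(1)[OF f]) (rule der, erule (1) e)
    show "nrm q k (\<lambda>t. \<eta> h 0 t * f t) \<le> C * (M * (cmod h)\<^sup>2) * nrm q' k f"
    proof (rule C(2)[OF f])
      fix j x assume x: "\<bar>x\<bar> \<le> c k"
      have "cmod (\<eta> h j x) \<le> (R k)\<^sup>2 * exp (R k) * (cmod h)\<^sup>2 * 1" using bnd[OF h x] by simp
      also have "\<dots> \<le> (R k)\<^sup>2 * exp (R k) * (cmod h)\<^sup>2 * (exp (\<omega> 1) * E q' j)"
        using q q' by (intro mult_left_mono one_le_E) auto
      finally show "cmod (\<eta> h j x) \<le> M * (cmod h)\<^sup>2 * E q' j" by (simp add: M_def mult_ac)
    qed (rule der, erule (1) e, use M0 in simp)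
  qed
  have eq: "(\<lambda>t. \<eta> h 0 t * f t) = (exp_monomial a n (z + h) - f) - cscale (h * (- \<i>)) g" for h
  proof
    fix t
    show "\<eta> h 0 t * f t = ((exp_monomial a n (z + h) - f) - cscale (h * (- \<i>)) g) t"
    proof (cases "t \<in> I")
      case True
      have "exp (- \<i> * (z + h) * of_real t) = exp (- \<i> * of_real t * h) * exp (- \<i> * z * of_real t)"
        by (simp add: algebra_simps flip: exp_add)
      then show ?thesis using True
        by (simp add: f_def g_def exp_monomial_def cscale_def \<eta>_def algebra_simps)
    qed (simp add: f_def g_def exp_monomial_def cscale_def)
  qed
  have main: "cmod ((S (exp_monomial a n (z + h)) - S f) / h - (- \<i> * S g)) \<le> (K * (C * M * nrm q' k f)) * cmod h"
    if h: "cmod h \<le> 1" "h \<noteq> 0" for h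
  proof -
    have "S (\<lambda>t. \<eta> h 0 t * f t) = S (exp_monomial a n (z + h)) - S f - h * (- \<i>) * S g"
      unfolding eq
      using functional_linear(3)[OF S U_diff(1)[OF exp_monomial_U f] U_cscale(1)[OF g]] functional_linear(3)[OF S exp_monomial_U f]
        functional_linear(2)[OF S g g] by (simp only:)
    then have e2: "(S (exp_monomial a n (z + h)) - S f) / h - (- \<i> * S g) = S (\<lambda>t. \<eta> h 0 t * f t) / h"
      using h(2) by (simp add: field_simps)
    have "cmod (S (\<lambda>t. \<eta> h 0 t * f t)) \<le> K * nrm q k (\<lambda>t. \<eta> h 0 t * f t)" by (rule K(2)[OF prod(1)[OF h(1)]])
    also have "\<dots> \<le> K * (C * (M * (cmod h)\<^sup>2) * nrm q' k f)" using K(1) by (intro mult_left_mono prod(2) h) auto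
    also have "\<dots> = (K * (C * M * nrm q' k f)) * cmod h * cmod h" by (simp add: power2_eq_square mult_ac)
    finally show ?thesis unfolding e2 norm_divide using h(2) by (simp add: divide_le_eq)
  qed
  show ?thesis
    unfolding DERIV_def f_def[symmetric] g_def[symmetric]
  proof (rule LIM_zero_cancel, rule Lim_null_comparison)
    have "eventually (\<lambda>h. dist h 0 < 1) (at (0::complex))" unfolding eventually_at by (rule exI[of _ 1]) auto
    moreover have "eventually (\<lambda>h. h \<noteq> 0) (at (0::complex))" by (simp add: eventually_at_filter)
    ultimately show "eventually (\<lambda>h. cmod ((S (exp_monomial a n (z + h)) - S f) / h - (- \<i> * S g)) \<le>
       (K * (C * M * nrm q' k f)) * cmod h) (at 0)"
      by eventually_elim (rule main, auto)
    show "((\<lambda>h. (K * (C * M * nrm q' k f)) * cmod h) \<longlongrightarrow> 0) (at 0)" by (rule tendsto_eq_intros | simp)+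
  qed
qed

lemma functional_efun_holomorphic:
  assumes "functional S"
  shows "(\<lambda>z. S (efun z)) holomorphic_on UNIV"
  using functional_exp_monomial_derivative[OF assms, of 0]
  by (auto simp: holomorphic_on_open exp_monomial_0)

text \<open>The dictionary between the two sides: the transform vanishes at \<open>\<mu>\<close>
  with multiplicity at least \<open>n\<close> exactly when \<open>S\<close> kills the monomials of
  degree below \<open>n\<close> with frequency \<open>\<mu>\<close>.\<close>

lemma functional_higher_deriv:
  assumes "functional S"
  shows "(deriv ^^ n) (\<lambda>z. S (efun z)) \<mu> = (- \<i>) ^ n * S (exp_monomial a n \<mu>)"
proof (induction n arbitrary: \<mu>)
  case (Suc n)
  have "(deriv ^^ n) (\<lambda>z. S (efun z)) = (\<lambda>\<mu>. (- \<i>) ^ n * S (exp_monomial a n \<mu>))"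
    using Suc by blast
  moreover have "deriv (\<lambda>\<mu>. (- \<i>) ^ n * S (exp_monomial a n \<mu>)) \<mu> = (- \<i>) ^ n * (- \<i> * S (exp_monomial a (Suc n) \<mu>))"
    by (intro DERIV_imp_deriv DERIV_cmult functional_exp_monomial_derivative[OF assms])
  ultimately show ?case by simp
qed (simp add: exp_monomial_0)

subsection \<open>The module of entire functions\<close>

definition pn :: "nat \<Rightarrow> (complex \<Rightarrow> complex) \<Rightarrow> real" where
  "pn k \<phi> = real_of_ereal (p_norm \<omega> c r k \<phi>)"

lemma p_norm_le_iff:
  "p_norm \<omega> c r k \<phi> \<le> ereal M \<longleftrightarrow> (\<forall>z. cmod (\<phi> z) \<le> M * exp (r k * \<omega> (cmod z) + c k * \<bar>Im z\<bar>))"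
proof -
  have "cmod (\<phi> z) * exp (- r k * \<omega> (cmod z) - c k * \<bar>Im z\<bar>) \<le> M \<longleftrightarrow>
      cmod (\<phi> z) \<le> M * exp (r k * \<omega> (cmod z) + c k * \<bar>Im z\<bar>)" for z
  proof -
    have "exp (- r k * \<omega> (cmod z) - c k * \<bar>Im z\<bar>) = 1 / exp (r k * \<omega> (cmod z) + c k * \<bar>Im z\<bar>)"
      by (simp add: exp_minus[symmetric] inverse_eq_divide[symmetric])
    then show ?thesis by (simp add: divide_le_eq)
  qed
  then show ?thesis unfolding p_norm_def by (simp add: SUP_le_iff)
qed

lemma p_norm_nonneg: "0 \<le> p_norm \<omega> c r k \<phi>"
  unfolding p_norm_def by (rule SUP_upper2[of 0]) auto

lemma p_norm_less_infinity_iff: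
  "p_norm \<omega> c r k \<phi> < \<infinity> \<longleftrightarrow> (\<exists>M. \<forall>z. cmod (\<phi> z) \<le> M * exp (r k * \<omega> (cmod z) + c k * \<bar>Im z\<bar>))"
proof -
  have "p_norm \<omega> c r k \<phi> < \<infinity> \<longleftrightarrow> (\<exists>M. p_norm \<omega> c r k \<phi> \<le> ereal M)"
    using p_norm_nonneg[of k \<phi>] by (cases "p_norm \<omega> c r k \<phi>") auto
  then show ?thesis by (simp only: p_norm_le_iff)
qed

lemma Pk_iff:
  "\<phi> \<in> Pk \<omega> c r k \<longleftrightarrow> \<phi> holomorphic_on UNIV \<and> (\<exists>M. \<forall>z. cmod (\<phi> z) \<le> M * exp (r k * \<omega> (cmod z) + c k * \<bar>Im z\<bar>))"
  by (simp only: Pk_def mem_Collect_eq p_norm_less_infinity_iff)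

lemma ereal_pn: "\<phi> \<in> Pk \<omega> c r k \<Longrightarrow> ereal (pn k \<phi>) = p_norm \<omega> c r k \<phi>"
  using p_norm_nonneg[of k \<phi>] by (auto simp: pn_def Pk_def ereal_real)

lemma pn_nonneg [simp]: "0 \<le> pn k \<phi>"
  by (simp add: pn_def p_norm_nonneg real_of_ereal_pos)

lemma pn_bound: "\<phi> \<in> Pk \<omega> c r k \<Longrightarrow> cmod (\<phi> z) \<le> pn k \<phi> * exp (r k * \<omega> (cmod z) + c k * \<bar>Im z\<bar>)"
  using p_norm_le_iff[of k \<phi> "pn k \<phi>"] ereal_pn by simp

lemma pn_least:
  "\<phi> \<in> Pk \<omega> c r k \<Longrightarrow> (\<And>z. cmod (\<phi> z) \<le> M * exp (r k * \<omega> (cmod z) + c k * \<bar>Im z\<bar>)) \<Longrightarrow> pn k \<phi> \<le> M"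
  using p_norm_le_iff[of k \<phi> M] ereal_pn[of \<phi> k, symmetric] by simp

lemma r_above: "q < 1 \<Longrightarrow> \<exists>m\<ge>k. q < r m"
proof -
  assume "q < 1"
  then have "eventually (\<lambda>n. q < r n) sequentially" using r_lim by (rule order_tendstoD(1)[rotated])
  then show ?thesis using eventually_sequentially by (metis nle_le)
qed

text \<open>As \<open>q < 1\<close> and \<open>r\<close> tends to 1, some step has
  \<open>r m > q\<close>; taking it beyond \<open>k\<close> accommodates the type as well.\<close>

lemma functional_in_P:
  assumes S: "functional S"
  shows "(\<lambda>z. S (efun z)) \<in> P_space \<omega> c r"
proof -
  obtain q k K where q: "0 < q" "q < 1" and K: "0 < K" "\<And>f. f \<in> U \<Longrightarrow> cmod (S f) \<le> K * nrm q k f"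
    by (rule functional_bound[OF S]) (rule that)
  obtain m where m: "k \<le> m" "q < r m" using r_above[OF q(2)] by blast
  have "cmod (S (efun z)) \<le> (K * exp (\<omega> 1)) * exp (r m * \<omega> (cmod z) + c m * \<bar>Im z\<bar>)" for z
  proof -
    have "cmod (S (efun z)) \<le> K * nrm q k (efun z)" by (rule K(2)[OF efun_U])
    also have "\<dots> \<le> K * (exp (\<omega> 1) * exp (c k * \<bar>Im z\<bar>) * exp (q * \<omega> (cmod z)))"
      using K(1) nrm_efun[OF q, of k z] by (intro mult_left_mono) auto
    also have "\<dots> = (K * exp (\<omega> 1)) * exp (q * \<omega> (cmod z) + c k * \<bar>Im z\<bar>)"
      by (simp add: exp_add)
    also have "\<dots> \<le> (K * exp (\<omega> 1)) * exp (r m * \<omega> (cmod z) + c m * \<bar>Im z\<bar>)"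
    proof -
      have "q * \<omega> (cmod z) \<le> r m * \<omega> (cmod z)" using m nonneg by (intro mult_right_mono) auto
      moreover have "c k * \<bar>Im z\<bar> \<le> c m * \<bar>Im z\<bar>" using c_mono[OF m(1)] by (intro mult_right_mono) auto
      ultimately show ?thesis using K(1) by simp
    qed
    finally show ?thesis .
  qed
  then have "(\<lambda>z. S (efun z)) \<in> Pk \<omega> c r m"
    unfolding Pk_iff using functional_efun_holomorphic[OF S] by blast
  then show ?thesis unfolding P_space_def by blast
qed

section \<open>From entire functions back to functionals\<close>

lemma weight_decay:
  assumes "0 < \<epsilon>"
  obtains C where "0 < C" "\<And>x. (1 + \<bar>x\<bar>) * exp (- \<epsilon> * \<omega> \<bar>x\<bar>) \<le> C / (1 + x\<^sup>2)"
proof -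
  obtain C where C: "0 < C" "\<And>x. 0 \<le> x \<Longrightarrow> (1 + x) ^ 3 * exp (- \<epsilon> * \<omega> x) \<le> C"
    using power_exp_omega_bounded[OF assms, of 3] by blast
  have "(1 + \<bar>x\<bar>) * exp (- \<epsilon> * \<omega> \<bar>x\<bar>) \<le> C / (1 + x\<^sup>2)" for x
  proof -
    have "((1 + \<bar>x\<bar>) * exp (- \<epsilon> * \<omega> \<bar>x\<bar>)) * (1 + x\<^sup>2) \<le> ((1 + \<bar>x\<bar>) * exp (- \<epsilon> * \<omega> \<bar>x\<bar>)) * (1 + \<bar>x\<bar>)\<^sup>2"
      by (intro mult_left_mono) (auto simp: power2_sum)
    also have "\<dots> = (1 + \<bar>x\<bar>) ^ 3 * exp (- \<epsilon> * \<omega> \<bar>x\<bar>)"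
      by (simp add: power2_eq_square power3_eq_cube)
    also have "\<dots> \<le> C" by (rule C) simp
    finally show ?thesis by (simp add: pos_le_divide_eq add_pos_nonneg)
  qed
  then show thesis using that C by blast
qed

text \<open>The right-hand side of \<open>functional_cutoff\<close> with an arbitrary
  \<open>\<phi>\<close> in place of the transform: the candidate for the functional with transform
  \<open>\<phi>\<close>.\<close>

definition Gfun :: "(nat \<Rightarrow> real \<Rightarrow> complex) \<Rightarrow> real \<Rightarrow> (complex \<Rightarrow> complex) \<Rightarrow> (real \<Rightarrow> complex) \<Rightarrow> complex" where
  "Gfun \<eta> B \<phi> f = (LBINT x. FT (- B) B (\<lambda>t. \<eta> 0 t * f t) (of_real x) * \<phi> (of_real x)) / (2 * of_real pi)"

text \<open>The constants depend on the step \<open>k\<close> and on the cutoff, but on neither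
  \<open>\<phi>\<close> nor \<open>f\<close>: the bound gives continuity in \<open>f\<close>, and in
  \<open>\<phi>\<close> on the step \<open>Pk\<close>.\<close>

lemma Gfun_bound:
  assumes \<eta>: "cutoff k b B \<eta>"
  obtains q' k' C where "0 < q'" "q' < 1" "0 < C"
    "\<And>\<phi> f. \<phi> \<in> Pk \<omega> c r k \<Longrightarrow> f \<in> U \<Longrightarrow> cmod (Gfun \<eta> B \<phi> f) \<le> C * pn k \<phi> * nrm q' k' f"
    "\<And>\<phi> f. \<phi> \<in> Pk \<omega> c r k \<Longrightarrow> f \<in> U \<Longrightarrow>
      integrable lborel (\<lambda>x. FT (- B) B (\<lambda>t. \<eta> 0 t * f t) (of_real x) * \<phi> (of_real x))"
proof -
  have rk: "0 < r k" "r k < 1" using r_bounds[of k] by auto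
  \<comment> \<open>The gap between \<open>r k\<close> and \<open>q\<close> yields integrability
    against \<open>\<phi>\<close>, the gap between \<open>q\<close> and 1 leaves room for the loss
    in the product with the cutoff.\<close>
  define q where "q = (r k + 1) / 2"
  define q' where "q' = (q + 1) / 2"
  have q: "0 < q" "r k < q" "q < q'" "q' < 1" using rk by (auto simp: q_def q'_def)
  have B: "B \<in> I" "0 < B" using \<eta> c_pos[of k] by (auto simp: cutoff_def)
  obtain k' where k': "B \<le> c k'" using B I_Union[of B] by auto
  obtain C0 where C0: "\<And>j t. cmod (\<eta> j t) \<le> C0 * E 1 j" using \<eta> unfolding cutoff_def by blast
  have der: "\<And>j t. (\<eta> j has_vector_derivative \<eta> (Suc j) t) (at t)" using \<eta> by (simp add: cutoff_def)
  have "\<exists>A>0. \<forall>k. \<forall>f\<in>U. nrm q k (\<lambda>x. \<eta> 0 x * f x) \<le> A * nrm q' k f"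
    by (rule nrm_cutoff, rule der, rule C0) (rule q)+
  then obtain A where A: "0 < A" "\<And>f. f \<in> U \<Longrightarrow> nrm q k' (\<lambda>x. \<eta> 0 x * f x) \<le> A * nrm q' k' f" by blast
  have "0 < q - r k" using q by simp
  then obtain C3 where C3: "0 < C3" "\<And>x. (1 + \<bar>x\<bar>) * exp (- (q - r k) * \<omega> \<bar>x\<bar>) \<le> C3 / (1 + x\<^sup>2)"
    by (rule weight_decay) (rule that)
  define C where "C = A * (exp (\<omega> 1) * (2 * B)) * C3"
  have Cpos: "0 < C" using A C3 B by (simp add: C_def)
  have pt: "cmod (FT (- B) B (\<lambda>t. \<eta> 0 t * f t) (of_real x) * \<phi> (of_real x)) \<le> C * pn k \<phi> * nrm q' k' f / (1 + x\<^sup>2)"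
    if \<phi>: "\<phi> \<in> Pk \<omega> c r k" and f: "f \<in> U" for \<phi> f x
  proof -
    note g = cutoff_mult(1)[OF \<eta> f]
    have "cmod (FT (- B) B (\<lambda>t. \<eta> 0 t * f t) (of_real x)) \<le>
        nrm q k' (\<lambda>t. \<eta> 0 t * f t) * (exp (\<omega> 1) * (2 * B)) * (1 + \<bar>x\<bar>) * exp (- q * \<omega> \<bar>x\<bar>)"
      by (rule supported_decay[OF g _ _ k']) (use q in auto)
    also have "\<dots> \<le> (A * nrm q' k' f) * (exp (\<omega> 1) * (2 * B)) * (1 + \<bar>x\<bar>) * exp (- q * \<omega> \<bar>x\<bar>)"
      using B by (intro mult_right_mono A f) auto
    finally have 1: "cmod (FT (- B) B (\<lambda>t. \<eta> 0 t * f t) (of_real x)) \<le> \<dots>" .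
    have 2: "cmod (\<phi> (of_real x)) \<le> pn k \<phi> * exp (r k * \<omega> \<bar>x\<bar>)" using pn_bound[OF \<phi>, of "of_real x"] by simp
    have "cmod (FT (- B) B (\<lambda>t. \<eta> 0 t * f t) (of_real x) * \<phi> (of_real x)) \<le>
       ((A * nrm q' k' f) * (exp (\<omega> 1) * (2 * B)) * (1 + \<bar>x\<bar>) * exp (- q * \<omega> \<bar>x\<bar>)) * (pn k \<phi> * exp (r k * \<omega> \<bar>x\<bar>))"
      unfolding norm_mult using A B by (intro mult_mono 1 2) auto
    also have "\<dots> = (A * nrm q' k' f * (exp (\<omega> 1) * (2 * B)) * pn k \<phi>) * ((1 + \<bar>x\<bar>) * exp (- (q - r k) * \<omega> \<bar>x\<bar>))"
      by (simp add: algebra_simps flip: exp_add)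
    also have "\<dots> \<le> (A * nrm q' k' f * (exp (\<omega> 1) * (2 * B)) * pn k \<phi>) * (C3 / (1 + x\<^sup>2))"
      using A B by (intro mult_left_mono C3) auto
    also have "\<dots> = C * pn k \<phi> * nrm q' k' f / (1 + x\<^sup>2)" by (simp add: C_def)
    finally show ?thesis .
  qed
  have int: "integrable lborel (\<lambda>x. FT (- B) B (\<lambda>t. \<eta> 0 t * f t) (of_real x) * \<phi> (of_real x))"
    if \<phi>: "\<phi> \<in> Pk \<omega> c r k" and f: "f \<in> U" for \<phi> f
  proof (rule integrable_bound_1_plus_square[where C = "C * pn k \<phi> * nrm q' k' f"])
    have "\<phi> holomorphic_on UNIV" using \<phi> by (simp add: Pk_iff)
    then show "(\<lambda>x. FT (- B) B (\<lambda>t. \<eta> 0 t * f t) (of_real x) * \<phi> (of_real x)) \<in> borel_measurable lborel"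
      using supported_FT_measurable[OF cutoff_mult(1)[OF \<eta> f]] holomorphic_real_measurable
      by simp
  qed (rule pt[OF \<phi> f])
  show thesis
  proof (rule that[of q' C k'])
    fix \<phi> f assume \<phi>: "\<phi> \<in> Pk \<omega> c r k" and f: "f \<in> U"
    show "integrable lborel (\<lambda>x. FT (- B) B (\<lambda>t. \<eta> 0 t * f t) (of_real x) * \<phi> (of_real x))"
      by (rule int[OF \<phi> f])
    have "cmod (LBINT x. FT (- B) B (\<lambda>t. \<eta> 0 t * f t) (of_real x) * \<phi> (of_real x)) \<le>
        (LBINT x. C * pn k \<phi> * nrm q' k' f * (1 / (1 + x\<^sup>2)))"
    proof (rule Bochner_Integration.integral_norm_bound_integral[OF int[OF \<phi> f]])
      show "integrable lborel (\<lambda>x. C * pn k \<phi> * nrm q' k' f * (1 / (1 + x\<^sup>2)))"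
        by (intro integrable_mult_right integrable_inverse_1_plus_square_lborel)
    qed (use pt[OF \<phi> f] in simp)
    also have "\<dots> = C * pn k \<phi> * nrm q' k' f * pi"
      by (simp only: integral_mult_right_zero integral_inverse_1_plus_square_lborel)
    finally have "cmod (LBINT x. FT (- B) B (\<lambda>t. \<eta> 0 t * f t) (of_real x) * \<phi> (of_real x)) / (2 * pi) \<le>
        C * pn k \<phi> * nrm q' k' f * pi / (2 * pi)" by (rule divide_right_mono) simp
    moreover have "cmod (Gfun \<eta> B \<phi> f) = cmod (LBINT x. FT (- B) B (\<lambda>t. \<eta> 0 t * f t) (of_real x) * \<phi> (of_real x)) / (2 * pi)"
      by (simp add: Gfun_def norm_divide norm_mult)
    moreover have "C * pn k \<phi> * nrm q' k' f * pi / (2 * pi) \<le> C * pn k \<phi> * nrm q' k' f"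
      using mult_nonneg_nonneg[OF mult_nonneg_nonneg[of C "pn k \<phi>"], of "nrm q' k' f"] Cpos by simp
    ultimately show "cmod (Gfun \<eta> B \<phi> f) \<le> C * pn k \<phi> * nrm q' k' f" by linarith
  qed (use q Cpos in auto)
qed

lemma Gfun_functional:
  assumes \<eta>: "cutoff k b B \<eta>" and \<phi>: "\<phi> \<in> Pk \<omega> c r k"
  shows "functional (Gfun \<eta> B \<phi>)"
proof -
  obtain q' k' C where q': "0 < q'" "q' < 1" and C: "0 < C"
    "\<And>\<phi> f. \<phi> \<in> Pk \<omega> c r k \<Longrightarrow> f \<in> U \<Longrightarrow> cmod (Gfun \<eta> B \<phi> f) \<le> C * pn k \<phi> * nrm q' k' f"
    "\<And>\<phi> f. \<phi> \<in> Pk \<omega> c r k \<Longrightarrow> f \<in> U \<Longrightarrow>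
      integrable lborel (\<lambda>x. FT (- B) B (\<lambda>t. \<eta> 0 t * f t) (of_real x) * \<phi> (of_real x))"
    by (rule Gfun_bound[OF \<eta>]) (rule that)
  have i: "(\<lambda>t. \<eta> 0 t * f t * exp (\<i> * z * of_real t)) integrable_on {- B..B}" if "f \<in> U" for f z
    using FT_integrable[OF supported_FT_continuous[OF cutoff_mult(1)[OF \<eta> that]]] .
  have add: "FT (- B) B (\<lambda>t. \<eta> 0 t * (f + g) t) z = FT (- B) B (\<lambda>t. \<eta> 0 t * f t) z + FT (- B) B (\<lambda>t. \<eta> 0 t * g t) z"
    if "f \<in> U" "g \<in> U" for f g z
    using Henstock_Kurzweil_Integration.integral_add[OF i[OF that(1), of z] i[OF that(2), of z]]
    by (simp add: FT_def distrib_left distrib_right)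
  have scale: "FT (- B) B (\<lambda>t. \<eta> 0 t * cscale b f t) z = b * FT (- B) B (\<lambda>t. \<eta> 0 t * f t) z" for b f z
    by (simp add: FT_def cscale_def mult_ac)
  show ?thesis unfolding functional_def
  proof (intro conjI ballI allI)
    fix f g assume fg: "f \<in> U" "g \<in> U"
    show "Gfun \<eta> B \<phi> (f + g) = Gfun \<eta> B \<phi> f + Gfun \<eta> B \<phi> g"
      unfolding Gfun_def add[OF fg] distrib_right
      using Bochner_Integration.integral_add[OF C(3)[OF \<phi> fg(1)] C(3)[OF \<phi> fg(2)]]
      by (simp only: add_divide_distrib)
  next
    fix b f
    show "Gfun \<eta> B \<phi> (cscale b f) = b * Gfun \<eta> B \<phi> f"
      by (simp add: Gfun_def scale mult.assoc)
  next
    have "cmod (Gfun \<eta> B \<phi> f) \<le> (C * pn k \<phi> + 1) * nrm q' k' f" if "f \<in> U" for f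
      using C(2)[OF \<phi> that] by (rule order_trans) (simp add: mult_right_mono)
    moreover have "0 < C * pn k \<phi> + 1" using C(1) by (simp add: add_nonneg_pos)
    ultimately show "\<exists>q k K. 0 < q \<and> q < 1 \<and> 0 < K \<and> (\<forall>f\<in>U. cmod (Gfun \<eta> B \<phi> f) \<le> K * nrm q k f)"
      using q' by blast
  qed
qed

text \<open>For a real frequency a translation reduces the claim to \<open>FT_inversion_gen\<close>
  for the cutoff at the point \<open>0\<close>, with \<open>\<psi>\<close> the translate of
  \<open>\<phi>\<close>. Its half-plane bounds hold because the derivative of \<open>\<eta>\<close>
  lives on \<open>b \<le> \<bar>t\<bar>\<close>, while \<open>\<phi>\<close> has exponential type
  only \<open>c k < b\<close> on the imaginary axis.\<close>

lemma Gfun_efun_real: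
  assumes \<eta>: "cutoff k b B \<eta>" and \<phi>: "\<phi> \<in> Pk \<omega> c r k"
  shows "Gfun \<eta> B \<phi> (efun (of_real z)) = \<phi> (of_real z)"
proof -
  have rk: "0 < r k" "r k < 1" using r_bounds[of k] by auto
  have hol: "\<phi> holomorphic_on UNIV" using \<phi> by (simp add: Pk_iff)
  have bB: "c k < b" "b < B" "0 < b" "B \<in> I" using \<eta> c_pos[of k] by (auto simp: cutoff_def)
  have der: "\<And>j t. (\<eta> j has_vector_derivative \<eta> (Suc j) t) (at t)"
    and \<eta>1: "\<And>t. \<bar>t\<bar> \<le> b \<Longrightarrow> \<eta> 0 t = 1" "\<And>j t. \<bar>t\<bar> \<le> b \<Longrightarrow> \<eta> (Suc j) t = 0"
    and \<eta>0: "\<And>j t. B \<le> \<bar>t\<bar> \<Longrightarrow> \<eta> j t = 0" using \<eta> by (auto simp: cutoff_def)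
  obtain C0 where C0: "\<And>j t. cmod (\<eta> j t) \<le> C0 * E 1 j" using \<eta> unfolding cutoff_def by blast
  have "0 \<le> C0 * E 1 0" using C0[of 0 0] norm_ge_zero order_trans by blast
  then have C00: "0 \<le> C0" using E_pos(1)[of 1 0] by (auto simp: zero_le_mult_iff dest: leD)
  have cont: "continuous_on {\<alpha>..\<beta>} (\<eta> j)" for \<alpha> \<beta> j
    by (rule continuous_on_if_vector_derivative, rule der)
  define q where "q = (r k + 1) / 2"
  have q: "0 < q" "r k < q" "q < 1" using rk by (auto simp: q_def)
  \<comment> \<open>The tower to be estimated starts at \<open>\<eta> (Suc 0)\<close>; the shift of
    the index weakens the bound from \<open>E 1\<close> to \<open>E q\<close>.\<close>
  obtain C1 where C1: "0 < C1" "\<And>j. E 1 (Suc j) \<le> C1 * E q j" using E_Suc[OF q(1,3)] by blast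
  have bd: "cmod (\<eta> (Suc j) t) \<le> (C0 * C1) * E q j" for j t
    using C0[of "Suc j" t] mult_left_mono[OF C1(2)[of j] C00] by (simp add: mult.assoc)
  \<comment> \<open>Translating \<open>\<phi>\<close> multiplies the exponent of its growth by some
    \<open>\<sigma> > 1\<close>; this one makes \<open>r k * \<sigma>\<close> the midpoint of
    \<open>r k\<close> and \<open>q\<close>, so the decay still wins.\<close>
  define \<sigma> where "\<sigma> = (1 + q / r k) / 2"
  have \<sigma>: "1 < \<sigma>" "r k * \<sigma> < q" using q rk by (auto simp: \<sigma>_def field_simps)
  obtain C2 where C2: "0 < C2" "\<And>x y. 0 \<le> x \<Longrightarrow> 0 \<le> y \<Longrightarrow> \<omega> (x + y) \<le> \<sigma> * (\<omega> x + \<omega> y) + C2"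
    using almost_subadditive[OF \<sigma>(1)] by blast
  obtain C3 where C3: "0 < C3" "\<And>x. 0 \<le> x \<Longrightarrow> \<omega> x \<le> 1 * x + C3" using omega_le_linear[of 1] by auto
  \<comment> \<open>On the imaginary axis \<open>\<omega>\<close> is charged to the gap between the
    type \<open>c k\<close> and the radius \<open>b\<close>.\<close>
  obtain C4 where C4: "0 < C4" "\<And>x. 0 \<le> x \<Longrightarrow> \<omega> x \<le> (b - c k) * x + C4" using omega_le_linear[of "b - c k"] bB by auto
  define \<psi> where "\<psi> \<zeta> = \<phi> (\<zeta> + of_real z)" for \<zeta>
  have hol\<psi>: "\<psi> holomorphic_on UNIV" unfolding \<psi>_def[abs_def]
    by (intro holomorphic_on_compose_gen[OF _ hol, unfolded o_def] holomorphic_intros) auto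
  define A1 where "A1 = pn k \<phi> * exp (\<bar>z\<bar> + C3)"
  define A2 where "A2 = pn k \<phi> * exp (r k * (\<sigma> * \<omega> \<bar>z\<bar> + C2))"
  define A where "A = max A1 A2"
  have type: "cmod (\<psi> \<zeta>) \<le> A * exp ((1 + c k) * cmod \<zeta>)" for \<zeta>
  proof -
    have "r k * \<omega> (cmod (\<zeta> + of_real z)) \<le> 1 * \<omega> (cmod (\<zeta> + of_real z))"
      using rk nonneg by (intro mult_right_mono) auto
    also have "\<dots> \<le> cmod (\<zeta> + of_real z) + C3" using C3(2)[of "cmod (\<zeta> + of_real z)"] by simp
    also have "\<dots> \<le> cmod \<zeta> + \<bar>z\<bar> + C3" using norm_triangle_ineq[of \<zeta> "of_real z"] by simp
    finally have "r k * \<omega> (cmod (\<zeta> + of_real z)) \<le> cmod \<zeta> + \<bar>z\<bar> + C3" .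
    moreover have "c k * \<bar>Im (\<zeta> + of_real z)\<bar> \<le> c k * cmod \<zeta>"
      using mult_left_mono[OF abs_Im_le_cmod[of \<zeta>] less_imp_le[OF c_pos[of k]]] by simp
    ultimately have "r k * \<omega> (cmod (\<zeta> + of_real z)) + c k * \<bar>Im (\<zeta> + of_real z)\<bar> \<le> (\<bar>z\<bar> + C3) + (1 + c k) * cmod \<zeta>"
      unfolding distrib_right by linarith
    then have "pn k \<phi> * exp (r k * \<omega> (cmod (\<zeta> + of_real z)) + c k * \<bar>Im (\<zeta> + of_real z)\<bar>) \<le> pn k \<phi> * exp ((\<bar>z\<bar> + C3) + (1 + c k) * cmod \<zeta>)"
      by (intro mult_left_mono) auto
    also have "\<dots> = A1 * exp ((1 + c k) * cmod \<zeta>)" by (simp only: A1_def exp_add mult.assoc)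
    also have "\<dots> \<le> A * exp ((1 + c k) * cmod \<zeta>)" by (intro mult_right_mono) (auto simp: A_def)
    finally show ?thesis using pn_bound[OF \<phi>, of "\<zeta> + of_real z"] unfolding \<psi>_def by linarith
  qed
  have re: "cmod (\<psi> (of_real x)) \<le> A * exp (r k * \<sigma> * \<omega> \<bar>x\<bar>)" for x
  proof -
    have "\<omega> \<bar>x + z\<bar> \<le> \<omega> (\<bar>x\<bar> + \<bar>z\<bar>)" by (intro omega_mono) auto
    also have "\<dots> \<le> \<sigma> * (\<omega> \<bar>x\<bar> + \<omega> \<bar>z\<bar>) + C2" by (rule C2) auto
    finally have "r k * \<omega> \<bar>x + z\<bar> \<le> r k * (\<sigma> * (\<omega> \<bar>x\<bar> + \<omega> \<bar>z\<bar>) + C2)" using rk by (intro mult_left_mono) auto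
    also have "\<dots> = r k * (\<sigma> * \<omega> \<bar>z\<bar> + C2) + r k * \<sigma> * \<omega> \<bar>x\<bar>" by (simp add: algebra_simps)
    finally have "pn k \<phi> * exp (r k * \<omega> \<bar>x + z\<bar>) \<le> pn k \<phi> * exp (r k * (\<sigma> * \<omega> \<bar>z\<bar> + C2) + r k * \<sigma> * \<omega> \<bar>x\<bar>)"
      by (intro mult_left_mono) auto
    also have "\<dots> = A2 * exp (r k * \<sigma> * \<omega> \<bar>x\<bar>)" by (simp only: A2_def exp_add mult.assoc)
    also have "\<dots> \<le> A * exp (r k * \<sigma> * \<omega> \<bar>x\<bar>)" by (intro mult_right_mono) (auto simp: A_def)
    finally have "pn k \<phi> * exp (r k * \<omega> \<bar>x + z\<bar>) \<le> A * exp (r k * \<sigma> * \<omega> \<bar>x\<bar>)" .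
    moreover have "cmod (\<phi> (of_real (x + z))) \<le> pn k \<phi> * exp (r k * \<omega> \<bar>x + z\<bar>)"
      using pn_bound[OF \<phi>, of "of_real (x + z)"] by (simp del: of_real_add)
    ultimately show ?thesis by (simp add: \<psi>_def)
  qed
  have side: "\<exists>M. (\<forall>w. 0 \<le> s * Im w \<longrightarrow> cmod (FT \<alpha> \<beta> (\<eta> (Suc 0)) w * \<psi> w) \<le> M) \<and>
      (\<forall>x. cmod (FT \<alpha> \<beta> (\<eta> (Suc 0)) (of_real x) * \<psi> (of_real x)) \<le> M / (1 + x\<^sup>2))"
    if s: "s = 1 \<or> s = (- 1 :: real)" and ab: "\<alpha> \<le> \<beta>" "\<And>t. \<alpha> \<le> t \<Longrightarrow> t \<le> \<beta> \<Longrightarrow> b \<le> s * t"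
      and ends: "\<And>j. \<eta> (Suc j) \<alpha> = 0" "\<And>j. \<eta> (Suc j) \<beta> = 0" for s \<alpha> \<beta>
  proof -
    have im: "cmod (FT \<alpha> \<beta> (\<eta> (Suc 0)) (\<i> * of_real (s * y)) * \<psi> (\<i> * of_real (s * y))) \<le>
        (C0 * E 1 1 * (\<beta> - \<alpha>)) * (pn k \<phi> * exp ((b - c k) * \<bar>z\<bar> + C4))" if y: "0 \<le> y" for y
    proof -
      have 1: "cmod (FT \<alpha> \<beta> (\<eta> (Suc 0)) (\<i> * of_real (s * y))) \<le> C0 * E 1 1 * exp (- (b * y)) * (\<beta> - \<alpha>)"
      proof (rule norm_FT_le[OF cont ab(1)])
        show "cmod (\<eta> (Suc 0) t) \<le> C0 * E 1 1" for t using C0[of "Suc 0" t] by simp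
        fix t assume "\<alpha> \<le> t" "t \<le> \<beta>"
        then have "b * y \<le> s * t * y" using ab(2) y by (intro mult_right_mono) auto
        then show "exp (- (Im (\<i> * of_real (s * y)) * t)) \<le> exp (- (b * y))" by (simp add: mult_ac)
      qed
      have "cmod (\<i> * of_real (s * y) + of_real z) \<le> y + \<bar>z\<bar>"
        using norm_triangle_ineq[of "\<i> * of_real (s * y)" "of_real z"] s y by (elim disjE) (simp_all add: norm_mult)
      then have "\<omega> (cmod (\<i> * of_real (s * y) + of_real z)) \<le> \<omega> (y + \<bar>z\<bar>)" by (intro omega_mono) auto
      also have "\<dots> \<le> (b - c k) * (y + \<bar>z\<bar>) + C4" using y by (intro C4) auto
      finally have w: "\<omega> (cmod (\<i> * of_real (s * y) + of_real z)) \<le> (b - c k) * (y + \<bar>z\<bar>) + C4" .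
      have "r k * \<omega> (cmod (\<i> * of_real (s * y) + of_real z)) \<le> 1 * \<omega> (cmod (\<i> * of_real (s * y) + of_real z))"
        using rk by (intro mult_right_mono nonneg) auto
      then have "r k * \<omega> (cmod (\<i> * of_real (s * y) + of_real z)) \<le> (b - c k) * (y + \<bar>z\<bar>) + C4"
        using w by linarith
      moreover have "c k * \<bar>Im (\<i> * of_real (s * y) + of_real z)\<bar> = c k * y" using s y by (elim disjE) simp_all
      ultimately have "r k * \<omega> (cmod (\<i> * of_real (s * y) + of_real z)) + c k * \<bar>Im (\<i> * of_real (s * y) + of_real z)\<bar> \<le> ((b - c k) * \<bar>z\<bar> + C4) + b * y"
        unfolding left_diff_distrib distrib_left distrib_right by linarith
      then have "pn k \<phi> * exp (r k * \<omega> (cmod (\<i> * of_real (s * y) + of_real z)) + c k * \<bar>Im (\<i> * of_real (s * y) + of_real z)\<bar>)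
         \<le> pn k \<phi> * exp (((b - c k) * \<bar>z\<bar> + C4) + b * y)" by (intro mult_left_mono) auto
      then have 2: "cmod (\<psi> (\<i> * of_real (s * y))) \<le> pn k \<phi> * exp (((b - c k) * \<bar>z\<bar> + C4) + b * y)"
        using pn_bound[OF \<phi>, of "\<i> * of_real (s * y) + of_real z"] unfolding \<psi>_def by linarith
      have "cmod (FT \<alpha> \<beta> (\<eta> (Suc 0)) (\<i> * of_real (s * y)) * \<psi> (\<i> * of_real (s * y))) \<le>
        (C0 * E 1 1 * exp (- (b * y)) * (\<beta> - \<alpha>)) * (pn k \<phi> * exp (((b - c k) * \<bar>z\<bar> + C4) + b * y))"
        unfolding norm_mult[of "FT _ _ _ _"] using C00 ab(1) by (intro mult_mono 1 2) auto
      also have "\<dots> = (C0 * E 1 1 * (\<beta> - \<alpha>)) * (pn k \<phi> * (exp (- (b * y)) * exp (((b - c k) * \<bar>z\<bar> + C4) + b * y)))"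
        by (simp only: mult_ac)
      also have "exp (- (b * y)) * exp (((b - c k) * \<bar>z\<bar> + C4) + b * y) = exp ((b - c k) * \<bar>z\<bar> + C4)"
        by (simp flip: exp_add)
      finally show ?thesis .
    qed
    obtain M where "0 < M"
      "\<And>w. 0 \<le> s * Im w \<Longrightarrow> cmod (FT \<alpha> \<beta> (\<eta> (Suc 0)) w * \<psi> w) \<le> M"
      "\<And>x. cmod (FT \<alpha> \<beta> (\<eta> (Suc 0)) (of_real x) * \<psi> (of_real x)) \<le> M / (1 + x\<^sup>2)"
      by (rule half_plane_bound[where G = "\<lambda>j. \<eta> (Suc j)" and N = "C0 * C1" and A = A and T = "1 + c k" and \<rho> = "r k * \<sigma>"
            and q = q and s = s and \<psi> = \<psi> and \<alpha> = \<alpha> and \<beta> = \<beta> and M = "(C0 * E 1 1 * (\<beta> - \<alpha>)) * (pn k \<phi> * exp ((b - c k) * \<bar>z\<bar> + C4))"],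
          rule ab(1), rule der, rule ends, rule ends, rule q(1), rule less_imp_le[OF q(3)], rule bd, rule hol\<psi>,
          rule type, rule re, rule \<sigma>(2), rule s, erule im) (rule that)
    then show ?thesis by blast
  qed
  \<comment> \<open>The derivative of the cutoff vanishes on \<open>[-b; b]\<close>, so the halves
    of \<open>[-B; B]\<close> reduce to the outer pieces to which \<open>side\<close>
    applies.\<close>
  have zero: "FT \<alpha> \<beta> (\<eta> (Suc 0)) w = 0" if "- b \<le> \<alpha>" "\<beta> \<le> b" for \<alpha> \<beta> w
  proof -
    have "FT \<alpha> \<beta> (\<eta> (Suc 0)) = FT \<alpha> \<beta> (\<lambda>_. 0)"
      by (rule FT_cong) (use \<eta>1(2)[of _ 0] that in \<open>auto simp: abs_le_iff\<close>)
    then show ?thesis by (simp add: FT_def)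
  qed
  have right: "FT 0 B (\<eta> (Suc 0)) = FT b B (\<eta> (Suc 0))"
    using FT_split[OF cont, of 0 b B] zero[of 0 b] bB by (auto simp: fun_eq_iff)
  have left: "FT (- B) 0 (\<eta> (Suc 0)) = FT (- B) (- b) (\<eta> (Suc 0))"
    using FT_split[OF cont, of "- B" "- b" 0] zero[of "- b" 0] bB by (auto simp: fun_eq_iff)
  obtain M1 where M1: "\<And>w. 0 \<le> Im w \<Longrightarrow> cmod (FT 0 B (\<eta> (Suc 0)) w * \<psi> w) \<le> M1"
      "\<And>x. cmod (FT 0 B (\<eta> (Suc 0)) (of_real x) * \<psi> (of_real x)) \<le> M1 / (1 + x\<^sup>2)"
  proof -
    have "\<exists>M. (\<forall>w. 0 \<le> 1 * Im w \<longrightarrow> cmod (FT b B (\<eta> (Suc 0)) w * \<psi> w) \<le> M) \<and>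
      (\<forall>x. cmod (FT b B (\<eta> (Suc 0)) (of_real x) * \<psi> (of_real x)) \<le> M / (1 + x\<^sup>2))"
      by (rule side) (use bB \<eta>1(2)[of b] \<eta>0[of B] in simp_all)
    then obtain M where "(\<forall>w. 0 \<le> 1 * Im w \<longrightarrow> cmod (FT b B (\<eta> (Suc 0)) w * \<psi> w) \<le> M)"
      "(\<forall>x. cmod (FT b B (\<eta> (Suc 0)) (of_real x) * \<psi> (of_real x)) \<le> M / (1 + x\<^sup>2))" by blast
    then show thesis by (intro that[of M]) (simp_all add: right)
  qed
  obtain M2 where M2: "\<And>w. Im w \<le> 0 \<Longrightarrow> cmod (FT (- B) 0 (\<eta> (Suc 0)) w * \<psi> w) \<le> M2"
      "\<And>x. cmod (FT (- B) 0 (\<eta> (Suc 0)) (of_real x) * \<psi> (of_real x)) \<le> M2 / (1 + x\<^sup>2)"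
  proof -
    have "\<exists>M. (\<forall>w. 0 \<le> - 1 * Im w \<longrightarrow> cmod (FT (- B) (- b) (\<eta> (Suc 0)) w * \<psi> w) \<le> M) \<and>
      (\<forall>x. cmod (FT (- B) (- b) (\<eta> (Suc 0)) (of_real x) * \<psi> (of_real x)) \<le> M / (1 + x\<^sup>2))"
      by (rule side) (use bB \<eta>1(2)[of "- b"] \<eta>0[of "- B"] in simp_all)
    then obtain M where "(\<forall>w. 0 \<le> - 1 * Im w \<longrightarrow> cmod (FT (- B) (- b) (\<eta> (Suc 0)) w * \<psi> w) \<le> M)"
      "(\<forall>x. cmod (FT (- B) (- b) (\<eta> (Suc 0)) (of_real x) * \<psi> (of_real x)) \<le> M / (1 + x\<^sup>2))" by blast
    then show thesis by (intro that[of M]) (simp_all add: left)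
  qed
  define M where "M = max M1 M2"
  have M0: "0 \<le> M" using order_trans[OF norm_ge_zero M1(1)[of 0]] by (simp add: M_def)
  have dec: "M' / (1 + x\<^sup>2) \<le> 2 * M / (1 + \<bar>x\<bar>)" if "M' \<le> M" for M' x
  proof -
    have "0 \<le> (\<bar>x\<bar> - 1)\<^sup>2" by simp
    then have "2 * \<bar>x\<bar> \<le> 1 + x\<^sup>2" by (simp add: power2_diff)
    moreover have "1 + x\<^sup>2 \<le> 1 + 2 * x\<^sup>2" by simp
    ultimately have "2 * \<bar>x\<bar> \<le> 1 + 2 * x\<^sup>2" by (rule order_trans)
    then have "1 + \<bar>x\<bar> \<le> 2 * (1 + x\<^sup>2)" by simp
    from mult_left_mono[OF this M0] have "M * (1 + \<bar>x\<bar>) \<le> (2 * M) * (1 + x\<^sup>2)" by (simp only: mult_ac)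
    then have "M / (1 + x\<^sup>2) \<le> 2 * M / (1 + \<bar>x\<bar>)"
      by (subst pos_divide_le_eq) (auto simp: add_pos_nonneg pos_le_divide_eq)
    moreover have "M' / (1 + x\<^sup>2) \<le> M / (1 + x\<^sup>2)" using that by (intro divide_right_mono) auto
    ultimately show ?thesis by linarith
  qed
  have "(LBINT t. FT (- B) B (\<eta> 0) (of_real t) * exp (- (\<i> * of_real t * of_real 0)) * \<psi> (of_real t)) = 2 * of_real pi * \<eta> 0 0 * \<psi> 0"
  proof (rule FT_inversion_gen[where M = M and C = "2 * M" and g' = "\<eta> (Suc 0)"])
    show "cmod (FT 0 B (\<eta> (Suc 0)) w * exp (- (\<i> * w * of_real 0)) * \<psi> w) \<le> M" if "0 \<le> Im w" for w
      using M1(1)[OF that] by (simp add: M_def)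
    show "cmod (FT (- B) 0 (\<eta> (Suc 0)) w * exp (- (\<i> * w * of_real 0)) * \<psi> w) \<le> M" if "Im w \<le> 0" for w
      using M2(1)[OF that] by (simp add: M_def)
    show "cmod (FT 0 B (\<eta> (Suc 0)) (of_real t) * exp (- (\<i> * of_real t * of_real 0)) * \<psi> (of_real t)) \<le> 2 * M / (1 + \<bar>t\<bar>)" for t
      using M1(2)[of t] dec[of M1 t] by (simp add: M_def)
    show "cmod (FT (- B) 0 (\<eta> (Suc 0)) (of_real t) * exp (- (\<i> * of_real t * of_real 0)) * \<psi> (of_real t)) \<le> 2 * M / (1 + \<bar>t\<bar>)" for t
      using M2(2)[of t] dec[of M2 t] by (simp add: M_def)
  qed (use bB der cont hol\<psi> \<eta>0[of B] \<eta>0[of "- B"] in auto)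
  then have inv: "(LBINT t. FT (- B) B (\<eta> 0) (of_real t) * \<psi> (of_real t)) = 2 * of_real pi * \<phi> (of_real z)"
    using \<eta>1(1)[of 0] bB by (simp add: \<psi>_def)
  \<comment> \<open>Multiplication by a real exponential is a translation on the Fourier
    side.\<close>
  have ft: "FT (- B) B (\<lambda>t. \<eta> 0 t * efun (of_real z) t) (of_real (z + 1 * x)) = FT (- B) B (\<eta> 0) (of_real x)" for x
  proof -
    have "\<eta> 0 t * efun (of_real z) t * exp (\<i> * of_real (z + 1 * x) * of_real t) = \<eta> 0 t * exp (\<i> * of_real x * of_real t)"
      if "- B \<le> t" "t \<le> B" for t
    proof -
      have "- B \<in> I" using bB I_Union[of B] I_Union[of "- B"] by simp
      then have "t \<in> I" using I_convex bB(4) that by blast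
      then show ?thesis by (simp add: efun_def algebra_simps flip: exp_add)
    qed
    then show ?thesis unfolding FT_def by (intro Henstock_Kurzweil_Integration.integral_cong) auto
  qed
  have "(LBINT x. FT (- B) B (\<lambda>t. \<eta> 0 t * efun (of_real z) t) (of_real x) * \<phi> (of_real x)) =
      \<bar>1\<bar> *\<^sub>R (LBINT x. FT (- B) B (\<lambda>t. \<eta> 0 t * efun (of_real z) t) (of_real (z + 1 * x)) * \<phi> (of_real (z + 1 * x)))"
    by (rule lborel_integral_real_affine) simp
  also have "\<dots> = (LBINT x. FT (- B) B (\<eta> 0) (of_real x) * \<psi> (of_real x))"
    unfolding ft by (simp add: \<psi>_def add.commute)
  finally show ?thesis unfolding Gfun_def inv by simp
qed

text \<open>The identity theorem, used to pass from real exponentials, where translation is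
  available, to complex ones.\<close>

lemma entire_eq_of_eq_on_reals:
  assumes "f holomorphic_on UNIV" "g holomorphic_on UNIV" "\<And>x::real. f (of_real x) = g (of_real x)"
  shows "f z = g z"
proof -
  have "(\<lambda>z. f z - g z) z = 0"
  proof (rule analytic_continuation[where f = "\<lambda>z. f z - g z" and S = UNIV and U = "range complex_of_real" and \<xi> = 0])
    show "0 islimpt range complex_of_real"
      unfolding islimpt_approachable
    proof (intro allI impI)
      fix e :: real assume "0 < e"
      then show "\<exists>x'\<in>range complex_of_real. x' \<noteq> 0 \<and> dist x' 0 < e"
        by (intro bexI[OF _ rangeI[of _ "e / 2"]]) (auto simp: norm_divide)
    qed
  qed (use assms in \<open>auto intro: holomorphic_intros\<close>)
  then show ?thesis by simp
qed

lemma Gfun_efun: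
  assumes \<eta>: "cutoff k b B \<eta>" and \<phi>: "\<phi> \<in> Pk \<omega> c r k"
  shows "Gfun \<eta> B \<phi> (efun z) = \<phi> z"
  using entire_eq_of_eq_on_reals[OF functional_efun_holomorphic[OF Gfun_functional[OF assms]], of \<phi> z]
    Gfun_efun_real[OF assms] \<phi> by (simp add: Pk_iff)

end

section \<open>Indicators and supports of functionals\<close>

lemma rcis_imaginary: "s = 1 \<or> s = (- 1 :: real) \<Longrightarrow> rcis \<rho> (s * (pi / 2)) = \<i> * of_real (s * \<rho>)"
  by (elim disjE) (auto simp: complex_eq_iff rcis_def)

text \<open>The inequality \<open>indicator_fun \<phi> (s * (pi / 2)) \<le> m\<close> freed from
  logarithms, in a form valid on the whole half-axis; \<open>s = 1\<close> stands for the upper and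
  \<open>s = - 1\<close> for the lower one.\<close>

definition imaginary_growth :: "(complex \<Rightarrow> complex) \<Rightarrow> real \<Rightarrow> real \<Rightarrow> bool" where
  "imaginary_growth \<phi> s m \<longleftrightarrow> (\<forall>\<epsilon>>0. \<exists>C. \<forall>y\<ge>0. cmod (\<phi> (\<i> * of_real (s * y))) \<le> C * exp ((m + \<epsilon>) * y))"

text \<open>The limit superior controls large \<open>y\<close>; on the remaining compact interval
  continuity supplies the constant.\<close>

lemma imaginary_growth_if_indicator_le:
  assumes \<phi>: "continuous_on UNIV \<phi>" and s: "s = 1 \<or> s = (- 1 :: real)"
    and le: "indicator_fun \<phi> (s * (pi / 2)) \<le> ereal m"
  shows "imaginary_growth \<phi> s m"
  unfolding imaginary_growth_def
proof (intro allI impI)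
  fix \<epsilon> :: real assume \<epsilon>: "0 < \<epsilon>"
  have "ereal m < ereal (m + \<epsilon>)" using \<epsilon> by simp
  with le have "indicator_fun \<phi> (s * (pi / 2)) < ereal (m + \<epsilon>)" by (rule le_less_trans)
  then have "eventually (\<lambda>\<rho>. (if \<phi> (rcis \<rho> (s * (pi / 2))) = 0 then - \<infinity> else ereal (ln (cmod (\<phi> (rcis \<rho> (s * (pi / 2))))) / \<rho>)) < ereal (m + \<epsilon>)) at_top"
    unfolding indicator_fun_def by (rule Limsup_lessD)
  then obtain R0 where R0: "\<And>\<rho>. R0 \<le> \<rho> \<Longrightarrow> (if \<phi> (\<i> * of_real (s * \<rho>)) = 0 then - \<infinity> else ereal (ln (cmod (\<phi> (\<i> * of_real (s * \<rho>)))) / \<rho>)) < ereal (m + \<epsilon>)"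
    unfolding eventually_at_top_linorder rcis_imaginary[OF s] by blast
  define R where "R = max R0 1"
  have big: "cmod (\<phi> (\<i> * of_real (s * \<rho>))) \<le> exp ((m + \<epsilon>) * \<rho>)" if "R \<le> \<rho>" for \<rho>
  proof (cases "\<phi> (\<i> * of_real (s * \<rho>)) = 0")
    case False
    have \<rho>: "R0 \<le> \<rho>" "0 < \<rho>" using that by (auto simp: R_def)
    have "ln (cmod (\<phi> (\<i> * of_real (s * \<rho>)))) / \<rho> < m + \<epsilon>" using R0[OF \<rho>(1)] False by simp
    then have "ln (cmod (\<phi> (\<i> * of_real (s * \<rho>)))) < (m + \<epsilon>) * \<rho>" using \<rho>(2) by (simp add: pos_divide_less_eq)
    then have "exp (ln (cmod (\<phi> (\<i> * of_real (s * \<rho>))))) \<le> exp ((m + \<epsilon>) * \<rho>)" by simp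
    then show ?thesis using False by (subst (asm) exp_ln) auto
  qed simp
  have "continuous_on {0..R} (\<lambda>y. cmod (\<phi> (\<i> * of_real (s * y))))"
    by (intro continuous_on_norm continuous_on_compose2[OF \<phi>] continuous_intros) auto
  then have "compact ((\<lambda>y. cmod (\<phi> (\<i> * of_real (s * y)))) ` {0..R})"
    by (intro compact_continuous_image) auto
  then have "bounded ((\<lambda>y. cmod (\<phi> (\<i> * of_real (s * y)))) ` {0..R})"
    by (rule compact_imp_bounded)
  then obtain B where B: "0 < B" "\<And>y. 0 \<le> y \<Longrightarrow> y \<le> R \<Longrightarrow> cmod (\<phi> (\<i> * of_real (s * y))) \<le> B"
    unfolding bounded_pos by auto
  define C where "C = 1 + B * exp (\<bar>m + \<epsilon>\<bar> * R)"
  have "cmod (\<phi> (\<i> * of_real (s * y))) \<le> C * exp ((m + \<epsilon>) * y)" if "0 \<le> y" for y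
  proof (cases "R \<le> y")
    case True
    have "1 * exp ((m + \<epsilon>) * y) \<le> C * exp ((m + \<epsilon>) * y)" using B(1) by (intro mult_right_mono) (auto simp: C_def)
    then show ?thesis using big[OF True] by linarith
  next
    case False
    have "\<bar>m + \<epsilon>\<bar> * y \<le> \<bar>m + \<epsilon>\<bar> * R" using False by (intro mult_left_mono) auto
    moreover have "- ((m + \<epsilon>) * y) \<le> \<bar>m + \<epsilon>\<bar> * y"
      using abs_ge_minus_self[of "(m + \<epsilon>) * y"] that unfolding abs_mult by simp
    ultimately have "0 \<le> \<bar>m + \<epsilon>\<bar> * R + (m + \<epsilon>) * y" by linarith
    then have "B * 1 \<le> B * (exp (\<bar>m + \<epsilon>\<bar> * R) * exp ((m + \<epsilon>) * y))"
      using B(1) by (intro mult_left_mono) (auto simp flip: exp_add)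
    also have "\<dots> \<le> C * exp ((m + \<epsilon>) * y)" by (simp add: C_def algebra_simps)
    finally show ?thesis using B(2)[OF that] False by simp
  qed
  then show "\<exists>C. \<forall>y\<ge>0. cmod (\<phi> (\<i> * of_real (s * y))) \<le> C * exp ((m + \<epsilon>) * y)" by blast
qed

lemma indicator_le_if_imaginary_growth:
  assumes s: "s = 1 \<or> s = (- 1 :: real)" and g: "imaginary_growth \<phi> s m"
  shows "indicator_fun \<phi> (s * (pi / 2)) \<le> ereal m"
proof (rule ereal_le_epsilon2)
  fix e :: real assume e: "0 < e"
  obtain C where C: "\<And>y. 0 \<le> y \<Longrightarrow> cmod (\<phi> (\<i> * of_real (s * y))) \<le> C * exp ((m + e / 2) * y)"
    using g half_gt_zero[OF e] unfolding imaginary_growth_def by blast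
  have C0: "0 \<le> C" using order_trans[OF norm_ge_zero C[of 0]] by simp
  define R where "R = max 1 (2 * ln (C + 1) / e)"
  have "(if \<phi> (rcis \<rho> (s * (pi / 2))) = 0 then - \<infinity> else ereal (ln (cmod (\<phi> (rcis \<rho> (s * (pi / 2))))) / \<rho>)) \<le> ereal m + ereal e"
    (is "?l \<rho> \<le> _") if \<rho>: "R \<le> \<rho>" for \<rho>
  proof (cases "\<phi> (rcis \<rho> (s * (pi / 2))) = 0")
    case False
    then have n0: "0 < cmod (\<phi> (\<i> * of_real (s * \<rho>)))" unfolding rcis_imaginary[OF s] by simp
    have "1 \<le> \<rho>" "2 * ln (C + 1) / e \<le> \<rho>" using \<rho> by (auto simp: R_def)
    then have \<rho>': "0 < \<rho>" "ln (C + 1) \<le> e / 2 * \<rho>" using e by (simp_all add: field_simps)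
    have "cmod (\<phi> (\<i> * of_real (s * \<rho>))) \<le> (C + 1) * exp ((m + e / 2) * \<rho>)"
      using C[of \<rho>] \<rho>'(1) by (simp add: distrib_right add_increasing2)
    then have "ln (cmod (\<phi> (\<i> * of_real (s * \<rho>)))) \<le> ln ((C + 1) * exp ((m + e / 2) * \<rho>))"
      using n0 C0 by (subst ln_le_cancel_iff) (auto intro!: mult_pos_pos)
    also have "\<dots> = ln (C + 1) + (m + e / 2) * \<rho>" using C0 by (subst ln_mult) auto
    also have "\<dots> \<le> (m + e) * \<rho>" using \<rho>'(2) by (simp add: algebra_simps)
    finally show ?thesis using False \<rho>'(1) unfolding rcis_imaginary[OF s] by (simp add: pos_divide_le_eq)
  qed simp
  then have "\<forall>\<^sub>F \<rho> in at_top. ?l \<rho> \<le> ereal m + ereal e"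
    unfolding eventually_at_top_linorder by blast
  then show "indicator_fun \<phi> (s * (pi / 2)) \<le> ereal m + ereal e"
    unfolding indicator_fun_def by (rule Limsup_bounded)
qed

text \<open>In contrast to \<open>norm_FT_le\<close> the product with the exponential is bounded as
  a whole, which pays when \<open>g\<close> vanishes where the exponential is large.\<close>

lemma norm_FT_le':
  assumes c: "continuous_on {\<alpha>..\<beta>} g" and ab: "\<alpha> \<le> \<beta>"
    and le: "\<And>t. \<alpha> \<le> t \<Longrightarrow> t \<le> \<beta> \<Longrightarrow> cmod (g t) * exp (- (Im \<zeta> * t)) \<le> M"
  shows "cmod (FT \<alpha> \<beta> g \<zeta>) \<le> M * (\<beta> - \<alpha>)"
  unfolding FT_def
proof (rule integral_bound[OF ab])
  show "continuous_on {\<alpha>..\<beta>} (\<lambda>t. g t * exp (\<i> * \<zeta> * of_real t))"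
    by (intro continuous_intros c)
  show "cmod (g t * exp (\<i> * \<zeta> * of_real t)) \<le> M" if "t \<in> {\<alpha>..\<beta>}" for t
    using le[of t] that by (simp add: norm_mult)
qed

section \<open>Paley-Wiener statements for functionals\<close>

context ultra_data
begin

lemma functional_Pk:
  assumes "functional S"
  obtains k where "(\<lambda>z. S (efun z)) \<in> Pk \<omega> c r k"
  using functional_in_P[OF assms] unfolding P_space_def by blast

lemma Pk_type:
  assumes "\<phi> \<in> Pk \<omega> c r k"
  obtains A where "\<And>z. cmod (\<phi> z) \<le> A * exp ((1 + c k) * cmod z)"
proof -
  obtain C where C: "0 < C" "\<And>x. 0 \<le> x \<Longrightarrow> \<omega> x \<le> 1 * x + C" using omega_le_linear[of 1] by auto
  have "cmod (\<phi> z) \<le> pn k \<phi> * exp C * exp ((1 + c k) * cmod z)" for z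
  proof -
    have "r k * \<omega> (cmod z) \<le> 1 * \<omega> (cmod z)" using r_bounds[of k] nonneg[of "cmod z"] by (intro mult_right_mono) auto
    moreover have "c k * \<bar>Im z\<bar> \<le> c k * cmod z" using c_pos[of k] abs_Im_le_cmod[of z] by (intro mult_left_mono) auto
    ultimately have "r k * \<omega> (cmod z) + c k * \<bar>Im z\<bar> \<le> C + (1 + c k) * cmod z"
      using C(2)[of "cmod z"] by (simp add: distrib_right)
    then have "pn k \<phi> * exp (r k * \<omega> (cmod z) + c k * \<bar>Im z\<bar>) \<le> pn k \<phi> * exp (C + (1 + c k) * cmod z)"
      by (intro mult_left_mono) auto
    also have "\<dots> = pn k \<phi> * exp C * exp ((1 + c k) * cmod z)" by (simp add: exp_add)
    finally show ?thesis using pn_bound[OF assms, of z] by linarith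
  qed
  then show thesis by (rule that)
qed

text \<open>In the Fourier representation of \<open>S f\<close> the integrand, damped by \<open>exp (\<i> * s * \<delta> * z)\<close>, is bounded and
  holomorphic on a half-plane, so its integral over the real line vanishes; then \<open>\<delta> \<longlongrightarrow> 0\<close>.\<close>

lemma functional_zero_on_half_line:
  assumes S: "functional S" and s: "s = 1 \<or> s = (- 1 :: real)"
    and gr: "imaginary_growth (\<lambda>z. S (efun z)) s m"
    and f: "f \<in> U" and f0: "\<And>t. s * t \<le> m \<Longrightarrow> f t = 0"
  shows "S f = 0"
proof -
  obtain q k K where b: "\<And>f. f \<in> U \<Longrightarrow> cmod (S f) \<le> K * nrm q k f" "0 < q" "q < 1" "0 < K"
    by (rule functional_bound[OF S]) (rule that)
  obtain b0 B \<eta> where \<eta>: "cutoff k b0 B \<eta>" using cutoff_ex by blast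
  define g where "g = (\<lambda>x. \<eta> 0 x * f x)"
  define \<phi> where "\<phi> = (\<lambda>z. S (efun z))"
  have g: "supported B g" unfolding g_def by (rule cutoff_mult(1)[OF \<eta> f])
  have Sf: "S f = (LBINT x. FT (- B) B g (of_real x) * \<phi> (of_real x)) / (2 * of_real pi)"
    unfolding g_def \<phi>_def by (rule functional_cutoff(1)[OF S b \<eta> f])
  have int: "integrable lborel (\<lambda>x. FT (- B) B g (of_real x) * \<phi> (of_real x))"
    unfolding g_def \<phi>_def by (rule functional_cutoff(2)[OF S b \<eta> f])
  obtain k1 where "(\<lambda>z. S (efun z)) \<in> Pk \<omega> c r k1" by (rule functional_Pk[OF S])
  then have Pk1: "\<phi> \<in> Pk \<omega> c r k1" by (simp only: \<phi>_def)
  have hol: "\<phi> holomorphic_on UNIV" using Pk1 by (simp add: Pk_iff)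
  obtain A0 where A0: "\<And>z. cmod (\<phi> z) \<le> A0 * exp ((1 + c k1) * cmod z)" using Pk_type[OF Pk1] by blast
  have B: "0 < B" "B \<in> I" using g by (auto simp: supported_def)
  obtain k2 where k2: "B \<le> c k2" using B(2) I_Union[of B] abs_ge_self order_trans by blast
  define q1 where "q1 = (1 + r k1) / 2"
  have q1: "0 < q1" "q1 < 1" "q1 \<le> 1" "r k1 < q1" using r_bounds[of k1] by (auto simp: q1_def)
  have zero: "(LBINT x. FT (- B) B g (of_real x) * (\<phi> (of_real x) * exp (\<i> * of_real (s * \<delta>) * of_real x))) = 0"
    if \<delta>: "0 < \<delta>" for \<delta>
  proof -
    define \<psi> where "\<psi> z = \<phi> z * exp (\<i> * of_real (s * \<delta>) * z)" for z
    have hol\<psi>: "\<psi> holomorphic_on UNIV" unfolding \<psi>_def by (intro holomorphic_intros hol)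
    \<comment> \<open>The excess over \<open>m\<close> in the growth is taken equal to the damping
      \<open>\<delta>\<close>, so that the two cancel on the imaginary half-axis.\<close>
    obtain C where C: "\<And>y. 0 \<le> y \<Longrightarrow> cmod (\<phi> (\<i> * of_real (s * y))) \<le> C * exp ((m + \<delta>) * y)"
      using gr \<delta> unfolding imaginary_growth_def \<phi>_def by blast
    have C0: "0 \<le> C" using order_trans[OF norm_ge_zero C[of 0]] by simp
    have ne: "cmod (exp (\<i> * of_real (s * \<delta>) * z)) \<le> exp (\<delta> * cmod z)" for z
    proof -
      have "- (s * \<delta> * Im z) \<le> \<bar>s * \<delta> * Im z\<bar>" by linarith
      also have "\<dots> = \<delta> * \<bar>Im z\<bar>" using s \<delta> by (elim disjE) (simp_all add: abs_mult)
      also have "\<dots> \<le> \<delta> * cmod z" using \<delta> abs_Im_le_cmod by (intro mult_left_mono) auto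
      finally show ?thesis by simp
    qed
    define A where "A = max A0 (pn k1 \<phi>)"
    have type: "cmod (\<psi> z) \<le> A * exp ((1 + c k1 + \<delta>) * cmod z)" for z
    proof -
      have "cmod (\<psi> z) \<le> (A * exp ((1 + c k1) * cmod z)) * exp (\<delta> * cmod z)"
        unfolding \<psi>_def norm_mult
      proof (intro mult_mono ne)
        have "A0 * exp ((1 + c k1) * cmod z) \<le> A * exp ((1 + c k1) * cmod z)"
          by (intro mult_right_mono) (auto simp: A_def)
        then show "cmod (\<phi> z) \<le> A * exp ((1 + c k1) * cmod z)" using A0[of z] by linarith
        then show "0 \<le> A * exp ((1 + c k1) * cmod z)" using norm_ge_zero order_trans by blast
      qed auto
      then show ?thesis by (simp only: mult.assoc distrib_right flip: exp_add)
    qed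
    have re: "cmod (\<psi> (of_real x)) \<le> A * exp (r k1 * \<omega> \<bar>x\<bar>)" for x
    proof -
      have "cmod (\<psi> (of_real x)) = cmod (\<phi> (of_real x))" by (simp add: \<psi>_def norm_mult)
      also have "\<dots> \<le> pn k1 \<phi> * exp (r k1 * \<omega> \<bar>x\<bar>)" using pn_bound[OF Pk1, of "of_real x"] by simp
      also have "\<dots> \<le> A * exp (r k1 * \<omega> \<bar>x\<bar>)" by (intro mult_right_mono) (auto simp: A_def)
      finally show ?thesis .
    qed
    define N where "N = nrm q1 k2 g"
    have bd: "cmod (D j g t) \<le> N * E q1 j" if "- B \<le> t" "t \<le> B" for j t
      unfolding N_def by (rule nrm_bound) (use g q1 k2 that in \<open>auto simp: supported_def\<close>)
    have im: "cmod (FT (- B) B (D 0 g) (\<i> * of_real (s * y)) * \<psi> (\<i> * of_real (s * y))) \<le> (N * E q1 0) * (2 * B) * C"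
      if y: "0 \<le> y" for y
    proof -
      have 1: "cmod (FT (- B) B g (\<i> * of_real (s * y))) \<le> (N * E q1 0) * exp (- (m * y)) * (B - - B)"
      proof (rule norm_FT_le')
        fix t assume t: "- B \<le> t" "t \<le> B"
        show "cmod (g t) * exp (- (Im (\<i> * of_real (s * y)) * t)) \<le> (N * E q1 0) * exp (- (m * y))"
        \<comment> \<open>Where the exponential could exceed \<open>exp (- (m * y))\<close>, the
          function \<open>g\<close> vanishes.\<close>
        proof (cases "s * t \<le> m")
          case True
          then show ?thesis using f0[of t] by (simp add: g_def N_def)
        next
          case False
          then have "m * y \<le> s * t * y" using y by (intro mult_right_mono) auto
          then show ?thesis using bd[OF t, of 0] by (intro mult_mono) (auto simp: N_def mult_ac)
        qed
      qed (use supported_FT_continuous[OF g] B in auto)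
      have ex: "cmod (exp (\<i> * of_real (s * \<delta>) * (\<i> * of_real (s * y)))) = exp (- (\<delta> * y))"
        using s by (elim disjE) simp_all
      have 2: "cmod (\<psi> (\<i> * of_real (s * y))) \<le> C * exp ((m + \<delta>) * y) * exp (- (\<delta> * y))"
        unfolding \<psi>_def norm_mult[of "\<phi> _"] ex by (intro mult_right_mono C[OF y]) simp
      have "cmod (FT (- B) B (D 0 g) (\<i> * of_real (s * y)) * \<psi> (\<i> * of_real (s * y))) \<le>
        ((N * E q1 0) * exp (- (m * y)) * (B - - B)) * (C * exp ((m + \<delta>) * y) * exp (- (\<delta> * y)))"
        unfolding norm_mult D_0 using 1 2 B by (intro mult_mono) (auto simp: N_def)
      also have "\<dots> = (N * E q1 0) * (2 * B) * C * (exp (- (m * y)) * (exp ((m + \<delta>) * y) * exp (- (\<delta> * y))))"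
        by simp
      also have "exp (- (m * y)) * (exp ((m + \<delta>) * y) * exp (- (\<delta> * y))) = 1"
        by (simp add: algebra_simps flip: exp_add)
      finally show ?thesis by simp
    qed
    have le: "- B \<le> B" using B by simp
    have der: "(D j g has_vector_derivative D (Suc j) g t) (at t)" if "- B \<le> t" "t \<le> B" for j t
      by (rule supported_der[OF g that])
    have ends: "D j g (- B) = 0" "D j g B = 0" for j using g by (auto simp: supported_def)
    obtain M where M: "0 < M" "\<And>z. 0 \<le> s * Im z \<Longrightarrow> cmod (FT (- B) B (D 0 g) z * \<psi> z) \<le> M"
      "\<And>x. cmod (FT (- B) B (D 0 g) (of_real x) * \<psi> (of_real x)) \<le> M / (1 + x\<^sup>2)"
      by (rule half_plane_bound[where G = "\<lambda>j. D j g" and N = N and A = A and T = "1 + c k1 + \<delta>" and \<rho> = "r k1"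
          and q = q1 and s = s and \<psi> = \<psi> and \<alpha> = "- B" and \<beta> = B and M = "(N * E q1 0) * (2 * B) * C"],
          rule le, rule der, assumption, assumption, rule ends(1), rule ends(2), rule q1(1), rule q1(3), rule bd, assumption, assumption,
          rule hol\<psi>, rule type, rule re, rule q1(4), rule s, erule im) (rule that)
    define H where "H z = FT (- B) B g (of_real s * z) * \<psi> (of_real s * z)" for z
    have s2: "s * s = 1" using s by auto
    have "(LBINT x. H (of_real x)) = 0"
    proof (rule integral_real_line_half_plane(2)[where \<delta> = 1 and C = M and M = M])
      have F: "(\<lambda>z. FT (- B) B g z * \<psi> z) holomorphic_on UNIV"
        by (intro holomorphic_on_mult holomorphic_FT supported_FT_continuous[OF g] hol\<psi>)
      have "((\<lambda>z. FT (- B) B g z * \<psi> z) \<circ> (\<lambda>z. of_real s * z)) holomorphic_on UNIV"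
        by (rule holomorphic_on_compose_gen[OF _ F]) (auto intro!: holomorphic_intros)
      then show "H holomorphic_on {z. - 1 < Im z}"
        unfolding H_def[abs_def] o_def by (rule holomorphic_on_subset) simp
      show "cmod (H z) \<le> M" if "0 \<le> Im z" for z
        unfolding H_def using M(2)[of "of_real s * z"] s2 that by (simp flip: mult.assoc)
      show "cmod (H (of_real x)) \<le> M / (1 + x\<^sup>2)" for x
        unfolding H_def using s M(3)[of "s * x"] by (elim disjE) simp_all
    qed simp
    moreover have "(LBINT x. FT (- B) B g (of_real x) * \<psi> (of_real x)) = \<bar>s\<bar> *\<^sub>R (LBINT x. FT (- B) B g (of_real (0 + s * x)) * \<psi> (of_real (0 + s * x)))"
      using s by (intro lborel_integral_real_affine) auto
    ultimately have "(LBINT x. FT (- B) B g (of_real x) * \<psi> (of_real x)) = 0" by (simp add: H_def)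
    then show ?thesis by (simp only: \<psi>_def)
  qed
  have "(\<lambda>n. LBINT x. FT (- B) B g (of_real x) * (\<phi> (of_real x) * exp (\<i> * of_real (s * (1 / real (Suc n))) * of_real x)))
    \<longlonglongrightarrow> (LBINT x. FT (- B) B g (of_real x) * \<phi> (of_real x))"
  proof (rule integral_dominated_convergence[where w = "\<lambda>x. cmod (FT (- B) B g (of_real x) * \<phi> (of_real x))"])
    have m: "(\<lambda>x. FT (- B) B g (of_real x) * \<phi> (of_real x)) \<in> borel_measurable lborel" using int by auto
    then show "(\<lambda>x. FT (- B) B g (of_real x) * \<phi> (of_real x)) \<in> borel_measurable lborel" .
    have e: "(\<lambda>x. exp (\<i> * of_real (s * (1 / real (Suc n))) * of_real x)) \<in> borel_measurable borel" for n
      by (intro borel_measurable_continuous_onI continuous_intros)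
    have "(\<lambda>x. (FT (- B) B g (of_real x) * \<phi> (of_real x)) * exp (\<i> * of_real (s * (1 / real (Suc n))) * of_real x)) \<in> borel_measurable lborel" for n
      by (intro borel_measurable_times[OF m]) (use e in simp)
    then show "(\<lambda>x. FT (- B) B g (of_real x) * (\<phi> (of_real x) * exp (\<i> * of_real (s * (1 / real (Suc n))) * of_real x))) \<in> borel_measurable lborel" for n
      by (simp only: mult.assoc)
    show "integrable lborel (\<lambda>x. cmod (FT (- B) B g (of_real x) * \<phi> (of_real x)))" using int by (rule integrable_norm)
    have "(\<lambda>n. FT (- B) B g (of_real x) * (\<phi> (of_real x) * exp (\<i> * of_real (s * (1 / real (Suc n))) * of_real x))) \<longlonglongrightarrow>
      FT (- B) B g (of_real x) * (\<phi> (of_real x) * exp (\<i> * of_real (s * 0) * of_real x))" for x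
    proof (intro tendsto_intros)
      show "(\<lambda>n. 1 / real (Suc n)) \<longlonglongrightarrow> 0" using LIMSEQ_inverse_real_of_nat by (simp add: inverse_eq_divide)
    qed
    then show "AE x in lborel. (\<lambda>n. FT (- B) B g (of_real x) * (\<phi> (of_real x) * exp (\<i> * of_real (s * (1 / real (Suc n))) * of_real x))) \<longlonglongrightarrow>
      FT (- B) B g (of_real x) * \<phi> (of_real x)" by simp
    show "AE x in lborel. cmod (FT (- B) B g (of_real x) * (\<phi> (of_real x) * exp (\<i> * of_real (s * (1 / real (Suc n))) * of_real x))) \<le>
      cmod (FT (- B) B g (of_real x) * \<phi> (of_real x))" for n
      by (simp add: norm_mult)
  qed
  moreover have "(LBINT x. FT (- B) B g (of_real x) * (\<phi> (of_real x) * exp (\<i> * of_real (s * (1 / real (Suc n))) * of_real x))) = 0" for n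
    by (rule zero) simp
  ultimately have "(\<lambda>n. 0) \<longlonglongrightarrow> (LBINT x. FT (- B) B g (of_real x) * \<phi> (of_real x))" by simp
  then have "(LBINT x. FT (- B) B g (of_real x) * \<phi> (of_real x)) = 0" by (simp add: LIMSEQ_const_iff)
  then show ?thesis using Sf by simp
qed

text \<open>A two-sided cutoff with one edge moved beyond \<open>[-B; B]\<close>, the left one for
  \<open>s = 1\<close> and the right one for \<open>s = - 1\<close>. Taking \<open>min\<close> and
  \<open>max\<close> with \<open>d\<close> and \<open>- d\<close> keeps the plateau nonempty even if
  \<open>d\<close> is far out.\<close>

lemma one_sided_cutoff:
  assumes s: "s = 1 \<or> s = (- 1 :: real)" and \<delta>: "0 < \<delta>"
  obtains \<xi> :: "nat \<Rightarrow> real \<Rightarrow> complex" and C where "0 < C"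
    "\<And>j t. (\<xi> j has_vector_derivative \<xi> (Suc j) t) (at t)"
    "\<And>j t. cmod (\<xi> j t) \<le> C * E 1 j"
    "\<And>j t. s * t \<le> d \<Longrightarrow> \<bar>t\<bar> \<le> B \<Longrightarrow> \<xi> j t = (if j = 0 then 1 else 0)"
    "\<And>j t. d + \<delta> \<le> s * t \<Longrightarrow> \<xi> j t = 0"
proof -
  define \<alpha> where "\<alpha> = (if s = 1 then min (- B) d else - d)"
  define \<beta> where "\<beta> = (if s = 1 then d else max B (- d))"
  have ab: "\<alpha> \<le> \<beta>" by (auto simp: \<alpha>_def \<beta>_def)
  obtain \<xi> :: "nat \<Rightarrow> real \<Rightarrow> complex" and C where \<xi>: "0 < C"
    "\<And>j t. (\<xi> j has_vector_derivative \<xi> (Suc j) t) (at t)"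
    "\<And>j t. cmod (\<xi> j t) \<le> C * E 1 j"
    "\<And>t. \<alpha> \<le> t \<Longrightarrow> t \<le> \<beta> \<Longrightarrow> \<xi> 0 t = 1"
    "\<And>j t. \<alpha> \<le> t \<Longrightarrow> t \<le> \<beta> \<Longrightarrow> \<xi> (Suc j) t = 0"
    "\<And>j t. t \<le> \<alpha> - \<delta> \<or> \<beta> + \<delta> \<le> t \<Longrightarrow> \<xi> j t = 0"
    by (rule cutoff_exists[OF ab \<delta>]) (rule that)
  show thesis
  proof (rule that[of C \<xi>])
    fix j t assume t: "s * t \<le> d" "\<bar>t\<bar> \<le> B"
    have "\<alpha> \<le> t" "t \<le> \<beta>" using s t by (auto simp: \<alpha>_def \<beta>_def)
    then show "\<xi> j t = (if j = 0 then 1 else 0)" using \<xi>(4)[of t] \<xi>(5)[of t "j - 1"] by (cases j) auto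
  next
    fix j t assume "d + \<delta> \<le> s * t"
    then show "\<xi> j t = 0" using s by (intro \<xi>(6)) (auto simp: \<alpha>_def \<beta>_def)
  qed (fact \<xi>(1-3))+
qed

text \<open>A cutoff between \<open>d\<close> and \<open>e\<close> splits \<open>f\<close> into two pieces, each killed by \<open>functional_zero_on_half_line\<close>.\<close>

lemma functional_zero_if_growth_crossing:
  assumes S: "functional S" and gr: "imaginary_growth (\<lambda>z. S (efun z)) 1 d" "imaginary_growth (\<lambda>z. S (efun z)) (- 1) (- e)"
    and de: "d < e" and f: "f \<in> U"
  shows "S f = 0"
proof -
  obtain q k K where b: "\<And>f. f \<in> U \<Longrightarrow> cmod (S f) \<le> K * nrm q k f" "0 < q" "q < 1" "0 < K"
    by (rule functional_bound[OF S]) (rule that)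
  obtain b0 B \<eta> where \<eta>: "cutoff k b0 B \<eta>" using cutoff_ex by blast
  define g where "g = (\<lambda>x. \<eta> 0 x * f x)"
  have g: "supported B g" unfolding g_def by (rule cutoff_mult(1)[OF \<eta> f])
  then have gU: "g \<in> U" by (simp add: supported_def)
  have s: "1 = 1 \<or> 1 = (- 1 :: real)" by simp
  have ed: "0 < e - d" using de by simp
  obtain \<xi> :: "nat \<Rightarrow> real \<Rightarrow> complex" and C where \<xi>: "0 < C"
    "\<And>j t. (\<xi> j has_vector_derivative \<xi> (Suc j) t) (at t)"
    "\<And>j t. cmod (\<xi> j t) \<le> C * E 1 j"
    "\<And>j t. 1 * t \<le> d \<Longrightarrow> \<bar>t\<bar> \<le> B \<Longrightarrow> \<xi> j t = (if j = 0 then 1 else 0)"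
    "\<And>j t. d + (e - d) \<le> 1 * t \<Longrightarrow> \<xi> j t = 0"
    by (rule one_sided_cutoff[OF s ed, of d B]) (rule that)
  define h where "h = (\<lambda>x. \<xi> 0 x * g x)"
  have h: "h \<in> U" unfolding h_def by (rule U_cutoff(1)[OF gU \<xi>(2,3)])
  have "S h = 0"
  proof (rule functional_zero_on_half_line[OF S _ gr(2) h])
    show "h t = 0" if "- 1 * t \<le> - e" for t using \<xi>(5)[of t 0] that by (simp add: h_def)
  qed simp
  moreover have "S (g - h) = 0"
  proof (rule functional_zero_on_half_line[OF S _ gr(1)])
    show "g - h \<in> U" using gU h by (rule U_diff)
    show "(g - h) t = 0" if "1 * t \<le> d" for t
    proof (cases "\<bar>t\<bar> \<le> B")
      case True then show ?thesis using \<xi>(4)[OF that True, of 0] by (simp add: h_def)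
    next
      case False
      have "\<forall>j t. B \<le> \<bar>t\<bar> \<longrightarrow> D j g t = 0" using g by (simp add: supported_def)
      from this[rule_format, of t 0] show ?thesis using False by (simp add: h_def)
    qed
  qed simp
  ultimately have "S g = 0" using functional_linear(3)[OF S gU h] by simp
  then show ?thesis using functional_cutoff(3)[OF S b \<eta> f] by (simp add: g_def)
qed

text \<open>Since \<open>\<omega> x = o(x)\<close>, only the exponential type \<open>c k\<close> is
  visible along the imaginary axis.\<close>

lemma indicator_bounded:
  assumes \<phi>: "\<phi> \<in> Pk \<omega> c r k" and s: "s = 1 \<or> s = (- 1 :: real)"
  shows "indicator_fun \<phi> (s * (pi / 2)) \<le> ereal (c k)"
proof (rule indicator_le_if_imaginary_growth[OF s])
  show "imaginary_growth \<phi> s (c k)" unfolding imaginary_growth_def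
  proof (intro allI impI)
    fix \<epsilon> :: real assume \<epsilon>: "0 < \<epsilon>"
    obtain C where C: "0 < C" "\<And>x. 0 \<le> x \<Longrightarrow> \<omega> x \<le> \<epsilon> * x + C" by (rule omega_le_linear[OF \<epsilon>]) (rule that)
    have "cmod (\<phi> (\<i> * of_real (s * y))) \<le> (pn k \<phi> * exp C) * exp ((c k + \<epsilon>) * y)" if y: "0 \<le> y" for y
    proof -
      have "r k * \<omega> y \<le> 1 * \<omega> y" using r_bounds[of k] nonneg[OF y] by (intro mult_right_mono) auto
      then have "r k * \<omega> y + c k * y \<le> C + (c k + \<epsilon>) * y" using C(2)[OF y] by (simp add: distrib_right)
      then have "pn k \<phi> * exp (r k * \<omega> y + c k * y) \<le> pn k \<phi> * exp (C + (c k + \<epsilon>) * y)"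
        by (intro mult_left_mono) auto
      moreover have "cmod (\<phi> (\<i> * of_real (s * y))) \<le> pn k \<phi> * exp (r k * \<omega> y + c k * y)"
        using pn_bound[OF \<phi>, of "\<i> * of_real (s * y)"] s y by (elim disjE) (simp_all add: norm_mult)
      ultimately show ?thesis by (simp add: exp_add mult.assoc)
    qed
    then show "\<exists>C. \<forall>y\<ge>0. cmod (\<phi> (\<i> * of_real (s * y))) \<le> C * exp ((c k + \<epsilon>) * y)" by blast
  qed
qed

lemma functional_efun_continuous: "functional S \<Longrightarrow> continuous_on UNIV (\<lambda>z. S (efun z))"
  by (rule holomorphic_on_imp_continuous_on, rule functional_efun_holomorphic)

lemma functional_growth:
  assumes S: "functional S" and s: "s = 1 \<or> s = (- 1 :: real)"
    and "indicator_fun (\<lambda>z. S (efun z)) (s * (pi / 2)) \<le> ereal m"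
  shows "imaginary_growth (\<lambda>z. S (efun z)) s m"
  by (rule imaginary_growth_if_indicator_le[OF functional_efun_continuous[OF S] s assms(3)])

text \<open>If the end points were in the wrong order, two reals \<open>d < e\<close> would fit
  strictly between them, and the functional would vanish on everything by
  \<open>functional_zero_if_growth_crossing\<close>.\<close>

lemma functional_indicator_order:
  assumes S: "functional S" and nz: "f \<in> U" "S f \<noteq> 0"
  shows "- indicator_fun (\<lambda>z. S (efun z)) (- (pi / 2)) \<le> indicator_fun (\<lambda>z. S (efun z)) (pi / 2)" (is "- ?l \<le> ?h")
proof (rule ccontr)
  assume "\<not> - ?l \<le> ?h"
  then have "?h < - ?l" by simp
  then obtain d where d: "?h < ereal d" "ereal d < - ?l" using ereal_dense2 by blast
  then obtain e where e: "ereal d < ereal e" "ereal e < - ?l" using ereal_dense2 by blast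
  have "- (- ?l) \<le> - ereal e" using e(2) by (subst ereal_minus_le_minus) simp
  then have "?l \<le> - ereal e" by simp
  then have "imaginary_growth (\<lambda>z. S (efun z)) (- 1) (- e)" by (intro functional_growth[OF S]) simp_all
  moreover have "imaginary_growth (\<lambda>z. S (efun z)) 1 d" using d(1) by (intro functional_growth[OF S]) simp_all
  ultimately have "S f = 0" using e(1) by (intro functional_zero_if_growth_crossing[OF S _ _ _ nz(1)]) simp_all
  with nz(2) show False ..
qed

lemma functional_zero_on_flat:
  assumes S: "functional S" and f: "f \<in> U"
    and hi: "indicator_fun (\<lambda>z. S (efun z)) (pi / 2) \<le> hi" and lo: "lo \<le> - indicator_fun (\<lambda>z. S (efun z)) (- (pi / 2))"
    and flat: "\<And>j x. x \<in> I \<Longrightarrow> lo \<le> ereal x \<Longrightarrow> ereal x \<le> hi \<Longrightarrow> D j f x = 0"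
  shows "S f = 0"
proof (rule ccontr)
  assume nz: "S f \<noteq> 0"
  obtain k where Pk: "(\<lambda>z. S (efun z)) \<in> Pk \<omega> c r k" by (rule functional_Pk[OF S])
  let ?l = "indicator_fun (\<lambda>z. S (efun z)) (- (pi / 2))" and ?h = "indicator_fun (\<lambda>z. S (efun z)) (pi / 2)"
  have hc: "?h \<le> ereal (c k)" using indicator_bounded[OF Pk, of 1] by simp
  have lc: "?l \<le> ereal (c k)" using indicator_bounded[OF Pk, of "- 1"] by simp
  \<comment> \<open>The order of the end points together with their bounds by \<open>c k\<close>
    makes both of them finite.\<close>
  have order: "- ?l \<le> ?h" by (rule functional_indicator_order[OF S f nz])
  have "ereal (- c k) \<le> - ?l" using ereal_minus_le_minus[of "ereal (c k)" ?l] lc by simp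
  then obtain m where m: "- ?l = ereal m" "- c k \<le> m" using order hc by (cases "- ?l") auto
  then obtain d where d: "?h = ereal d" "d \<le> c k" using order hc by (cases ?h) auto
  have md: "m \<le> d" using order m(1) d(1) by simp
  have lm: "?l = ereal (- m)" using m(1) by (cases ?l) auto
  have flat': "D j f t = 0" if "m \<le> t" "t \<le> d" for j t
  proof (rule flat)
    show "t \<in> I" using that m(2) d(2) by (intro c_in_I[of _ k]) auto
    have "lo \<le> ereal m" using lo m(1) by simp
    also have "\<dots> \<le> ereal t" using that by simp
    finally show "lo \<le> ereal t" .
    have "ereal t \<le> ereal d" using that by simp
    also have "\<dots> \<le> hi" using hi d(1) by simp
    finally show "ereal t \<le> hi" .
  qed
  \<comment> \<open>The cut is made at the left end \<open>m\<close> of the segment of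
    \<open>S\<close> itself, where \<open>f\<close> is flat. The right piece vanishes for
    \<open>t \<le> d\<close>, the left one for \<open>m \<le> t\<close>.\<close>
  define g where "g = (\<lambda>t. if m \<le> t then f t else 0)"
  have g: "g \<in> U" unfolding g_def by (rule U_split(1)[OF f]) (simp add: flat' md)
  have "S g = 0"
  proof (rule functional_zero_on_half_line[OF S _ _ g])
    show "imaginary_growth (\<lambda>z. S (efun z)) 1 d" using d(1) by (intro functional_growth[OF S]) simp_all
    show "g t = 0" if "1 * t \<le> d" for t using flat'[of t 0] that by (simp add: g_def)
  qed simp
  moreover have "S (f - g) = 0"
  proof (rule functional_zero_on_half_line[OF S _ _ U_diff(1)[OF f g]])
    show "imaginary_growth (\<lambda>z. S (efun z)) (- 1) (- m)" using lm by (intro functional_growth[OF S]) simp_all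
    show "(f - g) t = 0" if "- 1 * t \<le> - m" for t using that by (simp add: g_def)
  qed simp
  ultimately have "S f = 0" using functional_linear(3)[OF S f g] by simp
  with nz show False ..
qed

text \<open>Cutting off beyond \<open>d\<close> does not change the value of \<open>S\<close> on an exponential, but it confines the
  exponential to \<open>s * t \<le> d + \<epsilon> / 2\<close>, where it is small.\<close>

lemma growth_if_zero_on_flat:
  assumes S: "functional S" and s: "s = 1 \<or> s = (- 1 :: real)"
    and X: "\<And>x. x \<in> X \<Longrightarrow> s * x \<le> d" and kill: "\<And>f. f \<in> W_of \<omega> a c X \<Longrightarrow> S f = 0"
  shows "imaginary_growth (\<lambda>z. S (efun z)) s d"
  unfolding imaginary_growth_def
proof (intro allI impI)
  fix \<epsilon> :: real assume \<epsilon>: "0 < \<epsilon>"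
  then have \<epsilon>2: "0 < \<epsilon> / 2" by simp
  obtain q k K where b: "\<And>f. f \<in> U \<Longrightarrow> cmod (S f) \<le> K * nrm q k f" "0 < q" "q < 1" "0 < K"
    by (rule functional_bound[OF S]) (rule that)
  obtain b0 B \<eta> where \<eta>: "cutoff k b0 B \<eta>" using cutoff_ex by blast
  obtain \<xi> :: "nat \<Rightarrow> real \<Rightarrow> complex" and C where \<xi>: "0 < C"
    "\<And>j t. (\<xi> j has_vector_derivative \<xi> (Suc j) t) (at t)"
    "\<And>j t. cmod (\<xi> j t) \<le> C * E 1 j"
    "\<And>j t. s * t \<le> d \<Longrightarrow> \<bar>t\<bar> \<le> B \<Longrightarrow> \<xi> j t = (if j = 0 then 1 else 0)"
    "\<And>j t. d + \<epsilon> / 2 \<le> s * t \<Longrightarrow> \<xi> j t = 0"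
    by (rule one_sided_cutoff[OF s \<epsilon>2, of d B]) (rule that)
  define q' where "q' = (1 + q) / 2"
  have q': "q < q'" "q' < 1" "0 < q'" using b(2,3) by (auto simp: q'_def)
  obtain C1 where C1: "0 < C1" "\<And>F G M N j. 0 \<le> M \<Longrightarrow> 0 \<le> N \<Longrightarrow> (\<And>i. cmod (F i) \<le> M * E q' i) \<Longrightarrow>
    (\<And>i. cmod (G i) \<le> N * E q' i) \<Longrightarrow> cmod (\<Sum>i\<le>j. of_nat (j choose i) * F i * G (j - i)) \<le> C1 * M * N * E q j"
    using E_product_bound[OF b(2) q'(1)] by blast
  obtain C2 where C2: "0 < C2" "\<And>x. 0 \<le> x \<Longrightarrow> \<omega> x \<le> \<epsilon> / 2 * x + C2" by (rule omega_le_linear[OF \<epsilon>2]) (rule that)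
  define A where "A = C1 * C * (exp (\<omega> 1) * exp C2)"
  have "cmod (S (efun (\<i> * of_real (s * y)))) \<le> (K * A) * exp ((d + \<epsilon>) * y)" if y: "0 \<le> y" for y
  proof -
    define z where "z = \<i> * complex_of_real (s * y)"
    define g where "g = (\<lambda>x. \<xi> 0 x * efun z x)"
    have g: "g \<in> U" "D j g = (\<lambda>x. \<Sum>i\<le>j. of_nat (j choose i) * \<xi> i x * D (j - i) (efun z) x)" for j
      unfolding g_def by (rule U_cutoff(1,2)[OF efun_U \<xi>(2,3)])+
    \<comment> \<open>The part of the exponential beyond the cutoff. Times \<open>\<eta>\<close> it
      is flat on \<open>X\<close>: within \<open>[-B; B]\<close> because \<open>\<xi>\<close> is 1
      where \<open>s * t \<le> d\<close>, and outside because \<open>\<eta>\<close> is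
      \<open>0\<close>; hence \<open>S\<close> kills it.\<close>
    define h where "h = efun z - g"
    have h: "h \<in> U" unfolding h_def using efun_U g(1) by (rule U_diff)
    have h0: "D j h t = 0" if t: "s * t \<le> d" "\<bar>t\<bar> \<le> B" for j t
    proof -
      have "D j g t = (\<Sum>i\<le>j. if i = 0 then D j (efun z) t else 0)"
        unfolding g(2) by (intro sum.cong) (auto simp: \<xi>(4)[OF t])
      then show ?thesis unfolding h_def U_diff(2)[OF efun_U g(1)] by simp
    qed
    have cm: "(\<lambda>x. \<eta> 0 x * h x) \<in> U" "D j (\<lambda>x. \<eta> 0 x * h x) t = 0" if "B \<le> \<bar>t\<bar>" for j t
      using cutoff_mult(1)[OF \<eta> h] that by (auto simp: supported_def)
    obtain C\<eta> where \<eta>': "\<And>j t. (\<eta> j has_vector_derivative \<eta> (Suc j) t) (at t)" "\<And>j t. cmod (\<eta> j t) \<le> C\<eta> * E 1 j"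
      using \<eta> unfolding cutoff_def by blast
    have "S (\<lambda>x. \<eta> 0 x * h x) = 0"
    proof (rule kill)
      have "D j (\<lambda>x. \<eta> 0 x * h x) t = 0" if "t \<in> X" for j t
      proof (cases "\<bar>t\<bar> \<le> B")
        case True
        then show ?thesis using h0[OF X[OF that] True] by (simp add: U_cutoff(2)[OF h \<eta>'])
      next
        case False
        then show ?thesis by (intro cm(2)) simp
      qed
      then show "(\<lambda>x. \<eta> 0 x * h x) \<in> W_of \<omega> a c X"
        using U_cutoff(1)[OF h \<eta>'] unfolding W_of_def D_def[symmetric] by simp
    qed
    then have "S h = 0" using functional_cutoff(3)[OF S b \<eta> h] by simp
    then have Sg: "S (efun z) = S g" using functional_linear(3)[OF S efun_U g(1)] unfolding h_def by simp
    \<comment> \<open>The exponential has modulus \<open>exp (s * t * y)\<close>. On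
      \<open>s * t \<le> d + \<epsilon> / 2\<close> one half of \<open>\<epsilon>\<close> is spent
      there, the other half on \<open>\<omega> y\<close>.\<close>
    define N where "N = exp (\<omega> 1) * exp C2 * exp ((d + \<epsilon>) * y)"
    have e: "cmod (D i (efun z) t) \<le> N * E q' i" if t: "s * t \<le> d + \<epsilon> / 2" for i t
    proof (cases "t \<in> I")
      case True
      have "\<omega> y \<le> \<epsilon> / 2 * y + C2" by (rule C2(2)[OF y])
      moreover have "q' * \<omega> y \<le> 1 * \<omega> y" using q'(2) nonneg[OF y] by (intro mult_right_mono) auto
      ultimately have w: "q' * \<omega> y \<le> \<epsilon> / 2 * y + C2" by simp
      have "s * t * y \<le> (d + \<epsilon> / 2) * y" using t y by (intro mult_right_mono)
      with w have ex: "s * t * y + q' * \<omega> y \<le> C2 + (d + \<epsilon>) * y" by (simp add: algebra_simps)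
      have nz: "cmod (- \<i> * z) = y" using s y by (elim disjE) (simp_all add: z_def norm_mult)
      have "D i (efun z) t = (- \<i> * z) ^ i * exp (- \<i> * of_real t * z)" using True by (simp add: D_efun)
      moreover have "cmod (exp (- \<i> * of_real t * z)) = exp (s * t * y)" by (simp add: z_def mult_ac)
      ultimately have "cmod (D i (efun z) t) = y ^ i * exp (s * t * y)"
        by (simp only: norm_mult[of "(- \<i> * z) ^ i"] norm_power nz)
      also have "\<dots> = (y ^ i * exp (- q' * \<omega> y)) * exp (s * t * y + q' * \<omega> y)"
        by (simp add: mult.assoc flip: exp_add)
      also have "\<dots> \<le> (exp (q' * \<omega> 1) * E q' i) * exp (C2 + (d + \<epsilon>) * y)"
        using ex y by (intro mult_mono power_le_E' q') auto
      also have "\<dots> \<le> (exp (\<omega> 1) * E q' i) * exp (C2 + (d + \<epsilon>) * y)"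
        using q'(2) nonneg[of 1] mult_right_mono[of q' 1 "\<omega> 1"] by (intro mult_right_mono) auto
      finally show ?thesis by (simp add: N_def exp_add mult_ac)
    qed (simp add: U_outside[OF efun_U] N_def)
    have "nrm q k g \<le> C1 * C * N"
    proof (rule nrm_least[OF g(1) b(2,3)])
      fix j t
      show "cmod (D j g t) \<le> C1 * C * N * E q j"
      proof (cases "s * t \<le> d + \<epsilon> / 2")
        case True
        have "C * E 1 i \<le> C * E q' i" for i using q' \<xi>(1) by (intro mult_left_mono E_antimono) auto
        then have "cmod (\<xi> i t) \<le> C * E q' i" for i by (rule order_trans[OF \<xi>(3)])
        then show ?thesis unfolding g(2) using e[OF True] \<xi>(1)
          by (intro C1(2)) (auto simp: N_def)
      next
        case False
        then show ?thesis unfolding g(2) using \<xi>(5)[of t] C1(1) \<xi>(1) by (simp add: N_def)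
      qed
    qed
    then have "K * nrm q k g \<le> K * (C1 * C * N)" using b(4) by (intro mult_left_mono) auto
    then have "cmod (S g) \<le> K * (C1 * C * N)" using b(1)[OF g(1)] by linarith
    then show ?thesis unfolding Sg[unfolded z_def] by (simp add: A_def N_def mult_ac)
  qed
  then show "\<exists>C. \<forall>y\<ge>0. cmod (S (efun (\<i> * of_real (s * y)))) \<le> C * exp ((d + \<epsilon>) * y)" by blast
qed

text \<open>Comparing with every real \<open>d\<close> above the supremum also covers an infinite or
  empty \<open>X\<close>; for empty \<open>X\<close> the bounds are infinite of the wrong sign, in
  accordance with \<open>S = 0\<close> on \<open>U\<close>.\<close>

lemma indicator_le_if_zero_on_flat:
  assumes S: "functional S" and kill: "\<And>f. f \<in> W_of \<omega> a c X \<Longrightarrow> S f = 0"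
  shows "indicator_fun (\<lambda>z. S (efun z)) (pi / 2) \<le> (SUP x\<in>X. ereal x)"
    and "(INF x\<in>X. ereal x) \<le> - indicator_fun (\<lambda>z. S (efun z)) (- (pi / 2))"
proof -
  show "indicator_fun (\<lambda>z. S (efun z)) (pi / 2) \<le> (SUP x\<in>X. ereal x)"
  proof (rule ereal_le_real)
    fix d assume d: "(SUP x\<in>X. ereal x) \<le> ereal d"
    have "imaginary_growth (\<lambda>z. S (efun z)) 1 d"
      using d by (intro growth_if_zero_on_flat[OF S _ _ kill]) (auto simp: SUP_le_iff)
    then show "indicator_fun (\<lambda>z. S (efun z)) (pi / 2) \<le> ereal d"
      using indicator_le_if_imaginary_growth[of 1 "\<lambda>z. S (efun z)" d] by simp
  qed
  have "indicator_fun (\<lambda>z. S (efun z)) (- (pi / 2)) \<le> - (INF x\<in>X. ereal x)"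
  proof (rule ereal_le_real)
    fix d assume d: "- (INF x\<in>X. ereal x) \<le> ereal d"
    then have "ereal (- d) \<le> (INF x\<in>X. ereal x)" by (subst (asm) ereal_uminus_le_reorder) simp
    then have "- x \<le> d" if "x \<in> X" for x using that by (auto simp: le_INF_iff)
    then have "imaginary_growth (\<lambda>z. S (efun z)) (- 1) d"
      by (intro growth_if_zero_on_flat[OF S _ _ kill]) auto
    then show "indicator_fun (\<lambda>z. S (efun z)) (- (pi / 2)) \<le> ereal d"
      using indicator_le_if_imaginary_growth[of "- 1" "\<lambda>z. S (efun z)" d] by simp
  qed
  then have "- (- (INF x\<in>X. ereal x)) \<le> - indicator_fun (\<lambda>z. S (efun z)) (- (pi / 2))"
    by (subst ereal_minus_le_minus)
  then show "(INF x\<in>X. ereal x) \<le> - indicator_fun (\<lambda>z. S (efun z)) (- (pi / 2))" by simp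
qed

end

section \<open>Hahn-Banach separation and duality\<close>

definition sublinear_on :: "('x \<Rightarrow> complex) set \<Rightarrow> (('x \<Rightarrow> complex) \<Rightarrow> real) \<Rightarrow> bool" where
  "sublinear_on V p \<longleftrightarrow> (\<forall>x\<in>V. \<forall>y\<in>V. p (x + y) \<le> p x + p y) \<and>
     (\<forall>t>0. \<forall>x\<in>V. p (cscale (of_real t) x) = t * p x)"

context
  fixes V :: "('x \<Rightarrow> complex) set"
  assumes V: "cfun.subspace V"
begin

lemma V_closed: "x \<in> V \<Longrightarrow> y \<in> V \<Longrightarrow> x + y \<in> V" "x \<in> V \<Longrightarrow> cscale b x \<in> V" "0 \<in> V" "x \<in> V \<Longrightarrow> - x \<in> V"
  using V by (auto simp: cfun.subspace_def intro: cfun.subspace_neg[OF V])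

lemma sublinear_on_zero: "sublinear_on V p \<Longrightarrow> p 0 = 0"
proof -
  assume p: "sublinear_on V p"
  have "p (cscale (of_real 2) 0) = 2 * p 0"
    using p V_closed(3) unfolding sublinear_on_def by (metis zero_less_numeral)
  moreover have "cscale (of_real 2) 0 = (0 :: 'x \<Rightarrow> complex)" by (simp add: cscale_def fun_eq_iff)
  ultimately show ?thesis by simp
qed

lemma sublinear_on_lower:
  assumes p: "sublinear_on V p" and x: "x \<in> V"
  shows "- p (- x) \<le> p x"
proof -
  have "p (x + - x) \<le> p x + p (- x)" using p x V_closed(4)[OF x] unfolding sublinear_on_def by blast
  then show ?thesis using sublinear_on_zero[OF p] by simp
qed

lemma sublinear_on_intro:
  assumes "\<And>x y. x \<in> V \<Longrightarrow> y \<in> V \<Longrightarrow> p (x + y) \<le> p x + p y"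
    and le: "\<And>t x. 0 < t \<Longrightarrow> x \<in> V \<Longrightarrow> p (cscale (of_real t) x) \<le> t * p x"
  shows "sublinear_on V p"
proof -
  have "t * p x \<le> p (cscale (of_real t) x)" if t: "0 < t" and x: "x \<in> V" for t x
  proof -
    have "cscale (of_real (1 / t)) (cscale (of_real t) x) = x" using t by (simp add: cscale_def fun_eq_iff)
    then have "p x \<le> 1 / t * p (cscale (of_real t) x)"
      using le[of "1 / t" "cscale (of_real t) x"] V_closed(2)[OF x] t by simp
    then show ?thesis using t by (simp add: field_simps)
  qed
  with assms show ?thesis unfolding sublinear_on_def by (auto intro: order_antisym)
qed

text \<open>A minimal sublinear functional \<open>p\<close> agrees with \<open>directional_inf p h\<close> for every \<open>h\<close>, hence is additive.\<close>

definition directional_inf :: "(('x \<Rightarrow> complex) \<Rightarrow> real) \<Rightarrow> ('x \<Rightarrow> complex) \<Rightarrow> ('x \<Rightarrow> complex) \<Rightarrow> real" where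
  "directional_inf p h x = (INF t\<in>{0..}. p (x + cscale (of_real t) h) - t * p h)"

text \<open>The content is that the infimum is taken over a set bounded below: subadditivity gives
  the lower bound \<open>- p (- x)\<close>.\<close>

lemma directional_inf_le:
  assumes p: "sublinear_on V p" and h: "h \<in> V" and x: "x \<in> V" and t: "0 \<le> t"
  shows "directional_inf p h x \<le> p (x + cscale (of_real t) h) - t * p h"
proof -
  have "- p (- x) \<le> p (x + cscale (of_real t) h) - t * p h" if "0 \<le> t" for t
  proof (cases "t = 0")
    case True
    then have "x + cscale (of_real t) h = x" by (simp add: cscale_def fun_eq_iff)
    then show ?thesis using True sublinear_on_lower[OF p x] by simp
  next
    case False
    have "p (- x + (x + cscale (of_real t) h)) \<le> p (- x) + p (x + cscale (of_real t) h)"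
      using p x h unfolding sublinear_on_def by (blast intro: V_closed)
    moreover have "p (cscale (of_real t) h) = t * p h" using p h that False unfolding sublinear_on_def by auto
    ultimately show ?thesis by simp
  qed
  then have "bdd_below ((\<lambda>t. p (x + cscale (of_real t) h) - t * p h) ` {0..})"
    by (intro bdd_belowI2[where m = "- p (- x)"]) simp
  then show ?thesis unfolding directional_inf_def using t by (intro cINF_lower) auto
qed

lemma sublinear_directional_inf:
  assumes p: "sublinear_on V p" and h: "h \<in> V"
  shows "sublinear_on V (directional_inf p h)"
proof (rule sublinear_on_intro)
  note le = directional_inf_le[OF p h]
  fix x y assume xy: "x \<in> V" "y \<in> V"
  have "directional_inf p h (x + y) - (p (x + cscale (of_real s) h) - s * p h) \<le> p (y + cscale (of_real t) h) - t * p h"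
    if st: "0 \<le> s" "0 \<le> t" for s t
  proof -
    have "directional_inf p h (x + y) \<le> p (x + y + cscale (of_real (s + t)) h) - (s + t) * p h"
      using xy st by (intro le V_closed) auto
    also have "x + y + cscale (of_real (s + t)) h = (x + cscale (of_real s) h) + (y + cscale (of_real t) h)"
      by (simp add: cscale_def fun_eq_iff algebra_simps)
    also have "p \<dots> \<le> p (x + cscale (of_real s) h) + p (y + cscale (of_real t) h)"
      using p xy h unfolding sublinear_on_def by (blast intro: V_closed)
    finally show ?thesis unfolding distrib_right by linarith
  qed
  then have "directional_inf p h (x + y) - (p (x + cscale (of_real s) h) - s * p h) \<le> directional_inf p h y" if "0 \<le> s" for s
    unfolding directional_inf_def[of p h y] using that by (intro cINF_greatest) auto
  then have "directional_inf p h (x + y) - directional_inf p h y \<le> p (x + cscale (of_real s) h) - s * p h" if "0 \<le> s" for s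
    using that by (simp add: algebra_simps)
  then have "directional_inf p h (x + y) - directional_inf p h y \<le> directional_inf p h x"
    unfolding directional_inf_def[of p h x] by (intro cINF_greatest) auto
  then show "directional_inf p h (x + y) \<le> directional_inf p h x + directional_inf p h y" by simp
next
  fix t :: real and x assume t: "0 < t" and x: "x \<in> V"
  have "directional_inf p h (cscale (of_real t) x) / t \<le> p (x + cscale (of_real s) h) - s * p h" if s: "0 \<le> s" for s
  proof -
    have "directional_inf p h (cscale (of_real t) x) \<le> p (cscale (of_real t) x + cscale (of_real (t * s)) h) - (t * s) * p h"
      using s t x by (intro directional_inf_le[OF p h] V_closed) auto
    also have "cscale (of_real t) x + cscale (of_real (t * s)) h = cscale (of_real t) (x + cscale (of_real s) h)"
      by (simp add: cscale_def fun_eq_iff algebra_simps)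
    also have "p \<dots> = t * p (x + cscale (of_real s) h)"
      using p x h t unfolding sublinear_on_def by (blast intro: V_closed)
    finally have "directional_inf p h (cscale (of_real t) x) \<le> (p (x + cscale (of_real s) h) - s * p h) * t"
      unfolding left_diff_distrib by (simp only: mult_ac)
    then show ?thesis using t by (simp only: pos_divide_le_eq)
  qed
  then have "directional_inf p h (cscale (of_real t) x) / t \<le> directional_inf p h x"
    unfolding directional_inf_def[of p h x] by (intro cINF_greatest) auto
  then show "directional_inf p h (cscale (of_real t) x) \<le> t * directional_inf p h x"
    using t by (simp add: pos_divide_le_eq mult.commute)
qed

text \<open>Zorn's lemma downwards: the pointwise infimum of a chain is sublinear. It is finite
  since each member stays above \<open>- q (- x)\<close>.\<close>

lemma minimal_sublinear:
  assumes q: "sublinear_on V q"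
  obtains p where "sublinear_on V p" "\<And>x. x \<in> V \<Longrightarrow> p x \<le> q x"
    "\<forall>p'. sublinear_on V p' \<longrightarrow> (\<forall>x\<in>V. p' x \<le> p x) \<longrightarrow> (\<forall>x\<in>V. p' x = p x)"
proof -
  define A where "A = {p. sublinear_on V p \<and> (\<forall>x\<in>V. p x \<le> q x) \<and> (\<forall>x. x \<notin> V \<longrightarrow> p x = 0)}"
  define P where "P p p' \<longleftrightarrow> (\<forall>x\<in>V. p' x \<le> p x)" for p p' :: "('x \<Rightarrow> complex) \<Rightarrow> real"
  \<comment> \<open>Only values on \<open>V\<close> matter; setting the others to \<open>0\<close>
    makes the order antisymmetric.\<close>
  have trunc: "(\<lambda>x. if x \<in> V then p x else 0) \<in> A" if "sublinear_on V p" "\<And>x. x \<in> V \<Longrightarrow> p x \<le> q x" for p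
    using that V_closed unfolding A_def sublinear_on_def by auto
  have "partial_order_on A (relation_of P A)"
  proof (rule partial_order_on_relation_ofI)
    show "P p p" if "p \<in> A" for p by (simp add: P_def)
    show "P p1 p3" if "p1 \<in> A" "p2 \<in> A" "p3 \<in> A" "P p1 p2" "P p2 p3" for p1 p2 p3
      using that(4,5) unfolding P_def by (meson order_trans)
    show "p1 = p2" if "p1 \<in> A" "p2 \<in> A" "P p1 p2" "P p2 p1" for p1 p2
    proof
      fix x show "p1 x = p2 x" using that unfolding A_def P_def by (cases "x \<in> V") (auto intro: order_antisym)
    qed
  qed
  moreover have "\<exists>u\<in>A. \<forall>p\<in>C. P p u" if C: "C \<in> Chains (relation_of P A)" for C
  proof (cases "C = {}")
    case True
    then show ?thesis using trunc[OF q] by auto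
  next
    case False
    have CA: "p \<in> A" if "p \<in> C" for p using C that by (auto simp: Chains_def relation_of_def)
    have CP: "P p p' \<or> P p' p" if "p \<in> C" "p' \<in> C" for p p' using C that by (auto simp: Chains_def relation_of_def)
    define u where "u x = (INF p\<in>C. p x)" for x
    have bd: "bdd_below ((\<lambda>p. p x) ` C)" if x: "x \<in> V" for x
    proof (rule bdd_belowI2)
      fix p assume "p \<in> C"
      from CA[OF this] have p: "sublinear_on V p" "p (- x) \<le> q (- x)" using V_closed(4)[OF x] by (auto simp: A_def)
      show "- q (- x) \<le> p x" using sublinear_on_lower[OF p(1) x] p(2) by simp
    qed
    have ule: "u x \<le> p x" if "p \<in> C" "x \<in> V" for p x
      unfolding u_def by (rule cINF_lower[OF bd[OF that(2)] that(1)])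
    have "sublinear_on V u"
    proof (rule sublinear_on_intro)
      fix x y assume xy: "x \<in> V" "y \<in> V"
      \<comment> \<open>The chain property enters here: of two members, the one that is smaller
        serves at both points at once.\<close>
      have "u (x + y) - p y \<le> p' x" if pp: "p \<in> C" "p' \<in> C" for p p'
      proof -
        have sub: "p (x + y) \<le> p x + p y" "p' (x + y) \<le> p' x + p' y"
          using CA[OF pp(1)] CA[OF pp(2)] xy unfolding A_def sublinear_on_def by auto
        have "u (x + y) \<le> p (x + y)" "u (x + y) \<le> p' (x + y)" using pp xy by (auto intro!: ule V_closed)
        moreover have "p x \<le> p' x \<or> p' y \<le> p y" using CP[OF pp] xy by (auto simp: P_def)
        ultimately show ?thesis using sub by linarith
      qed
      then have "u (x + y) - p y \<le> u x" if "p \<in> C" for p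
        unfolding u_def[of x] using that False by (intro cINF_greatest) auto
      then have "u (x + y) - u x \<le> p y" if "p \<in> C" for p using that by (simp add: algebra_simps)
      then have "u (x + y) - u x \<le> u y" unfolding u_def[of y] using False by (intro cINF_greatest) auto
      then show "u (x + y) \<le> u x + u y" by simp
    next
      fix t :: real and x assume t: "0 < t" and x: "x \<in> V"
      have "u (cscale (of_real t) x) / t \<le> p x" if "p \<in> C" for p
      proof -
        have "u (cscale (of_real t) x) \<le> p (cscale (of_real t) x)" using that x by (intro ule V_closed)
        also have "\<dots> = t * p x" using CA[OF that] t x by (auto simp: A_def sublinear_on_def)
        finally show ?thesis using t by (simp add: pos_divide_le_eq mult.commute)
      qed
      then have "u (cscale (of_real t) x) / t \<le> u x" unfolding u_def[of x] using False by (intro cINF_greatest) auto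
      then show "u (cscale (of_real t) x) \<le> t * u x" using t by (simp add: pos_divide_le_eq mult.commute)
    qed
    moreover obtain p0 where p0: "p0 \<in> C" using False by blast
    have "u x \<le> q x" if "x \<in> V" for x using ule[OF p0 that] CA[OF p0] that unfolding A_def by force
    ultimately have "(\<lambda>x. if x \<in> V then u x else 0) \<in> A" by (intro trunc)
    moreover have "P p (\<lambda>x. if x \<in> V then u x else 0)" if "p \<in> C" for p using ule[OF that] by (simp add: P_def)
    ultimately show ?thesis by blast
  qed
  ultimately obtain m where m: "m \<in> A" "\<And>p. p \<in> A \<Longrightarrow> P m p \<Longrightarrow> p = m" using predicate_Zorn[of A P] by blast
  show thesis
  proof (rule that[of m])
    show "sublinear_on V m" "\<And>x. x \<in> V \<Longrightarrow> m x \<le> q x" using m(1) by (auto simp: A_def)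
    have "p' x = m x" if p': "sublinear_on V p'" "\<forall>x\<in>V. p' x \<le> m x" and x: "x \<in> V" for p' x
    proof -
      have "p' y \<le> q y" if "y \<in> V" for y using p'(2) m(1) that unfolding A_def by force
      then have "(\<lambda>x. if x \<in> V then p' x else 0) \<in> A" using p'(1) by (intro trunc)
      moreover have "P m (\<lambda>x. if x \<in> V then p' x else 0)" using p'(2) by (simp add: P_def)
      ultimately have "(\<lambda>x. if x \<in> V then p' x else 0) = m" by (rule m(2))
      from fun_cong[OF this, of x] show ?thesis using x by simp
    qed
    then show "\<forall>p'. sublinear_on V p' \<longrightarrow> (\<forall>x\<in>V. p' x \<le> m x) \<longrightarrow> (\<forall>x\<in>V. p' x = m x)" by blast
  qed
qed

text \<open>The distance to \<open>M\<close> is sublinear and vanishes on \<open>M\<close>. A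
  minimal sublinear functional below it is real linear and is then made complex linear; starting the
  minimisation from \<open>directional_inf p0 f\<close> keeps it from degenerating at
  \<open>f\<close>.\<close>

lemma Hahn_Banach_separation:
  assumes N: "\<And>x y. x \<in> V \<Longrightarrow> y \<in> V \<Longrightarrow> N (x + y) \<le> N x + N y" "\<And>b x. x \<in> V \<Longrightarrow> N (cscale b x) = cmod b * N x"
    and M: "cfun.subspace M" "M \<subseteq> V" and f: "f \<in> V" and e: "0 < e" "\<And>g. g \<in> M \<Longrightarrow> e \<le> N (f - g)"
  obtains S :: "('x \<Rightarrow> complex) \<Rightarrow> complex" where
    "\<And>x y. x \<in> V \<Longrightarrow> y \<in> V \<Longrightarrow> S (x + y) = S x + S y" "\<And>b x. x \<in> V \<Longrightarrow> S (cscale b x) = b * S x"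
    "\<And>x. x \<in> V \<Longrightarrow> cmod (S x) \<le> 2 * N x" "\<And>g. g \<in> M \<Longrightarrow> S g = 0" "S f \<noteq> 0"
proof -
  have neg: "- x = cscale (- 1) x" for x :: "'x \<Rightarrow> complex" by (simp add: cscale_def fun_eq_iff)
  have Nneg: "N (- x) = N x" if "x \<in> V" for x using N(2)[OF that, of "- 1"] unfolding neg[symmetric] by simp
  have N0: "N 0 = 0" using N(2)[OF V_closed(3), of 0] by (simp add: cscale_def zero_fun_def)
  have Nn: "0 \<le> N x" if "x \<in> V" for x
    using N(1)[OF that V_closed(4)[OF that]] Nneg[OF that] N0 by simp
  have MV: "g \<in> M \<Longrightarrow> g \<in> V" for g using M(2) by blast
  have Mc: "0 \<in> M" "\<And>g h. g \<in> M \<Longrightarrow> h \<in> M \<Longrightarrow> g + h \<in> M" "\<And>b g. g \<in> M \<Longrightarrow> cscale b g \<in> M"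
    using M(1) by (auto simp: cfun.subspace_def)
  have diff: "x - g \<in> V" if "x \<in> V" "g \<in> M" for x g using cfun.subspace_diff[OF V that(1) MV[OF that(2)]] .
  define p0 where "p0 x = (INF g\<in>M. N (x - g))" for x
  have p0le: "p0 x \<le> N (x - g)" if "x \<in> V" "g \<in> M" for x g
    unfolding p0_def by (rule cINF_lower[OF bdd_belowI2[of _ 0] that(2)]) (simp add: Nn diff that(1))
  have p0ge: "B \<le> p0 x" if "\<And>g. g \<in> M \<Longrightarrow> B \<le> N (x - g)" for B x
    unfolding p0_def using that Mc(1) by (intro cINF_greatest) auto
  have sub: "sublinear_on V p0"
  proof (rule sublinear_on_intro)
    fix x y assume xy: "x \<in> V" "y \<in> V"
    have "p0 (x + y) - N (x - g) \<le> N (y - h)" if gh: "g \<in> M" "h \<in> M" for g h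
    proof -
      have "p0 (x + y) \<le> N ((x + y) - (g + h))" using xy gh by (intro p0le V_closed Mc)
      also have "(x + y) - (g + h) = (x - g) + (y - h)" by simp
      also have "N \<dots> \<le> N (x - g) + N (y - h)" using xy gh by (intro N diff)
      finally show ?thesis by linarith
    qed
    then have "p0 (x + y) - N (x - g) \<le> p0 y" if "g \<in> M" for g using that by (intro p0ge)
    then have "p0 (x + y) - p0 y \<le> N (x - g)" if "g \<in> M" for g using that by (simp add: algebra_simps)
    then have "p0 (x + y) - p0 y \<le> p0 x" by (rule p0ge)
    then show "p0 (x + y) \<le> p0 x + p0 y" by simp
  next
    fix t :: real and x assume t: "0 < t" and x: "x \<in> V"
    have "p0 (cscale (of_real t) x) / t \<le> N (x - g)" if g: "g \<in> M" for g
    proof -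
      have "p0 (cscale (of_real t) x) \<le> N (cscale (of_real t) x - cscale (of_real t) g)" using x g by (intro p0le V_closed Mc)
      also have "cscale (of_real t) x - cscale (of_real t) g = cscale (of_real t) (x - g)"
        by (simp add: cscale_def fun_eq_iff algebra_simps)
      also have "N \<dots> = t * N (x - g)" using N(2)[OF diff[OF x g]] t by simp
      finally show ?thesis using t by (simp add: pos_divide_le_eq mult.commute)
    qed
    then have "p0 (cscale (of_real t) x) / t \<le> p0 x" by (rule p0ge)
    then show "p0 (cscale (of_real t) x) \<le> t * p0 x" using t by (simp add: pos_divide_le_eq mult.commute)
  qed
  have c0: "x + cscale (of_real 0) y = x" for x y :: "'x \<Rightarrow> complex" by (simp add: cscale_def fun_eq_iff)
  have c1: "cscale (of_real 1) y = y" for y :: "'x \<Rightarrow> complex" by (simp add: cscale_def fun_eq_iff)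
  \<comment> \<open>Minimising below \<open>directional_inf p0 f\<close> rather than
    \<open>p0\<close> forces \<open>p (- f) \<le> - p0 f\<close>, that is
    \<open>p f \<ge> p0 f \<ge> e\<close>.\<close>
  obtain p where p: "sublinear_on V p" "\<And>x. x \<in> V \<Longrightarrow> p x \<le> directional_inf p0 f x"
    "\<forall>p'. sublinear_on V p' \<longrightarrow> (\<forall>x\<in>V. p' x \<le> p x) \<longrightarrow> (\<forall>x\<in>V. p' x = p x)"
    by (rule minimal_sublinear[OF sublinear_directional_inf[OF sub f]]) (rule that)
  have add: "p (x + h) = p x + p h" if x: "x \<in> V" and h: "h \<in> V" for x h
  proof (rule order_antisym)
    show "p (x + h) \<le> p x + p h" using p(1) x h unfolding sublinear_on_def by blast
    have "directional_inf p h x = p x"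
    proof (rule p(3)[rule_format, OF sublinear_directional_inf[OF p(1) h] _ x])
      show "directional_inf p h y \<le> p y" if "y \<in> V" for y
        using directional_inf_le[OF p(1) h that order_refl] unfolding c0 by linarith
    qed
    then show "p x + p h \<le> p (x + h)"
      using directional_inf_le[OF p(1) h x, of 1] unfolding c1 by linarith
  qed
  have pm: "p (- x) = - p x" if "x \<in> V" for x
    using add[OF that V_closed(4)[OF that]] sublinear_on_zero[OF p(1)] by simp
  have ple: "p x \<le> p0 x" if "x \<in> V" for x
    using p(2)[OF that] directional_inf_le[OF sub f that order_refl] unfolding c0 by linarith
  have scale: "p (cscale (of_real t) x) = t * p x" if x: "x \<in> V" for t x
  proof -
    consider "0 < t" | "t = 0" | "t < 0" by linarith
    then show ?thesis
    proof cases
      case 1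
      then show ?thesis using p(1) x unfolding sublinear_on_def by blast
    next
      case 2
      then have "cscale (of_real t) x = 0" by (simp add: cscale_def fun_eq_iff)
      then show ?thesis using 2 sublinear_on_zero[OF p(1)] by simp
    next
      case 3
      then have "0 < - t" by simp
      then have 1: "p (cscale (of_real (- t)) x) = - t * p x" using p(1) x unfolding sublinear_on_def by blast
      have 2: "cscale (of_real t) x = - cscale (of_real (- t)) x" by (simp add: cscale_def fun_eq_iff)
      show ?thesis unfolding 2 pm[OF V_closed(2)[OF x]] 1 by simp
    qed
  qed
  have pN: "\<bar>p x\<bar> \<le> N x" if "x \<in> V" for x
  proof -
    have "p y \<le> N y" if "y \<in> V" for y using ple[OF that] p0le[OF that Mc(1)] by simp
    from this[OF that] this[OF V_closed(4)[OF that]] show ?thesis using pm[OF that] Nneg[OF that] by simp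
  qed
  have pM: "p g = 0" if g: "g \<in> M" for g
  proof -
    have "p h \<le> 0" if "h \<in> M" for h using ple[OF MV[OF that]] p0le[OF MV[OF that] that] N0 by simp
    from this[OF g] this[of "- g"] Mc(3)[OF g, of "- 1"] show ?thesis using pm[OF MV[OF g]] unfolding neg[symmetric] by simp
  qed
  have pf: "e \<le> p f"
  proof -
    have "p (- f) \<le> p0 (- f + cscale (of_real 1) f) - 1 * p0 f"
      using p(2)[OF V_closed(4)[OF f]] directional_inf_le[OF sub f V_closed(4)[OF f], of 1] by simp
    then have "p (- f) \<le> - p0 f" using sublinear_on_zero[OF sub] unfolding c1 by simp
    moreover have "e \<le> p0 f" by (rule p0ge) (rule e(2))
    ultimately show ?thesis using pm[OF f] by simp
  qed
  \<comment> \<open>The usual complex linear functional with real part \<open>p\<close>; estimating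
    the real and imaginary parts separately gives the constant 2.\<close>
  define S where "S x = complex_of_real (p x) - \<i> * of_real (p (cscale \<i> x))" for x
  show thesis
  proof (rule that[of S])
    fix x y assume xy: "x \<in> V" "y \<in> V"
    have "cscale \<i> (x + y) = cscale \<i> x + cscale \<i> y" by (simp add: cscale_def fun_eq_iff algebra_simps)
    then have "p (cscale \<i> (x + y)) = p (cscale \<i> x) + p (cscale \<i> y)"
      using add[OF V_closed(2)[OF xy(1)] V_closed(2)[OF xy(2)]] by simp
    then show "S (x + y) = S x + S y" by (simp add: S_def add[OF xy] algebra_simps)
  next
    fix b x assume x: "x \<in> V"
    have "cscale b x = cscale (of_real (Re b)) x + cscale (of_real (Im b)) (cscale \<i> x)"
      "cscale \<i> (cscale b x) = cscale (of_real (Re b)) (cscale \<i> x) + cscale (of_real (- Im b)) x"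
      by (simp_all add: cscale_def fun_eq_iff algebra_simps complex_eq_iff)
    then have "p (cscale b x) = Re b * p x + Im b * p (cscale \<i> x)" "p (cscale \<i> (cscale b x)) = Re b * p (cscale \<i> x) - Im b * p x"
      using x by (simp_all only: add scale V_closed)
    then show "S (cscale b x) = b * S x" by (simp add: S_def complex_eq_iff)
  next
    fix x assume x: "x \<in> V"
    have "cmod (S x) \<le> \<bar>p x\<bar> + \<bar>p (cscale \<i> x)\<bar>"
      using norm_triangle_ineq4[of "complex_of_real (p x)" "\<i> * of_real (p (cscale \<i> x))"] by (simp add: S_def norm_mult)
    also have "\<dots> \<le> N x + N (cscale \<i> x)" by (intro add_mono pN V_closed x)
    finally show "cmod (S x) \<le> 2 * N x" using N(2)[OF x, of \<i>] by simp
  next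
    show "S g = 0" if "g \<in> M" for g using pM[OF that] pM[OF Mc(3)[OF that]] by (simp add: S_def)
    show "S f \<noteq> 0" using pf e(1) by (auto simp: S_def complex_eq_iff)
  qed
qed

end


section \<open>Seminorm topologies and the dual space\<close>

lemma topspace_seminorm_topology: "topspace (seminorm_topology X \<P>) = X"
  unfolding seminorm_topology_def by auto

lemma openin_seminorm_ball:
  "p \<in> \<P> \<Longrightarrow> f \<in> X \<Longrightarrow> 0 < e \<Longrightarrow> openin (seminorm_topology X \<P>) {g \<in> X. p (g - f) < e}"
  unfolding seminorm_topology_def by (rule topology_generated_by_Basis) blast

lemma openin_seminorm_topologyI:
  assumes X: "A \<subseteq> X" and p0: "\<And>p. p \<in> \<P> \<Longrightarrow> p 0 = 0"
    and ball: "\<And>f. f \<in> A \<Longrightarrow> \<exists>p\<in>\<P>. \<exists>d>0. {g \<in> X. p (g - f) < d} \<subseteq> A"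
  shows "openin (seminorm_topology X \<P>) A"
proof (subst openin_subopen, intro ballI)
  fix f assume f: "f \<in> A"
  obtain p d where p: "p \<in> \<P>" "0 < d" "{g \<in> X. p (g - f) < d} \<subseteq> A" using ball[OF f] by blast
  have "f \<in> {g \<in> X. p (g - f) < d}" using f X p0[OF p(1)] p(2) by auto
  then show "\<exists>T. openin (seminorm_topology X \<P>) T \<and> f \<in> T \<and> T \<subseteq> A"
    using openin_seminorm_ball[OF p(1) _ p(2), of f X] p(3) f X by blast
qed

lemma continuous_map_seminorm_topologyI:
  fixes h :: "('x \<Rightarrow> complex) \<Rightarrow> 'b::metric_space"
  assumes p0: "\<And>p. p \<in> \<P> \<Longrightarrow> p 0 = 0"
    and ball: "\<And>f e. f \<in> X \<Longrightarrow> 0 < e \<Longrightarrow> \<exists>p\<in>\<P>. \<exists>d>0. \<forall>g\<in>X. p (g - f) < d \<longrightarrow> dist (h g) (h f) < e"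
  shows "continuous_map (seminorm_topology X \<P>) euclidean h"
  unfolding continuous_map_def topspace_seminorm_topology
proof (intro conjI allI impI)
  fix T :: "'b set" assume "openin euclidean T"
  then have T: "open T" by simp
  show "openin (seminorm_topology X \<P>) {x \<in> X. h x \<in> T}"
  proof (rule openin_seminorm_topologyI)
    show "p 0 = 0" if "p \<in> \<P>" for p by (rule p0[OF that])
    fix f assume f: "f \<in> {x \<in> X. h x \<in> T}"
    then obtain e where e: "0 < e" "\<And>y. dist y (h f) < e \<Longrightarrow> y \<in> T" using T unfolding open_dist by blast
    obtain p d where "p \<in> \<P>" "0 < d" "\<forall>g\<in>X. p (g - f) < d \<longrightarrow> dist (h g) (h f) < e" using ball[OF _ e(1)] f by blast
    then show "\<exists>p\<in>\<P>. \<exists>d>0. {g \<in> X. p (g - f) < d} \<subseteq> {x \<in> X. h x \<in> T}" using e(2) by blast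
  qed auto
qed auto

context ultra_data
begin

lemma nrm_zero: "0 < q \<Longrightarrow> q < 1 \<Longrightarrow> nrm q k 0 = 0"
  using nrm_least[OF U_zero(1), of q k 0] by (simp add: U_zero(2) order_antisym)

lemma U_top_alt: "U_top \<omega> a c = seminorm_topology U {nrm q k | q k. 0 < q \<and> q < 1}"
  unfolding U_top_def nrm_def[abs_def] by (rule arg_cong[where f = "seminorm_topology U"]) auto

lemma topspace_U_top: "topspace (U_top \<omega> a c) = U"
  unfolding U_top_alt by (rule topspace_seminorm_topology)

text \<open>By induction on the generation of the topology. For intersections the seminorms must be
  directed: the maxima of the two indices give one ball inside both.\<close>

lemma openin_U_top_ball:
  assumes "openin (U_top \<omega> a c) T" "f \<in> T"
  shows "\<exists>q k e. 0 < q \<and> q < 1 \<and> 0 < e \<and> {g \<in> U. nrm q k (g - f) < e} \<subseteq> T"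
proof -
  have TU: "T \<subseteq> U" using openin_subset[OF assms(1)] unfolding topspace_U_top .
  have "generate_topology_on (insert U {{g \<in> U. p (g - f) < e} |p f e. p \<in> {nrm q k | q k. 0 < q \<and> q < 1} \<and> f \<in> U \<and> 0 < e}) T"
    using assms(1) unfolding U_top_alt seminorm_topology_def by (rule openin_topology_generated_by)
  then show ?thesis using assms(2)
  proof (induction arbitrary: f)
    case Empty
    then show ?case by simp
  next
    case (Int A B)
    obtain q k e q' k' e' where A: "0 < q" "q < 1" "0 < e" "{g \<in> U. nrm q k (g - f) < e} \<subseteq> A"
      and B: "0 < q'" "q' < 1" "0 < e'" "{g \<in> U. nrm q' k' (g - f) < e'} \<subseteq> B"
      using Int.IH(1)[of f] Int.IH(2)[of f] Int.prems by blast
    have "f \<in> U"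
    proof -
      from Int.hyps(1) have "A \<subseteq> U" by (induction) auto
      then show ?thesis using Int.prems by blast
    qed
    then have "{g \<in> U. nrm (max q q') (max k k') (g - f) < min e e'} \<subseteq> A \<inter> B"
    proof (intro subsetI)
      fix g assume "f \<in> U" and g: "g \<in> {g \<in> U. nrm (max q q') (max k k') (g - f) < min e e'}"
      then have gf: "g - f \<in> U" by (intro U_diff) auto
      have "nrm q k (g - f) \<le> nrm (max q q') (max k k') (g - f)"
        "nrm q' k' (g - f) \<le> nrm (max q q') (max k k') (g - f)"
        using A(1,2) B(1,2) by (auto intro!: nrm_mono[OF gf])
      then show "g \<in> A \<inter> B" using g A(4) B(4) by fastforce
    qed
    moreover have "0 < max q q'" "max q q' < 1" "0 < min e e'" using A B by auto
    ultimately show ?case by blast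
  next
    case (UN K)
    then obtain A where A: "A \<in> K" "f \<in> A" by blast
    from UN.IH[OF A] show ?case using A(1) by blast
  next
    case (Basis A)
    then consider "A = U" | q k h e where "0 < q" "q < 1" "h \<in> U" "0 < e" "A = {g \<in> U. nrm q k (g - h) < e}" by blast
    then show ?case
    proof cases
      case 1
      then show ?thesis by (intro exI[of _ "1/2"] exI[of _ 0] exI[of _ 1]) auto
    next
      case 2
      then have f: "f \<in> U" "nrm q k (f - h) < e" using Basis.prems by auto
      have "{g \<in> U. nrm q k (g - f) < e - nrm q k (f - h)} \<subseteq> A"
      proof (intro subsetI)
        fix g assume g: "g \<in> {g \<in> U. nrm q k (g - f) < e - nrm q k (f - h)}"
        then have "nrm q k ((g - f) + (f - h)) \<le> nrm q k (g - f) + nrm q k (f - h)"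
          using f 2 by (intro nrm_triangle U_diff) auto
        then have "nrm q k (g - h) < e" using g by simp
        then show "g \<in> A" using g 2(5) by simp
      qed
      moreover have "0 < e - nrm q k (f - h)" using f(2) by simp
      ultimately show ?thesis using 2(1,2) by blast
    qed
  qed
qed

lemma functional_continuous:
  assumes S: "functional S"
  shows "continuous_map (U_top \<omega> a c) euclidean S"
  unfolding U_top_alt
proof (rule continuous_map_seminorm_topologyI)
  show "p 0 = 0" if "p \<in> {nrm q k | q k. 0 < q \<and> q < 1}" for p
    using that nrm_zero by auto
  obtain q k K where b: "\<And>f. f \<in> U \<Longrightarrow> cmod (S f) \<le> K * nrm q k f" "0 < q" "q < 1" "0 < K"
    by (rule functional_bound[OF S]) (rule that)
  fix f and e :: real assume f: "f \<in> U" and e: "0 < e"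
  have "dist (S g) (S f) < e" if g: "g \<in> U" "nrm q k (g - f) < e / K" for g
  proof -
    have "dist (S g) (S f) = cmod (S (g - f))" using functional_linear(3)[OF S g(1) f] by (simp add: dist_norm)
    also have "\<dots> \<le> K * nrm q k (g - f)" by (rule b(1)[OF U_diff(1)[OF g(1) f]])
    also have "\<dots> < e" using g(2) b(4) by (simp add: pos_less_divide_eq mult.commute)
    finally show ?thesis .
  qed
  moreover have "0 < e / K" using e b(4) by simp
  ultimately show "\<exists>p\<in>{nrm q k | q k. 0 < q \<and> q < 1}. \<exists>d>0. \<forall>g\<in>U. p (g - f) < d \<longrightarrow> dist (S g) (S f) < e"
    using b(2,3) by blast
qed

lemma functional_if_continuous:
  assumes lin: "\<And>f g. f \<in> U \<Longrightarrow> g \<in> U \<Longrightarrow> S (f + g) = S f + S g" "\<And>b f. f \<in> U \<Longrightarrow> S (cscale b f) = b * S f"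
    and c: "continuous_map (U_top \<omega> a c) euclidean S"
  shows "functional S"
proof -
  have S0: "S 0 = 0" using lin(2)[OF U_zero(1), of 0] by (simp add: cscale_def zero_fun_def)
  have "openin (U_top \<omega> a c) {x \<in> topspace (U_top \<omega> a c). S x \<in> ball 0 1}"
    by (rule openin_continuous_map_preimage[OF c]) simp
  moreover have "0 \<in> {x \<in> topspace (U_top \<omega> a c). S x \<in> ball 0 1}" using U_zero(1) S0 by (simp add: topspace_U_top)
  ultimately obtain q k e where q: "0 < q" "q < 1" "0 < e"
    and sub: "{g \<in> U. nrm q k (g - 0) < e} \<subseteq> {x \<in> topspace (U_top \<omega> a c). S x \<in> ball 0 1}"
    using openin_U_top_ball by meson
  have "cmod (S f) \<le> 1 / e * nrm q k f" if f: "f \<in> U" for f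
  proof (rule field_le_epsilon)
    fix \<epsilon> :: real assume \<epsilon>: "0 < \<epsilon>"
    \<comment> \<open>Scaling by \<open>t\<close> brings \<open>f\<close> into the ball; the summand
      \<open>e * \<epsilon>\<close> keeps the denominator positive when the seminorm of
      \<open>f\<close> is \<open>0\<close>.\<close>
    define t where "t = e / (nrm q k f + e * \<epsilon>)"
    have pos: "0 < nrm q k f + e * \<epsilon>" using q(3) \<epsilon> by (simp add: add_nonneg_pos)
    have t: "0 < t" "t * nrm q k f < e" using pos q(3) \<epsilon> by (simp_all add: t_def pos_divide_less_eq distrib_left)
    have tf: "cscale (of_real t) f \<in> U" by (rule U_cscale(1)[OF f])
    have "nrm q k (cscale (of_real t) f) < e" using nrm_cscale[OF f q(1,2), of k "of_real t"] t by simp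
    then have "cscale (of_real t) f \<in> {x \<in> topspace (U_top \<omega> a c). S x \<in> ball 0 1}"
      using sub tf by auto
    then have "cmod (S (cscale (of_real t) f)) < 1" by simp
    then have "t * cmod (S f) < 1" using lin(2)[OF f] t(1) by (simp add: norm_mult)
    then have "cmod (S f) < 1 / t" using t(1) by (simp add: pos_less_divide_eq mult.commute)
    also have "1 / t = 1 / e * nrm q k f + \<epsilon>" using q(3) pos by (simp add: t_def field_simps)
    finally show "cmod (S f) \<le> 1 / e * nrm q k f + \<epsilon>" by simp
  qed
  moreover have "0 < 1 / e" using q(3) by simp
  ultimately show ?thesis unfolding functional_def using lin q(1,2) by blast
qed

lemma functional_cong:
  assumes S: "functional S" and eq: "\<And>f. f \<in> U \<Longrightarrow> T f = S f"
  shows "functional T"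
proof -
  have "f + g \<in> U" "cscale b f \<in> U" if "f \<in> U" "g \<in> U" for f g b using that U_add(1) U_cscale(1) by auto
  then show ?thesis using S eq unfolding functional_def by auto
qed

lemma U_dual_iff: "S \<in> U_dual \<omega> a c \<longleftrightarrow> S \<in> extensional U \<and> functional S"
  unfolding U_dual_def using functional_if_continuous[of S] functional_continuous[of S] functional_linear(1,2)[of S]
  by blast

lemma U_separation:
  assumes M: "cfun.subspace M" "M \<subseteq> U" and f: "f \<in> U" "f \<notin> U_top \<omega> a c closure_of M"
  obtains S where "functional S" "\<And>g. g \<in> M \<Longrightarrow> S g = 0" "S f \<noteq> 0"
proof -
  obtain T where T: "f \<in> T" "openin (U_top \<omega> a c) T" "T \<inter> M = {}"
    using f unfolding in_closure_of topspace_U_top by blast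
  obtain q k e where q: "0 < q" "q < 1" "0 < e" "{g \<in> U. nrm q k (g - f) < e} \<subseteq> T"
    using openin_U_top_ball[OF T(2,1)] by blast
  have "e \<le> nrm q k (f - g)" if g: "g \<in> M" for g
  proof -
    have gU: "g \<in> U" using g M(2) by blast
    have "cscale (- 1) (f - g) = g - f" by (simp add: cscale_def fun_eq_iff)
    then have "nrm q k (g - f) = nrm q k (f - g)" using nrm_cscale[OF U_diff(1)[OF f(1) gU] q(1,2), of k "- 1"] by simp
    moreover have "\<not> nrm q k (g - f) < e" using q(4) T(3) g gU by blast
    ultimately show ?thesis by simp
  qed
  note dist = this
  show thesis
  proof (rule Hahn_Banach_separation[OF U_subspace, of "nrm q k" M f e])
    show "nrm q k (x + y) \<le> nrm q k x + nrm q k y" if "x \<in> U" "y \<in> U" for x y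
      by (rule nrm_triangle[OF that q(1,2)])
    show "nrm q k (cscale b x) = cmod b * nrm q k x" if "x \<in> U" for b x
      by (rule nrm_cscale[OF that q(1,2)])
    show "e \<le> nrm q k (f - g)" if "g \<in> M" for g by (rule dist[OF that])
    fix S :: "(real \<Rightarrow> complex) \<Rightarrow> complex"
    assume S: "\<And>x y. x \<in> U \<Longrightarrow> y \<in> U \<Longrightarrow> S (x + y) = S x + S y" "\<And>b x. x \<in> U \<Longrightarrow> S (cscale b x) = b * S x"
      "\<And>x. x \<in> U \<Longrightarrow> cmod (S x) \<le> 2 * nrm q k x" "\<And>g. g \<in> M \<Longrightarrow> S g = 0" "S f \<noteq> 0"
    have "(0::real) < 2" by simp
    then have "functional S" unfolding functional_def using S(1-3) q(1,2) by blast
    then show thesis using S(4,5) by (rule that)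
  qed (fact M f(1) q(3))+
qed

lemma functional_zero_on_closure:
  assumes S: "functional S" and M: "\<And>g. g \<in> M \<Longrightarrow> S g = 0" and f: "f \<in> U_top \<omega> a c closure_of M"
  shows "S f = 0"
proof -
  have "S ` (U_top \<omega> a c closure_of M) \<subseteq> euclidean closure_of (S ` M)"
    by (rule continuous_map_image_closure_subset[OF functional_continuous[OF S]])
  also have "S ` M \<subseteq> {0}" using M by auto
  then have "euclidean closure_of (S ` M) \<subseteq> {0}" by (intro closure_of_minimal) auto
  finally show ?thesis using f by blast
qed

text \<open>The annihilator without the extensionality convention; by
  \<open>fourier_laplace_annihilator\<close> this makes no difference to the transforms.\<close>

definition ann :: "(real \<Rightarrow> complex) set \<Rightarrow> ((real \<Rightarrow> complex) \<Rightarrow> complex) set" where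
  "ann X = {S. functional S \<and> (\<forall>f\<in>X. S f = 0)}"

definition transforms :: "(real \<Rightarrow> complex) set \<Rightarrow> (complex \<Rightarrow> complex) set" where
  "transforms X = (\<lambda>S z. S (efun z)) ` ann X"

lemma bipolar:
  assumes M: "cfun.subspace M" "closedin (U_top \<omega> a c) M" and f: "f \<in> U" and z: "\<And>S. S \<in> ann M \<Longrightarrow> S f = 0"
  shows "f \<in> M"
proof (rule ccontr)
  assume "f \<notin> M"
  then have "f \<notin> U_top \<omega> a c closure_of M" using M(2) by (simp add: closure_of_closedin)
  moreover have "M \<subseteq> U" using closedin_subset[OF M(2)] by (simp add: topspace_U_top)
  ultimately obtain S where "functional S" "\<And>g. g \<in> M \<Longrightarrow> S g = 0" "S f \<noteq> 0"
    using U_separation[OF M(1) _ f] by blast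
  then show False using z[of S] by (simp add: ann_def)
qed

lemma fourier_laplace_annihilator:
  assumes "W \<subseteq> U"
  shows "fourier_laplace a ` annihilator \<omega> a c W = transforms W"
proof (intro set_eqI iffI)
  fix \<phi> assume "\<phi> \<in> fourier_laplace a ` annihilator \<omega> a c W"
  then obtain S where "S \<in> ann W" "\<phi> = fourier_laplace a S"
    unfolding annihilator_def U_dual_iff ann_def by blast
  then show "\<phi> \<in> transforms W" unfolding transforms_def by (auto simp: fourier_laplace_efun fun_eq_iff)
next
  fix \<phi> assume "\<phi> \<in> transforms W"
  then obtain S where S: "functional S" "\<forall>f\<in>W. S f = 0" "\<phi> = (\<lambda>z. S (efun z))" unfolding transforms_def ann_def by blast
  have "restrict S U \<in> annihilator \<omega> a c W"
    unfolding annihilator_def U_dual_iff using assms S(2) functional_cong[OF S(1), of "restrict S U"] by auto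
  moreover have "\<phi> = fourier_laplace a (restrict S U)" by (simp add: S(3) fourier_laplace_efun fun_eq_iff efun_U)
  ultimately show "\<phi> \<in> fourier_laplace a ` annihilator \<omega> a c W" by blast
qed

end

section \<open>Annihilator submodules and weak synthesis\<close>

text \<open>Removes the existential: only the conditions that all members vanish to a given order
  remain, and these are what the annihilator translates into.\<close>

lemma zero_set_alt:
  "zero_set J = {(\<mu>, n). 1 \<le> n \<and> (\<forall>\<psi>\<in>J. vanishes_at_least \<psi> \<mu> n) \<and> \<not> (\<forall>\<psi>\<in>J. vanishes_at_least \<psi> \<mu> (Suc n))}"
  unfolding zero_set_def vanishes_at_least_def less_Suc_eq by auto

text \<open>A nonempty interval determines its end points; an empty one does not, whence the second
  hypothesis.\<close>

lemma indicator_segment_eqD: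
  assumes "indicator_segment J' = indicator_segment J"
    and "- (SUP \<phi>\<in>J. indicator_fun \<phi> (- (pi / 2))) \<le> (SUP \<phi>\<in>J. indicator_fun \<phi> (pi / 2))"
  shows "(SUP \<phi>\<in>J'. indicator_fun \<phi> (- (pi / 2))) = (SUP \<phi>\<in>J. indicator_fun \<phi> (- (pi / 2)))"
    "(SUP \<phi>\<in>J'. indicator_fun \<phi> (pi / 2)) = (SUP \<phi>\<in>J. indicator_fun \<phi> (pi / 2))"
  using assms unfolding indicator_segment_def by (auto simp: Icc_eq_Icc)

text \<open>If a neighbourhood of \<open>x\<close> missed \<open>X\<close>, points of
  \<open>X\<close> would still lie on both sides of \<open>x\<close>, and convexity would put
  \<open>x\<close> into \<open>X\<close>.\<close>

lemma rel_closed_interval_mem: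
  assumes X: "rel_closed_interval a X" and x: "x \<in> sym_interval a"
    and le: "(INF y\<in>X. ereal y) \<le> ereal x" "ereal x \<le> (SUP y\<in>X. ereal y)"
  shows "x \<in> X"
proof -
  have conv: "z \<in> X" if "y \<in> X" "w \<in> X" "y \<le> z" "z \<le> w" for y z w
    using X that unfolding rel_closed_interval_def is_interval_1 by blast
  obtain T where T: "closed T" "X = sym_interval a \<inter> T"
    using X unfolding rel_closed_interval_def closedin_closed by blast
  have "x \<in> T"
  proof (rule ccontr)
    assume "x \<notin> T"
    then have "open (- T)" "x \<in> - T" using T(1) by auto
    then obtain e where e: "0 < e" "\<And>y. dist y x < e \<Longrightarrow> y \<notin> T" unfolding open_dist by blast
    have "ereal (x - e / 2) < (SUP y\<in>X. ereal y)" by (rule less_le_trans[OF _ le(2)]) (use e(1) in simp)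
    moreover have "(INF y\<in>X. ereal y) < ereal (x + e / 2)" by (rule le_less_trans[OF le(1)]) (use e(1) in simp)
    ultimately obtain y w where y: "y \<in> X" "x - e / 2 < y" and w: "w \<in> X" "w < x + e / 2"
      unfolding less_SUP_iff INF_less_iff by auto
    have far: "e \<le> \<bar>z - x\<bar>" if "z \<in> X" for z using e(2)[of z] that T(2) by (force simp: dist_real_def)
    have "x \<le> y" "w \<le> x" using far[OF y(1)] far[OF w(1)] y w e(1) by linarith+
    then have "x \<in> X" using conv[OF w(1) y(1)] by simp
    then show False using \<open>x \<notin> T\<close> T(2) by blast
  qed
  then show ?thesis using T(2) x by blast
qed

section \<open>Submodules of transforms\<close>

context ultra_data
begin

lemma functional_of_P:
  assumes "\<phi> \<in> P_space \<omega> c r"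
  obtains S where "functional S" "\<phi> = (\<lambda>z. S (efun z))"
proof -
  obtain k where k: "\<phi> \<in> Pk \<omega> c r k" using assms unfolding P_space_def by blast
  obtain b B \<eta> where \<eta>: "cutoff k b B \<eta>" using cutoff_ex by blast
  show thesis
    by (rule that[OF Gfun_functional[OF \<eta> k]]) (simp add: fun_eq_iff Gfun_efun[OF \<eta> k])
qed

lemma functional_lincomb:
  assumes S: "functional S" and T: "functional T"
  shows "functional (\<lambda>f. S f + b * T f)"
proof -
  obtain q k K where s: "\<And>f. f \<in> U \<Longrightarrow> cmod (S f) \<le> K * nrm q k f" "0 < q" "q < 1" "0 < K"
    by (rule functional_bound[OF S]) (rule that)
  obtain q' k' K' where t: "\<And>f. f \<in> U \<Longrightarrow> cmod (T f) \<le> K' * nrm q' k' f" "0 < q'" "q' < 1" "0 < K'"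
    by (rule functional_bound[OF T]) (rule that)
  define Q where "Q = max q q'"
  define k1 where "k1 = max k k'"
  have Q: "0 < Q" "Q < 1" "q \<le> Q" "q' \<le> Q" "k \<le> k1" "k' \<le> k1" using s t by (auto simp: Q_def k1_def)
  have "cmod (S f + b * T f) \<le> (K + cmod b * K') * nrm Q k1 f" if f: "f \<in> U" for f
  proof -
    have "cmod (S f + b * T f) \<le> cmod (S f) + cmod b * cmod (T f)" using norm_triangle_ineq[of "S f" "b * T f"] by (simp add: norm_mult)
    also have "\<dots> \<le> K * nrm q k f + cmod b * (K' * nrm q' k' f)" using s(1)[OF f] t(1)[OF f] by (intro add_mono mult_left_mono) auto
    also have "\<dots> \<le> K * nrm Q k1 f + cmod b * (K' * nrm Q k1 f)"
      using s t Q by (intro add_mono mult_left_mono nrm_mono[OF f]) auto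
    finally show ?thesis by (simp add: algebra_simps)
  qed
  moreover have "0 < K + cmod b * K'" using s(4) t(4) by (intro add_pos_nonneg) auto
  ultimately have "\<exists>q k K. 0 < q \<and> q < 1 \<and> 0 < K \<and> (\<forall>f\<in>U. cmod (S f + b * T f) \<le> K * nrm q k f)"
    using Q(1,2) by blast
  then show ?thesis unfolding functional_def using functional_linear(1,2)[OF S] functional_linear(1,2)[OF T]
    by (simp add: algebra_simps)
qed

text \<open>On exponentials this transpose of differentiation multiplies the transform by
  \<open>z\<close>; it yields the module structure.\<close>

lemma functional_diff_op:
  assumes S: "functional S"
  shows "functional (\<lambda>f. \<i> * S (diff_op a f))"
proof -
  obtain q k K where s: "\<And>f. f \<in> U \<Longrightarrow> cmod (S f) \<le> K * nrm q k f" "0 < q" "q < 1" "0 < K"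
    by (rule functional_bound[OF S]) (rule that)
  define q' where "q' = (1 + q) / 2"
  have q': "q < q'" "q' < 1" "0 < q'" using s(2,3) by (auto simp: q'_def)
  obtain C where C: "0 < C" "\<And>k f. f \<in> U \<Longrightarrow> nrm q k (diff_op a f) \<le> C * nrm q' k f"
    using nrm_diff_op[OF s(2) q'(1,2)] by blast
  have "cmod (\<i> * S (diff_op a f)) \<le> (K * C) * nrm q' k f" if f: "f \<in> U" for f
    using s(1)[OF U_diff_op[OF f]] mult_left_mono[OF C(2)[OF f, of k] less_imp_le[OF s(4)]]
    by (simp add: norm_mult mult.assoc)
  moreover have "0 < K * C" using s(4) C(1) by simp
  moreover have "diff_op a (f + g) = diff_op a f + diff_op a g" if "f \<in> U" "g \<in> U" for f g
    using U_add(2)[OF that, of "Suc 0"] by (simp add: fun_eq_iff D_Suc)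
  moreover have "diff_op a (cscale b f) = cscale b (diff_op a f)" if "f \<in> U" for b f
    using U_cscale(2)[OF that, of "Suc 0"] by (simp add: fun_eq_iff D_Suc cscale_def[of b "diff_op a f"])
  moreover have "\<exists>q k K. 0 < q \<and> q < 1 \<and> 0 < K \<and> (\<forall>f\<in>U. cmod (\<i> * S (diff_op a f)) \<le> K * nrm q k f)"
    using calculation(1,2) q' by blast
  ultimately show ?thesis unfolding functional_def
    by (simp add: functional_linear(1)[OF S U_diff_op U_diff_op] functional_linear(2)[OF S U_diff_op U_diff_op] algebra_simps)
qed

lemma diff_op_efun: "diff_op a (efun z) = cscale (- \<i> * z) (efun z)"
  using D_efun[of "Suc 0" z] unfolding D_Suc D_0 efun_def by (auto simp: fun_eq_iff cscale_def zero_ext_def)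

lemma transforms_subset_P: "transforms X \<subseteq> P_space \<omega> c r"
  unfolding transforms_def ann_def using functional_in_P by auto

lemma mem_transforms_iff:
  assumes "functional S" "X \<subseteq> U"
  shows "(\<lambda>z. S (efun z)) \<in> transforms X \<longleftrightarrow> (\<forall>f\<in>X. S f = 0)"
proof
  assume "(\<lambda>z. S (efun z)) \<in> transforms X"
  then obtain T where T: "functional T" "\<forall>f\<in>X. T f = 0" "(\<lambda>z. S (efun z)) = (\<lambda>z. T (efun z))"
    unfolding transforms_def ann_def by blast
  have "S f = T f" if "f \<in> X" for f
    using functional_injective[OF assms(1) T(1) fun_cong[OF T(3)]] that assms(2) by blast
  with T(2) show "\<forall>f\<in>X. S f = 0" by simp
qed (use assms(1) in \<open>auto simp: transforms_def ann_def\<close>)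

lemma Pk_closed:
  assumes "\<phi> \<in> Pk \<omega> c r k" "\<psi> \<in> Pk \<omega> c r k"
  shows "\<phi> + cscale b \<psi> \<in> Pk \<omega> c r k"
proof -
  have "cmod ((\<phi> + cscale b \<psi>) z) \<le> (pn k \<phi> + cmod b * pn k \<psi>) * exp (r k * \<omega> (cmod z) + c k * \<bar>Im z\<bar>)" for z
  proof -
    have "cmod ((\<phi> + cscale b \<psi>) z) \<le> cmod (\<phi> z) + cmod b * cmod (\<psi> z)"
      using norm_triangle_ineq[of "\<phi> z" "b * \<psi> z"] by (simp add: cscale_def norm_mult)
    also have "\<dots> \<le> pn k \<phi> * exp (r k * \<omega> (cmod z) + c k * \<bar>Im z\<bar>) + cmod b * (pn k \<psi> * exp (r k * \<omega> (cmod z) + c k * \<bar>Im z\<bar>))"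
      by (intro add_mono mult_left_mono pn_bound assms) auto
    finally show ?thesis by (simp add: algebra_simps)
  qed
  moreover have "(\<lambda>z. \<phi> z + b * \<psi> z) holomorphic_on UNIV" using assms by (auto simp: Pk_iff intro!: holomorphic_intros)
  then have "(\<phi> + cscale b \<psi>) holomorphic_on UNIV" by (simp add: cscale_def plus_fun_def)
  ultimately show ?thesis unfolding Pk_iff by blast
qed

lemma minus_eq_cscale: "\<phi> - \<psi> = \<phi> + cscale (- 1) \<psi>"
  by (simp add: cscale_def fun_eq_iff)

text \<open>An inverse of the transform by choice. Its values on \<open>U\<close> are determined, by
  \<open>functional_injective\<close>; those off \<open>U\<close> are arbitrary.\<close>

definition preimage :: "(complex \<Rightarrow> complex) \<Rightarrow> (real \<Rightarrow> complex) \<Rightarrow> complex" where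
  "preimage \<phi> = (SOME S. functional S \<and> \<phi> = (\<lambda>z. S (efun z)))"

lemma preimage:
  assumes "\<phi> \<in> P_space \<omega> c r"
  shows "functional (preimage \<phi>)" "(\<lambda>z. preimage \<phi> (efun z)) = \<phi>"
proof -
  have "\<exists>S. functional S \<and> \<phi> = (\<lambda>z. S (efun z))" using functional_of_P[OF assms] by blast
  from someI_ex[OF this] show "functional (preimage \<phi>)" "(\<lambda>z. preimage \<phi> (efun z)) = \<phi>"
    unfolding preimage_def by auto
qed

lemma preimage_eq:
  assumes S: "functional S" and eq: "\<And>z. \<phi> z = S (efun z)" and f: "f \<in> U"
  shows "preimage \<phi> f = S f"
proof -
  have "\<phi> = (\<lambda>z. S (efun z))" using eq by (simp add: fun_eq_iff)
  then have P: "\<phi> \<in> P_space \<omega> c r" using functional_in_P[OF S] by simp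
  show ?thesis
    using functional_injective[OF preimage(1)[OF P] S _ f] fun_cong[OF preimage(2)[OF P]] eq by simp
qed

lemma Pk_P: "\<phi> \<in> Pk \<omega> c r k \<Longrightarrow> \<phi> \<in> P_space \<omega> c r"
  unfolding P_space_def by blast

lemma preimage_lincomb:
  assumes "\<phi> \<in> P_space \<omega> c r" "\<psi> \<in> P_space \<omega> c r" "f \<in> U"
  shows "preimage (\<phi> + cscale b \<psi>) f = preimage \<phi> f + b * preimage \<psi> f"
proof (rule preimage_eq[OF functional_lincomb[OF preimage(1)[OF assms(1)] preimage(1)[OF assms(2)]] _ assms(3)])
  show "(\<phi> + cscale b \<psi>) z = preimage \<phi> (efun z) + b * preimage \<psi> (efun z)" for z
    using fun_cong[OF preimage(2)[OF assms(1)], of z] fun_cong[OF preimage(2)[OF assms(2)], of z] by (simp add: cscale_def)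
qed

lemma preimage_continuous:
  assumes f: "f \<in> U"
  shows "continuous_map (Pk_top \<omega> c r k) euclideanreal (\<lambda>\<phi>. cmod (preimage \<phi> f))"
  unfolding Pk_top_def pn_def[symmetric, abs_def]
proof (rule continuous_map_seminorm_topologyI)
  have zero: "0 \<in> Pk \<omega> c r k" unfolding Pk_iff by (auto simp: zero_fun_def intro!: exI[of _ 0])
  have "pn k 0 \<le> 0" by (rule pn_least[OF zero]) simp
  then have "pn k 0 = 0" by (simp add: order_antisym)
  then show "p 0 = 0" if "p \<in> {pn k}" for p using that by simp
  obtain b B \<eta> where \<eta>: "cutoff k b B \<eta>" using cutoff_ex by blast
  obtain q' k' C where C: "0 < q'" "q' < 1" "0 < C"
    "\<And>\<phi> f. \<phi> \<in> Pk \<omega> c r k \<Longrightarrow> f \<in> U \<Longrightarrow> cmod (Gfun \<eta> B \<phi> f) \<le> C * pn k \<phi> * nrm q' k' f"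
    by (rule Gfun_bound[OF \<eta>]) (rule that)
  define K where "K = C * (nrm q' k' f + 1)"
  have "0 < nrm q' k' f + 1" using nrm_nonneg[of q' k' f] by linarith
  then have K: "0 < K" using C(3) by (simp add: K_def)
  have le: "cmod (preimage \<phi> f) \<le> K * pn k \<phi>" if \<phi>: "\<phi> \<in> Pk \<omega> c r k" for \<phi>
  proof -
    have "preimage \<phi> f = Gfun \<eta> B \<phi> f"
      by (rule preimage_eq[OF Gfun_functional[OF \<eta> \<phi>] _ f]) (simp add: Gfun_efun[OF \<eta> \<phi>])
    then have "cmod (preimage \<phi> f) \<le> C * pn k \<phi> * nrm q' k' f" using C(4)[OF \<phi> f] by simp
    also have "\<dots> \<le> C * pn k \<phi> * (nrm q' k' f + 1)" using C(3) by (intro mult_left_mono) auto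
    finally show ?thesis by (simp add: K_def mult_ac)
  qed
  fix \<phi> and e :: real assume \<phi>: "\<phi> \<in> Pk \<omega> c r k" and e: "0 < e"
  have "dist (cmod (preimage \<psi> f)) (cmod (preimage \<phi> f)) < e" if \<psi>: "\<psi> \<in> Pk \<omega> c r k" "pn k (\<psi> - \<phi>) < e / K" for \<psi>
  proof -
    have "preimage (\<psi> - \<phi>) f = preimage \<psi> f - preimage \<phi> f"
      unfolding minus_eq_cscale preimage_lincomb[OF Pk_P[OF \<psi>(1)] Pk_P[OF \<phi>] f] by simp
    then have "dist (cmod (preimage \<psi> f)) (cmod (preimage \<phi> f)) \<le> cmod (preimage (\<psi> - \<phi>) f)"
      by (simp add: dist_real_def norm_triangle_ineq3)
    also have "\<dots> \<le> K * pn k (\<psi> - \<phi>)" unfolding minus_eq_cscale by (intro le Pk_closed \<psi>(1) \<phi>)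
    also have "\<dots> < e" using \<psi>(2) K by (simp add: pos_less_divide_eq mult.commute)
    finally show ?thesis .
  qed
  moreover have "0 < e / K" using e K by simp
  ultimately show "\<exists>p\<in>{pn k}. \<exists>d>0. \<forall>\<psi>\<in>Pk \<omega> c r k. p (\<psi> - \<phi>) < d \<longrightarrow> dist (cmod (preimage \<psi> f)) (cmod (preimage \<phi> f)) < e"
    by blast
qed

text \<open>For each \<open>f\<close> in \<open>U\<close> the seminorm
  \<open>cmod (preimage \<phi> f)\<close> is continuous on every step by \<open>Gfun_bound\<close>,
  hence belongs to the inductive limit. The transforms of \<open>ann X\<close> are the common zeros
  of these seminorms for \<open>f \<in> X\<close>.\<close>

lemma closedin_transforms:
  assumes X: "X \<subseteq> U"
  shows "closedin (P_top \<omega> c r) (transforms X)"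
proof -
  let ?\<P> = "{p. seminorm_on (P_space \<omega> c r) p \<and> (\<forall>k. continuous_map (Pk_top \<omega> c r k) euclideanreal p)}"
  have sn: "(\<lambda>\<phi>. cmod (preimage \<phi> f)) \<in> ?\<P>" if f: "f \<in> U" for f
  proof -
    have "cmod (preimage (\<phi> + \<psi>) f) \<le> cmod (preimage \<phi> f) + cmod (preimage \<psi> f)"
      if "\<phi> \<in> P_space \<omega> c r" "\<psi> \<in> P_space \<omega> c r" for \<phi> \<psi>
      using preimage_lincomb[OF that f, of 1] norm_triangle_ineq[of "preimage \<phi> f" "preimage \<psi> f"] by (simp add: cscale_def plus_fun_def)
    moreover have "cmod (preimage (cscale b \<phi>) f) = cmod b * cmod (preimage \<phi> f)" if \<phi>: "\<phi> \<in> P_space \<omega> c r" for b \<phi>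
    proof -
      have "\<phi> + cscale (b - 1) \<phi> = cscale b \<phi>" by (simp add: cscale_def fun_eq_iff algebra_simps)
      then have "preimage (cscale b \<phi>) f = b * preimage \<phi> f"
        using preimage_lincomb[OF \<phi> \<phi> f, of "b - 1"] by (simp add: algebra_simps)
      then show ?thesis by (simp add: norm_mult)
    qed
    ultimately show ?thesis using preimage_continuous[OF f] unfolding seminorm_on_def by blast
  qed
  have "openin (P_top \<omega> c r) (P_space \<omega> c r - transforms X)"
  proof (subst openin_subopen, intro ballI)
    fix \<phi> assume \<phi>: "\<phi> \<in> P_space \<omega> c r - transforms X"
    then have P: "\<phi> \<in> P_space \<omega> c r" by blast
    have "\<not> (\<forall>f\<in>X. preimage \<phi> f = 0)"
      using mem_transforms_iff[OF preimage(1)[OF P] X] \<phi> unfolding preimage(2)[OF P] by blast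
    then obtain f where f: "f \<in> X" "preimage \<phi> f \<noteq> 0" by blast
    have fU: "f \<in> U" using f(1) X by blast
    let ?T = "{\<psi> \<in> P_space \<omega> c r. cmod (preimage (\<psi> - \<phi>) f) < cmod (preimage \<phi> f)}"
    have "openin (P_top \<omega> c r) ?T"
      unfolding P_top_def by (rule openin_seminorm_ball[OF sn[OF fU] P]) (use f(2) in simp)
    moreover have "preimage (\<phi> - \<phi>) f = 0"
      unfolding minus_eq_cscale preimage_lincomb[OF P P fU] by simp
    then have "\<phi> \<in> ?T" using P f(2) by simp
    moreover have "\<psi> \<notin> transforms X" if \<psi>: "\<psi> \<in> ?T" for \<psi>
    proof
      assume "\<psi> \<in> transforms X"
      moreover have P': "\<psi> \<in> P_space \<omega> c r" using \<psi> by blast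
      ultimately have "preimage \<psi> f = 0"
        using mem_transforms_iff[OF preimage(1)[OF P'] X] f(1) unfolding preimage(2)[OF P'] by blast
      then have "preimage (\<psi> - \<phi>) f = - preimage \<phi> f"
        unfolding minus_eq_cscale preimage_lincomb[OF P' P fU] by simp
      then show False using \<psi> by simp
    qed
    ultimately show "\<exists>T. openin (P_top \<omega> c r) T \<and> \<phi> \<in> T \<and> T \<subseteq> P_space \<omega> c r - transforms X" by blast
  qed
  then show ?thesis
    using transforms_subset_P[of X] unfolding closedin_def P_top_def topspace_seminorm_topology by blast
qed

text \<open>Invariance is required only through the annihilating functionals, so that
  \<open>X\<close> may be a mere set of generators.\<close>

lemma submodule_transforms:
  assumes X: "X \<subseteq> U" and inv: "\<And>S f. S \<in> ann X \<Longrightarrow> f \<in> X \<Longrightarrow> S (diff_op a f) = 0"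
  shows "submodule \<omega> c r (transforms X)"
proof -
  have lin: "\<phi> + cscale b \<psi> \<in> transforms X" if \<phi>: "\<phi> \<in> transforms X" and \<psi>: "\<psi> \<in> transforms X" for \<phi> \<psi> b
  proof -
    obtain S T where "S \<in> ann X" "T \<in> ann X" "\<phi> = (\<lambda>z. S (efun z))" "\<psi> = (\<lambda>z. T (efun z))"
      using \<phi> \<psi> unfolding transforms_def by blast
    moreover from this have "(\<lambda>f. S f + b * T f) \<in> ann X" using functional_lincomb by (auto simp: ann_def)
    ultimately show ?thesis unfolding transforms_def by (intro image_eqI[of _ _ "\<lambda>f. S f + b * T f"]) (auto simp: cscale_def)
  qed
  have "\<exists>q k K. 0 < q \<and> q < 1 \<and> 0 < K \<and> (\<forall>f\<in>U. cmod (0 :: complex) \<le> K * nrm q k f)"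
    by (rule exI[of _ "1/2"], rule exI[of _ 0], rule exI[of _ 1]) simp
  then have "functional (\<lambda>_. 0)" unfolding functional_def by simp
  then have zero: "0 \<in> transforms X"
    unfolding transforms_def ann_def by (intro image_eqI[of _ _ "\<lambda>_. 0"]) auto
  have scale: "cscale b \<phi> \<in> transforms X" if "\<phi> \<in> transforms X" for b \<phi> using lin[OF zero that, of b] by simp
  have add: "\<phi> + \<psi> \<in> transforms X" if "\<phi> \<in> transforms X" "\<psi> \<in> transforms X" for \<phi> \<psi>
    using lin[OF that, of 1] by (simp add: cscale_def plus_fun_def)
  have shift: "(\<lambda>z. z * \<phi> z) \<in> transforms X" if \<phi>: "\<phi> \<in> transforms X" for \<phi>
  proof -
    obtain S where SX: "S \<in> ann X" and S: "\<phi> = (\<lambda>z. S (efun z))" using \<phi> unfolding transforms_def by blast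
    have F: "functional S" using SX by (simp add: ann_def)
    have "(\<lambda>f. \<i> * S (diff_op a f)) \<in> ann X" using functional_diff_op[OF F] inv[OF SX] by (auto simp: ann_def)
    moreover have "\<i> * S (diff_op a (efun z)) = z * \<phi> z" for z
      unfolding diff_op_efun functional_linear(2)[OF F efun_U efun_U] S by (simp add: mult.assoc)
    ultimately show ?thesis unfolding transforms_def by (intro image_eqI[of _ _ "\<lambda>f. \<i> * S (diff_op a f)"]) auto
  qed
  have "(\<lambda>z. poly p z * \<phi> z) \<in> transforms X" if \<phi>: "\<phi> \<in> transforms X" for p \<phi>
  proof (induction p)
    case 0
    then show ?case using zero by (simp add: zero_fun_def)
  next
    case (pCons b p)
    have "(\<lambda>z. poly (pCons b p) z * \<phi> z) = cscale b \<phi> + (\<lambda>z. z * (poly p z * \<phi> z))"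
      by (simp add: cscale_def fun_eq_iff algebra_simps)
    then show ?case using add[OF scale[OF \<phi>, of b] shift[OF pCons.IH]] by simp
  qed
  then show ?thesis
    unfolding submodule_def cfun.subspace_def using zero add scale closedin_transforms[OF X] by blast
qed

lemma vanishes_transforms_iff:
  "(\<forall>\<psi>\<in>transforms X. vanishes_at_least \<psi> \<mu> n) \<longleftrightarrow> (\<forall>i<n. \<forall>S\<in>ann X. S (exp_monomial a i \<mu>) = 0)"
  unfolding transforms_def ann_def vanishes_at_least_def by (auto simp: functional_higher_deriv)

lemma diff_op_exp_monomial:
  "diff_op a (exp_monomial a (Suc n) \<mu>) = cscale (of_nat (Suc n)) (exp_monomial a n \<mu>) + cscale (- \<i> * \<mu>) (exp_monomial a (Suc n) \<mu>)"
proof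
  fix x
  show "diff_op a (exp_monomial a (Suc n) \<mu>) x = (cscale (of_nat (Suc n)) (exp_monomial a n \<mu>) + cscale (- \<i> * \<mu>) (exp_monomial a (Suc n) \<mu>)) x"
  proof (cases "x \<in> I")
    case True
    let ?d = "of_nat (Suc n) * of_real x ^ n * exp (- \<i> * \<mu> * of_real x) + of_real x ^ Suc n * (- \<i> * \<mu> * exp (- \<i> * \<mu> * of_real x))"
    have "((\<lambda>t. of_real t ^ Suc n * exp (- \<i> * \<mu> * of_real t)) has_vector_derivative ?d) (at x)"
      by (rule has_vector_derivative_real_field, (rule derivative_eq_intros | rule refl)+) (simp add: algebra_simps)
    then have "(exp_monomial a (Suc n) \<mu> has_vector_derivative ?d) (at x)"
      by (rule has_vector_derivative_transform_within_open[OF _ open_I True]) (simp add: exp_monomial_def)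
    then show ?thesis using True by (simp add: diff_op_def vector_derivative_at cscale_def exp_monomial_def algebra_simps)
  qed (simp add: diff_op_def cscale_def exp_monomial_def)
qed

text \<open>The derivative of the monomial of degree \<open>m + 1\<close> combines the degrees
  \<open>m\<close> and \<open>m + 1\<close>; subtracting the latter leaves the former.\<close>

lemma exp_monomial_lower:
  assumes W: "cfun.subspace W" "diff_op a ` W \<subseteq> W" and n: "exp_monomial a n \<mu> \<in> W" "i \<le> n"
  shows "exp_monomial a i \<mu> \<in> W"
  using n(2,1)
proof (induction rule: inc_induct)
  case (step m)
  have m: "exp_monomial a (Suc m) \<mu> \<in> W" by (rule step.IH[OF step.prems])
  then have "diff_op a (exp_monomial a (Suc m) \<mu>) \<in> W" using W(2) by blast
  then have "cscale (1 / of_nat (Suc m)) (diff_op a (exp_monomial a (Suc m) \<mu>) - cscale (- \<i> * \<mu>) (exp_monomial a (Suc m) \<mu>)) \<in> W"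
    using m by (intro cfun.subspace_scale[OF W(1)] cfun.subspace_diff[OF W(1)])
  moreover have "cscale (1 / of_nat (Suc m)) (diff_op a (exp_monomial a (Suc m) \<mu>) - cscale (- \<i> * \<mu>) (exp_monomial a (Suc m) \<mu>)) = exp_monomial a m \<mu>"
    unfolding diff_op_exp_monomial by (simp add: cscale_def fun_eq_iff del: of_nat_Suc)
  ultimately show ?case by simp
qed

lemma subspace_W_of: "cfun.subspace (W_of \<omega> a c X)"
  unfolding cfun.subspace_def W_of_def D_def[symmetric]
  using U_zero U_add U_cscale by auto

lemma W_of_U: "W_of \<omega> a c X \<subseteq> U"
  unfolding W_of_def by blast

lemma diff_op_W_of: "f \<in> W_of \<omega> a c X \<Longrightarrow> diff_op a f \<in> W_of \<omega> a c X"
  unfolding W_of_def D_def[symmetric] by (simp add: U_diff_op D_diff_op)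

lemma Exp_U: "Exp_of a W \<subseteq> U"
  unfolding Exp_of_def using exp_monomial_U by blast

text \<open>Replaces the sum by the union of its generators, where annihilation is checked one by
  one.\<close>

lemma ann_sum_iff:
  "S \<in> ann {f + g | f g. f \<in> cfun.span (Exp_of a W) \<and> g \<in> W_of \<omega> a c X} \<longleftrightarrow> S \<in> ann (Exp_of a W \<union> W_of \<omega> a c X)"
proof
  assume "S \<in> ann {f + g | f g. f \<in> cfun.span (Exp_of a W) \<and> g \<in> W_of \<omega> a c X}"
  then have S: "functional S" "S (f + g) = 0" if "f \<in> cfun.span (Exp_of a W)" "g \<in> W_of \<omega> a c X" for f g
    using that unfolding ann_def by blast+
  have 0: "0 \<in> cfun.span (Exp_of a W)" "0 \<in> W_of \<omega> a c X"
    by (rule cfun.span_zero, rule cfun.subspace_0[OF subspace_W_of])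
  show "S \<in> ann (Exp_of a W \<union> W_of \<omega> a c X)"
    unfolding ann_def using S(1)[OF 0] S(2)[OF cfun.span_base 0(2)] S(2)[OF 0(1)] by auto
next
  assume "S \<in> ann (Exp_of a W \<union> W_of \<omega> a c X)"
  then have S: "functional S" "\<And>f. f \<in> Exp_of a W \<Longrightarrow> S f = 0" "\<And>f. f \<in> W_of \<omega> a c X \<Longrightarrow> S f = 0"
    unfolding ann_def by auto
  have "cfun.subspace {f \<in> U. S f = 0}"
    unfolding cfun.subspace_def using U_zero(1) functional_zero[OF S(1)] functional_linear(1,2)[OF S(1)] U_add(1) U_cscale(1) by auto
  then have "cfun.span (Exp_of a W) \<subseteq> {f \<in> U. S f = 0}"
    using S(2) Exp_U[of W] by (intro cfun.span_minimal) auto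
  then have "f \<in> U" "S f = 0" if "f \<in> cfun.span (Exp_of a W)" for f using that by auto
  moreover have "g \<in> U" if "g \<in> W_of \<omega> a c X" for g using that W_of_U by blast
  ultimately have "S (f + g) = 0" if "f \<in> cfun.span (Exp_of a W)" "g \<in> W_of \<omega> a c X" for f g
    using that functional_linear(1)[OF S(1), of f g] S(3)[OF that(2)] by simp
  then show "S \<in> ann {f + g | f g. f \<in> cfun.span (Exp_of a W) \<and> g \<in> W_of \<omega> a c X}"
    using S(1) unfolding ann_def by auto
qed

lemma transforms_segment_le:
  assumes "W_of \<omega> a c X \<subseteq> Y"
  shows "(SUP \<phi>\<in>transforms Y. indicator_fun \<phi> (pi / 2)) \<le> (SUP x\<in>X. ereal x)"
    and "(SUP \<phi>\<in>transforms Y. indicator_fun \<phi> (- (pi / 2))) \<le> - (INF x\<in>X. ereal x)"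
proof -
  have kill: "S f = 0" if "S \<in> ann Y" "f \<in> W_of \<omega> a c X" for S f using that assms by (auto simp: ann_def)
  have F: "functional S" if "S \<in> ann Y" for S using that by (simp add: ann_def)
  have "indicator_fun (\<lambda>z. S (efun z)) (pi / 2) \<le> (SUP x\<in>X. ereal x)" if "S \<in> ann Y" for S
    by (rule indicator_le_if_zero_on_flat(1)[OF F[OF that] kill[OF that]])
  then show "(SUP \<phi>\<in>transforms Y. indicator_fun \<phi> (pi / 2)) \<le> (SUP x\<in>X. ereal x)"
    unfolding transforms_def by (auto intro!: SUP_least)
  have "indicator_fun (\<lambda>z. S (efun z)) (- (pi / 2)) \<le> - (INF x\<in>X. ereal x)" if "S \<in> ann Y" for S
  proof -
    have "- (- indicator_fun (\<lambda>z. S (efun z)) (- (pi / 2))) \<le> - (INF x\<in>X. ereal x)"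
      by (subst ereal_minus_le_minus) (rule indicator_le_if_zero_on_flat(2)[OF F[OF that] kill[OF that]])
    then show ?thesis by simp
  qed
  then show "(SUP \<phi>\<in>transforms Y. indicator_fun \<phi> (- (pi / 2))) \<le> - (INF x\<in>X. ereal x)"
    unfolding transforms_def by (auto intro!: SUP_least)
qed

lemma nonzero_segment:
  assumes \<phi>: "\<phi> \<in> J" "J \<subseteq> P_space \<omega> c r" "\<phi> z \<noteq> 0"
  shows "- (SUP \<phi>\<in>J. indicator_fun \<phi> (- (pi / 2))) \<le> (SUP \<phi>\<in>J. indicator_fun \<phi> (pi / 2))"
proof -
  have "\<phi> \<in> P_space \<omega> c r" using \<phi>(1,2) by blast
  then obtain S where S: "functional S" "\<phi> = (\<lambda>z. S (efun z))" by (rule functional_of_P) (rule that)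
  have "- (SUP \<phi>\<in>J. indicator_fun \<phi> (- (pi / 2))) \<le> - indicator_fun \<phi> (- (pi / 2))"
    by (subst ereal_minus_le_minus) (rule SUP_upper[OF \<phi>(1)])
  also have "\<dots> \<le> indicator_fun \<phi> (pi / 2)"
    using functional_indicator_order[OF S(1) efun_U, of z] \<phi>(3) S(2) by simp
  also have "\<dots> \<le> (SUP \<phi>\<in>J. indicator_fun \<phi> (pi / 2))" by (rule SUP_upper[OF \<phi>(1)])
  finally show ?thesis .
qed

lemma functional_zero_on_W_of:
  assumes S: "functional S" and J: "(\<lambda>z. S (efun z)) \<in> J" and f: "f \<in> W_of \<omega> a c X"
    and X: "\<And>x. x \<in> I \<Longrightarrow> - (SUP \<phi>\<in>J. indicator_fun \<phi> (- (pi / 2))) \<le> ereal x \<Longrightarrow>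
      ereal x \<le> (SUP \<phi>\<in>J. indicator_fun \<phi> (pi / 2)) \<Longrightarrow> x \<in> X"
  shows "S f = 0"
proof (rule functional_zero_on_flat[OF S])
  show "f \<in> U" using f W_of_U by blast
  show "indicator_fun (\<lambda>z. S (efun z)) (pi / 2) \<le> (SUP \<phi>\<in>J. indicator_fun \<phi> (pi / 2))" by (rule SUP_upper[OF J])
  show "- (SUP \<phi>\<in>J. indicator_fun \<phi> (- (pi / 2))) \<le> - indicator_fun (\<lambda>z. S (efun z)) (- (pi / 2))"
    by (subst ereal_minus_le_minus) (rule SUP_upper[OF J])
  show "D j f x = 0" if "x \<in> I" "- (SUP \<phi>\<in>J. indicator_fun \<phi> (- (pi / 2))) \<le> ereal x"
    "ereal x \<le> (SUP \<phi>\<in>J. indicator_fun \<phi> (pi / 2))" for j x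
    using f X[OF that] unfolding W_of_def D_def by blast
qed

lemma rel_closed_interval_ereal: "rel_closed_interval a {x \<in> I. lo \<le> ereal x \<and> ereal x \<le> hi}"
  unfolding rel_closed_interval_def
proof
  show "is_interval {x \<in> I. lo \<le> ereal x \<and> ereal x \<le> hi}"
    unfolding is_interval_1
  proof (intro ballI allI impI)
    fix y z x assume "y \<in> {x \<in> I. lo \<le> ereal x \<and> ereal x \<le> hi}" "z \<in> {x \<in> I. lo \<le> ereal x \<and> ereal x \<le> hi}" "y \<le> x \<and> x \<le> z"
    then show "x \<in> {x \<in> I. lo \<le> ereal x \<and> ereal x \<le> hi}"
      using I_convex[of y z x] order_trans[of lo "ereal y" "ereal x"] order_trans[of "ereal x" "ereal z" hi] by simp
  qed
  have "closed (ereal -` {lo..hi})" by (intro closed_vimage closed_atLeastAtMost continuous_on_ereal continuous_on_id)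
  moreover have "{x \<in> I. lo \<le> ereal x \<and> ereal x \<le> hi} = I \<inter> (ereal -` {lo..hi})" by auto
  ultimately show "closedin (top_of_set I) {x \<in> I. lo \<le> ereal x \<and> ereal x \<le> hi}"
    unfolding closedin_closed by blast
qed

text \<open>Otherwise all derivatives of the entire transform would vanish at \<open>\<mu>\<close>,
  and the identity theorem would make it zero.\<close>

lemma nonzero_finite_order:
  assumes S: "functional S" and nz: "S (efun z) \<noteq> 0"
  shows "\<exists>i. S (exp_monomial a i \<mu>) \<noteq> 0"
proof (rule ccontr)
  assume "\<not> ?thesis"
  then have "(deriv ^^ i) (\<lambda>z. S (efun z)) \<mu> = 0" for i by (simp add: functional_higher_deriv[OF S])
  then have "S (efun z) = 0"
    using holomorphic_fun_eq_0_on_connected[OF functional_efun_holomorphic[OF S], of \<mu> z] connected_UNIV by simp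
  with nz show False ..
qed

section \<open>The two implications\<close>

context
  fixes W
  assumes W: "D_invariant \<omega> a c W"
begin

lemma W_facts: "cfun.subspace W" "closedin (U_top \<omega> a c) W" "diff_op a ` W \<subseteq> W" "W \<subseteq> U"
  using W closedin_subset[of "U_top \<omega> a c" W] unfolding D_invariant_def topspace_U_top by auto

lemma submodule_W: "submodule \<omega> c r (transforms W)"
  using W_facts(3) by (intro submodule_transforms W_facts(4)) (auto simp: ann_def)

text \<open>The zero set lists exact common multiplicities only. A monomial of degree
  \<open>n\<close> in \<open>W\<close> gives a common zero of order at least \<open>n + 1\<close>; a
  nonzero member bounds the order, so an exact multiplicity exists, and \<open>J'\<close> inherits
  it.\<close>

lemma zero_set_transforms_le:
  assumes J': "J' \<subseteq> P_space \<omega> c r" and z: "zero_set J' = zero_set (transforms W)"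
    and nz: "\<phi> \<in> transforms W" "\<phi> z \<noteq> 0"
    and S: "functional S" "(\<lambda>z. S (efun z)) \<in> J'" and e: "exp_monomial a n \<mu> \<in> W"
  shows "S (exp_monomial a n \<mu>) = 0"
proof -
  obtain T where T: "T \<in> ann W" "\<phi> = (\<lambda>z. T (efun z))" using nz(1) unfolding transforms_def by blast
  obtain i where i: "T (exp_monomial a i \<mu>) \<noteq> 0" using nonzero_finite_order[of T z \<mu>] T nz(2) by (auto simp: ann_def)
  define V where "V m \<longleftrightarrow> (\<forall>\<psi>\<in>transforms W. vanishes_at_least \<psi> \<mu> m)" for m
  have V: "V m \<longleftrightarrow> (\<forall>i<m. \<forall>S\<in>ann W. S (exp_monomial a i \<mu>) = 0)" for m
    unfolding V_def by (rule vanishes_transforms_iff)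
  have V0: "V (Suc n)" unfolding V using exp_monomial_lower[OF W_facts(1,3) e] by (auto simp: ann_def less_Suc_eq_le)
  have bounded: "m \<le> i" if "V m" for m using that T(1) i unfolding V by (meson not_le)
  have "\<exists>m. V m \<and> Suc n \<le> m \<and> \<not> V (Suc m)"
  proof (rule ccontr)
    assume "\<not> ?thesis"
    then have step: "V (Suc m)" if "V m" "Suc n \<le> m" for m using that by blast
    have "V (Suc n + j)" for j by (induction j) (simp_all add: V0 step)
    from bounded[OF this[of i]] show False by simp
  qed
  then obtain m where m: "V m" "Suc n \<le> m" "\<not> V (Suc m)" by blast
  then have "(\<mu>, m) \<in> zero_set J'" unfolding z unfolding zero_set_alt V_def by simp
  then have "vanishes_at_least (\<lambda>z. S (efun z)) \<mu> m" using S(2) unfolding zero_set_alt by blast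
  then have "(deriv ^^ n) (\<lambda>z. S (efun z)) \<mu> = 0" using m(2) unfolding vanishes_at_least_def by simp
  then show ?thesis by (simp add: functional_higher_deriv[OF S(1)])
qed

lemma localisable_if_synthesis:
  assumes syn: "weak_synthesis \<omega> a c W"
  shows "weakly_localisable \<omega> c r (transforms W)"
  unfolding weakly_localisable_def
proof (intro conjI allI impI submodule_W equalityI subsetI)
  fix J' \<phi>
  assume J': "submodule \<omega> c r J' \<and> zero_set J' = zero_set (transforms W) \<and>
    indicator_segment J' = indicator_segment (transforms W) \<and> transforms W \<subseteq> J'"
  then show "\<phi> \<in> J'" if "\<phi> \<in> transforms W" using that by blast
  assume \<phi>: "\<phi> \<in> J'"
  have J'P: "J' \<subseteq> P_space \<omega> c r"
    using J' closedin_subset[of "P_top \<omega> c r" J'] unfolding submodule_def P_top_def topspace_seminorm_topology by blast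
  obtain X where X: "is_residual_interval \<omega> a c W X"
    "W = U_top \<omega> a c closure_of {f + g | f g. f \<in> cfun.span (Exp_of a W) \<and> g \<in> W_of \<omega> a c X}"
    using syn unfolding weak_synthesis_def by blast
  have "\<phi> \<in> P_space \<omega> c r" using \<phi> J'P by blast
  then obtain S where S: "functional S" "\<phi> = (\<lambda>z. S (efun z))" by (rule functional_of_P) (rule that)
  show "\<phi> \<in> transforms W"
  proof (cases "\<exists>\<psi>\<in>transforms W. \<exists>z. \<psi> z \<noteq> 0")
    case True
    then obtain \<psi> z where \<psi>: "\<psi> \<in> transforms W" "\<psi> z \<noteq> 0" by blast
    \<comment> \<open>A nonzero member makes the segment nonempty, so that equality of segments
      becomes equality of end points.\<close>
    note order = nonzero_segment[OF \<psi>(1) transforms_subset_P \<psi>(2)]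
    have seg: "indicator_segment J' = indicator_segment (transforms W)" using J' by blast
    note eq = indicator_segment_eqD[OF seg order]
    have WX: "W_of \<omega> a c X \<subseteq> W" using X(1) unfolding is_residual_interval_def by blast
    have XI: "rel_closed_interval a X" using X(1) unfolding is_residual_interval_def by blast
    have "S f = 0" if f: "f \<in> W_of \<omega> a c X" for f
    proof (rule functional_zero_on_W_of[OF S(1) _ f, of J'])
      show "(\<lambda>z. S (efun z)) \<in> J'" using \<phi> S(2) by simp
      fix x assume x: "x \<in> I" "- (SUP \<phi>\<in>J'. indicator_fun \<phi> (- (pi / 2))) \<le> ereal x"
        "ereal x \<le> (SUP \<phi>\<in>J'. indicator_fun \<phi> (pi / 2))"
      have "- (- (INF x\<in>X. ereal x)) \<le> - (SUP \<phi>\<in>transforms W. indicator_fun \<phi> (- (pi / 2)))"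
        by (subst ereal_minus_le_minus) (rule transforms_segment_le(2)[OF WX])
      then have "(INF x\<in>X. ereal x) \<le> ereal x" using x(2) unfolding eq by simp
      moreover have "ereal x \<le> (SUP x\<in>X. ereal x)"
        using x(3) transforms_segment_le(1)[OF WX] unfolding eq by (rule order_trans)
      ultimately show "x \<in> X" by (rule rel_closed_interval_mem[OF XI x(1)])
    qed
    moreover have "S f = 0" if "f \<in> Exp_of a W" for f
    proof -
      obtain n \<mu> where e: "f = exp_monomial a n \<mu>" "exp_monomial a n \<mu> \<in> W" using \<open>f \<in> Exp_of a W\<close> unfolding Exp_of_def by blast
      show ?thesis unfolding e(1)
        by (rule zero_set_transforms_le[OF J'P _ \<psi> S(1) _ e(2)]) (use J' \<phi> S(2) in auto)
    qed
    ultimately have "S \<in> ann (Exp_of a W \<union> W_of \<omega> a c X)" using S(1) by (auto simp: ann_def)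
    then have M: "S \<in> ann {f + g | f g. f \<in> cfun.span (Exp_of a W) \<and> g \<in> W_of \<omega> a c X}"
      by (simp only: ann_sum_iff)
    have "S f = 0" if f: "f \<in> W" for f
    proof (rule functional_zero_on_closure[OF S(1)])
      show "f \<in> U_top \<omega> a c closure_of {f + g | f g. f \<in> cfun.span (Exp_of a W) \<and> g \<in> W_of \<omega> a c X}"
        using f X(2) by simp
      show "S g = 0" if "g \<in> {f + g | f g. f \<in> cfun.span (Exp_of a W) \<and> g \<in> W_of \<omega> a c X}" for g
        using M that unfolding ann_def by blast
    qed
    then show ?thesis using S unfolding transforms_def ann_def by blast
  next
    case False
    \<comment> \<open>The zero module has indicators \<open>- \<infinity>\<close> and thus an empty
      segment; a nonzero function in \<open>J'\<close> would make the segment of \<open>J'\<close>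
      nonempty.\<close>
    have zero: "(\<lambda>_. 0) \<in> transforms W" using submodule_W unfolding submodule_def cfun.subspace_def zero_fun_def by blast
    have "transforms W = {\<lambda>_. 0}" using False zero by (auto simp: fun_eq_iff)
    moreover have "indicator_fun (\<lambda>_. 0) \<theta> = - \<infinity>" for \<theta>
      unfolding indicator_fun_def by (simp add: Limsup_const)
    ultimately have "indicator_segment (transforms W) = {}" unfolding indicator_segment_def by simp
    moreover have "indicator_segment J' \<noteq> {}" if "\<phi> z \<noteq> 0" for z
      using nonzero_segment[OF \<phi> J'P that] unfolding indicator_segment_def by simp
    ultimately have "\<phi> = (\<lambda>_. 0)" using J' by (auto simp: fun_eq_iff)
    then show ?thesis using zero by simp
  qed
qed

lemma synthesis_if_localisable:
  assumes loc: "weakly_localisable \<omega> c r (transforms W)"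
  shows "weak_synthesis \<omega> a c W"
proof -
  let ?lo = "- (SUP \<phi>\<in>transforms W. indicator_fun \<phi> (- (pi / 2)))" and ?hi = "SUP \<phi>\<in>transforms W. indicator_fun \<phi> (pi / 2)"
  \<comment> \<open>The part of the indicator segment inside \<open>(-a;a)\<close>; the end points
    themselves may lie at \<open>- a\<close> or \<open>a\<close>, and for the zero module the set is
    empty.\<close>
  define X where "X = {x \<in> I. ?lo \<le> ereal x \<and> ereal x \<le> ?hi}"
  have XI: "rel_closed_interval a X" unfolding X_def by (rule rel_closed_interval_ereal)
  have WX: "W_of \<omega> a c X \<subseteq> W"
  proof
    fix f assume f: "f \<in> W_of \<omega> a c X"
    show "f \<in> W"
    proof (rule bipolar[OF W_facts(1,2)])
      show "f \<in> U" using f W_of_U by blast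
      show "S f = 0" if "S \<in> ann W" for S
        by (rule functional_zero_on_W_of[OF _ _ f, of _ "transforms W"]) (use that in \<open>auto simp: ann_def transforms_def X_def\<close>)
    qed
  qed
  have "W_of \<omega> a c X' - W \<noteq> {}" if X': "rel_closed_interval a X'" "X' \<subset> X" for X'
  proof
    assume "W_of \<omega> a c X' - W = {}"
    then have WX': "W_of \<omega> a c X' \<subseteq> W" by blast
    \<comment> \<open>If \<open>W\<close> contained all functions flat on \<open>X'\<close>, every
      annihilating functional would have its segment within \<open>X'\<close> up to end points, and
      \<open>X'\<close> could not be smaller.\<close>
    have "x \<in> X'" if x: "x \<in> X" for x
    proof (rule rel_closed_interval_mem[OF X'(1)])
      show "x \<in> I" using x by (simp add: X_def)
      have "- (- (INF x\<in>X'. ereal x)) \<le> ?lo"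
        by (subst ereal_minus_le_minus) (rule transforms_segment_le(2)[OF WX'])
      then have lo: "(INF x\<in>X'. ereal x) \<le> ?lo" by simp
      have lohi: "?lo \<le> ereal x" "ereal x \<le> ?hi" using x by (simp_all add: X_def)
      show "(INF x\<in>X'. ereal x) \<le> ereal x" by (rule order_trans[OF lo lohi(1)])
      show "ereal x \<le> (SUP x\<in>X'. ereal x)"
        by (rule order_trans[OF lohi(2) transforms_segment_le(1)[OF WX']])
    qed
    then show False using X'(2) by blast
  qed
  then have res: "is_residual_interval \<omega> a c W X" unfolding is_residual_interval_def using XI WX by blast
  let ?M = "{f + g | f g. f \<in> cfun.span (Exp_of a W) \<and> g \<in> W_of \<omega> a c X}"
  have M: "cfun.subspace ?M" by (intro cfun.subspace_sums cfun.subspace_span subspace_W_of)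
  have EW: "Exp_of a W \<subseteq> W" unfolding Exp_of_def by blast
  have MW: "?M \<subseteq> W"
    using cfun.span_minimal[OF EW W_facts(1)] WX cfun.subspace_add[OF W_facts(1)] by blast
  \<comment> \<open>The generators of the synthesised subspace. The transforms of their annihilator
    form the competing submodule to which maximality of \<open>transforms W\<close> is
    applied.\<close>
  define Y where "Y = Exp_of a W \<union> W_of \<omega> a c X"
  have Y: "Y \<subseteq> W" "W_of \<omega> a c X \<subseteq> Y" using EW WX by (auto simp: Y_def)
  have YU: "Y \<subseteq> U" using Y W_facts(4) by blast
  have sub: "submodule \<omega> c r (transforms Y)"
  proof (rule submodule_transforms[OF YU])
    fix S f assume S: "S \<in> ann Y" and f: "f \<in> Y"
    have F: "functional S" "\<And>g. g \<in> Y \<Longrightarrow> S g = 0" using S by (auto simp: ann_def)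
    show "S (diff_op a f) = 0"
    proof (cases "f \<in> W_of \<omega> a c X")
      case True
      then show ?thesis using diff_op_W_of[OF True] by (intro F(2)) (simp add: Y_def)
    next
      case False
      then obtain n \<mu> where e: "f = exp_monomial a n \<mu>" "exp_monomial a n \<mu> \<in> W"
        using f unfolding Y_def Exp_of_def by blast
      have low: "S (exp_monomial a i \<mu>) = 0" if "i \<le> n" for i
        using exp_monomial_lower[OF W_facts(1,3) e(2) that] by (intro F(2)) (auto simp: Y_def Exp_of_def)
      show ?thesis
      proof (cases n)
        case 0
        have "S (efun \<mu>) = 0" using low[of 0] by (simp add: exp_monomial_0)
        then show ?thesis
          unfolding e(1) 0 exp_monomial_0 diff_op_efun functional_linear(2)[OF F(1) efun_U efun_U] by simp
      next
        case (Suc m)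
        have "S (diff_op a f) = of_nat (Suc m) * S (exp_monomial a m \<mu>) + (- \<i> * \<mu>) * S (exp_monomial a (Suc m) \<mu>)"
          unfolding e(1) Suc diff_op_exp_monomial
          by (simp only: functional_linear(1)[OF F(1) U_cscale(1)[OF exp_monomial_U] U_cscale(1)[OF exp_monomial_U]]
            functional_linear(2)[OF F(1) exp_monomial_U exp_monomial_U])
        then show ?thesis using low[of m] low[of "Suc m"] Suc by simp
      qed
    qed
  qed
  have "ann W \<subseteq> ann Y" using Y(1) by (auto simp: ann_def)
  then have JJ: "transforms W \<subseteq> transforms Y" unfolding transforms_def by blast
  \<comment> \<open>By the bipolar theorem a monomial killed by \<open>ann W\<close> lies in
    \<open>W\<close>, hence among the generators; so the common zeros agree.\<close>
  have V: "(\<forall>S\<in>ann W. S (exp_monomial a i \<mu>) = 0) \<longleftrightarrow> (\<forall>S\<in>ann Y. S (exp_monomial a i \<mu>) = 0)" for i \<mu>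
  proof
    assume "\<forall>S\<in>ann W. S (exp_monomial a i \<mu>) = 0"
    then have "exp_monomial a i \<mu> \<in> W" by (intro bipolar[OF W_facts(1,2) exp_monomial_U]) blast
    then have "exp_monomial a i \<mu> \<in> Y" by (auto simp: Y_def Exp_of_def)
    then show "\<forall>S\<in>ann Y. S (exp_monomial a i \<mu>) = 0" by (auto simp: ann_def)
  qed (use \<open>ann W \<subseteq> ann Y\<close> in blast)
  have zs: "zero_set (transforms Y) = zero_set (transforms W)"
    unfolding zero_set_alt vanishes_transforms_iff V ..
  have "(SUP \<phi>\<in>transforms Y. indicator_fun \<phi> (pi / 2)) \<le> ?hi"
    using transforms_segment_le(1)[OF Y(2)] by (rule order_trans) (auto simp: X_def intro!: SUP_least)
  then have hi: "(SUP \<phi>\<in>transforms Y. indicator_fun \<phi> (pi / 2)) = ?hi"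
    by (rule order_antisym) (intro SUP_subset_mono JJ order_refl)
  have "?lo \<le> (INF x\<in>X. ereal x)" by (auto simp: X_def intro!: INF_greatest)
  then have "- (INF x\<in>X. ereal x) \<le> - ?lo" by (subst ereal_minus_le_minus)
  then have "(SUP \<phi>\<in>transforms Y. indicator_fun \<phi> (- (pi / 2))) \<le> (SUP \<phi>\<in>transforms W. indicator_fun \<phi> (- (pi / 2)))"
    using transforms_segment_le(2)[OF Y(2)] by simp
  then have lo: "(SUP \<phi>\<in>transforms Y. indicator_fun \<phi> (- (pi / 2))) = (SUP \<phi>\<in>transforms W. indicator_fun \<phi> (- (pi / 2)))"
    by (rule order_antisym) (intro SUP_subset_mono JJ order_refl)
  have seg: "indicator_segment (transforms Y) = indicator_segment (transforms W)"
    unfolding indicator_segment_def hi lo ..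
  have eq: "transforms Y = transforms W"
    using loc sub zs seg JJ unfolding weakly_localisable_def by blast
  \<comment> \<open>An element of \<open>W\<close> off the closure is separated by a functional in
    \<open>ann Y\<close>. Its transform lies in \<open>transforms W\<close>, and injectivity of the
    transform makes the functional vanish on \<open>W\<close>.\<close>
  have "W \<subseteq> U_top \<omega> a c closure_of ?M"
  proof (rule ccontr)
    assume "\<not> W \<subseteq> U_top \<omega> a c closure_of ?M"
    then obtain f where f: "f \<in> W" "f \<notin> U_top \<omega> a c closure_of ?M" by blast
    have MU: "?M \<subseteq> U" using MW W_facts(4) by (rule order_trans)
    have fU: "f \<in> U" using f(1) W_facts(4) by blast
    obtain S where S: "functional S" "\<And>g. g \<in> ?M \<Longrightarrow> S g = 0" "S f \<noteq> 0"
      by (rule U_separation[OF M MU fU f(2)]) (rule that)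
    have "S \<in> ann ?M" unfolding ann_def by (intro CollectI conjI ballI S(1)) (rule S(2))
    then have "S \<in> ann Y" unfolding Y_def by (simp only: ann_sum_iff)
    then have "(\<lambda>z. S (efun z)) \<in> transforms Y" unfolding transforms_def by (rule imageI)
    then have "\<forall>f\<in>W. S f = 0" unfolding eq by (simp only: mem_transforms_iff[OF S(1) W_facts(4)])
    then have "S f = 0" using f(1) by (rule bspec)
    with S(3) show False ..
  qed
  moreover have "U_top \<omega> a c closure_of ?M \<subseteq> W" by (rule closure_of_minimal[OF MW W_facts(2)])
  ultimately have "W = U_top \<omega> a c closure_of ?M" by (rule equalityI)
  then show ?thesis unfolding weak_synthesis_def using res by blast
qed

end

end

theorem proposition2p4:
  fixes \<omega> :: "real \<Rightarrow> real" and a :: ereal and c r :: "nat \<Rightarrow> real"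
    and W :: "(real \<Rightarrow> complex) set"
  assumes "ultra_data \<omega> a c r"
    and "D_invariant \<omega> a c W"
  shows "weak_synthesis \<omega> a c W \<longleftrightarrow>
    weakly_localisable \<omega> c r (fourier_laplace a ` annihilator \<omega> a c W)"
proof -
  interpret ultra_data \<omega> a c r by (rule assms(1))
  have "W \<subseteq> U_space \<omega> a c" by (rule W_facts(4)[OF assms(2)])
  then have "fourier_laplace a ` annihilator \<omega> a c W = transforms W" by (rule fourier_laplace_annihilator)
  then show ?thesis
    using localisable_if_synthesis[OF assms(2)] synthesis_if_localisable[OF assms(2)] by auto
qed

end
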